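(* Let $p,p_d$ and the Wigner matrices $H=H^{(N)}$ satisfy the noise assumptions listed in the context. Define $$F := \int_{-\infty}^{\infty} \frac{(p'(x))^2}{p(x)}\,dx,\qquad F_d := \int_{-\infty}^{\infty} \frac{(p_d'(x))^2}{p_d(x)}\,dx,\qquad G := \int_{-\infty}^{\infty} \frac{(p''(x))^2}{p(x)}\,dx .$$ Let $\omega>0$ be a fixed constant with $\omega F<1$. Then, under the null hypothesis $\boldsymbol H_0$ (i.e. $M=H$), the log likelihood ratio $\log\mathcal L(M;\omega)$ converges in distribution, as $N\to\infty$, to the Gaussian $\mathcal N(-\rho,2\rho)$ with mean $-\rho$ and variance $2\rho$, where $$\rho := -\frac14\left(\log(1-\omega F)+\omega(F-2F_d)+\frac{\omega^2}{4}(2F^2-G)\right).$$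
   Context: Noise. $H=(H_{ij})$ is an $N\times N$ real symmetric random matrix (a Wigner matrix) such that $H_{ij}$, $1\le i\le j\le N$, are independent centered real random variables with $N\,\mathbb E[H_{ij}^2]=1$ for $i<j$ and $N\,\mathbb E[H_{ii}^2]=w_2$ for some constant $w_2$ independent of $N$; for every $D>0$ there is a constant $C_D$ independent of $N$ with $N^{D/2}\,\mathbb E[|H_{ij}|^D]\le C_D$ for all $1\le i\le j\le N$. The normalized off-diagonal entries $\sqrt N H_{ij}$ ($i<j$) all have density $p$ and the normalized diagonal entries $\sqrt N H_{ii}$ all have density $p_d$, where $p,p_d$ do not depend on $N$ and satisfy: (1) $p$ and $p_d$ are smooth, positive everywhere, and symmetric about $0$; (2) $p$, $p_d$ and all their derivatives vanish at infinity; (3) for every positive integer $s$ there are constants $C_s,r_s>0$, independent of $N$, with $|p^{(s)}(x)/p(x)|,\ |p_d^{(s)}(x)/p_d(x)|\le C_s(1+|x|^{r_s})$ for all $x\in\mathbb R$, where $p^{(s)},p_d^{(s)}$ are the $s$-th derivatives. Spike and hypotheses. $\boldsymbol x=(x_1,\dots,x_N)$ is a random vector, independent of $H$, with $\sqrt N x_i$ i.i.d. Rademacher ($\pm1$ with probability $1/2$ each). The data matrix is $M=H+\sqrt\lambda\,\boldsymbol x\boldsymbol x^T$; $\boldsymbol H_0:\lambda=0$ and $\boldsymbol H_1:\lambda=\omega>0$. Likelihood ratio (of the law of $M$ under $\boldsymbol H_1$ with respect to its law under $\boldsymbol H_0$): $$\mathcal L(M;\omega)=\frac1{2^N}\sum_{\boldsymbol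 x\in\{\pm1/\sqrt N\}^N}\ \prod_{i<j}\frac{p(\sqrt N M_{ij}-\sqrt{\omega N}\,x_ix_j)}{p(\sqrt N M_{ij})}\ \prod_{k}\frac{p_d(\sqrt N M_{kk}-\sqrt{\omega N}\,x_k^2)}{p_d(\sqrt N M_{kk})}.$$ *)

theory Defs
  imports "HOL-Probability.Probability"
begin

definition upper_indices :: "nat \<Rightarrow> (nat \<times> nat) set" where
  "upper_indices N = {(i, j). 1 \<le> i \<and> i \<le> j \<and> j \<le> N}"

definition strict_upper_indices :: "nat \<Rightarrow> (nat \<times> nat) set" where
  "strict_upper_indices N = {(i, j). 1 \<le> i \<and> i < j \<and> j \<le> N}"

definition smooth_fun :: "(real \<Rightarrow> real) \<Rightarrow> bool" where
  "smooth_fun f \<longleftrightarrow> (\<forall>k x. ((deriv ^^ k) f) field_differentiable (at x))"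

text \<open>Regularity of the densities only: that \<open>p\<close> and \<open>pd\<close> integrate to 1 is part of
  \<open>noise_matrices\<close> below, where they are the densities of the normalized entries.\<close>

definition noise_densities :: "(real \<Rightarrow> real) \<Rightarrow> (real \<Rightarrow> real) \<Rightarrow> bool" where
  "noise_densities p pd \<longleftrightarrow>
     (\<forall>q\<in>{p, pd}. smooth_fun q \<and> (\<forall>x. 0 < q x) \<and> (\<forall>x. q (- x) = q x)
        \<and> (\<forall>k. (((deriv ^^ k) q) \<longlongrightarrow> 0) at_infinity)) \<and>
     (\<forall>s\<ge>1. \<exists>C>0. \<exists>r>0. \<forall>q\<in>{p, pd}. \<forall>x.
        \<bar>(deriv ^^ s) q x / q x\<bar> \<le> C * (1 + \<bar>x\<bar> powr r))"

text \<open>\<open>H N s i j\<close> is the entry \<open>(i, j)\<close>, with \<open>1 \<le> i, j \<le> N\<close>, of the \<open>N \<times> N\<close> random matrix at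
  the sample point \<open>s\<close>; values outside this range are irrelevant.  The matrices of different
  sizes may live on different probability spaces \<open>P N\<close>.  Finiteness of the moments has to be
  stated separately, as the integral of a non-integrable function is 0.\<close>

definition noise_matrices ::
  "(nat \<Rightarrow> 'a measure) \<Rightarrow> (nat \<Rightarrow> 'a \<Rightarrow> nat \<Rightarrow> nat \<Rightarrow> real) \<Rightarrow>
   (real \<Rightarrow> real) \<Rightarrow> (real \<Rightarrow> real) \<Rightarrow> real \<Rightarrow> bool" where
  "noise_matrices P H p pd w2 \<longleftrightarrow>
     (\<forall>N\<ge>1.
        prob_space (P N) \<and>
        (\<forall>s\<in>space (P N). \<forall>i\<in>{1..N}. \<forall>j\<in>{1..N}. H N s i j = H N s j i) \<and>
        prob_space.indep_vars (P N) (\<lambda>_. borel) (\<lambda>(i, j) s. H N s i j) (upper_indices N) \<and>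
        (\<forall>(i, j)\<in>upper_indices N. (LINT s|P N. H N s i j) = 0) \<and>
        (\<forall>(i, j)\<in>strict_upper_indices N.
           real N * (LINT s|P N. (H N s i j)\<^sup>2) = 1 \<and>
           distributed (P N) lborel (\<lambda>s. sqrt (real N) * H N s i j) (\<lambda>x. ennreal (p x))) \<and>
        (\<forall>i\<in>{1..N}.
           real N * (LINT s|P N. (H N s i i)\<^sup>2) = w2 \<and>
           distributed (P N) lborel (\<lambda>s. sqrt (real N) * H N s i i) (\<lambda>x. ennreal (pd x)))) \<and>
     (\<forall>D>0. \<exists>C. \<forall>N\<ge>1. \<forall>(i, j)\<in>upper_indices N.
        integrable (P N) (\<lambda>s. \<bar>H N s i j\<bar> powr D) \<and>
        real N powr (D / 2) * (LINT s|P N. \<bar>H N s i j\<bar> powr D) \<le> C)"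

definition rademacher_spikes :: "nat \<Rightarrow> (nat \<Rightarrow> real) set" where
  "rademacher_spikes N = {1..N} \<rightarrow>\<^sub>E {- 1 / sqrt (real N), 1 / sqrt (real N)}"

definition likelihood_ratio ::
  "(real \<Rightarrow> real) \<Rightarrow> (real \<Rightarrow> real) \<Rightarrow> real \<Rightarrow> nat \<Rightarrow> (nat \<Rightarrow> nat \<Rightarrow> real) \<Rightarrow> real" where
  "likelihood_ratio p pd \<omega> N M =
     1 / 2 ^ N * (\<Sum>x\<in>rademacher_spikes N.
       (\<Prod>(i, j)\<in>strict_upper_indices N.
          p (sqrt (real N) * M i j - sqrt (\<omega> * real N) * x i * x j) / p (sqrt (real N) * M i j)) *
       (\<Prod>k\<in>{1..N}.
          pd (sqrt (real N) * M k k - sqrt (\<omega> * real N) * (x k)\<^sup>2) / pd (sqrt (real N) * M k k)))"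

definition fisher_F :: "(real \<Rightarrow> real) \<Rightarrow> real" where
  "fisher_F q = (LBINT x. (deriv q x)\<^sup>2 / q x)"

definition fisher_G :: "(real \<Rightarrow> real) \<Rightarrow> real" where
  "fisher_G q = (LBINT x. (deriv (deriv q) x)\<^sup>2 / q x)"

definition rho :: "(real \<Rightarrow> real) \<Rightarrow> (real \<Rightarrow> real) \<Rightarrow> real \<Rightarrow> real" where
  "rho p pd \<omega> = - (1 / 4) *
     (ln (1 - \<omega> * fisher_F p) + \<omega> * (fisher_F p - 2 * fisher_F pd)
        + \<omega>\<^sup>2 / 4 * (2 * (fisher_F p)\<^sup>2 - fisher_G p))"

text \<open>\<open>normal_density\<close> takes the standard deviation, not the variance.\<close>

definition normal_law :: "real \<Rightarrow> real \<Rightarrow> real measure" where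
  "normal_law m v = density lborel (\<lambda>x. ennreal (normal_density m (sqrt v) x))"

end

theory Submission
  imports Defs
begin

text \<open>Write \<open>c = \<omega> * fisher_F p\<close> and \<open>\<delta> = sqrt (\<omega> / N)\<close>. In terms of the normalized entries \<open>y = sqrt N * H\<close>, the likelihood ratio
  \<open>L\<close> is the average over all sign vectors \<open>s\<close> of the products of \<open>q (y - \<delta> * s i * s j) / q y\<close> over the entries, where \<open>q\<close> is
  the density of the entry. To leading order each factor is 1 plus \<open>s i * s j\<close> times the score \<open>- \<delta> * q' / q\<close> of the entry plus
  its curvature \<open>\<delta>^2 / 2 * q'' / q\<close>. In the average over \<open>s\<close> those products of scores survive in which every sign occurs
  twice, that is products over unions of cycles. So \<open>L\<close> should behave like \<open>exp (X - E X^2 / 2)\<close>, where \<open>X\<close> is the sum over all cycles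
  of length at least 3 of the product of the scores along the cycle, plus the curvatures of the off-diagonal entries, plus
  the scores of the diagonal entries. The cycles of length \<open>l\<close> contribute \<open>c^l / (2 * l)\<close> to the variance of \<open>X\<close>, the
  curvatures \<open>\<omega>^2 / 8 * fisher_G p\<close> and the diagonal \<open>\<omega> * fisher_F pd\<close>. Since \<open>c < 1\<close> the series converges to a logarithm, and the
  sum is \<open>2 * rho p pd \<omega>\<close>. This explains a lognormal limit of \<open>L\<close> with these parameters.

  The proof does not expand \<open>L\<close>. It shows that \<open>L\<close> is close in mean square to a truncation \<open>h\<close> of \<open>exp (X - s / 2)\<close>, where \<open>s\<close> is the
  variance of \<open>X\<close>, by computing the three terms of the square of the difference.

  The second moment of \<open>L\<close> need not exist, so all entries are restricted to a slowly growing window, which has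
  probability close to 1. On the window the second moment is an average over two sign vectors, hence over their product;
  it is a Curie-Weiss partition function below the critical temperature and is asymptotically at most \<open>exp (2 * rho p pd \<omega>)\<close>:
  \<open>replica_average_bound\<close> and \<open>second_moment_limit\<close>.

  The mixed term is \<open>E (L * h)\<close>, the mean of \<open>h\<close> under the spiked law. As \<open>X\<close> does not change when the entries are multiplied
  by \<open>s i * s j\<close>, all sign vectors give the same mean and the spike may be taken constant: \<open>planted_integral\<close>, \<open>X_gauge\<close>.

  It remains to know the law of \<open>X\<close>, under the null law and under this planted law. The limits are normal laws with variance \<open>s\<close>
  and means 0 and \<open>s\<close> (\<open>char_limit\<close>, used twice in \<open>chaos_statistic\<close>). For this purpose the vertices are divided into \<open>B\<close> blocks,
  and only cycles that visit each block at most once are kept; as \<open>B\<close> grows this loses nothing (\<open>variance_limit\<close>). The block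
  structure makes \<open>X\<close> a sum over pairs of blocks whose terms are, given the others, sums of independent variables with weights
  given by path sums. The sums of the squares of these weights concentrate (\<open>chain_square_conc\<close>), so each pair multiplies the
  characteristic function by a Gaussian factor (\<open>char_step\<close>).

  With these limits the square of the difference tends to \<open>V - 2 * V + V = 0\<close> for \<open>V = exp (2 * rho p pd \<omega>)\<close>, if first \<open>N\<close> and then \<open>B\<close>
  tend to infinity (\<open>log_likelihood_limit\<close>).\<close>

abbreviation (input) seq_limit :: "(nat => 'a::topological_space) => 'a => bool" (infix "---->" 60) where
 "X ----> L == X \<longlonglongrightarrow> L"

section \<open>Moments of linear forms and random matrices\<close>

text \<open>A bound on the mean of a nonnegative function, stated with the nonnegative integral: it makes sense before
  integrability is known and is stable under the conditioning in \<open>mean_le_resample\<close>.\<close>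
definition mean_le :: "'a measure => ('a => real) => real => bool" where
 "mean_le M f c \<longleftrightarrow> f \<in> borel_measurable M \<and> 0 <= c \<and> (\<integral>\<^sup>+x. ennreal (f x) \<partial>M) <= ennreal c"

lemma mean_le_mono:
 assumes "mean_le M g d" "f \<in> borel_measurable M" "!!x. x \<in> space M ==> f x <= g x" "d <= c"
 shows "mean_le M f c"
proof -
 have "(\<integral>\<^sup>+x. ennreal (f x) \<partial>M) <= (\<integral>\<^sup>+x. ennreal (g x) \<partial>M)"
  by (intro nn_integral_mono ennreal_leI assms)
 also have "... <= ennreal c" using assms(1,4) by (auto simp: mean_le_def intro: order_trans ennreal_leI)
 finally show ?thesis using assms by (auto simp: mean_le_def)
qed

lemma mean_le_add:
 assumes "mean_le M f c" "mean_le M g d" "!!x. 0 <= f x" "!!x. 0 <= g x"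
 shows "mean_le M (%x. f x + g x) (c + d)"
 using assms by (auto simp: mean_le_def ennreal_plus nn_integral_add intro!: add_mono)

lemma mean_le_zero: "mean_le M (%x. 0) 0"
 by (simp add: mean_le_def)

lemma mean_le_sum:
 assumes "finite I" "!!i. i \<in> I ==> mean_le M (f i) (c i)" "!!i x. 0 <= f i x"
 shows "mean_le M (%x. \<Sum>i\<in>I. f i x) (\<Sum>i\<in>I. c i)"
 using assms by (induction I rule: finite_induct) (auto intro!: mean_le_add sum_nonneg mean_le_zero)

lemma mean_le_cmult:
 assumes "mean_le M f c" "0 <= k"
 shows "mean_le M (%x. k * f x) (k * c)"
proof -
 have "(\<integral>\<^sup>+x. ennreal (k * f x) \<partial>M) = ennreal k*(\<integral>\<^sup>+x. ennreal (f x) \<partial>M)"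
  using assms by (subst nn_integral_cmult[symmetric]) (auto simp: mean_le_def ennreal_mult')
 also have "... <= ennreal (k * c)"
  using assms by (auto simp: mean_le_def ennreal_mult intro!: mult_left_mono)
 finally show ?thesis using assms by (auto simp: mean_le_def)
qed

lemma mean_le_integral:
 assumes "mean_le M f c" "!!x. 0 <= f x"
 shows "integrable M f" "integral\<^sup>L M f <= c"
proof -
 show i: "integrable M f"
  using assms by (intro integrableI_nonneg) (auto simp: mean_le_def less_top[symmetric] top_unique)
 show "integral\<^sup>L M f <= c"
  using assms i by (subst integral_eq_nn_integral) (auto simp: mean_le_def intro!: enn2real_leI)
qed

lemma mean_leI:
 assumes "integrable M f" "!!x. 0 <= f x" "integral\<^sup>L M f <= c"
 shows "mean_le M f c"
proof -
 have "0 <= integral\<^sup>L M f" by (intro Bochner_Integration.integral_nonneg assms)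
 then show ?thesis using assms order_trans[OF _ assms(3), of 0]
  by (auto simp: mean_le_def nn_integral_eq_integral intro!: ennreal_leI)
qed

lemma (in prob_space) mean_le_const: "0 <= c ==> mean_le M (%x. c) c"
 by (simp add: mean_le_def emeasure_space_1)

lemma (in prob_space) mean_le_sqrt:
 assumes "mean_le M f c" "!!x. 0 <= f x"
 shows "mean_le M (%x. sqrt (f x)) (sqrt c)"
proof -
 have [measurable]: "f \<in> borel_measurable M" using assms by (simp add: mean_le_def)
 note i = mean_le_integral[OF assms]
 have isq: "integrable M (%x. sqrt (f x))"
  by (rule square_integrable_imp_integrable) (use i assms in \<open>auto\<close>)
 have "(expectation (%x. sqrt (f x)))^2 <= expectation (%x. (sqrt (f x))^2)"
  using variance_positive[of "%x. sqrt (f x)"] variance_eq[OF isq] i assms by simp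
 then have "(expectation (%x. sqrt (f x)))^2 <= c" using i assms by simp
 then have "expectation (%x. sqrt (f x)) <= sqrt c" by (rule real_le_rsqrt)
 then show ?thesis using assms isq by (intro mean_leI) auto
qed

context prob_space begin

text \<open>Induction on the index set: adding an independent centred term \<open>Y\<close> to \<open>S\<close> kills the odd mixed moments, so that
  the fourth moment grows by \<open>E Y^4 + 6 E Y^2 E S^2\<close>, which the square of the variance absorbs.\<close>
lemma linear_form_moments:
 fixes Z :: "'i => 'a => real" and c :: "'i => real"
 assumes "finite K" "indep_vars (%_. borel) Z K"
  and Z4: "!!k. k \<in> K ==> integrable M (%x. Z k x^4)"
  and Z1: "!!k. k \<in> K ==> expectation (Z k) = 0"
  and Z2: "!!k. k \<in> K ==> expectation (%x. (Z k x)^2) = v"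
  and Z4m: "!!k. k \<in> K ==> expectation (%x. Z k x^4) <= m" and v: "v^2 <= m"
 shows "integrable M (%x. (\<Sum>k\<in>K. c k * Z k x)^4) \<and>
   expectation (%x. (\<Sum>k\<in>K. c k * Z k x)) = 0 \<and>
   expectation (%x. (\<Sum>k\<in>K. c k * Z k x)^2) = v * (\<Sum>k\<in>K. (c k)^2) \<and>
   expectation (%x. (\<Sum>k\<in>K. c k * Z k x)^4) <= 3 * m*(\<Sum>k\<in>K. (c k)^2)^2"
 using assms(1-6)
proof (induction K rule: finite_induct)
 case empty
 then show ?case by simp
next
 case (insert k K)
 have [measurable]: "random_variable borel (Z i)" if "i \<in> insert k K" for i
  using insert.prems(1) that by (auto simp: indep_vars_def)
 have iv: "indep_vars (%_. borel) Z K" by (rule indep_vars_subset[OF insert.prems(1)]) auto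
 define S where "S x = (\<Sum>k\<in>K. c k * Z k x)" for x
 define G where "G = (\<Sum>k\<in>K. (c k)^2)"
 have [measurable]: "random_variable borel S" unfolding S_def by measurable
 have IH: "integrable M (%x. S x^4)" "expectation S = 0" "expectation (%x. (S x)^2) = v * G"
   "expectation (%x. S x^4) <= 3 * m * G^2"
  using insert.IH[OF iv] insert.prems unfolding S_def G_def by auto
 define Y where "Y = Z k"
 have [measurable]: "random_variable borel Y" unfolding Y_def by simp
 have Y: "integrable M (%x. Y x^4)" "expectation Y = 0" "expectation (%x. (Y x)^2) = v"
   "expectation (%x. Y x^4) <= m" using insert.prems unfolding Y_def by auto
 have ind: "indep_var borel Y borel S"
 proof -
  define T where "T = (%i x. if i = k then Z k x else c i * Z i x)"
  have "indep_vars (%_. borel) T (insert k K)"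
   using indep_vars_compose2[OF insert.prems(1), of "%i y. if i = k then y else c i * y" "%_. borel"]
   by (simp add: T_def if_distrib[of "%f. f _"] cong: if_cong)
  then have "indep_var borel (T k) borel (%\<omega>. \<Sum>i\<in>K. T i \<omega>)"
   using insert by (intro indep_vars_sum) auto
  also have "(%\<omega>. \<Sum>i\<in>K. T i \<omega>) = S"
   using insert.hyps unfolding S_def T_def by (intro ext sum.cong) auto
  finally show ?thesis by (simp add: T_def Y_def)
 qed
 have pw: "integrable M (%x. X x^j)" if "integrable M (%x. X x^4)" "j <= 4" "random_variable borel X"
  for X :: "'a => real" and j :: nat
 proof (rule Bochner_Integration.integrable_bound)
  show "integrable M (%x. 1 + X x^4)" using that by auto
  show "AE x in M. norm (X x^j) <= norm (1 + X x^4)"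
  proof (intro AE_I2)
   fix x
   have "\<bar>X x\<bar>^j <= 1 + \<bar>X x\<bar>^4"
   proof (cases "\<bar>X x\<bar> <= 1")
    case True then have "\<bar>X x\<bar>^j <= 1" by (simp add: power_le_one)
    then show ?thesis by (simp add: add_increasing2)
   next
    case False then have "\<bar>X x\<bar>^j <= \<bar>X x\<bar>^4" using that by (intro power_increasing) auto
    then show ?thesis by simp
   qed
   then show "norm (X x^j) <= norm (1 + X x^4)" by (simp add: power_abs)
  qed
  show "(%x. X x^j) \<in> borel_measurable M" using that by measurable
 qed
 have iS: "integrable M (%x. S x^j)" and iY: "integrable M (%x. Y x^j)" if "j <= 4" for j
  using pw[of S j] pw[of Y j] IH(1) Y(1) that by auto
 have indp: "indep_var borel (%x. Y x^i) borel (%x. S x^j)" for i j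
  using indep_var_compose[OF ind, of "%y. y^i" borel "%y. y^j" borel] by (simp add: comp_def)
 have iYS: "integrable M (%x. Y x^i * S x^j)"
   and eYS: "expectation (%x. Y x^i * S x^j) = expectation (%x. Y x^i) * expectation (%x. S x^j)"
  if "i <= 4" "j <= 4" for i j
  using indep_var_integrable[OF indp[of i j]] indep_var_lebesgue_integral[OF indp[of i j]] iS iY that by auto
 have e1: "expectation (%x. Y x^1) = 0" "expectation (%x. S x^1) = 0" using IH Y by simp_all
 let ?c = "c k"
 have eqS: "(\<Sum>i\<in>insert k K. c i * Z i x) = ?c * Y x + S x" for x
  using insert.hyps by (simp add: S_def Y_def)
 have eqG: "(\<Sum>i\<in>insert k K. (c i)^2) = ?c^2 + G" using insert.hyps by (simp add: G_def)
 have x2: "(?c * Y x + S x)^2 = ?c^2*(Y x^2 * S x^0) + (2*?c*(Y x^1 * S x^1) + Y x^0 * S x^2)" for x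
  by (simp add: power2_eq_square algebra_simps)
 have x4: "(?c * Y x + S x)^4 = ?c^4*(Y x^4 * S x^0) + (4*?c^3*(Y x^3 * S x^1) +
   (6*?c^2*(Y x^2 * S x^2) + (4*?c*(Y x^1 * S x^3) + Y x^0 * S x^4)))" for x
  by (simp add: power2_eq_square power3_eq_cube power4_eq_xxxx algebra_simps)
 have i4: "integrable M (%x. (?c * Y x + S x)^4)"
  unfolding x4 by (intro Bochner_Integration.integrable_add integrable_mult_right iYS) auto
 have s2: "expectation (%x. (?c * Y x + S x)^2) = v * (?c^2 + G)"
  unfolding x2
  apply (subst Bochner_Integration.integral_add, (intro Bochner_Integration.integrable_add integrable_mult_right iYS; simp)+)
  apply (subst Bochner_Integration.integral_add, (intro Bochner_Integration.integrable_add integrable_mult_right iYS; simp)+)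
  apply (simp only: integral_mult_right_zero eYS numeral_le_iff zero_le_numeral one_le_numeral e1 le_numeral_extra)
  apply (use IH Y in \<open>simp add: prob_space algebra_simps\<close>)
  done
 have s4: "expectation (%x. (?c * Y x + S x)^4) =
   ?c^4 * expectation (%x. Y x^4) + 6*?c^2*(v * (v * G)) + expectation (%x. S x^4)"
  unfolding x4
  apply (subst Bochner_Integration.integral_add, (intro Bochner_Integration.integrable_add integrable_mult_right iYS; simp)+)
  apply (subst Bochner_Integration.integral_add, (intro Bochner_Integration.integrable_add integrable_mult_right iYS; simp)+)
  apply (subst Bochner_Integration.integral_add, (intro Bochner_Integration.integrable_add integrable_mult_right iYS; simp)+)
  apply (subst Bochner_Integration.integral_add, (intro Bochner_Integration.integrable_add integrable_mult_right iYS; simp)+)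
  apply (simp only: integral_mult_right_zero eYS numeral_le_iff zero_le_numeral one_le_numeral e1 le_numeral_extra order_refl semiring_norm)
  apply (use IH Y in \<open>simp add: prob_space algebra_simps\<close>)
  done
 have G0: "0 <= G" unfolding G_def by (intro sum_nonneg) auto
 have m0: "0 <= m" using v by (meson order_trans zero_le_power2)
 have "?c^4 * expectation (%x. Y x^4) <= ?c^4 * m"
  by (rule mult_left_mono[OF Y(4)]) simp
 moreover have "6*?c^2*(v * (v * G)) <= 6*?c^2*(m * G)"
  using mult_right_mono[OF v G0] by (intro mult_left_mono) (auto simp: power2_eq_square algebra_simps)
 moreover have "?c^4 * m + 6*?c^2*(m * G) + 3 * m * G^2 <= 3 * m*(?c^2 + G)^2"
 proof -
  have "3 * m*(?c^2 + G)^2 - (?c^4 * m + 6*?c^2*(m * G) + 3 * m * G^2) = 2 * m*?c^4"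
   by (simp add: power2_eq_square power4_eq_xxxx algebra_simps)
  moreover have "0 <= 2 * m*?c^4" using m0 by simp
  ultimately show ?thesis by linarith
 qed
 ultimately have m4: "expectation (%x. (?c * Y x + S x)^4) <= 3 * m*(?c^2 + G)^2"
  unfolding s4 using IH(4) by linarith
 have s1: "expectation (%x. ?c * Y x + S x) = 0"
  using iYS[of 1 0] iYS[of 0 1] IH Y by simp
 show ?case unfolding eqS eqG using i4 s1 s2 m4 by simp
qed

end

lemma ennreal_power2_le: "a^2 <= b^2 ==> a <= b" for a b :: ennreal
 by (cases a; cases b)
   (auto simp: ennreal_power ennreal_le_iff top_unique power2_le_iff_abs_le ennreal_top_eq_mult_iff power2_eq_square
     simp flip: ennreal_mult intro: power2_le_imp_le)

lemma mean_le_cong_bound: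
 assumes "mean_le M f c" "c <= d" shows "mean_le M f d"
 using assms by (auto simp: mean_le_def intro: order_trans ennreal_leI)

lemma mean_le_Cauchy_Schwarz:
 assumes f: "mean_le M (%x. (f x)^2) (a^2)" and g: "mean_le M (%x. (g x)^2) (b^2)"
  and [measurable]: "f \<in> borel_measurable M" "g \<in> borel_measurable M"
  and nn: "!!x. 0 <= f x" "!!x. 0 <= g x" "0 <= a" "0 <= b"
 shows "mean_le M (%x. f x * g x) (a * b)"
proof -
 have "(\<integral>\<^sup>+x. ennreal (f x) * ennreal (g x) \<partial>M)^2 \<le>
   (\<integral>\<^sup>+x. (ennreal (f x))^2 \<partial>M)*(\<integral>\<^sup>+x. (ennreal (g x))^2 \<partial>M)"
  by (rule Cauchy_Schwarz_nn_integral) auto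
 also have "... <= ennreal (a^2) * ennreal (b^2)"
  using f g nn by (intro mult_mono) (auto simp: mean_le_def ennreal_power)
 also have "... = (ennreal (a * b))^2"
  using nn by (simp add: ennreal_mult'[symmetric] ennreal_power power_mult_distrib)
 finally have "(\<integral>\<^sup>+x. ennreal (f x * g x) \<partial>M)^2 <= (ennreal (a * b))^2"
  using nn by (simp add: ennreal_mult)
 then have "(\<integral>\<^sup>+x. ennreal (f x * g x) \<partial>M) <= ennreal (a * b)"
  by (rule ennreal_power2_le)
 then show ?thesis using nn by (simp add: mean_le_def)
qed

text \<open>A single random variable is an independent family; the moment estimates for families then apply to it.\<close>
lemma (in prob_space) indep_vars_unit:
 assumes [measurable]: "random_variable borel X"
 shows "indep_vars (%_. borel) (%_::unit. X) UNIV"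
 using sets.sigma_sets_eq[of "borel"]
 by (subst indep_vars_finite[where E="%_. sets borel"])
   (auto simp: UNIV_unit intro: sets.Int_stable)

text \<open>Entries with common first and second moments \<open>mu\<close>, \<open>v\<close> and fourth moment at most \<open>q^2\<close>. In the main application
  \<open>mu\<close>, \<open>v\<close> and \<open>q\<close> are all of order \<open>1/N\<close>; \<open>mu\<close> vanishes under the null law but not under the planted one.\<close>
locale entry_family = prob_space M for M :: "'a measure" +
 fixes T :: "'i => 'a => real" and K :: "'i set" and mu v q :: real
 assumes fin: "finite K" and ind: "indep_vars (%_. borel) T K"
  and T4: "!!k. k \<in> K ==> integrable M (%x. T k x^4)"
  and T1: "!!k. k \<in> K ==> expectation (T k) = mu"
  and T2: "!!k. k \<in> K ==> expectation (%x. (T k x)^2) = v"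
  and T4q: "!!k. k \<in> K ==> expectation (%x. T k x^4) <= q^2"
  and q0: "0 <= q"
begin

lemma rvT[measurable]: "k \<in> K ==> T k \<in> borel_measurable M"
 using ind by (auto simp: indep_vars_def)

lemma pow_integrable:
 assumes "k \<in> K" "j <= 4" shows "integrable M (%x. T k x^j)"
proof (rule Bochner_Integration.integrable_bound)
 show "integrable M (%x. 1 + T k x^4)" using assms T4 by auto
 show "AE x in M. norm (T k x^j) <= norm (1 + T k x^4)"
 proof (intro AE_I2)
  fix x
  have "\<bar>T k x\<bar>^j <= 1 + \<bar>T k x\<bar>^4"
  proof (cases "\<bar>T k x\<bar> <= 1")
   case True then have "\<bar>T k x\<bar>^j <= 1" by (simp add: power_le_one)
   then show ?thesis by (simp add: add_increasing2)
  next
   case False then have "\<bar>T k x\<bar>^j <= \<bar>T k x\<bar>^4" using assms by (intro power_increasing) auto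
   then show ?thesis by simp
  qed
  then show "norm (T k x^j) <= norm (1 + T k x^4)" by (simp add: power_abs)
 qed
 show "(%x. T k x^j) \<in> borel_measurable M" using assms by measurable
qed

lemma moment_bounds:
 assumes "k \<in> K"
 shows "mu^2 <= v" "v <= q" "0 <= v"
proof -
 have i: "integrable M (T k)" "integrable M (%x. (T k x)^2)"
  using pow_integrable[OF assms, of 1] pow_integrable[OF assms, of 2] by auto
 have "variance (T k) = v - mu^2" using variance_eq[OF i] T1[OF assms] T2[OF assms] by simp
 with variance_positive[of "T k"] show "mu^2 <= v" by linarith
 then show v0: "0 <= v" by (meson order_trans zero_le_power2)
 have "0 <= variance (%x. (T k x)^2)" by (rule variance_positive)
 moreover have "variance (%x. (T k x)^2) = expectation (%x. T k x^4) - v^2"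
  using variance_eq[of "%x. (T k x)^2"] i T4[OF assms] T2[OF assms] by simp
 ultimately have "v^2 <= expectation (%x. T k x^4)" by linarith
 also have "... <= q^2" using T4q assms by auto
 finally show "v <= q" using q0 by (rule power2_le_imp_le)
qed

text \<open>Split off the mean: \<open>S - mu * sum c J\<close> is a centred linear form, covered by \<open>linear_form_moments\<close>. The constant 20 in
  the fourth moment is not sharp.\<close>
lemma linear:
 fixes c :: "'i => real"
 assumes "J \<subseteq> K"
 defines "S == %x. \<Sum>k\<in>J. c k * T k x"
 shows lin_integrable: "integrable M (%x. S x^4)"
  and lin_mean: "expectation S = mu * sum c J"
  and lin_int2: "integrable M (%x. (S x)^2)"
  and lin_second: "expectation (%x. (S x)^2) = (v - mu^2)*(\<Sum>k\<in>J. (c k)^2) + mu^2*(sum c J)^2"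
  and lin_var: "expectation (%x. (S x - mu * sum c J)^2) = (v - mu^2)*(\<Sum>k\<in>J. (c k)^2)"
  and lin_var_int: "integrable M (%x. (S x - mu * sum c J)^2)"
  and lin_fourth: "expectation (%x. S x^4) <= (20*(q*(\<Sum>k\<in>J. (c k)^2) + mu^2*(sum c J)^2))^2"
proof -
 have finJ: "finite J" using assms fin finite_subset by blast
 define Z where "Z = (%k x. T k x - mu)"
 have iv: "indep_vars (%_. borel) Z J"
  unfolding Z_def by (rule indep_vars_compose2[OF indep_vars_subset[OF ind assms(1)]]) auto
 have [measurable]: "k \<in> J ==> T k \<in> borel_measurable M" for k using assms(1) by auto
 have iT: "integrable M (%x. T k x^j)" if "k \<in> J" "j <= 4" for k j
  using pow_integrable assms(1) that by auto
 have iT1: "integrable M (T k)" if "k \<in> J" for k using iT[OF that, of 1] by simp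
 have bnd4: "(a - b)^4 <= 8*(a^4 + b^4)" for a b :: real
 proof -
  have "(a - b)^2 <= 2*(a^2 + b^2)" using zero_le_power2[of "a+b"] by (simp add: power2_eq_square algebra_simps)
  then have "((a - b)^2)^2 <= (2*(a^2 + b^2))^2" by (rule power_mono) simp
  also have "... <= 8*(a^4 + b^4)" using zero_le_power2[of "a^2 - b^2"]
   by (simp add: power2_eq_square power4_eq_xxxx algebra_simps)
  finally show ?thesis by simp
 qed
 have iZ: "integrable M (%x. Z k x^4)" if "k \<in> J" for k
 proof (rule Bochner_Integration.integrable_bound)
  show "integrable M (%x. 8*(T k x^4 + mu^4))" using iT that by auto
 qed (use that bnd4 in \<open>auto simp: Z_def\<close>)
 have eZ: "expectation (Z k) = 0" if "k \<in> J" for k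
  using that iT1 T1 assms(1) by (auto simp: Z_def prob_space)
 have eZ2: "expectation (%x. (Z k x)^2) = v - mu^2" if "k \<in> J" for k
  using variance_eq[OF iT1[OF that]] iT[OF that, of 2] T1[of k] T2[of k] assms(1) that by (auto simp: Z_def)
 have mq: "mu^4 <= q^2" if "k \<in> J" for k
  using moment_bounds[of k] that assms(1) power_mono[of "mu^2" q 2] by (force simp: power_mult[symmetric])
 have eZ4: "expectation (%x. Z k x^4) <= 16 * q^2" if "k \<in> J" for k
 proof -
  have "expectation (%x. Z k x^4) <= expectation (%x. 8*(T k x^4 + mu^4))"
   using that iT iZ bnd4 by (intro integral_mono) (auto simp: Z_def)
  also have "... = 8*(expectation (%x. T k x^4) + mu^4)" using iT that by (simp add: prob_space)
  also have "... <= 16 * q^2" using T4q[of k] that assms(1) mq[OF that] by auto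
  finally show ?thesis .
 qed
 have vq: "(if J = {} then 0 else v - mu^2)^2 <= 16 * q^2"
 proof (cases "J = {}")
  case False then obtain k where "k \<in> J" by auto
  then have "mu^2 <= v" "v <= q" using moment_bounds[of k] assms(1) by auto
  then have "0 <= v - mu^2" "v - mu^2 <= q" using zero_le_power2[of mu] by linarith+
  then have "(v - mu^2)^2 <= q^2" by (intro power_mono)
  moreover have "0 <= q^2" by simp
  ultimately have "(v - mu^2)^2 <= 16 * q^2" by linarith
  then show ?thesis using False by simp
 qed auto
 define R where "R x = (\<Sum>k\<in>J. c k * Z k x)" for x
 have eZ2': "expectation (%x. (Z k x)^2) = (if J = {} then 0 else v - mu^2)" if "k \<in> J" for k
  using eZ2[OF that] that by auto
 note L = linear_form_moments[OF finJ iv iZ eZ eZ2' eZ4 vq, of c, folded R_def]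
 have L': "integrable M (%x. R x^4)" "expectation R = 0"
   "expectation (%x. (R x)^2) = (v - mu^2)*(\<Sum>k\<in>J. (c k)^2)"
   "expectation (%x. R x^4) <= 48 * q^2*(\<Sum>k\<in>J. (c k)^2)^2"
  using L by (cases "J = {}"; auto)+
 have SR: "S x = R x + mu * sum c J" for x
  unfolding S_def R_def Z_def by (simp add: algebra_simps sum.distrib sum_subtractf sum_distrib_left)
 have [measurable]: "R \<in> borel_measurable M" unfolding R_def Z_def by measurable
 have iR: "integrable M (%x. R x^j)" if "j <= 4" for j
 proof -
  interpret R: entry_family M "%_::unit. R" "UNIV" "0" "expectation (%x. (R x)^2)" "sqrt (expectation (%x. R x^4))"
  proof
   show "indep_vars (%_. borel) (%_::unit. R) UNIV"
    by (rule indep_vars_unit) measurable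
  qed (use L' in \<open>auto intro!: Bochner_Integration.integral_nonneg\<close>)
  show ?thesis using R.pow_integrable[of "()" j] that by simp
 qed
 show "integrable M (%x. S x^4)"
 proof -
  have "(R x + mu * sum c J)^4 = R x^4 + 4*(mu * sum c J) * R x^3 + 6*(mu * sum c J)^2 * R x^2
    + 4*(mu * sum c J)^3 * R x^1 + (mu * sum c J)^4" for x
   by (simp add: power2_eq_square power3_eq_cube power4_eq_xxxx algebra_simps)
  then show ?thesis unfolding SR using iR[of 4] iR[of 3] iR[of 2] iR[of 1] by simp
 qed
 have iR1: "integrable M R" using iR[of 1] by simp
 have iR2: "integrable M (%x. (R x)^2)" using iR[of 2] by simp
 show "expectation S = mu * sum c J" unfolding SR[abs_def] using L' iR1 by (simp add: prob_space)
 have sq: "(R x + mu * sum c J)^2 = (R x)^2 + (2*(mu * sum c J) * R x + (mu * sum c J)^2)" for x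
  by (simp add: power2_eq_square algebra_simps)
 show "integrable M (%x. (S x)^2)" unfolding SR sq using iR1 iR2 by simp
 show "expectation (%x. (S x)^2) = (v - mu^2)*(\<Sum>k\<in>J. (c k)^2) + mu^2*(sum c J)^2"
  unfolding SR sq using iR1 iR2 L' by (simp add: prob_space power_mult_distrib)
 show "expectation (%x. (S x - mu * sum c J)^2) = (v - mu^2)*(\<Sum>k\<in>J. (c k)^2)"
  unfolding SR using L' by simp
 show "integrable M (%x. (S x - mu * sum c J)^2)" unfolding SR using iR2 by simp
 have "expectation (%x. S x^4) <= expectation (%x. 8*(R x^4 + (mu * sum c J)^4))"
 proof (rule integral_mono)
  show "S x^4 <= 8*(R x^4 + (mu * sum c J)^4)" for x
   using bnd4[of "R x" "- (mu * sum c J)"] by (simp add: SR)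
 qed (use L' \<open>integrable M (%x. S x^4)\<close> in auto)
 also have "... = 8*(expectation (%x. R x^4) + (mu * sum c J)^4)" using L' by (simp add: prob_space)
 also have "... <= 8*(48 * q^2*(\<Sum>k\<in>J. (c k)^2)^2 + (mu * sum c J)^4)" using L' by simp
 also have "... <= (20*(q*(\<Sum>k\<in>J. (c k)^2) + mu^2*(sum c J)^2))^2"
 proof -
  define a where "a = q*(\<Sum>k\<in>J. (c k)^2)"
  define b where "b = (mu * sum c J)^2"
  have "0 <= a" "0 <= b" using q0 by (auto simp: a_def b_def intro!: mult_nonneg_nonneg sum_nonneg)
  then have "8*(48 * a^2 + b^2) <= (20*(a + b))^2"
   by (simp add: power2_eq_square algebra_simps add_mono mult_mono)
  then show ?thesis unfolding a_def b_def by (simp add: power_mult_distrib power_mult[symmetric] mult.assoc)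
 qed
 finally show "expectation (%x. S x^4) <= (20*(q*(\<Sum>k\<in>J. (c k)^2) + mu^2*(sum c J)^2))^2" .
qed

end

text \<open>The variance of a sum of independent variables is the sum of the variances, each at most a second moment.\<close>
lemma (in prob_space) indep_sum_second_le:
 fixes X :: "'i => 'a => real"
 assumes R: "finite R" and ind: "indep_vars (%_. borel) X R"
  and int: "!!i. i \<in> R ==> integrable M (%x. (X i x)^2)"
  and s: "!!i. i \<in> R ==> expectation (%x. (X i x)^2) <= s^2"
 shows "mean_le M (%x. ((\<Sum>i\<in>R. X i x) - (\<Sum>i\<in>R. expectation (X i)))^2) (real (card R) * s^2)"
proof (rule mean_leI)
 have [measurable]: "i \<in> R ==> X i \<in> borel_measurable M" for i using ind by (auto simp: indep_vars_def)
 define Y where "Y i x = X i x - expectation (X i)" for i x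
 have [measurable]: "i \<in> R ==> Y i \<in> borel_measurable M" for i unfolding Y_def by measurable
 have i1: "integrable M (X i)" if "i \<in> R" for i
  by (rule square_integrable_imp_integrable[OF _ int[OF that]]) (use that in measurable)
 have eY: "expectation (Y i) = 0" if "i \<in> R" for i
  unfolding Y_def using i1[OF that] by (subst Bochner_Integration.integral_diff) (auto simp: prob_space)
 have iY: "integrable M (Y i)" if "i \<in> R" for i unfolding Y_def using i1[OF that] by auto
 have iY2: "integrable M (%x. (Y i x)^2)" if "i \<in> R" for i
  using that int i1 by (auto simp: Y_def power2_diff)
 have eY2: "expectation (%x. (Y i x)^2) <= s^2" if "i \<in> R" for i
  using variance_eq[OF i1[OF that] int[OF that]] s[OF that] zero_le_power2[of "expectation (X i)"]
  unfolding Y_def by linarith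
 have indY: "indep_vars (%_. borel) Y R"
  unfolding Y_def by (rule indep_vars_compose2[OF ind]) auto
 have pr: "integrable M (%x. Y i x * Y j x) \<and> (i \<noteq> j \<longrightarrow> expectation (%x. Y i x * Y j x) = 0)"
  if "i \<in> R" "j \<in> R" for i j
 proof (cases "i = j")
  case True then show ?thesis using iY2[OF that(1)] by (simp add: power2_eq_square)
 next
  case False
  have "indep_var borel (Y i) borel (%x. \<Sum>j\<in>{j}. Y j x)"
   using False that by (intro indep_vars_sum indep_vars_subset[OF indY]) auto
  then have "indep_var borel (Y i) borel (Y j)" by simp
  then show ?thesis
   using indep_var_integrable[of "Y i" "Y j"] indep_var_lebesgue_integral[of "Y i" "Y j"] iY eY that by simp
 qed
 have eq: "((\<Sum>i\<in>R. X i x) - (\<Sum>i\<in>R. expectation (X i)))^2 = (\<Sum>i\<in>R. \<Sum>j\<in>R. Y i x * Y j x)" for x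
  by (simp add: Y_def sum_subtractf[symmetric] power2_eq_square sum_product)
 show "integrable M (%x. ((\<Sum>i\<in>R. X i x) - (\<Sum>i\<in>R. expectation (X i)))^2)"
  unfolding eq using pr by (intro Bochner_Integration.integrable_sum) auto
 have "expectation (%x. ((\<Sum>i\<in>R. X i x) - (\<Sum>i\<in>R. expectation (X i)))^2) = (\<Sum>i\<in>R. \<Sum>j\<in>R. expectation (%x. Y i x * Y j x))"
  unfolding eq using pr by (simp add: Bochner_Integration.integral_sum)
 also have "... = (\<Sum>i\<in>R. \<Sum>j\<in>R. if i = j then expectation (%x. (Y i x)^2) else 0)"
  using pr by (intro sum.cong refl) (auto simp: power2_eq_square)
 also have "... = (\<Sum>i\<in>R. expectation (%x. (Y i x)^2))" using R by simp
 also have "... <= (\<Sum>i\<in>R. s^2)" by (intro sum_mono eY2)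
 finally show "expectation (%x. ((\<Sum>i\<in>R. X i x) - (\<Sum>i\<in>R. expectation (X i)))^2) <= real (card R) * s^2" by simp
qed auto

text \<open>A random matrix \<open>T\<close> with independent entries is multiplied by a fixed matrix \<open>A\<close>. The product \<open>W\<close> has independent rows,
  hence its Hilbert-Schmidt norm concentrates. Up to moments of the entries, all bounds involve \<open>A\<close> only through the
  two numbers \<open>sqA\<close> and \<open>colA\<close>, which therefore are the quantities that the induction along a path has to propagate.\<close>
locale matrix_family = entry_family M T "R \<times> C" mu v q
 for M :: "'a measure" and T :: "'i \<times> 'l => 'a => real" and R C mu v q +
 fixes A :: "'l => 'j => real" and J :: "'j set"
 assumes finR: "finite R" and finC: "finite C" and finJ: "finite J"
begin

definition W :: "'i => 'j => 'a => real" where "W i j x = (\<Sum>l\<in>C. T (i, l) x * A l j)"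
definition "sqA = (\<Sum>l\<in>C. \<Sum>j\<in>J. (A l j)^2)"
definition "colA = (\<Sum>j\<in>J. (\<Sum>l\<in>C. A l j)^2)"
definition "dev = 20*(q * sqA + mu^2 * colA)"

lemma sqA_nonneg: "0 <= sqA" and colA_nonneg: "0 <= colA"
 by (auto simp: sqA_def colA_def intro!: sum_nonneg)

lemma dev_nonneg: "0 <= dev"
 using q0 sqA_nonneg colA_nonneg by (simp add: dev_def)

lemma rvW[measurable]: "i \<in> R ==> W i j \<in> borel_measurable M"
 unfolding W_def by measurable

lemma row:
 assumes "i \<in> R"
 shows row_int4: "integrable M (%x. W i j x^4)"
  and row_int2: "integrable M (%x. (W i j x)^2)"
  and row_second: "expectation (%x. (W i j x)^2) = (v - mu^2)*(\<Sum>l\<in>C. (A l j)^2) + mu^2*(\<Sum>l\<in>C. A l j)^2"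
  and row_fourth: "expectation (%x. W i j x^4) <= (20*(q*(\<Sum>l\<in>C. (A l j)^2) + mu^2*(\<Sum>l\<in>C. A l j)^2))^2"
proof -
 have sub: "{i} \<times> C \<subseteq> R \<times> C" using assms by auto
 have re: "(\<Sum>k\<in>{i} \<times> C. f k) = (\<Sum>l\<in>C. f (i, l))" for f :: "'i \<times> 'l => real"
  using sum.cartesian_product[of "%i l. f (i, l)" C "{i}"] by (simp add: case_prod_unfold)
 note L = lin_integrable[OF sub, of "%k. A (snd k) j"] lin_int2[OF sub, of "%k. A (snd k) j"]
  lin_second[OF sub, of "%k. A (snd k) j"] lin_fourth[OF sub, of "%k. A (snd k) j"]
 show "integrable M (%x. W i j x^4)" "integrable M (%x. (W i j x)^2)"
  "expectation (%x. (W i j x)^2) = (v - mu^2)*(\<Sum>l\<in>C. (A l j)^2) + mu^2*(\<Sum>l\<in>C. A l j)^2"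
  "expectation (%x. W i j x^4) <= (20*(q*(\<Sum>l\<in>C. (A l j)^2) + mu^2*(\<Sum>l\<in>C. A l j)^2))^2"
  using L unfolding re by (simp_all add: W_def mult.commute[of "A _ _"])
qed

text \<open>Cauchy-Schwarz over the pairs of columns reduces the square of the row norm to fourth moments of single entries.\<close>
lemma row_square_second:
 assumes "i \<in> R"
 shows "mean_le M (%x. (\<Sum>j\<in>J. (W i j x)^2)^2) (dev^2)"
proof -
 define s where "s j = 20*(q*(\<Sum>l\<in>C. (A l j)^2) + mu^2*(\<Sum>l\<in>C. A l j)^2)" for j
 have s0: "0 <= s j" for j using q0 by (auto simp: s_def intro!: add_nonneg_nonneg mult_nonneg_nonneg sum_nonneg)
 have "mean_le M (%x. ((W i j x)^2)^2) ((s j)^2)" for j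
  using row_int4[OF assms, of j] row_fourth[OF assms, of j] by (intro mean_leI) (auto simp: s_def)
 then have "mean_le M (%x. (W i j x)^2*(W i k x)^2) (s j * s k)" for j k
  using assms s0 by (intro mean_le_Cauchy_Schwarz) auto
 then have "mean_le M (%x. \<Sum>j\<in>J. \<Sum>k\<in>J. (W i j x)^2*(W i k x)^2) (\<Sum>j\<in>J. \<Sum>k\<in>J. s j * s k)"
  by (intro mean_le_sum finJ) (auto intro!: sum_nonneg)
 moreover have "sum s J = dev"
  unfolding s_def dev_def sqA_def colA_def
  by (subst sum.swap[of _ J C]) (simp add: sum_distrib_left sum.distrib algebra_simps)
 ultimately show ?thesis by (simp add: power2_eq_square[of "sum _ _"] power2_eq_square[of dev] sum_product[symmetric])
qed

lemma total_second:
 "integrable M (%x. \<Sum>i\<in>R. \<Sum>j\<in>J. (W i j x)^2)"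
 "expectation (%x. \<Sum>j\<in>J. (W i j x)^2) = (v - mu^2) * sqA + mu^2 * colA" if "i \<in> R" for i
proof -
 show "integrable M (%x. \<Sum>i\<in>R. \<Sum>j\<in>J. (W i j x)^2)"
  using row_int2 by (intro Bochner_Integration.integrable_sum) auto
 show "expectation (%x. \<Sum>j\<in>J. (W i j x)^2) = (v - mu^2) * sqA + mu^2 * colA"
  using that row_int2 row_second unfolding sqA_def colA_def
  by (subst sum.swap[of _ J C]) (simp add: sum_distrib_left sum.distrib)
qed

lemma square_mean_le:
 "mean_le M (%x. \<Sum>i\<in>R. \<Sum>j\<in>J. (W i j x)^2) (real (card R)*(v * sqA + mu^2 * colA))"
proof (cases "R = {}")
 case False
 have "mean_le M (%x. \<Sum>j\<in>J. (W i j x)^2) (v * sqA + mu^2 * colA)" if "i \<in> R" for i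
 proof (rule mean_leI)
  show "integrable M (%x. \<Sum>j\<in>J. (W i j x)^2)"
   using row_int2 that by (intro Bochner_Integration.integrable_sum) auto
  show "expectation (%x. \<Sum>j\<in>J. (W i j x)^2) <= v * sqA + mu^2 * colA"
   unfolding total_second(2)[OF that] using sqA_nonneg by (simp add: algebra_simps)
 qed (auto intro: sum_nonneg)
 then have "mean_le M (%x. \<Sum>i\<in>R. \<Sum>j\<in>J. (W i j x)^2) (\<Sum>i\<in>R. v * sqA + mu^2 * colA)"
  by (intro mean_le_sum finR) (auto intro!: sum_nonneg)
 then show ?thesis by simp
qed (simp add: mean_le_zero)

text \<open>The rows are independent, so the variance of the total is at most \<open>card R\<close> times the second moment of one row.\<close>
lemma square_concentrates:
 "mean_le M (%x. \<bar>(\<Sum>i\<in>R. \<Sum>j\<in>J. (W i j x)^2) - real (card R)*((v - mu^2) * sqA + mu^2 * colA)\<bar>)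
   (sqrt (real (card R)) * dev)"
proof -
 define X where "X i x = (\<Sum>j\<in>J. (W i j x)^2)" for i x
 have rv: "i \<in> R ==> X i \<in> borel_measurable M" for i unfolding X_def by measurable
 have "indep_vars (%i. PiM ({i} \<times> C) (%_. borel)) (%i x. restrict (%k. T k x) ({i} \<times> C)) R"
  by (rule indep_vars_restrict[OF ind]) (auto simp: disjoint_family_on_def)
 then have "indep_vars (%_. borel) (%i x. (%y. \<Sum>j\<in>J. (\<Sum>l\<in>C. y (i, l) * A l j)^2) (restrict (%k. T k x) ({i} \<times> C))) R"
  by (rule indep_vars_compose2) measurable
 then have ind: "indep_vars (%_. borel) X R"
  unfolding X_def W_def by simp
 have sec: "mean_le M (%x. (X i x)^2) (dev^2)" if "i \<in> R" for i
  using row_square_second[OF that] by (simp add: X_def)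
 have "mean_le M (%x. ((\<Sum>i\<in>R. X i x) - (\<Sum>i\<in>R. expectation (X i)))^2) (real (card R) * dev^2)"
  by (rule indep_sum_second_le[OF finR ind]) (use mean_le_integral[OF sec] in auto)
 moreover have "(\<Sum>i\<in>R. expectation (X i)) = real (card R)*((v - mu^2) * sqA + mu^2 * colA)"
  using total_second(2) by (simp add: X_def[abs_def])
 ultimately have "mean_le M (%x. sqrt (((\<Sum>i\<in>R. X i x) - real (card R)*((v - mu^2) * sqA + mu^2 * colA))^2)) (sqrt (real (card R) * dev^2))"
  by (intro mean_le_sqrt) auto
 then show ?thesis using dev_nonneg by (simp add: X_def real_sqrt_mult)
qed

lemma fourth_mean_le:
 "mean_le M (%x. sqrt (\<Sum>i\<in>R. \<Sum>j\<in>J. (W i j x)^4)) (sqrt (real (card R)) * dev)"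
proof -
 have "mean_le M (%x. \<Sum>j\<in>J. W i j x^4) (dev^2)" if i: "i \<in> R" for i
 proof (rule mean_le_mono[OF row_square_second[OF i]])
  fix x
  have "(\<Sum>j\<in>J. ((W i j x)^2)^2) <= (\<Sum>j\<in>J. (W i j x)^2)^2"
  proof -
   have "(\<Sum>j\<in>J. ((W i j x)^2)^2) <= (\<Sum>j\<in>J. (W i j x)^2*(\<Sum>j\<in>J. (W i j x)^2))"
    unfolding power2_eq_square[of "_^2"]
    by (intro sum_mono mult_left_mono member_le_sum finJ) auto
   then show ?thesis by (simp add: sum_distrib_right power2_eq_square[of "sum _ _"])
  qed
  then show "(\<Sum>j\<in>J. W i j x^4) <= (\<Sum>j\<in>J. (W i j x)^2)^2" by simp
 qed (use i in auto)
 then have "mean_le M (%x. \<Sum>i\<in>R. \<Sum>j\<in>J. W i j x^4) (\<Sum>i\<in>R. dev^2)"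
  by (intro mean_le_sum finR) (auto intro!: sum_nonneg)
 then have "mean_le M (%x. sqrt (\<Sum>i\<in>R. \<Sum>j\<in>J. W i j x^4)) (sqrt (real (card R) * dev^2))"
  by (intro mean_le_sqrt) (auto intro!: sum_nonneg)
 then show ?thesis using dev_nonneg by (simp add: real_sqrt_mult)
qed

lemma column_sums:
 "mean_le M (%x. \<Sum>j\<in>J. (\<Sum>i\<in>R. W i j x)^2) (real (card R) * v * sqA + (real (card R))^2 * mu^2 * colA)"
 "mean_le M (%x. \<bar>(\<Sum>i\<in>R. W i j x) - real (card R) * mu*(\<Sum>l\<in>C. A l j)\<bar>)
   (sqrt (real (card R) * v * (\<Sum>l\<in>C. (A l j)^2)))"
proof -
 note L = linear[OF order_refl, of "%k. A (snd k) j" for j]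
 have S: "(\<Sum>k\<in>R \<times> C. A (snd k) j * T k x) = (\<Sum>i\<in>R. W i j x)" for j x
  by (simp add: W_def sum.cartesian_product[symmetric] mult.commute case_prod_unfold[symmetric])
    (simp add: sum.cartesian_product case_prod_unfold mult.commute)
 have c1: "(\<Sum>k\<in>R \<times> C. A (snd k) j) = real (card R)*(\<Sum>l\<in>C. A l j)" for j
  using sum.cartesian_product[of "%i l. A l j" C R] by (simp add: case_prod_unfold)
 have c2: "(\<Sum>k\<in>R \<times> C. (A (snd k) j)^2) = real (card R)*(\<Sum>l\<in>C. (A l j)^2)" for j
  using sum.cartesian_product[of "%i l. (A l j)^2" C R] by (simp add: case_prod_unfold)
 note L' = L[unfolded S c1 c2]
 define a where "a j = (\<Sum>l\<in>C. (A l j)^2)" for j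
 have a0: "0 <= a j" for j by (auto simp: a_def intro!: sum_nonneg)
 define b where "b j = (\<Sum>l\<in>C. A l j)" for j
 have "mean_le M (%x. (\<Sum>i\<in>R. W i j x)^2) (real (card R) * v * a j + (real (card R))^2 * mu^2*(b j)^2)" for j
 proof (rule mean_leI)
  have "0 <= mu^2*(real (card R) * a j)" using a0[of j] by simp
  then show "expectation (%x. (\<Sum>i\<in>R. W i j x)^2) <= real (card R) * v * a j + (real (card R))^2 * mu^2*(b j)^2"
   unfolding L'(4)[of j] by (simp add: a_def b_def power_mult_distrib algebra_simps)
 qed (use L'(3)[of j] in auto)
 then have "mean_le M (%x. \<Sum>j\<in>J. (\<Sum>i\<in>R. W i j x)^2) (\<Sum>j\<in>J. real (card R) * v * a j + (real (card R))^2 * mu^2*(b j)^2)"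
  by (intro mean_le_sum finJ) auto
 moreover have "(\<Sum>j\<in>J. a j) = sqA" unfolding a_def sqA_def by (rule sum.swap)
 moreover have "(\<Sum>j\<in>J. (b j)^2) = colA" unfolding b_def colA_def ..
 ultimately show "mean_le M (%x. \<Sum>j\<in>J. (\<Sum>i\<in>R. W i j x)^2) (real (card R) * v * sqA + (real (card R))^2 * mu^2 * colA)"
  by (simp add: sum.distrib sum_distrib_left[symmetric])
 have "mean_le M (%x. ((\<Sum>i\<in>R. W i j x) - mu*(real (card R) * b j))^2) (real (card R) * v * a j)"
 proof (rule mean_leI)
  have "0 <= mu^2*(real (card R) * a j)" using a0[of j] by simp
  then show "expectation (%x. ((\<Sum>i\<in>R. W i j x) - mu*(real (card R) * b j))^2) <= real (card R) * v * a j"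
   using L'(5)[of j] by (simp add: a_def b_def algebra_simps)
 qed (use L'(6)[of j] in \<open>auto simp: b_def\<close>)
 from mean_le_sqrt[OF this]
 show "mean_le M (%x. \<bar>(\<Sum>i\<in>R. W i j x) - real (card R) * mu*(\<Sum>l\<in>C. A l j)\<bar>)
   (sqrt (real (card R) * v * (\<Sum>l\<in>C. (A l j)^2)))"
  by (simp add: a_def b_def algebra_simps)
qed

end

section \<open>Second-order expansion of characteristic functions\<close>

lemma iexp_le1: "cmod (iexp x - iexp y) <= \<bar>x - y\<bar>"
proof -
 have "iexp x - iexp y = iexp y*(iexp (x - y) - 1)"
  by (simp add: algebra_simps exp_add[symmetric])
 then have "cmod (iexp x - iexp y) = cmod (iexp (x - y) - 1)" by (simp add: norm_mult)
 also have "... <= \<bar>x - y\<bar>" using iexp_approx1[of "x - y" 0] by simp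
 finally show ?thesis .
qed

lemma exp_minus_lipschitz:
 fixes a b :: real assumes "0 <= a" "0 <= b" shows "\<bar>exp (- a) - exp (- b)\<bar> <= \<bar>a - b\<bar>"
proof -
 have *: "exp (- a) - exp (- b) <= b - a" if "a <= b" "0 <= a" for a b :: real
 proof -
  have "exp (- a) - exp (- b) = exp (- a)*(1 - exp (- (b - a)))" by (simp add: algebra_simps exp_add[symmetric])
  also have "... <= 1*(1 - exp (- (b - a)))" using that by (intro mult_right_mono) auto
  also have "... <= b - a" using exp_ge_add_one_self[of "a - b"] by (simp del: exp_ge_add_one_self)
  finally show ?thesis .
 qed
 show ?thesis using *[of a b] *[of b a] assms by (cases "a <= b") auto
qed

lemma damped_iexp_lipschitz:
 assumes "0 <= b" "0 <= b'"
 shows "cmod (iexp a * complex_of_real (exp (- b)) - iexp a' * complex_of_real (exp (- b'))) <= \<bar>a - a'\<bar> + \<bar>b - b'\<bar>"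
proof -
 have "iexp a * complex_of_real (exp (- b)) - iexp a' * complex_of_real (exp (- b')) = (iexp a - iexp a') * complex_of_real (exp (- b)) + iexp a' * complex_of_real (exp (- b) - exp (- b'))"
  by (simp add: algebra_simps)
 also have "cmod ... <= cmod (iexp a - iexp a') * exp (- b) + \<bar>exp (- b) - exp (- b')\<bar>"
  by (rule order_trans[OF norm_triangle_ineq]) (simp add: norm_mult del: of_real_diff)
 also have "... <= \<bar>a - a'\<bar>*1 + \<bar>b - b'\<bar>"
  using assms by (intro add_mono mult_mono iexp_le1 exp_minus_lipschitz) auto
 finally show ?thesis by simp
qed

lemma damped_iexp_second_order:
 assumes "0 <= b"
 shows "cmod (iexp a * complex_of_real (exp (- b)) - (1 + \<i> * a - b)) <= a^2 + b^2"
proof -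
 have e: "\<bar>exp (- b) - (1 - b)\<bar> <= b^2/2"
 proof -
  have "exp (-b) \<ge> 1 - b" using exp_ge_add_one_self[of "-b"] by simp
  moreover have "exp (-b) <= 1 - b + b^2/2"
  proof -
   have "exp (- b) = inverse (exp b)" by (simp add: exp_minus)
   moreover have "1 + b + b^2/2 <= exp b" by (rule exp_lower_Taylor_quadratic[OF assms])
   moreover have "(1 - b + b^2/2)*(1 + b + b^2/2) = 1 + b^4/4"
    by (simp add: power2_eq_square power4_eq_xxxx field_simps)
   moreover have p: "0 < 1 - b + b^2/2" using zero_le_power2[of "b - 1"] by (simp add: power2_diff)
   moreover have "(1 - b + b^2/2)*(1 + b + b^2/2) <= (1 - b + b^2/2) * exp b"
    using calculation by (intro mult_left_mono) auto
   moreover have "0 <= b^4/4" by simp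
   ultimately have "1 <= (1 - b + b^2/2) * exp b" by linarith
   then show ?thesis by (simp add: exp_minus field_simps)
  qed
  ultimately show ?thesis by simp
 qed
 have i2: "cmod (iexp a - (1 + \<i> * a)) <= a^2/2"
  using iexp_approx1[of a 1] by (simp add: power2_eq_square)
 have "iexp a * complex_of_real (exp (- b)) - (1 + \<i> * a - b) = (iexp a - (1 + \<i> * a)) + iexp a * complex_of_real (exp (- b) - (1 - b)) - (iexp a - 1) * b"
  by (simp add: algebra_simps)
 also have "cmod ... <= cmod (iexp a - (1 + \<i> * a)) + cmod (iexp a * complex_of_real (exp (- b) - (1 - b))) + cmod ((iexp a - 1) * b)"
  by (intro order_trans[OF norm_triangle_ineq4] add_mono norm_triangle_ineq order_refl)
 also have "... <= a^2/2 + b^2/2 + \<bar>a\<bar> * b"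
  using i2 e iexp_le1[of a 0] assms by (simp add: norm_mult del: of_real_diff) (intro add_mono mult_right_mono; simp)
 also have "... <= a^2 + b^2" using zero_le_power2[of "\<bar>a\<bar> - b"] by (simp add: power2_diff)
 finally show ?thesis .
qed

text \<open>Both terms agree with \<open>1 + \<i> * u * m - u^2 * s / 2\<close> up to third order. The third absolute moment is interpolated
  between the second and the fourth: \<open>\<bar>x\<bar>^3\<close> is at most \<open>\<eta> * x^2 + x^4 / \<eta>\<close>. When \<open>r\<close> is summably small, \<open>\<eta>\<close> may be sent to 0
  after all other limits, as in the Lindeberg method.\<close>
lemma (in prob_space) char_second_order:
 fixes \<xi> :: "'a => real"
 assumes rv[measurable]: "random_variable borel \<xi>" and i4: "integrable M (%x. \<xi> x^4)" and \<eta>: "\<eta> > 0"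
 defines "m == expectation \<xi>" and "s == expectation (%x. (\<xi> x)^2)" and "r == expectation (%x. \<xi> x^4)"
 shows "cmod (expectation (%x. iexp (u*\<xi> x)) - iexp (u * m) * complex_of_real (exp (- (u^2 * s/2))))
   <= \<bar>u\<bar>^3*(\<eta> * s + r/\<eta>) + u^2 * m^2 + u^4 * r"
proof -
 interpret X: entry_family M "%_::unit. \<xi>" "UNIV" m s "sqrt r"
 proof
  show "indep_vars (%_. borel) (%_::unit. \<xi>) UNIV"
   by (rule indep_vars_unit) measurable
 qed (use i4 in \<open>auto intro!: Bochner_Integration.integral_nonneg simp: m_def s_def r_def\<close>)
 have iX: "integrable M (%x. \<xi> x^j)" if "j <= 4" for j using X.pow_integrable[of "()" j] that by simp
 have i1: "integrable M \<xi>" and i2: "integrable M (%x. (\<xi> x)^2)" using iX[of 1] iX[of 2] by auto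
 have i3: "integrable M (%x. \<bar>\<xi> x\<bar>^3)" using iX[of 3] integrable_norm[of M "%x. \<xi> x^3"] by (simp add: power_abs)
 have s0: "0 <= s" "s <= sqrt r" using X.moment_bounds by auto
 have r0: "0 <= r" unfolding r_def by (intro Bochner_Integration.integral_nonneg) auto
 have sr: "s^2 <= r" using power_mono[OF s0(2,1), of 2] r0 by simp
 have T: "cmod (iexp x - (1 + \<i> * complex_of_real x - complex_of_real (x^2/2))) <= \<bar>x\<bar>^3/6" for x :: real
  using iexp_approx1[of x 2] by (simp add: eval_nat_numeral field_simps power_mult_distrib)
 define E where "E x = 1 + \<i> * complex_of_real (u*\<xi> x) - complex_of_real (u^2/2*(\<xi> x)^2)" for x
 have iE1: "integrable M (%x. 1 + \<i> * complex_of_real (u*\<xi> x))"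
  using i1 by (intro Bochner_Integration.integrable_add integrable_mult_right integrable_of_real) auto
 have iE2: "integrable M (%x. complex_of_real (u^2/2*(\<xi> x)^2))"
  using i2 by (intro integrable_of_real integrable_mult_right) auto
 have iE: "integrable M E" unfolding E_def[abs_def] by (intro Bochner_Integration.integrable_diff iE1 iE2)
 have iI: "integrable M (%x. iexp (u*\<xi> x))" by (intro integrable_iexp) auto
 have e1: "expectation (%x. 1 + \<i> * complex_of_real (u*\<xi> x)) = 1 + \<i>*(u * m)"
  using i1 by (subst Bochner_Integration.integral_add) (auto simp: prob_space m_def)
 have e2: "expectation (%x. complex_of_real (u^2/2*(\<xi> x)^2)) = complex_of_real (u^2 * s/2)"
  unfolding integral_complex_of_real by (simp add: s_def)
 have eE: "expectation E = 1 + \<i>*(u * m) - complex_of_real (u^2 * s/2)"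
  unfolding E_def[abs_def] by (subst Bochner_Integration.integral_diff[OF iE1 iE2]) (simp only: e1 e2)
 have "cmod (expectation (%x. iexp (u*\<xi> x)) - expectation E) = cmod (expectation (%x. iexp (u*\<xi> x) - E x))"
  using iE iI by simp
 also have "... <= expectation (%x. cmod (iexp (u*\<xi> x) - E x))" by (rule integral_norm_bound)
 also have "... <= expectation (%x. \<bar>u\<bar>^3*(\<eta>*(\<xi> x)^2 + \<xi> x^4/\<eta>))"
 proof (rule integral_mono)
  show "integrable M (%x. cmod (iexp (u*\<xi> x) - E x))" using iE iI by simp
  show "integrable M (%x. \<bar>u\<bar>^3*(\<eta>*(\<xi> x)^2 + \<xi> x^4/\<eta>))" using i2 i4 by simp
  fix x
  have "E x = 1 + \<i> * complex_of_real (u*\<xi> x) - complex_of_real ((u*\<xi> x)^2/2)"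
   unfolding E_def by (simp add: power_mult_distrib)
  then have "cmod (iexp (u*\<xi> x) - E x) <= \<bar>u*\<xi> x\<bar>^3/6" using T[of "u*\<xi> x"] by simp
  also have "... = \<bar>u\<bar>^3*(\<bar>\<xi> x\<bar>^3/6)" by (simp add: abs_mult power_mult_distrib)
  also have "\<bar>\<xi> x\<bar>^3/6 <= \<eta>*(\<xi> x)^2 + \<xi> x^4/\<eta>"
  proof (cases "\<bar>\<xi> x\<bar> <= \<eta>")
   case True
   have "\<bar>\<xi> x\<bar>^3 = \<bar>\<xi> x\<bar>*(\<xi> x)^2" by (simp add: power3_eq_cube power2_eq_square)
   also have "... <= \<eta>*(\<xi> x)^2" using True by (intro mult_right_mono) auto
   finally have "\<bar>\<xi> x\<bar>^3 <= \<eta>*(\<xi> x)^2" .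
   moreover have "0 <= \<xi> x^4/\<eta>" using \<eta> by (intro divide_nonneg_pos) auto
   moreover have "0 <= \<bar>\<xi> x\<bar>^3" by simp
   ultimately show ?thesis by linarith
  next
   case False
   have "\<bar>\<xi> x\<bar>^3*\<eta> <= \<bar>\<xi> x\<bar>^3*\<bar>\<xi> x\<bar>" using False by (intro mult_left_mono) auto
   also have "... = \<xi> x^4" by (simp add: power3_eq_cube power4_eq_xxxx abs_mult_self_eq mult.assoc)
   finally have "\<bar>\<xi> x\<bar>^3 <= \<xi> x^4/\<eta>" using \<eta> by (simp add: field_simps)
   moreover have "0 <= \<eta>*(\<xi> x)^2" using \<eta> by simp
   moreover have "0 <= \<bar>\<xi> x\<bar>^3" by simp
   ultimately show ?thesis by linarith
  qed
  finally show "cmod (iexp (u*\<xi> x) - E x) <= \<bar>u\<bar>^3*(\<eta>*(\<xi> x)^2 + \<xi> x^4/\<eta>)"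
   by (simp add: mult_left_mono)
 qed
 also have "... = \<bar>u\<bar>^3*(\<eta> * s + r/\<eta>)" using i2 i4 by (simp add: s_def r_def)
 finally have 1: "cmod (expectation (%x. iexp (u*\<xi> x)) - expectation E) <= \<bar>u\<bar>^3*(\<eta> * s + r/\<eta>)" .
 have "cmod (iexp (u * m) * complex_of_real (exp (- (u^2 * s/2))) - expectation E) <= (u * m)^2 + (u^2 * s/2)^2"
  unfolding eE using damped_iexp_second_order[of "u^2 * s/2" "u * m"] s0 by simp
 also have "... <= u^2 * m^2 + u^4 * r"
 proof -
  have "(u^2 * s/2)^2 = u^4 * s^2/4" by (simp add: power_mult_distrib power_divide)
  also have "... <= u^4 * r/4" using sr by (intro divide_right_mono mult_left_mono) auto
  also have "... <= u^4 * r" using r0 by simp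
  finally show ?thesis by (simp add: power_mult_distrib)
 qed
 finally have 2: "cmod (iexp (u * m) * complex_of_real (exp (- (u^2 * s/2))) - expectation E) <= u^2 * m^2 + u^4 * r" .
 show ?thesis
  using norm_triangle_ineq4[of "expectation (%x. iexp (u*\<xi> x)) - expectation E" "iexp (u * m) * complex_of_real (exp (- (u^2 * s/2))) - expectation E"] 1 2
  by (simp add: algebra_simps)
qed

section \<open>Resampling coordinates of a product space\<close>

text \<open>Resampling the coordinates in \<open>K\<close>: a point of the product space is split into the part outside \<open>K\<close>, taken from \<open>x\<close>,
  and the part inside \<open>K\<close>, taken from an independent copy \<open>z\<close>. This expresses conditioning on the coordinates
  outside \<open>K\<close> without decomposing the index set.\<close>
definition mix :: "'i set => 'i set => ('i => 'b) => ('i => 'b) => ('i => 'b)" where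
 "mix I K x z = (\<lambda>e\<in>I. if e \<in> K then z e else x e)"

lemma measurable_mix[measurable]:
 "(%(x, z). mix I K x z) \<in> measurable (PiM I M \<Otimes>\<^sub>M PiM I M) (PiM I M)"
 unfolding mix_def case_prod_unfold
 by (intro measurable_restrict) (auto intro: measurable_compose[OF measurable_fst] measurable_compose[OF measurable_snd])

lemma distr_mix:
 assumes fin: "finite I" and Pm: "!!i. prob_space (M i)"
 shows "distr (PiM I M \<Otimes>\<^sub>M PiM I M) (PiM I M) (%(x, z). mix I K x z) = PiM I M"
proof -
 interpret PI: prob_space "PiM I M" by (intro prob_space_PiM Pm)
 note Times = PI.emeasure_pair_measure_Times
 interpret product_prob_space M by (intro product_prob_spaceI Pm)
 show ?thesis
 proof (rule PiM_eqI[OF fin])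
  fix A assume A: "!!i. i \<in> I ==> A i \<in> sets (M i)"
  define A1 where "A1 i = (if i \<in> K then space (M i) else A i)" for i
  define A2 where "A2 i = (if i \<in> K then A i else space (M i))" for i
  have sp: "A i \<subseteq> space (M i)" if "i \<in> I" for i using A[OF that] by (rule sets.sets_into_space)
  have eq: "(%(x, z). mix I K x z) -` Pi\<^sub>E I A \<inter> space (PiM I M \<Otimes>\<^sub>M PiM I M) = Pi\<^sub>E I A1 \<times> Pi\<^sub>E I A2"
   using sp by (auto simp: space_pair_measure space_PiM mix_def A1_def A2_def PiE_iff split: if_splits) (auto simp: extensional_def | blast)+
  have "emeasure (distr (PiM I M \<Otimes>\<^sub>M PiM I M) (PiM I M) (%(x, z). mix I K x z)) (Pi\<^sub>E I A) =
    emeasure (PiM I M \<Otimes>\<^sub>M PiM I M) (Pi\<^sub>E I A1 \<times> Pi\<^sub>E I A2)"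
   using A fin by (subst emeasure_distr) (auto simp: eq intro!: sets_PiM_I_finite)
  also have "... = emeasure (PiM I M) (Pi\<^sub>E I A1) * emeasure (PiM I M) (Pi\<^sub>E I A2)"
   using A fin by (intro Times sets_PiM_I_finite) (auto simp: A1_def A2_def)
  also have "... = (\<Prod>i\<in>I. emeasure (M i) (A1 i) * emeasure (M i) (A2 i))"
   using A fin by (subst (1 2) emeasure_PiM) (auto simp: A1_def A2_def prod.distrib)
  also have "... = (\<Prod>i\<in>I. emeasure (M i) (A i))"
   by (intro prod.cong refl) (auto simp: A1_def A2_def M.emeasure_space_1)
  finally show "emeasure (distr (PiM I M \<Otimes>\<^sub>M PiM I M) (PiM I M) (%(x, z). mix I K x z)) (Pi\<^sub>E I A) = (\<Prod>i\<in>I. emeasure (M i) (A i))" .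
 qed simp
qed

lemma mean_le_resample:
 assumes fin: "finite I" and Pm: "!!i. prob_space (M i)"
  and F[measurable]: "F \<in> borel_measurable (PiM I M)"
  and G: "mean_le (PiM I M) G c"
  and FG: "!!x. x \<in> space (PiM I M) ==> mean_le (PiM I M) (%z. F (mix I K x z)) (G x)"
 shows "mean_le (PiM I M) F c"
proof -
 interpret PI: prob_space "PiM I M" by (intro prob_space_PiM Pm)
 interpret PP: pair_sigma_finite "PiM I M" "PiM I M" ..
 have "(\<integral>\<^sup>+x. ennreal (F x) \<partial>PiM I M) = (\<integral>\<^sup>+w. ennreal (F (mix I K (fst w) (snd w))) \<partial>(PiM I M \<Otimes>\<^sub>M PiM I M))"
  by (subst (1) distr_mix[OF fin Pm, symmetric, where K=K], subst nn_integral_distr) (auto simp: case_prod_unfold)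
 also have "... = (\<integral>\<^sup>+x. \<integral>\<^sup>+z. ennreal (F (mix I K x z)) \<partial>PiM I M \<partial>PiM I M)"
  using measurable_mix[of I K M] by (subst PI.nn_integral_fst[symmetric]) (auto simp: case_prod_unfold)
 also have "... <= (\<integral>\<^sup>+x. ennreal (G x) \<partial>PiM I M)"
  using FG by (intro nn_integral_mono) (auto simp: mean_le_def)
 also have "... <= ennreal c" using G by (simp add: mean_le_def)
 finally show ?thesis using G by (simp add: mean_le_def)
qed

lemma integral_resample:
 fixes F :: "_ => 'b::{banach, second_countable_topology}"
 assumes fin: "finite I" and Pm: "!!i. prob_space (M i)"
  and F: "integrable (PiM I M) F"
 shows "integral\<^sup>L (PiM I M) F = (LINT x|PiM I M. (LINT z|PiM I M. F (mix I K x z)))"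
proof -
 interpret PI: prob_space "PiM I M" by (intro prob_space_PiM Pm)
 interpret PP: pair_sigma_finite "PiM I M" "PiM I M" ..
 have [measurable]: "F \<in> borel_measurable (PiM I M)" using F by auto
 have *: "integrable (PiM I M \<Otimes>\<^sub>M PiM I M) (%w. F (mix I K (fst w) (snd w)))"
  using F measurable_mix[of I K M]
  by (subst (asm) (1) distr_mix[OF fin Pm, symmetric, where K=K], subst (asm) integrable_distr_eq) (auto simp: case_prod_unfold)
 have "integral\<^sup>L (PiM I M) F = (LINT w|(PiM I M \<Otimes>\<^sub>M PiM I M). F (mix I K (fst w) (snd w)))"
  by (subst (1) distr_mix[OF fin Pm, symmetric, where K=K], subst integral_distr) (auto simp: case_prod_unfold)
 also have "... = (LINT x|PiM I M. (LINT z|PiM I M. F (mix I K x z)))"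
  using PP.integral_fst'[OF *] by simp
 finally show ?thesis .
qed

section \<open>Path sums through blocks of vertices\<close>

lemma indep_vars_PiM_reindex:
 assumes M: "!!i. prob_space (M i)" and f: "inj_on f K" "f \<in> K \<rightarrow> I" and K: "K \<noteq> {}"
 shows "prob_space.indep_vars (PiM I M) (%k. M (f k)) (%k x. x (f k)) K"
proof -
 interpret PI: prob_space "PiM I M" by (intro prob_space_PiM M)
 have rv: "(%x. x (f k)) \<in> measurable (PiM I M) (M (f k))" if "k \<in> K" for k
  using f that by (intro measurable_component_singleton) auto
 have "distr (PiM I M) (\<Pi>\<^sub>M k\<in>K. M (f k)) (%x. \<lambda>k\<in>K. x (f k)) = (\<Pi>\<^sub>M k\<in>K. M (f k))"
  by (rule distr_PiM_reindex[OF M f])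
 also have "... = (\<Pi>\<^sub>M k\<in>K. distr (PiM I M) (M (f k)) (%x. x (f k)))"
  using f by (intro PiM_cong refl distr_PiM_component[symmetric] M) auto
 finally show ?thesis
  using rv K by (subst PI.indep_vars_iff_distr_eq_PiM') auto
qed

text \<open>The vertices \<open>1, ..., B * n\<close> are divided into \<open>B\<close> consecutive blocks of size \<open>n\<close>, numbered from 0, and \<open>blk\<close> recovers the
  block of a vertex. The fewer than \<open>B\<close> vertices that may be left over do not enter the
  statistic.\<close>
definition blk :: "nat => nat => nat" where "blk n i = (i - 1) div n"
definition vtx :: "nat => nat => nat set" where "vtx n b = {b * n + 1..(b + 1) * n}"
definition vtxs :: "nat => nat set => nat set" where "vtxs n S = (\<Union>b\<in>S. vtx n b)"
definition ent :: "(nat \<times> nat => real) => nat => nat => real" where "ent y i j = y (min i j, max i j)"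

lemma finite_vtx[simp]: "finite (vtx n b)" by (simp add: vtx_def)
lemma card_vtx[simp]: "card (vtx n b) = n" by (simp add: vtx_def)
lemma finite_vtxs[simp]: "finite S ==> finite (vtxs n S)" by (simp add: vtxs_def)

lemma blk_vtx: "i \<in> vtx n b ==> blk n i = b"
proof -
 assume "i \<in> vtx n b"
 then have "b * n + 1 <= i" "i <= b * n + n" by (auto simp: vtx_def)
 then have "i - 1 = b * n + (i - 1 - b * n)" "i - 1 - b * n < n" by linarith+
 then have "(i - 1) div n = b" by (metis div_mult_self3 add.commute add_0 div_less less_nat_zero_code mult.commute)
 then show ?thesis by (simp add: blk_def)
qed

lemma blk_vtxs: "i \<in> vtxs n S ==> blk n i \<in> S"
 by (auto simp: vtxs_def blk_vtx)

lemma vtx_disjoint: "b \<noteq> b' ==> vtx n b \<inter> vtx n b' = {}"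
 using blk_vtx by blast

lemma vtx_vtxs: "b \<in> S ==> vtx n b \<subseteq> vtxs n S" by (auto simp: vtxs_def)

lemma in_vtxs_iff: "i \<in> vtxs n S ==> i \<in> vtx n (blk n i)"
 by (auto simp: vtxs_def blk_vtx)

lemma sum_vtxs: "finite S ==> (\<Sum>i\<in>vtxs n S. f i) = (\<Sum>b\<in>S. \<Sum>i\<in>vtx n b. f i :: real)"
 unfolding vtxs_def using vtx_disjoint by (intro sum.UNION_disjoint) auto

text \<open>\<open>chain Y n b1 A0 k S l j\<close> is the sum over all paths that start at \<open>l\<close>, end in block \<open>b1\<close>, take at most \<open>k\<close> steps and visit
  each block of \<open>S\<close> at most once, of the product of the entries of \<open>Y\<close> along the path times \<open>A0\<close> at its end. For the
  identity matrix \<open>A0\<close> these are the paths from \<open>l\<close> to \<open>j\<close>, for a column of ones all paths into block \<open>b1\<close>. Since the blocks are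
  distinct, the entries of the first step are independent of the rest of the path.\<close>
primrec chain :: "(nat => nat => real) => nat => nat => (nat => nat => real) => nat => nat set => nat => nat => real" where
 "chain Y n b1 A0 0 S l j = (if blk n l = b1 then A0 l j else 0)"
| "chain Y n b1 A0 (Suc k) S l j = (if blk n l = b1 then A0 l j
   else \<Sum>m\<in>vtxs n (insert b1 (S - {blk n l})). Y l m * chain Y n b1 A0 k (S - {blk n l}) m j)"

lemma chain_cong:
 assumes "!!l m. l \<in> vtxs n (insert b1 S) ==> m \<in> vtxs n (insert b1 S) ==> Y l m = Y' l m"
  and "l \<in> vtxs n (insert b1 S)"
 shows "chain Y n b1 A0 k S l j = chain Y' n b1 A0 k S l j"
 using assms
proof (induction k arbitrary: S l)
 case (Suc k)
 have sub: "vtxs n (insert b1 (S - {blk n l})) \<subseteq> vtxs n (insert b1 S)" by (auto simp: vtxs_def)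
 have "chain Y n b1 A0 k (S - {blk n l}) m j = chain Y' n b1 A0 k (S - {blk n l}) m j"
  if "m \<in> vtxs n (insert b1 (S - {blk n l}))" for m
  by (rule Suc.IH) (use Suc.prems(1) sub that in \<open>meson subsetD\<close>)+
 moreover have "Y l m = Y' l m" if "m \<in> vtxs n (insert b1 (S - {blk n l}))" for m
  using Suc.prems sub that by blast
 ultimately show ?case by (auto intro!: sum.cong)
qed auto

lemma chain_sum:
 assumes "finite J"
 shows "(\<Sum>j\<in>J. chain Y n b1 A0 k S l j) = chain Y n b1 (%l _. \<Sum>j\<in>J. A0 l j) k S l j'"
proof (induction k arbitrary: S l)
 case (Suc k)
 show ?case
  by (simp add: sum.swap[of _ J] flip: Suc.IH) (simp add: sum_distrib_left sum.swap[of _ J])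
qed auto

text \<open>Paths whose first step leads from \<open>i\<close> into one of the blocks of \<open>S'\<close>. The block of \<open>i\<close> is not visited again, so the
  row of entries at \<open>i\<close> is independent of the chains.\<close>
definition rowsum :: "(nat => nat => real) => nat => nat => (nat => nat => real) => nat => nat set => nat set => nat => nat => real" where
 "rowsum Y n b1 A0 k S S' i j = (\<Sum>m\<in>vtxs n S'. Y i m * chain Y n b1 A0 k S m j)"

lemma chain_Suc_rowsum:
 "i \<in> vtx n b ==> b \<noteq> b1 ==> chain Y n b1 A0 (Suc k) S i j = rowsum Y n b1 A0 k (S - {b}) (insert b1 (S - {b})) i j"
 by (simp add: rowsum_def blk_vtx)

definition ensemble :: "nat => real measure => real measure => (nat \<times> nat => real) measure" where
 "ensemble N \<nu> \<nu>d = PiM (upper_indices N) (%e. if fst e = snd e then \<nu>d else \<nu>)"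

lemma finite_upper_indices[simp]: "finite (upper_indices N)"
 by (rule finite_subset[of _ "{1..N} \<times> {1..N}"]) (auto simp: upper_indices_def)

text \<open>The entry function \<open>t\<close> is applied to the entries above the diagonal; its moments are those of an \<open>entry_family\<close>.\<close>
locale wigner =
 fixes N n B :: nat and \<nu> \<nu>d :: "real measure" and t :: "real => real" and mu v q :: real
 assumes nu: "prob_space \<nu>" "prob_space \<nu>d" and sets_nu[measurable_cong]: "sets \<nu> = sets borel" "sets \<nu>d = sets borel"
  and t[measurable]: "t \<in> borel_measurable borel"
  and t4: "integrable \<nu> (%x. t x^4)"
  and mu: "(LINT x|\<nu>. t x) = mu" and v: "(LINT x|\<nu>. (t x)^2) = v" and q: "(LINT x|\<nu>. t x^4) <= q^2" "0 <= q"
  and n: "0 < n" "B * n <= N"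
begin

abbreviation "I == upper_indices N"
abbreviation "Me == (%e::nat\<times>nat. if fst e = snd e then \<nu>d else \<nu>)"
abbreviation "E == ensemble N \<nu> \<nu>d"

lemma prob_Me: "prob_space (Me e)" using nu by auto

sublocale E: prob_space E
 unfolding ensemble_def by (intro prob_space_PiM) (use nu in auto)

lemma sets_Me: "sets (Me e) = sets borel" using sets_nu by auto

lemma measurable_entry[measurable (raw)]: "e \<in> I ==> (%y. y e) \<in> borel_measurable E"
 using measurable_component_singleton[of e I Me] unfolding ensemble_def
 by (subst measurable_cong_sets[OF refl sets_Me[of e, symmetric]])

lemma vtx_range: "i \<in> vtx n b ==> b < B ==> 1 <= i \<and> i <= N"
proof -
 assume "i \<in> vtx n b" "b < B"
 then have "i <= (b + 1) * n" "(b + 1) * n <= B * n" using mult_le_mono1[of "b + 1" B n] by (auto simp: vtx_def)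
 then show ?thesis using n \<open>i \<in> vtx n b\<close> by (auto simp: vtx_def)
qed

lemma vtxs_range: "i \<in> vtxs n S ==> S \<subseteq> {..<B} ==> 1 <= i \<and> i <= N"
 using vtx_range by (fastforce simp: vtxs_def)

lemma pair_in_I: "1 <= i ==> i <= N ==> 1 <= j ==> j <= N ==> (min i j, max i j) \<in> I"
 by (auto simp: upper_indices_def min_def max_def)

definition Y :: "(nat \<times> nat => real) => nat => nat => real" where "Y y i j = t (ent y i j)"

lemma measurable_Y: "1 <= i ==> i <= N ==> 1 <= j ==> j <= N ==> (%y. Y y i j) \<in> borel_measurable E"
 unfolding Y_def ent_def using pair_in_I by measurable

lemma measurable_chain:
 assumes "insert b1 S \<subseteq> {..<B}" "l \<in> vtxs n (insert b1 S)"
 shows "(%y. chain (Y y) n b1 A0 k S l j) \<in> borel_measurable E"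
 using assms
proof (induction k arbitrary: S l)
 case 0 show ?case by (cases "blk n l = b1") auto
next
 case (Suc k)
 have sub: "vtxs n (insert b1 (S - {blk n l})) \<subseteq> vtxs n (insert b1 S)" by (auto simp: vtxs_def)
 have "(%y. Y y l m) \<in> borel_measurable E" "(%y. chain (Y y) n b1 A0 k (S - {blk n l}) m j) \<in> borel_measurable E"
  if "m \<in> vtxs n (insert b1 (S - {blk n l}))" for m
  using Suc.prems sub that vtxs_range[OF _ Suc.prems(1)] by (auto intro!: measurable_Y Suc.IH)
 then show ?case by (cases "blk n l = b1") auto
qed

lemma measurable_rowsum:
 assumes "insert b1 S \<subseteq> {..<B}" "S' \<subseteq> insert b1 S" "1 <= i" "i <= N"
 shows "(%y. rowsum (Y y) n b1 A0 k S S' i j) \<in> borel_measurable E"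
proof -
 have "(%y. Y y i m) \<in> borel_measurable E" "(%y. chain (Y y) n b1 A0 k S m j) \<in> borel_measurable E"
  if "m \<in> vtxs n S'" for m
 proof -
  have m: "m \<in> vtxs n (insert b1 S)" using that assms(2) by (auto simp: vtxs_def)
  show "(%y. Y y i m) \<in> borel_measurable E" using vtxs_range[OF m assms(1)] assms by (intro measurable_Y) auto
  show "(%y. chain (Y y) n b1 A0 k S m j) \<in> borel_measurable E" using assms m by (intro measurable_chain)
 qed
 then show ?thesis unfolding rowsum_def by measurable
qed

lemma ent_mix:
 "1 <= i ==> i <= N ==> 1 <= j ==> j <= N ==>
  ent (mix I K x z) i j = (if (min i j, max i j) \<in> K then ent z i j else ent x i j)"
 using pair_in_I[of i j] by (simp add: ent_def mix_def)

context
 fixes b b1 k :: nat and S S' :: "nat set" and A0 :: "nat => nat => real" and J :: "nat set" and s e :: real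
 assumes blocks: "insert b1 S \<subseteq> {..<B}" "S' \<subseteq> insert b1 S" "b < B" "b \<notin> insert b1 S" and J: "finite J"
  and s: "mean_le E (%y. \<Sum>c\<in>S'. \<Sum>l\<in>vtx n c. \<Sum>j\<in>J. (chain (Y y) n b1 A0 k S l j)^2) s"
  and e: "mean_le E (%y. \<Sum>c\<in>S'. \<Sum>j\<in>J. (\<Sum>l\<in>vtx n c. chain (Y y) n b1 A0 k S l j)^2) e"
begin

lemma finS: "finite S'" "finite S" proof -
 have f: "finite (insert b1 S)" by (rule finite_subset[OF blocks(1)]) simp
 show "finite S'" by (rule finite_subset[OF blocks(2) f])
 show "finite S" using f by simp
qed

text \<open>Resampling all entries that touch block \<open>b\<close> leaves the chains in the other blocks fixed. Conditionally on them, the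
  row sums from block \<open>b\<close> are a \<open>matrix_family\<close> with \<open>A\<close> equal to the matrix of chains.\<close>
definition "touch = {p::nat\<times>nat. fst p \<in> vtx n b \<or> snd p \<in> vtx n b}"

lemma chain_mix:
 assumes "m \<in> vtxs n S'"
 shows "chain (Y (mix I touch x z)) n b1 A0 k S m j = chain (Y x) n b1 A0 k S m j"
proof (rule chain_cong)
 show "m \<in> vtxs n (insert b1 S)" using assms blocks by (auto simp: vtxs_def)
 fix l m assume lm: "l \<in> vtxs n (insert b1 S)" "m \<in> vtxs n (insert b1 S)"
 have "blk n l \<noteq> b" "blk n m \<noteq> b" using blk_vtxs[OF lm(1)] blk_vtxs[OF lm(2)] blocks(4) by auto
 then have "l \<notin> vtx n b" "m \<notin> vtx n b" using blk_vtx[of _ n b] by auto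
 then have "(min l m, max l m) \<notin> touch" by (auto simp: touch_def min_def max_def)
 then show "Y (mix I touch x z) l m = Y x l m"
  using vtxs_range[OF lm(1) blocks(1)] vtxs_range[OF lm(2) blocks(1)] by (simp add: Y_def ent_mix)
qed

lemma rowsum_mix:
 assumes "i \<in> vtx n b"
 shows "rowsum (Y (mix I touch x z)) n b1 A0 k S S' i j = (\<Sum>m\<in>vtxs n S'. Y z i m * chain (Y x) n b1 A0 k S m j)"
 unfolding rowsum_def
proof (intro sum.cong refl)
 fix m assume m: "m \<in> vtxs n S'"
 have "(min i m, max i m) \<in> touch" using assms by (auto simp: touch_def min_def max_def)
 moreover have "1 <= m \<and> m <= N" by (rule vtxs_range[OF m]) (use blocks in auto)
 ultimately have "Y (mix I touch x z) i m = Y z i m"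
  using vtx_range[OF assms blocks(3)] by (simp add: Y_def ent_mix)
 then show "Y (mix I touch x z) i m * chain (Y (mix I touch x z)) n b1 A0 k S m j = Y z i m * chain (Y x) n b1 A0 k S m j"
  using chain_mix[OF m] by simp
qed

lemma matrix_family:
 assumes "S' \<noteq> {}"
 shows "matrix_family E (%p z. Y z (fst p) (snd p)) (vtx n b) (vtxs n S') mu v q J"
proof -
 let ?K = "vtx n b \<times> vtxs n S'"
 define f where "f p = (min (fst p) (snd p), max (fst p) (snd p))" for p :: "nat \<times> nat"
 have rng: "1 <= fst p \<and> fst p <= N \<and> 1 <= snd p \<and> snd p <= N \<and> blk n (fst p) = b \<and> blk n (snd p) \<noteq> b" if "p \<in> ?K" for p
  using that vtx_range[of "fst p" b] vtxs_range[of "snd p" S'] blocks blk_vtx[of "fst p" n b] blk_vtxs[of "snd p" n S']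
  by (auto simp: mem_Times_iff)
 have inj: "inj_on f ?K"
 proof (rule inj_onI)
  fix p p' assume pp: "p \<in> ?K" "p' \<in> ?K" "f p = f p'"
  then have "(fst p = fst p' \<and> snd p = snd p') \<or> (fst p = snd p' \<and> snd p = fst p')"
   by (auto simp: f_def min_def max_def split: if_splits)
  then show "p = p'" using rng[OF pp(1)] rng[OF pp(2)] by (auto intro: prod_eqI)
 qed
 have fI: "f \<in> ?K \<rightarrow> I" using rng pair_in_I by (auto simp: f_def)
 have off: "Me (f p) = \<nu>" if "p \<in> ?K" for p using rng[OF that] by (auto simp: f_def min_def max_def split: if_splits)
 have ne: "?K \<noteq> {}" using assms n by (auto simp: vtxs_def vtx_def)
 have "E.indep_vars (%p. Me (f p)) (%p x. x (f p)) ?K"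
  unfolding ensemble_def by (rule indep_vars_PiM_reindex[OF prob_Me inj fI ne])
 then have "E.indep_vars (%_. borel) (%p x. t (x (f p))) ?K"
  by (rule E.indep_vars_compose2) (use t measurable_cong_sets[OF sets_Me refl] in blast)
 moreover have Yf: "Y z (fst p) (snd p) = t (z (f p))" for p z by (simp add: Y_def ent_def f_def)
 ultimately have ind: "E.indep_vars (%_. borel) (%p z. Y z (fst p) (snd p)) ?K" by simp
 have d: "distr E \<nu> (%x. x (f p)) = \<nu>" if "p \<in> ?K" for p
 proof -
  have "distr (PiM I Me) (Me (f p)) (%x. x (f p)) = Me (f p)"
   by (rule distr_PiM_component[OF prob_Me]) (use fI that in blast)
  then show ?thesis unfolding ensemble_def off[OF that] .
 qed
 have mf: "(%x. x (f p)) \<in> measurable E \<nu>" if "p \<in> ?K" for p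
  using measurable_entry[of "f p"] fI that measurable_cong_sets[OF refl sets_nu(1)] by blast
 have ig: "(LINT x|E. h (x (f p))) = (LINT x|\<nu>. h x)" "integrable E (%x. h (x (f p))) = integrable \<nu> h"
  if "p \<in> ?K" "h \<in> borel_measurable borel" for p and h :: "real => real"
 proof -
  have h: "h \<in> borel_measurable \<nu>" using that(2) measurable_cong_sets[OF sets_nu(1) refl] by blast
  show "(LINT x|E. h (x (f p))) = (LINT x|\<nu>. h x)"
   using integral_distr[OF mf[OF that(1)] h] d[OF that(1)] by simp
  show "integrable E (%x. h (x (f p))) = integrable \<nu> h"
   using integrable_distr_eq[OF mf[OF that(1)] h] d[OF that(1)] by simp
 qed
 show ?thesis
 proof (unfold_locales, goal_cases)
  case 1 then show ?case using finS by simp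
 next case 2 then show ?case by (rule ind)
 next case (3 p) then show ?case unfolding Yf using ig(2)[of p "%x. t x^4"] t4 by simp
 next case (4 p) then show ?case unfolding Yf using ig(1)[of p t] mu by simp
 next case (5 p) then show ?case unfolding Yf using ig(1)[of p "%x. (t x)^2"] v by simp
 next case (6 p) then show ?case unfolding Yf using ig(1)[of p "%x. t x^4"] q by simp
 qed (use q finS J in auto)
qed

lemma mv: "mu^2 <= v" "0 <= v" "v <= q"
proof -
 interpret nu: prob_space \<nu> by (rule nu)
 interpret X: entry_family \<nu> "%_::unit. t" "UNIV" mu v q
  by unfold_locales (use t4 mu v q nu.indep_vars_unit[of t] measurable_cong_sets[OF sets_nu(1) refl] in auto)
 show "mu^2 <= v" "0 <= v" "v <= q" using X.moment_bounds by auto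
qed

definition "Sq y = (\<Sum>c\<in>S'. \<Sum>l\<in>vtx n c. \<Sum>j\<in>J. (chain (Y y) n b1 A0 k S l j)^2)"
definition "Co y = (\<Sum>c\<in>S'. \<Sum>j\<in>J. (\<Sum>l\<in>vtx n c. chain (Y y) n b1 A0 k S l j)^2)"

lemma Sq_eq: "matrix_family.sqA (vtxs n S') (%m j. chain (Y x) n b1 A0 k S m j) J = Sq x" if "S' \<noteq> {}"
proof -
 interpret F: matrix_family E "%p z. Y z (fst p) (snd p)" "vtx n b" "vtxs n S'" mu v q "%m j. chain (Y x) n b1 A0 k S m j" J
  using matrix_family[OF that] .
 show ?thesis unfolding F.sqA_def Sq_def using sum_vtxs[OF finS(1)] by simp
qed

lemma Co_le: "matrix_family.colA (vtxs n S') (%m j. chain (Y x) n b1 A0 k S m j) J <= card S' * Co x" if "S' \<noteq> {}"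
proof -
 interpret F: matrix_family E "%p z. Y z (fst p) (snd p)" "vtx n b" "vtxs n S'" mu v q "%m j. chain (Y x) n b1 A0 k S m j" J
  using matrix_family[OF that] .
 have "F.colA = (\<Sum>j\<in>J. (\<Sum>c\<in>S'. \<Sum>l\<in>vtx n c. chain (Y x) n b1 A0 k S l j)^2)"
  unfolding F.colA_def using sum_vtxs[OF finS(1)] by simp
 also have "... <= (\<Sum>j\<in>J. (\<Sum>c\<in>S'. (\<Sum>l\<in>vtx n c. chain (Y x) n b1 A0 k S l j)^2) * card S')"
  using sum_squared_le_sum_of_squares[of _ S'] by (intro sum_mono) (auto simp: mult.commute)
 also have "... = card S' * Co x"
  unfolding Co_def by (subst sum.swap) (simp add: sum_distrib_left sum_distrib_right mult.commute)
 finally show ?thesis .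
qed

lemma Sq0: "0 <= Sq x" "0 <= Co x" by (auto simp: Sq_def Co_def intro!: sum_nonneg)

lemma measR: "i \<in> vtx n b ==> (%y. rowsum (Y y) n b1 A0 k S S' i j) \<in> borel_measurable E"
 using vtx_range[of i b] blocks by (intro measurable_rowsum) auto

lemma Sq_mean: "mean_le E Sq s" "mean_le E Co e" "0 <= s" "0 <= e"
 using s e by (auto simp: Sq_def[abs_def] Co_def[abs_def] mean_le_def)

lemma resample:
 assumes "F \<in> borel_measurable E" "mean_le E G c" "!!x. x \<in> space E ==> mean_le E (%z. F (mix I touch x z)) (G x)"
 shows "mean_le E F c"
 using assms mean_le_resample[of I Me F G c touch] prob_Me unfolding ensemble_def by auto

lemma comb: "[|0 <= a; 0 <= d|] ==> mean_le E (%x. a * Sq x + d * Co x) (a * s + d * e)"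
 using Sq_mean Sq0 by (intro mean_le_add mean_le_cmult) auto

text \<open>One step of the induction along paths, for the mean of the squared norm: condition on the chains and take the
  mean over the entries of block \<open>b\<close>. The lemmas that follow do the same for column sums, fourth powers and deviations.\<close>
lemma square_step:
 "mean_le E (%y. \<Sum>i\<in>vtx n b. \<Sum>j\<in>J. (rowsum (Y y) n b1 A0 k S S' i j)^2) (n*(v * s + mu^2 * card S' * e))"
proof (cases "S' = {}")
 case True then show ?thesis
  using Sq_mean mv by (auto simp: rowsum_def vtxs_def mean_le_def intro!: mult_nonneg_nonneg add_nonneg_nonneg)
next
 case False
 have *: "mean_le E (%z. \<Sum>i\<in>vtx n b. \<Sum>j\<in>J. (rowsum (Y (mix I touch x z)) n b1 A0 k S S' i j)^2) (n * v * Sq x + n*(mu^2 * card S') * Co x)" for x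
 proof -
  interpret F: matrix_family E "%p z. Y z (fst p) (snd p)" "vtx n b" "vtxs n S'" mu v q "%m j. chain (Y x) n b1 A0 k S m j" J
   using matrix_family[OF False] .
  have "mean_le E (%z. \<Sum>i\<in>vtx n b. \<Sum>j\<in>J. (rowsum (Y (mix I touch x z)) n b1 A0 k S S' i j)^2) (n*(v * Sq x + mu^2 * F.colA))"
   using F.square_mean_le unfolding F.W_def Sq_eq[OF False] by (simp add: rowsum_mix)
  moreover have "n*(v * Sq x + mu^2 * F.colA) <= n * v * Sq x + n*(mu^2 * card S') * Co x"
   using mult_left_mono[OF Co_le[OF False, of x], of "n * mu^2"] by (simp add: algebra_simps)
  ultimately show ?thesis by (rule mean_le_cong_bound)
 qed
 show ?thesis
  by (rule mean_le_cong_bound[OF resample[OF _ comb *]])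
    (use measR mv in \<open>auto simp: algebra_simps intro!: mult_nonneg_nonneg borel_measurable_sum borel_measurable_power\<close>)
qed

lemma column_step:
 "mean_le E (%y. \<Sum>j\<in>J. (\<Sum>i\<in>vtx n b. rowsum (Y y) n b1 A0 k S S' i j)^2) (n * v * s + (real n)^2 * mu^2 * card S' * e)"
proof (cases "S' = {}")
 case True then show ?thesis
  using Sq_mean mv by (auto simp: rowsum_def vtxs_def mean_le_def intro!: mult_nonneg_nonneg add_nonneg_nonneg)
next
 case False
 have *: "mean_le E (%z. \<Sum>j\<in>J. (\<Sum>i\<in>vtx n b. rowsum (Y (mix I touch x z)) n b1 A0 k S S' i j)^2) (n * v * Sq x + (real n)^2 * mu^2 * card S' * Co x)" for x
 proof -
  interpret F: matrix_family E "%p z. Y z (fst p) (snd p)" "vtx n b" "vtxs n S'" mu v q "%m j. chain (Y x) n b1 A0 k S m j" J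
   using matrix_family[OF False] .
  have "mean_le E (%z. \<Sum>j\<in>J. (\<Sum>i\<in>vtx n b. rowsum (Y (mix I touch x z)) n b1 A0 k S S' i j)^2) (n * v * Sq x + (real n)^2 * mu^2 * F.colA)"
   using F.column_sums(1) unfolding F.W_def Sq_eq[OF False] by (simp add: rowsum_mix)
  moreover have "n * v * Sq x + (real n)^2 * mu^2 * F.colA <= n * v * Sq x + (real n)^2 * mu^2 * card S' * Co x"
   using mult_left_mono[OF Co_le[OF False, of x], of "(real n)^2 * mu^2"] by (simp add: algebra_simps)
  ultimately show ?thesis by (rule mean_le_cong_bound)
 qed
 show ?thesis
  by (rule mean_le_cong_bound[OF resample[OF _ comb *]])
    (use measR mv in \<open>auto simp: algebra_simps intro!: mult_nonneg_nonneg borel_measurable_sum borel_measurable_power\<close>)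
qed

lemma dev_le:
 assumes "S' \<noteq> {}"
 shows "matrix_family.dev (vtxs n S') mu q (%m j. chain (Y x) n b1 A0 k S m j) J <= 20*(q * Sq x + mu^2 * card S' * Co x)"
proof -
 interpret F: matrix_family E "%p z. Y z (fst p) (snd p)" "vtx n b" "vtxs n S'" mu v q "%m j. chain (Y x) n b1 A0 k S m j" J
  using matrix_family[OF assms] .
 show ?thesis unfolding F.dev_def Sq_eq[OF assms]
  using mult_left_mono[OF Co_le[OF assms, of x], of "mu^2"] by (simp add: algebra_simps)
qed

lemma fourth_step:
 "mean_le E (%y. sqrt (\<Sum>i\<in>vtx n b. \<Sum>j\<in>J. rowsum (Y y) n b1 A0 k S S' i j^4)) (sqrt n*20*(q * s + mu^2 * card S' * e))"
proof (cases "S' = {}")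
 case True then show ?thesis
  using Sq_mean mv q by (auto simp: rowsum_def vtxs_def mean_le_def intro!: mult_nonneg_nonneg add_nonneg_nonneg)
next
 case False
 have *: "mean_le E (%z. sqrt (\<Sum>i\<in>vtx n b. \<Sum>j\<in>J. rowsum (Y (mix I touch x z)) n b1 A0 k S S' i j^4)) (sqrt n*20 * q * Sq x + sqrt n*20 * mu^2 * card S' * Co x)" for x
 proof -
  interpret F: matrix_family E "%p z. Y z (fst p) (snd p)" "vtx n b" "vtxs n S'" mu v q "%m j. chain (Y x) n b1 A0 k S m j" J
   using matrix_family[OF False] .
  have "mean_le E (%z. sqrt (\<Sum>i\<in>vtx n b. \<Sum>j\<in>J. rowsum (Y (mix I touch x z)) n b1 A0 k S S' i j^4)) (sqrt n * F.dev)"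
   using F.fourth_mean_le unfolding F.W_def by (simp add: rowsum_mix)
  moreover have "sqrt n * F.dev <= sqrt n*20 * q * Sq x + sqrt n*20 * mu^2 * card S' * Co x"
   using mult_left_mono[OF dev_le[OF False, of x], of "sqrt n"] by (simp add: algebra_simps)
  ultimately show ?thesis by (rule mean_le_cong_bound)
 qed
 show ?thesis
  by (rule mean_le_cong_bound[OF resample[OF _ comb *]])
    (use measR mv q in \<open>auto simp: algebra_simps intro!: mult_nonneg_nonneg borel_measurable_sum borel_measurable_power borel_measurable_sqrt\<close>)
qed

text \<open>The norm for block \<open>b\<close> follows the norms of the chains it is built from. The error has the extra factor \<open>sqrt n\<close>
  instead of \<open>n\<close>, except for the contribution of the means.\<close>
lemma concentration_step:
 "mean_le E (%y. \<bar>(\<Sum>i\<in>vtx n b. \<Sum>j\<in>J. (rowsum (Y y) n b1 A0 k S S' i j)^2)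
    - n*(v - mu^2)*(\<Sum>c\<in>S'. \<Sum>l\<in>vtx n c. \<Sum>j\<in>J. (chain (Y y) n b1 A0 k S l j)^2)\<bar>)
   (n * mu^2 * card S' * e + sqrt n*20*(q * s + mu^2 * card S' * e))"
proof (cases "S' = {}")
 case True then show ?thesis
  using Sq_mean mv q by (auto simp: rowsum_def vtxs_def mean_le_def intro!: mult_nonneg_nonneg add_nonneg_nonneg)
next
 case False
 define D where "D y = \<bar>(\<Sum>i\<in>vtx n b. \<Sum>j\<in>J. (rowsum (Y y) n b1 A0 k S S' i j)^2) - n*(v - mu^2) * Sq y\<bar>" for y
 have Smix: "Sq (mix I touch x z) = Sq x" for x z
  unfolding Sq_def using vtx_vtxs chain_mix by (intro sum.cong refl) (auto simp: subset_iff)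
 have *: "mean_le E (%z. D (mix I touch x z)) (sqrt n*20 * q * Sq x + (n * mu^2 * card S' + sqrt n*20 * mu^2 * card S') * Co x)" for x
 proof -
  interpret F: matrix_family E "%p z. Y z (fst p) (snd p)" "vtx n b" "vtxs n S'" mu v q "%m j. chain (Y x) n b1 A0 k S m j" J
   using matrix_family[OF False] .
  let ?R = "%z. \<Sum>i\<in>vtx n b. \<Sum>j\<in>J. (rowsum (Y (mix I touch x z)) n b1 A0 k S S' i j)^2"
  have eq: "?R z = (\<Sum>i\<in>vtx n b. \<Sum>j\<in>J. (F.W i j z)^2)" for z by (simp add: rowsum_mix F.W_def)
  have m: "?R \<in> borel_measurable E" unfolding eq by measurable
  have c0: "0 <= n * mu^2 * F.colA" using F.colA_nonneg by simp
  have "mean_le E (%z. \<bar>?R z - n*((v - mu^2) * Sq x + mu^2 * F.colA)\<bar> + n * mu^2 * F.colA) (sqrt n * F.dev + n * mu^2 * F.colA)"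
   using F.square_concentrates c0 unfolding eq Sq_eq[OF False] by (intro mean_le_add E.mean_le_const) auto
  then have "mean_le E (%z. D (mix I touch x z)) (sqrt n * F.dev + n * mu^2 * F.colA)"
   by (rule mean_le_mono) (use m c0 in \<open>auto simp: D_def Smix algebra_simps abs_if\<close>)
  moreover have "sqrt n * F.dev + n * mu^2 * F.colA <= sqrt n*20 * q * Sq x + (n * mu^2 * card S' + sqrt n*20 * mu^2 * card S') * Co x"
   using mult_left_mono[OF dev_le[OF False, of x], of "sqrt n"] mult_left_mono[OF Co_le[OF False, of x], of "n * mu^2"]
   by (simp add: algebra_simps)
  ultimately show ?thesis by (rule mean_le_cong_bound)
 qed
 have mD: "D \<in> borel_measurable E"
  unfolding D_def using measR Sq_mean(1)
  by (auto simp: mean_le_def intro!: borel_measurable_abs borel_measurable_diff borel_measurable_times borel_measurable_sum borel_measurable_power)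
 have "mean_le E D (n * mu^2 * card S' * e + sqrt n*20*(q * s + mu^2 * card S' * e))"
  by (rule mean_le_cong_bound[OF resample[OF mD comb *]])
    (use mv q in \<open>auto simp: algebra_simps intro!: mult_nonneg_nonneg add_nonneg_nonneg\<close>)
 then show ?thesis unfolding D_def[abs_def] Sq_def[abs_def] by simp
qed

lemma mean_step:
 assumes "J = {j}"
 shows "mean_le E (%y. \<bar>(\<Sum>i\<in>vtx n b. rowsum (Y y) n b1 A0 k S S' i j)
    - n * mu*(\<Sum>c\<in>S'. \<Sum>l\<in>vtx n c. chain (Y y) n b1 A0 k S l j)\<bar>) (sqrt (n * v * s))"
proof (cases "S' = {}")
 case True then show ?thesis
  using Sq_mean mv q by (auto simp: rowsum_def vtxs_def mean_le_def intro!: mult_nonneg_nonneg add_nonneg_nonneg)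
next
 case False
 define T where "T y = (\<Sum>c\<in>S'. \<Sum>l\<in>vtx n c. chain (Y y) n b1 A0 k S l j)" for y
 define D where "D y = \<bar>(\<Sum>i\<in>vtx n b. rowsum (Y y) n b1 A0 k S S' i j) - n * mu * T y\<bar>" for y
 have Tmix: "T (mix I touch x z) = T x" for x z
  unfolding T_def using vtx_vtxs chain_mix by (intro sum.cong refl) (auto simp: subset_iff)
 have mch: "(%y. chain (Y y) n b1 A0 k S l j) \<in> borel_measurable E" if "c \<in> S'" "l \<in> vtx n c" for c l
  using that blocks by (intro measurable_chain) (auto simp: vtxs_def)
 have *: "mean_le E (%z. D (mix I touch x z)) (sqrt (n * v * Sq x))" for x
 proof -
  interpret F: matrix_family E "%p z. Y z (fst p) (snd p)" "vtx n b" "vtxs n S'" mu v q "%m j. chain (Y x) n b1 A0 k S m j" J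
   using matrix_family[OF False] .
  have "(\<Sum>l\<in>vtxs n S'. (chain (Y x) n b1 A0 k S l j)^2) = Sq x"
   unfolding Sq_def using sum_vtxs[OF finS(1)] assms by simp
  then show ?thesis
   using F.column_sums(2)[of j] unfolding F.W_def D_def Tmix unfolding T_def
   by (simp add: rowsum_mix sum_vtxs[OF finS(1)])
 qed
 have mD: "D \<in> borel_measurable E"
  unfolding D_def T_def using measR mch
  by (auto intro!: borel_measurable_abs borel_measurable_diff borel_measurable_times borel_measurable_sum)
 have "mean_le E (%x. n * v * Sq x) (n * v * s)" using Sq_mean mv by (intro mean_le_cmult) auto
 then have "mean_le E (%x. sqrt (n * v * Sq x)) (sqrt (n * v * s))"
  using Sq0 mv by (intro E.mean_le_sqrt) auto
 from resample[OF mD this *] show ?thesis by (simp add: D_def T_def)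
qed

end

end

section \<open>Concentration of path sums\<close>

text \<open>The limit of the normalized squared norm of the chains with \<open>s\<close> blocks available, including the
  one where the path starts: a path goes directly to the
  target block, or continues to one of the \<open>s - 1\<close> others; each step costs a factor \<open>d\<close>, the variance of an entry times
  the block size. The same recursion, with the mean in place of the variance, describes the sum of the chains.\<close>
primrec lim_sq :: "real => nat => nat => real" where
 "lim_sq d 0 s = 0"
| "lim_sq d (Suc k) s = d*(1 + real (s - 1) * lim_sq d k (s - 1))"

definition limQ :: "nat => real => nat => nat set => nat => real" where
 "limQ b1 d k S b = (if b = b1 then 1 else lim_sq d k (card S))"

locale clt_array =
 fixes B :: nat and \<nu> \<nu>d :: "nat => real measure" and t :: "nat => real => real" and \<kappa> c Q :: real
 assumes B: "0 < B"
  and prob_nu: "!!N. prob_space (\<nu> N)" "!!N. prob_space (\<nu>d N)"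
  and sets_nu: "!!N. sets (\<nu> N) = sets borel" "!!N. sets (\<nu>d N) = sets borel"
  and tm: "!!N. t N \<in> borel_measurable borel"
  and t4: "!!N. integrable (\<nu> N) (%x. t N x^4)"
  and lim_mu: "(%N. real N*(LINT x|\<nu> N. t N x)) ----> \<kappa>"
  and lim_v: "(%N. real N*(LINT x|\<nu> N. (t N x)^2)) ----> c"
  and Q: "!!N. 0 < N ==> (LINT x|\<nu> N. t N x^4) <= (Q/real N)^2" "0 <= Q"
begin

definition "n N = N div B"
abbreviation "mu N == LINT x|\<nu> N. t N x"
abbreviation "v N == LINT x|\<nu> N. (t N x)^2"
abbreviation "q N == Q/real N"
abbreviation "E N == ensemble N (\<nu> N) (\<nu>d N)"
abbreviation "Y N == wigner.Y (t N)"

lemma wig: "B <= N ==> wigner N (n N) B (\<nu> N) (\<nu>d N) (t N) (mu N) (v N) (q N)"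
 unfolding n_def
proof (rule wigner.intro[OF prob_nu sets_nu tm t4 refl refl])
 assume "B <= N"
 then show "(LINT x|\<nu> N. t N x^4) <= (q N)^2" using Q(1)[of N] B by linarith
 show "0 <= q N" using Q(2) by simp
 show "0 < N div B" using \<open>B <= N\<close> B by (simp add: div_greater_zero_iff)
 show "B*(N div B) <= N" by simp
qed

lemma n_ratio: "(%N. real (n N)/real N) ----> 1/real B"
proof -
 have "\<bar>real (n N)/real N - 1/real B\<bar> <= 1/real N" if "0 < N" for N
 proof -
  have "real N = real B * real (n N) + real (N mod B)" unfolding n_def by (metis mult_div_mod_eq of_nat_add of_nat_mult)
  then have "1/real B - real (n N)/real N = (real (N mod B)/real B)/real N"
   using that B by (simp add: field_simps)
  moreover have "real (N mod B)/real B <= 1" using B by (simp add: order.strict_implies_order)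
  then have "(real (N mod B)/real B)/real N <= 1/real N" by (intro divide_right_mono) auto
  moreover have "0 <= (real (N mod B)/real B)/real N" by simp
  ultimately show ?thesis by linarith
 qed
 then have "(%N. real (n N)/real N - 1/real B) ----> 0"
  by (intro Lim_null_comparison[OF _ lim_inverse_n'] eventually_sequentiallyI[of 1]) auto
 then show ?thesis by (simp add: LIM_zero_iff)
qed

lemma n_at_top: "filterlim (%N. real (n N)) at_top sequentially"
proof -
 have "filterlim (%N. (real (n N)/real N) * real N) at_top sequentially"
  by (rule filterlim_tendsto_pos_mult_at_top[OF n_ratio _ filterlim_real_sequentially]) (use B in simp)
 then show ?thesis by (rule filterlim_cong[THEN iffD1, OF refl refl, rotated]) (auto intro: eventually_sequentiallyI[of 1] simp: n_def)
qed

lemma inv_n: "(%N. 1/real (n N)) ----> 0"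
 by (rule tendsto_divide_0[OF tendsto_const filterlim_at_top_imp_at_infinity[OF n_at_top]])

lemma lim_nmu: "(%N. real (n N) * mu N) ----> \<kappa>/real B"
proof -
 have "(%N. (real (n N)/real N)*(real N * mu N)) ----> 1/real B*\<kappa>" by (intro tendsto_mult n_ratio lim_mu)
 then show ?thesis by (rule Lim_transform_eventually[THEN tendsto_eq_rhs]) (auto intro: eventually_sequentiallyI[of 1] simp: n_def)
qed

lemma lim_nv: "(%N. real (n N) * v N) ----> c/real B"
proof -
 have "(%N. (real (n N)/real N)*(real N * v N)) ----> 1/real B * c" by (intro tendsto_mult n_ratio lim_v)
 then show ?thesis by (rule Lim_transform_eventually[THEN tendsto_eq_rhs]) (auto intro: eventually_sequentiallyI[of 1] simp: n_def)
qed

lemma lim_nmu2: "(%N. real (n N)*(mu N)^2) ----> 0"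
proof -
 have "(%N. (real (n N) * mu N)^2*(1/real (n N))) ----> (\<kappa>/real B)^2*0" by (intro tendsto_intros lim_nmu inv_n)
 moreover have "(%N. (real (n N) * mu N)^2*(1/real (n N))) = (%N. real (n N)*(mu N)^2)"
  by (auto simp: fun_eq_iff power2_eq_square field_simps)
 ultimately show ?thesis by simp
qed

lemma lim_nvar: "(%N. real (n N)*(v N - (mu N)^2)) ----> c/real B"
 using tendsto_diff[OF lim_nv lim_nmu2] by (simp add: algebra_simps)

definition nullL1 :: "(nat => (nat \<times> nat => real) => real) => bool" where
 "nullL1 F \<longleftrightarrow> (\<exists>r. r ----> 0 \<and> (\<forall>\<^sub>F N in sequentially. mean_le (E N) (F N) (r N)))"

lemma nullL1I: "r ----> 0 ==> \<forall>\<^sub>F N in sequentially. mean_le (E N) (F N) (r N) ==> nullL1 F"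
 by (auto simp: nullL1_def)

lemma nullL1_mono:
 assumes "nullL1 G" "\<forall>\<^sub>F N in sequentially. F N \<in> borel_measurable (E N) \<and> (\<forall>y. F N y <= G N y)"
 shows "nullL1 F"
proof -
 obtain r where r: "r ----> 0" "\<forall>\<^sub>F N in sequentially. mean_le (E N) (G N) (r N)"
  using assms(1) by (auto simp: nullL1_def)
 from r(2) assms(2) have "\<forall>\<^sub>F N in sequentially. mean_le (E N) (F N) (r N)"
  by eventually_elim (auto intro: mean_le_mono)
 then show ?thesis using r by (auto simp: nullL1_def)
qed

lemma nullL1_add:
 assumes "nullL1 F" "nullL1 G" "!!N y. 0 <= F N y" "!!N y. 0 <= G N y"
 shows "nullL1 (%N y. F N y + G N y)"
proof -
 obtain r s where r: "r ----> 0" "\<forall>\<^sub>F N in sequentially. mean_le (E N) (F N) (r N)"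
  and s: "s ----> 0" "\<forall>\<^sub>F N in sequentially. mean_le (E N) (G N) (s N)"
  using assms(1,2) by (auto simp: nullL1_def)
 from r(2) s(2) have "\<forall>\<^sub>F N in sequentially. mean_le (E N) (%y. F N y + G N y) (r N + s N)"
  by eventually_elim (auto intro: mean_le_add assms)
 then show ?thesis using tendsto_add[OF r(1) s(1)] by (auto simp: nullL1_def)
qed

lemma nullL1_cmult:
 assumes "nullL1 F" "a ----> (l::real)" "!!N. 0 <= a N"
 shows "nullL1 (%N y. a N * F N y)"
proof -
 obtain r where r: "r ----> 0" "\<forall>\<^sub>F N in sequentially. mean_le (E N) (F N) (r N)"
  using assms(1) by (auto simp: nullL1_def)
 from r(2) have "\<forall>\<^sub>F N in sequentially. mean_le (E N) (%y. a N * F N y) (a N * r N)"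
  by eventually_elim (auto intro: mean_le_cmult assms)
 then show ?thesis using tendsto_mult[OF assms(2) r(1)] by (auto simp: nullL1_def)
qed

lemma probE: "prob_space (E N)"
 unfolding ensemble_def by (intro prob_space_PiM) (use prob_nu in auto)

lemma nullL1_const:
 assumes "a ----> (0::real)" "!!N. 0 <= a N" shows "nullL1 (%N y. a N)"
 using assms prob_space.mean_le_const[OF probE] by (intro nullL1I[of a]) auto

lemma nullL1_sum:
 assumes "finite I" "!!i. i \<in> I ==> nullL1 (F i)" "!!i N y. 0 <= F i N y"
 shows "nullL1 (%N y. \<Sum>i\<in>I. F i N y)"
 using assms by (induction I rule: finite_induct) (auto intro!: nullL1_add sum_nonneg nullL1_const)

text \<open>The normalized moments converge, hence are bounded for large \<open>N\<close>; \<open>C0\<close> and \<open>N0\<close> name such a bound and the index from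
  which it holds, so that the bounds below are uniform over all block configurations.\<close>
lemma bound_exists: "\<exists>C\<ge>1. \<exists>N0\<ge>B. \<forall>N\<ge>N0. real (n N) * v N <= C \<and> (real (n N) * mu N)^2 <= C"
proof -
 from lim_nv have "Bseq (%N. real (n N) * v N)" by (intro convergent_imp_Bseq convergentI)
 then obtain C1 where C1: "!!N. norm (real (n N) * v N) <= C1" unfolding Bseq_def by blast
 from tendsto_power[OF lim_nmu, of 2] have "Bseq (%N. (real (n N) * mu N)^2)" by (intro convergent_imp_Bseq convergentI)
 then obtain C2 where C2: "!!N. norm ((real (n N) * mu N)^2) <= C2" unfolding Bseq_def by blast
 show ?thesis
  by (intro exI[of _ "max 1 (max C1 C2)"] exI[of _ B] conjI allI impI)
    (use C1 C2 in \<open>auto simp: abs_le_iff le_max_iff_disj\<close>)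
qed

definition C0 where "C0 = (SOME C. C \<ge> 1 \<and> (\<exists>N0\<ge>B. \<forall>N\<ge>N0. real (n N) * v N <= C \<and> (real (n N) * mu N)^2 <= C))"

lemma C0: "C0 \<ge> 1" "\<exists>N0\<ge>B. \<forall>N\<ge>N0. real (n N) * v N <= C0 \<and> (real (n N) * mu N)^2 <= C0"
 unfolding C0_def by (rule someI2_ex[OF bound_exists]; blast)+

definition N0 where "N0 = (SOME N0. N0 \<ge> B \<and> (\<forall>N\<ge>N0. real (n N) * v N <= C0 \<and> (real (n N) * mu N)^2 <= C0))"

lemma N0: "N0 \<ge> B" "N \<ge> N0 ==> real (n N) * v N <= C0" "N \<ge> N0 ==> (real (n N) * mu N)^2 <= C0"
 using someI_ex[OF C0(2)[unfolded Bex_def], folded N0_def] by auto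

definition Kb :: "nat => real" where "Kb k = (2 * C0*(real B)^2)^k"

lemma Kb_pos: "1 <= Kb k"
proof -
 have "1 <= C0*(real B)^2" using C0(1) B mult_mono[of 1 C0 1 "(real B)^2"] by simp
 then show ?thesis unfolding Kb_def by (intro one_le_power) simp
qed

lemma inv_sqrt_n: "(%N. 1/sqrt (real (n N))) ----> 0"
 using tendsto_real_sqrt[OF inv_n] by (simp add: real_sqrt_divide)

lemma lim_qn: "(%N. q N * real (n N)) ----> Q/real B"
 using tendsto_mult[OF tendsto_const[of Q] n_ratio] by simp

lemma eventually_large: "\<forall>\<^sub>F N in sequentially. N \<ge> N0 \<and> N \<ge> B \<and> 0 < n N"
proof (rule eventually_sequentiallyI[of N0])
 fix N assume "N0 <= N"
 then have "B <= N" using N0(1) by simp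
 then show "N \<ge> N0 \<and> N \<ge> B \<and> 0 < n N" using \<open>N0 <= N\<close> B by (simp add: n_def div_greater_zero_iff)
qed

context
 fixes A0 :: "nat => nat => nat => real" and J :: "nat => nat set" and \<gamma> :: "nat => real" and b1 :: nat
 assumes finJ: "!!N. finite (J N)" and b1: "b1 < B"
  and A2: "!!N. (\<Sum>l\<in>vtx (n N) b1. \<Sum>j\<in>J N. (A0 N l j)^2) = n N"
  and A1: "!!N. (\<Sum>j\<in>J N. (\<Sum>l\<in>vtx (n N) b1. A0 N l j)^2) <= n N*\<gamma> N"
  and \<gamma>: "!!N. N \<ge> B ==> 1 <= \<gamma> N \<and> \<gamma> N <= n N"
begin

text \<open>The two cases of interest are the identity matrix on block \<open>b1\<close>, with \<open>\<gamma> = 1\<close>, and a column of ones, with \<open>\<gamma> = n\<close>. Column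
  sums are weighted by the square of the mean \<open>mu\<close> of order \<open>1/N\<close>, which is why the weaker bound on them suffices.\<close>
abbreviation "ch N y k S l j == chain (Y N y) (n N) b1 (A0 N) k S l j"
abbreviation "rs N y k S S' i j == rowsum (Y N y) (n N) b1 (A0 N) k S S' i j"
definition "sq N k S b y = (\<Sum>l\<in>vtx (n N) b. \<Sum>j\<in>J N. (ch N y k S l j)^2)"
definition "co N k S b y = (\<Sum>j\<in>J N. (\<Sum>l\<in>vtx (n N) b. ch N y k S l j)^2)"

lemma sums_eq:
 "(\<Sum>b\<in>S'. sq N k S b y) = (\<Sum>c\<in>S'. \<Sum>l\<in>vtx (n N) c. \<Sum>j\<in>J N. (ch N y k S l j)^2)"
 "(\<Sum>b\<in>S'. co N k S b y) = (\<Sum>c\<in>S'. \<Sum>j\<in>J N. (\<Sum>l\<in>vtx (n N) c. ch N y k S l j)^2)"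
 by (simp_all add: sq_def co_def)

lemma card_blocks: "S' \<subseteq> {..<B} ==> real (card S') <= real B"
 using card_mono[of "{..<B}" S'] by simp

lemma sum_bound:
 assumes "finite S'" "S' \<subseteq> {..<B}" "!!b. b \<in> S' ==> mean_le M (F b) K" "!!b y. 0 <= F b y" "0 <= (K::real)"
 shows "mean_le M (%y. \<Sum>b\<in>S'. F b y) (real B * K)"
 by (rule mean_le_cong_bound[OF mean_le_sum[OF assms(1,3,4)]])
   (use card_blocks[OF assms(2)] assms(5) in \<open>auto intro: mult_right_mono\<close>)

lemma bounds:
 assumes "N \<ge> N0" "insert b1 S \<subseteq> {..<B}" "b1 \<notin> S" "b \<in> insert b1 S"
 shows "mean_le (E N) (sq N k S b) (Kb k * n N)" "mean_le (E N) (co N k S b) (Kb k * n N*\<gamma> N)"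
proof -
 have NB: "N \<ge> B" using assms(1) N0(1) by simp
 interpret w: wigner N "n N" B "\<nu> N" "\<nu>d N" "t N" "mu N" "v N" "q N" by (rule wig[OF NB])
 note g = \<gamma>[OF NB]
 have "mean_le (E N) (sq N k S b) (Kb k * n N) \<and> mean_le (E N) (co N k S b) (Kb k * n N*\<gamma> N)"
  using assms(2-4)
 proof (induction k arbitrary: S b)
  case (0 S b)
  show ?case
  proof (cases "b = b1")
   case True
   have "sq N 0 S b = (%y. real (n N))" "co N 0 S b = (%y. \<Sum>j\<in>J N. (\<Sum>l\<in>vtx (n N) b1. A0 N l j)^2)"
    using A2[of N] True by (auto simp: sq_def co_def blk_vtx fun_eq_iff cong: sum.cong)
   then show ?thesis using A1[of N] by (auto simp: Kb_def intro!: w.E.mean_le_const mean_le_cong_bound[OF w.E.mean_le_const] sum_nonneg)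
  next
   case False
   then have "sq N 0 S b = (%y. 0)" "co N 0 S b = (%y. 0)" by (auto simp: sq_def co_def blk_vtx fun_eq_iff cong: sum.cong)
   then show ?thesis using g by (auto simp: Kb_def intro!: mean_le_cong_bound[OF mean_le_zero] mult_nonneg_nonneg)
  qed
 next
  case (Suc k S b)
  show ?case
  proof (cases "b = b1")
   case True
   have "sq N (Suc k) S b = (%y. real (n N))" "co N (Suc k) S b = (%y. \<Sum>j\<in>J N. (\<Sum>l\<in>vtx (n N) b1. A0 N l j)^2)"
    using A2[of N] True by (auto simp: sq_def co_def blk_vtx fun_eq_iff cong: sum.cong)
   moreover have "real (n N) <= Kb (Suc k) * n N" "n N*\<gamma> N <= Kb (Suc k) * n N*\<gamma> N"
    using Kb_pos[of "Suc k"] g mult_right_mono[of 1 "Kb (Suc k)" "n N"] mult_right_mono[of 1 "Kb (Suc k)" "n N*\<gamma> N"]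
    by (simp_all add: mult.assoc)
   ultimately show ?thesis using A1[of N] by (auto intro!: mean_le_cong_bound[OF w.E.mean_le_const] sum_nonneg)
  next
   case False
   let ?S = "S - {b}" and ?S' = "insert b1 (S - {b})"
   have sub: "?S' \<subseteq> {..<B}" "b < B" "b \<notin> ?S'" "b1 \<notin> ?S" using Suc.prems False by auto
   have fin: "finite ?S'" by (rule finite_subset[OF sub(1)]) simp
   have IH: "mean_le (E N) (sq N k ?S c) (Kb k * n N)" "mean_le (E N) (co N k ?S c) (Kb k * n N*\<gamma> N)" if "c \<in> ?S'" for c
    using Suc.IH[OF sub(1,4) that] by auto
   have nn: "0 <= sq N k ?S c y" "0 <= co N k ?S c y" for c y by (auto simp: sq_def co_def intro!: sum_nonneg)
   have K0: "0 <= Kb k * n N" "0 <= Kb k * n N*\<gamma> N" using Kb_pos[of k] g by auto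
   have s: "mean_le (E N) (%y. \<Sum>c\<in>?S'. sq N k ?S c y) (B*(Kb k * n N))"
    by (rule sum_bound[OF fin sub(1) IH(1) nn(1) K0(1)])
   have e: "mean_le (E N) (%y. \<Sum>c\<in>?S'. co N k ?S c y) (B*(Kb k * n N*\<gamma> N))"
    by (rule sum_bound[OF fin sub(1) IH(2) nn(2) K0(2)])
   note st = w.square_step[OF sub(1) order_refl sub(2,3) finJ s[unfolded sums_eq] e[unfolded sums_eq]]
    w.column_step[OF sub(1) order_refl sub(2,3) finJ s[unfolded sums_eq] e[unfolded sums_eq]]
   have eq: "sq N (Suc k) S b = (%y. \<Sum>i\<in>vtx (n N) b. \<Sum>j\<in>J N. (rs N y k ?S ?S' i j)^2)"
    "co N (Suc k) S b = (%y. \<Sum>j\<in>J N. (\<Sum>i\<in>vtx (n N) b. rs N y k ?S ?S' i j)^2)"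
    using False unfolding sq_def co_def by (auto simp: fun_eq_iff chain_Suc_rowsum cong: sum.cong simp del: chain.simps)
   have nv: "n N * v N <= C0" "(n N * mu N)^2 <= C0" using N0 assms(1) by auto
   have cb: "real (card ?S') <= B" "0 <= real (card ?S')" using card_blocks[OF sub(1)] by auto
   let ?K = "Kb k * real B"
   have K1: "0 <= ?K" using Kb_pos[of k] by simp
   have p1: "n N * v N*(?K * n N) <= C0*(?K * n N)" using nv K1 by (intro mult_right_mono) auto
   have p2: "(n N * mu N)^2*(card ?S'*(?K*\<gamma> N)) <= C0*(B*(?K*\<gamma> N))"
    using nv K1 g cb C0(1) Kb_pos[of k] by (intro mult_mono) (auto intro!: mult_nonneg_nonneg)
   have B1: "1 <= real B" using B by simp
   have KS: "Kb (Suc k) = C0*(B*?K) + C0*(B*?K)" by (simp add: Kb_def power2_eq_square)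
   have KB: "C0*?K <= C0*(B*?K)" using B1 K1 C0(1) by (intro mult_left_mono) (auto simp: mult_le_cancel_right1)
   have b1: "n N*(v N*(B*(Kb k * n N)) + (mu N)^2 * card ?S'*(B*(Kb k * n N*\<gamma> N))) <= Kb (Suc k) * n N"
   proof -
    have "n N*(v N*(B*(Kb k * n N)) + (mu N)^2 * card ?S'*(B*(Kb k * n N*\<gamma> N)))
      = n N * v N*(?K * n N) + (n N * mu N)^2*(card ?S'*(?K*\<gamma> N))"
     by (simp add: power2_eq_square algebra_simps)
    also have "... <= C0*?K * n N + C0*(B*?K)*\<gamma> N" using p1 p2 by (simp add: algebra_simps)
    also have "... <= C0*(B*?K) * n N + C0*(B*?K) * n N"
     using KB g K1 C0(1) by (intro add_mono mult_right_mono mult_left_mono) auto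
    finally show ?thesis by (simp add: KS algebra_simps)
   qed
   have b2: "n N * v N*(B*(Kb k * n N)) + (real (n N))^2*(mu N)^2 * card ?S'*(B*(Kb k * n N*\<gamma> N)) <= Kb (Suc k) * n N*\<gamma> N"
   proof -
    have "n N * v N*(B*(Kb k * n N)) + (real (n N))^2*(mu N)^2 * card ?S'*(B*(Kb k * n N*\<gamma> N))
      = n N * v N*(?K * n N) + n N*((n N * mu N)^2*(card ?S'*(?K*\<gamma> N)))"
     by (simp add: power2_eq_square algebra_simps)
    also have "... <= C0*?K * n N*1 + n N*(C0*(B*(?K*\<gamma> N)))" using p1 p2
     by (intro add_mono mult_left_mono) (auto simp: algebra_simps)
    also have "... <= C0*(B*?K) * n N*\<gamma> N + n N*(C0*(B*(?K*\<gamma> N)))"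
    proof -
     have "C0*?K * n N <= C0*(B*?K) * n N" by (rule mult_right_mono[OF KB]) simp
     moreover have "0 <= C0*(B*?K) * n N" using C0(1) K1 Kb_pos[of k] by (intro mult_nonneg_nonneg) auto
     then have "C0*(B*?K) * n N*1 <= C0*(B*?K) * n N*\<gamma> N" using g by (intro mult_left_mono) auto
     ultimately show ?thesis by linarith
    qed
    finally show ?thesis by (simp add: KS algebra_simps)
   qed
   show ?thesis unfolding eq using mean_le_cong_bound[OF st(1) b1] mean_le_cong_bound[OF st(2) b2] by simp
  qed
 qed
 then show "mean_le (E N) (sq N k S b) (Kb k * n N)" "mean_le (E N) (co N k S b) (Kb k * n N*\<gamma> N)" by auto
qed

context
 fixes b k :: nat and S S' :: "nat set"
 assumes sub: "insert b1 S \<subseteq> {..<B}" "S' \<subseteq> insert b1 S" "b < B" "b \<notin> insert b1 S" "b1 \<notin> S"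
begin

lemma finS': "finite S'" "S' \<subseteq> {..<B}"
 using sub finite_subset[of S' "{..<B}"] by auto

lemma sq_nonneg: "0 <= sq N k S d y" and co_nonneg: "0 <= co N k S d y"
 by (auto simp: sq_def co_def intro!: sum_nonneg)

abbreviation "KB == real B * Kb k"

lemma S_bounds:
 assumes "N \<ge> N0"
 shows "mean_le (E N) (%y. \<Sum>c\<in>S'. sq N k S c y) (KB * n N)"
  "mean_le (E N) (%y. \<Sum>c\<in>S'. co N k S c y) (KB * n N*\<gamma> N)"
proof -
 have NB: "N \<ge> B" using assms(1) N0(1) by simp
 note g = \<gamma>[OF NB]
 have K0: "0 <= Kb k * n N" "0 <= Kb k * n N*\<gamma> N" using Kb_pos[of k] g by auto
 have c: "c \<in> insert b1 S" if "c \<in> S'" for c using sub that by auto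
 show "mean_le (E N) (%y. \<Sum>c\<in>S'. sq N k S c y) (KB * n N)"
  using sum_bound[OF finS' bounds(1)[OF assms sub(1,5) c] sq_nonneg K0(1)] by (simp add: mult.assoc)
 show "mean_le (E N) (%y. \<Sum>c\<in>S'. co N k S c y) (KB * n N*\<gamma> N)"
  using sum_bound[OF finS' bounds(2)[OF assms sub(1,5) c] co_nonneg K0(2)] by (simp add: mult.assoc)
qed

definition "bnd N = (20*(1/sqrt (n N)))*(KB*(q N * n N) + (card S' * KB)*(n N*(mu N)^2*\<gamma> N))"

lemma row_fourth_null:
 assumes g1: "!!N. \<gamma> N = 1"
 shows "nullL1 (%N y. (1/n N) * sqrt (\<Sum>i\<in>vtx (n N) b. \<Sum>j\<in>J N. rs N y k S S' i j^4))"
proof (rule nullL1I)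
 have "(%N. (20*(1/sqrt (n N)))*(KB*(q N * n N) + (card S' * KB)*(n N*(mu N)^2*1)))
   ----> (20*0)*(KB*(Q/B) + (card S' * KB)*(0*1))"
  by (intro tendsto_intros inv_sqrt_n lim_qn lim_nmu2)
 then show "bnd ----> 0" unfolding bnd_def[abs_def] g1 by simp
 show "\<forall>\<^sub>F N in sequentially. mean_le (E N) (%y. (1/n N) * sqrt (\<Sum>i\<in>vtx (n N) b. \<Sum>j\<in>J N. rs N y k S S' i j^4)) (bnd N)"
  using eventually_large
 proof eventually_elim
  case (elim N)
  interpret w: wigner N "n N" B "\<nu> N" "\<nu>d N" "t N" "mu N" "v N" "q N" by (rule wig) (use elim in simp)
  note sb = S_bounds[OF conjunct1[OF elim]]
  have "mean_le (E N) (%y. sqrt (\<Sum>i\<in>vtx (n N) b. \<Sum>j\<in>J N. rs N y k S S' i j^4))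
   (sqrt (n N)*20*(q N*(KB * n N) + (mu N)^2 * card S'*(KB * n N*\<gamma> N)))"
   by (rule w.fourth_step[OF sub(1-4) finJ sb[unfolded sums_eq]])
  then have "mean_le (E N) (%y. (1/n N) * sqrt (\<Sum>i\<in>vtx (n N) b. \<Sum>j\<in>J N. rs N y k S S' i j^4))
   ((1/n N)*(sqrt (n N)*20*(q N*(KB * n N) + (mu N)^2 * card S'*(KB * n N*\<gamma> N))))"
   by (rule mean_le_cmult) simp
  moreover have "(1/n N)*(sqrt (n N)*20*(q N*(KB * n N) + (mu N)^2 * card S'*(KB * n N*\<gamma> N))) = bnd N"
  proof -
   have s1: "(1/n N) * sqrt (n N) = 1/sqrt (n N)" using elim by (simp add: field_simps flip: real_sqrt_mult)
   have key: "(1/n N)*(sqrt (n N)*20 * Z) = (20*(1/sqrt (n N))) * Z" for Z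
    unfolding s1[symmetric] by (simp add: ac_simps)
   have X: "q N*(KB * n N) + (mu N)^2 * card S'*(KB * n N*\<gamma> N) = KB*(q N * n N) + (card S' * KB)*(n N*(mu N)^2*\<gamma> N)"
    by (simp add: algebra_simps)
   show ?thesis unfolding bnd_def X by (rule key)
  qed
  ultimately show ?case by simp
 qed
qed

text \<open>The errors in \<open>concentration_step\<close> are of order \<open>sqrt n * n / N\<close>, which is negligible against \<open>n\<close>.\<close>
lemma row_square_conc:
 assumes g1: "!!N. \<gamma> N = 1"
  and IH: "!!c'. c' \<in> S' ==> nullL1 (%N y. \<bar>sq N k S c' y/n N - limQ b1 (c/B) k S c'\<bar>)"
 shows "nullL1 (%N y. \<bar>(\<Sum>i\<in>vtx (n N) b. \<Sum>j\<in>J N. (rs N y k S S' i j)^2)/n N - c/B*(\<Sum>c'\<in>S'. limQ b1 (c/B) k S c')\<bar>)"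
proof -
 define R where "R N y = (\<Sum>i\<in>vtx (n N) b. \<Sum>j\<in>J N. (rs N y k S S' i j)^2)" for N y
 define L where "L = (\<Sum>c'\<in>S'. limQ b1 (c/B) k S c')"
 define a where "a N = n N*(v N - (mu N)^2)" for N
 define D where "D N y = \<bar>R N y - n N*(v N - (mu N)^2)*(\<Sum>c'\<in>S'. sq N k S c' y)\<bar>" for N y
 have D: "nullL1 (%N y. (1/n N) * D N y)"
 proof (rule nullL1I)
  have "(%N. card S' * KB*(n N*(mu N)^2) + bnd N) ----> card S' * KB*0 + 0"
  proof (intro tendsto_intros lim_nmu2)
   have "(%N. (20*(1/sqrt (n N)))*(KB*(q N * n N) + (card S' * KB)*(n N*(mu N)^2*1)))
     ----> (20*0)*(KB*(Q/B) + (card S' * KB)*(0*1))"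
    by (intro tendsto_intros inv_sqrt_n lim_qn lim_nmu2)
   then show "bnd ----> 0" unfolding bnd_def[abs_def] g1 by simp
  qed
  then show "(%N. card S' * KB*(n N*(mu N)^2) + bnd N) ----> 0" by simp
  show "\<forall>\<^sub>F N in sequentially. mean_le (E N) (%y. (1/n N) * D N y) (card S' * KB*(n N*(mu N)^2) + bnd N)"
   using eventually_large
  proof eventually_elim
   case (elim N)
   interpret w: wigner N "n N" B "\<nu> N" "\<nu>d N" "t N" "mu N" "v N" "q N" by (rule wig) (use elim in simp)
   note sb = S_bounds[OF conjunct1[OF elim]]
   have "mean_le (E N) (D N)
    (n N*(mu N)^2 * card S'*(KB * n N*\<gamma> N) + sqrt (n N)*20*(q N*(KB * n N) + (mu N)^2 * card S'*(KB * n N*\<gamma> N)))"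
    unfolding D_def[abs_def] R_def sums_eq by (rule w.concentration_step[OF sub(1-4) finJ sb[unfolded sums_eq]])
   then have "mean_le (E N) (%y. (1/n N) * D N y)
    ((1/n N)*(n N*(mu N)^2 * card S'*(KB * n N*\<gamma> N) + sqrt (n N)*20*(q N*(KB * n N) + (mu N)^2 * card S'*(KB * n N*\<gamma> N))))"
    by (rule mean_le_cmult) simp
   moreover have "(1/n N)*(n N*(mu N)^2 * card S'*(KB * n N*\<gamma> N) + sqrt (n N)*20*(q N*(KB * n N) + (mu N)^2 * card S'*(KB * n N*\<gamma> N)))
     = card S' * KB*(n N*(mu N)^2) + bnd N"
   proof -
   have s1: "(1/n N) * sqrt (n N) = 1/sqrt (n N)" using elim by (simp add: field_simps flip: real_sqrt_mult)
   have key: "(1/n N)*(sqrt (n N)*20 * Z) = (20*(1/sqrt (n N))) * Z" for Z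
    unfolding s1[symmetric] by (simp add: ac_simps)
   have X: "q N*(KB * n N) + (mu N)^2 * card S'*(KB * n N*\<gamma> N) = KB*(q N * n N) + (card S' * KB)*(n N*(mu N)^2*\<gamma> N)"
    by (simp add: algebra_simps)
   show ?thesis unfolding distrib_left[of "1/n N"] bnd_def X key using elim g1 by simp
   qed
   ultimately show ?case by simp
  qed
 qed
 have a: "a ----> c/B" unfolding a_def using lim_nvar by simp
 define G where "G N y = (1/n N) * D N y + (\<bar>a N\<bar>*(\<Sum>c'\<in>S'. \<bar>sq N k S c' y/n N - limQ b1 (c/B) k S c'\<bar>) + \<bar>a N - c/B\<bar>*\<bar>L\<bar>)" for N y
 have "nullL1 (%N y. \<bar>a N - c/B\<bar>*\<bar>L\<bar>)"
  by (rule nullL1_const) (use tendsto_mult[OF tendsto_rabs_zero[OF LIM_zero[OF a]] tendsto_const[of "\<bar>L\<bar>"]] in auto)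
 moreover have "nullL1 (%N y. \<bar>a N\<bar>*(\<Sum>c'\<in>S'. \<bar>sq N k S c' y/n N - limQ b1 (c/B) k S c'\<bar>))"
  by (rule nullL1_cmult[OF nullL1_sum[OF finS'(1) IH] tendsto_rabs[OF a]]) auto
 ultimately have G: "nullL1 G" unfolding G_def[abs_def]
  by (intro nullL1_add D) (auto simp: D_def intro!: sum_nonneg)
 show ?thesis
 proof (rule nullL1_mono[OF G], use eventually_large in eventually_elim)
  case (elim N)
  interpret w: wigner N "n N" B "\<nu> N" "\<nu>d N" "t N" "mu N" "v N" "q N" by (rule wig) (use elim in simp)
  note sb = S_bounds[OF conjunct1[OF elim]]
  have mR: "R N \<in> borel_measurable (E N)"
   unfolding R_def[abs_def] using w.measR[OF sub(1-4) finJ sb[unfolded sums_eq]]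
   by (auto intro!: borel_measurable_sum borel_measurable_power)
  have "\<bar>R N y/n N - c/B * L\<bar> <= G N y" for y
  proof -
   define s where "s c' = sq N k S c' y/n N" for c'
   define W where "W = (\<Sum>c'\<in>S'. sq N k S c' y)"
   have ss: "(\<Sum>c'\<in>S'. s c') = W/n N" by (simp add: s_def W_def sum_divide_distrib)
   have "R N y/n N - a N*(W/n N) = (1/n N)*(R N y - n N*(v N - (mu N)^2) * W)"
    using elim by (simp add: a_def field_simps)
   then have 1: "\<bar>R N y/n N - a N*(W/n N)\<bar> = (1/n N) * D N y" by (simp add: D_def W_def abs_mult)
   have "\<bar>W/n N - L\<bar> <= (\<Sum>c'\<in>S'. \<bar>s c' - limQ b1 (c/B) k S c'\<bar>)"
    unfolding ss[symmetric] L_def sum_subtractf[symmetric] by (rule sum_abs)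
   then have 2: "\<bar>a N\<bar>*\<bar>W/n N - L\<bar> <= \<bar>a N\<bar>*(\<Sum>c'\<in>S'. \<bar>s c' - limQ b1 (c/B) k S c'\<bar>)"
    by (rule mult_left_mono) simp
   have "R N y/n N - c/B * L = (R N y/n N - a N*(W/n N)) + a N*(W/n N - L) + (a N - c/B) * L"
    by (simp add: algebra_simps)
   also have "\<bar>...\<bar> <= \<bar>R N y/n N - a N*(W/n N)\<bar> + \<bar>a N\<bar>*\<bar>W/n N - L\<bar> + \<bar>a N - c/B\<bar>*\<bar>L\<bar>"
    by (intro order_trans[OF abs_triangle_ineq] add_mono) (auto simp: abs_mult)
   finally show ?thesis using 1 2 by (simp add: G_def s_def)
  qed
  then show ?case using mR by (auto simp: R_def[symmetric] L_def[symmetric] fun_eq_iff)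
 qed
qed

text \<open>The sum over a block deviates from \<open>n * mu\<close> times the sum of the chains by its standard deviation, and this has
  order \<open>sqrt n\<close>. Under the planted law \<open>n * mu\<close> tends to \<open>\<kappa> / B\<close>.\<close>
lemma row_mean_conc:
 assumes J0: "!!N. J N = {0}"
  and IH: "!!c'. c' \<in> S' ==> nullL1 (%N y. \<bar>(\<Sum>l\<in>vtx (n N) c'. ch N y k S l 0)/n N - limQ b1 (\<kappa>/B) k S c'\<bar>)"
 shows "nullL1 (%N y. \<bar>(\<Sum>i\<in>vtx (n N) b. rs N y k S S' i 0)/n N - \<kappa>/B*(\<Sum>c'\<in>S'. limQ b1 (\<kappa>/B) k S c')\<bar>)"
proof -
 define R where "R N y = (\<Sum>i\<in>vtx (n N) b. rs N y k S S' i 0)" for N y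
 define L where "L = (\<Sum>c'\<in>S'. limQ b1 (\<kappa>/B) k S c')"
 define a where "a N = n N * mu N" for N
 define T where "T N c' y = (\<Sum>l\<in>vtx (n N) c'. ch N y k S l 0)" for N c' y
 define D where "D N y = \<bar>R N y - n N * mu N*(\<Sum>c'\<in>S'. T N c' y)\<bar>" for N y
 have D: "nullL1 (%N y. (1/n N) * D N y)"
 proof (rule nullL1I)
  have "(%N. sqrt ((n N * v N) * KB*(1/n N))) ----> sqrt (c/B * KB*0)"
   by (intro tendsto_intros inv_n lim_nv)
  then show "(%N. sqrt ((n N * v N) * KB*(1/n N))) ----> 0" by simp
  show "\<forall>\<^sub>F N in sequentially. mean_le (E N) (%y. (1/n N) * D N y) (sqrt ((n N * v N) * KB*(1/n N)))"
   using eventually_large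
  proof eventually_elim
   case (elim N)
   interpret w: wigner N "n N" B "\<nu> N" "\<nu>d N" "t N" "mu N" "v N" "q N" by (rule wig) (use elim in simp)
   note sb = S_bounds[OF conjunct1[OF elim]]
   have "mean_le (E N) (D N) (sqrt (n N * v N*(KB * n N)))"
    unfolding D_def[abs_def] R_def T_def
    by (rule w.mean_step[OF sub(1-4) finJ sb[unfolded sums_eq] J0])
   then have "mean_le (E N) (%y. (1/n N) * D N y) ((1/n N) * sqrt (n N * v N*(KB * n N)))"
    by (rule mean_le_cmult) simp
   moreover have "(1/n N) * sqrt (n N * v N*(KB * n N)) = sqrt ((n N * v N) * KB*(1/n N))"
   proof -
    have "(n N * v N) * KB*(1/n N) = (1/n N)^2*(n N * v N*(KB * n N))"
     using elim by (simp add: power2_eq_square field_simps)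
    then show ?thesis by (simp only: real_sqrt_mult real_sqrt_abs) simp
   qed
   ultimately show ?case by simp
  qed
 qed
 have a: "a ----> \<kappa>/B" unfolding a_def using lim_nmu by simp
 define G where "G N y = (1/n N) * D N y + (\<bar>a N\<bar>*(\<Sum>c'\<in>S'. \<bar>T N c' y/n N - limQ b1 (\<kappa>/B) k S c'\<bar>) + \<bar>a N - \<kappa>/B\<bar>*\<bar>L\<bar>)" for N y
 have "nullL1 (%N y. \<bar>a N - \<kappa>/B\<bar>*\<bar>L\<bar>)"
  by (rule nullL1_const) (use tendsto_mult[OF tendsto_rabs_zero[OF LIM_zero[OF a]] tendsto_const[of "\<bar>L\<bar>"]] in auto)
 moreover have "nullL1 (%N y. \<bar>a N\<bar>*(\<Sum>c'\<in>S'. \<bar>T N c' y/n N - limQ b1 (\<kappa>/B) k S c'\<bar>))"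
  unfolding T_def by (rule nullL1_cmult[OF nullL1_sum[OF finS'(1) IH] tendsto_rabs[OF a]]) auto
 ultimately have G: "nullL1 G" unfolding G_def[abs_def]
  by (intro nullL1_add D) (auto simp: D_def intro!: sum_nonneg)
 show ?thesis
 proof (rule nullL1_mono[OF G], use eventually_large in eventually_elim)
  case (elim N)
  interpret w: wigner N "n N" B "\<nu> N" "\<nu>d N" "t N" "mu N" "v N" "q N" by (rule wig) (use elim in simp)
  note sb = S_bounds[OF conjunct1[OF elim]]
  have mR: "R N \<in> borel_measurable (E N)"
   unfolding R_def[abs_def] using w.measR[OF sub(1-4) finJ sb[unfolded sums_eq]]
   by (auto intro!: borel_measurable_sum)
  have "\<bar>R N y/n N - \<kappa>/B * L\<bar> <= G N y" for y
  proof -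
   define s where "s c' = T N c' y/n N" for c'
   define W where "W = (\<Sum>c'\<in>S'. T N c' y)"
   have ss: "(\<Sum>c'\<in>S'. s c') = W/n N" by (simp add: s_def W_def sum_divide_distrib)
   have "R N y/n N - a N*(W/n N) = (1/n N)*(R N y - n N * mu N * W)"
    using elim by (simp add: a_def field_simps)
   then have 1: "\<bar>R N y/n N - a N*(W/n N)\<bar> = (1/n N) * D N y" by (simp add: D_def W_def abs_mult)
   have "\<bar>W/n N - L\<bar> <= (\<Sum>c'\<in>S'. \<bar>s c' - limQ b1 (\<kappa>/B) k S c'\<bar>)"
    unfolding ss[symmetric] L_def sum_subtractf[symmetric] by (rule sum_abs)
   then have 2: "\<bar>a N\<bar>*\<bar>W/n N - L\<bar> <= \<bar>a N\<bar>*(\<Sum>c'\<in>S'. \<bar>s c' - limQ b1 (\<kappa>/B) k S c'\<bar>)"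
    by (rule mult_left_mono) simp
   have "R N y/n N - \<kappa>/B * L = (R N y/n N - a N*(W/n N)) + a N*(W/n N - L) + (a N - \<kappa>/B) * L"
    by (simp add: algebra_simps)
   also have "\<bar>...\<bar> <= \<bar>R N y/n N - a N*(W/n N)\<bar> + \<bar>a N\<bar>*\<bar>W/n N - L\<bar> + \<bar>a N - \<kappa>/B\<bar>*\<bar>L\<bar>"
    by (intro order_trans[OF abs_triangle_ineq] add_mono) (auto simp: abs_mult)
   finally show ?thesis using 1 2 by (simp add: G_def s_def)
  qed
  then show ?case using mR by (auto simp: R_def[symmetric] L_def[symmetric] fun_eq_iff)
 qed
qed

end

lemma limQ_sum:
 assumes "finite S" "b \<in> S" "b1 \<notin> S"
 shows "d*(\<Sum>c'\<in>insert b1 (S - {b}). limQ b1 d k (S - {b}) c') = lim_sq d (Suc k) (card S)"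
proof -
 have "(\<Sum>c'\<in>S - {b}. limQ b1 d k (S - {b}) c') = (\<Sum>c'\<in>S - {b}. lim_sq d k (card S - 1))"
  using assms by (intro sum.cong) (auto simp: limQ_def)
 then show ?thesis using assms by (simp add: limQ_def)
qed

lemma chain_square_conc:
 assumes g1: "!!N. \<gamma> N = 1" and "insert b1 S \<subseteq> {..<B}" "b1 \<notin> S" "b \<in> insert b1 S"
 shows "nullL1 (%N y. \<bar>sq N k S b y/n N - limQ b1 (c/B) k S b\<bar>)"
 using assms(2-4)
proof (induction k arbitrary: S b)
 case (0 S b)
 have "\<forall>\<^sub>F N in sequentially. mean_le (E N) (%y. \<bar>sq N 0 S b y/n N - limQ b1 (c/B) 0 S b\<bar>) 0"
  using eventually_large
 proof eventually_elim
  case (elim N)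
  then have "\<bar>sq N 0 S b y/n N - limQ b1 (c/B) 0 S b\<bar> = 0" for y
   using A2[of N] by (cases "b = b1") (auto simp: sq_def limQ_def blk_vtx cong: sum.cong)
  then show ?case by (simp add: mean_le_zero)
 qed
 then show ?case by (intro nullL1I[of "%_. 0"]) auto
next
 case (Suc k S b)
 show ?case
 proof (cases "b = b1")
  case True
  have "\<forall>\<^sub>F N in sequentially. mean_le (E N) (%y. \<bar>sq N (Suc k) S b y/n N - limQ b1 (c/B) (Suc k) S b\<bar>) 0"
   using eventually_large
  proof eventually_elim
   case (elim N)
   then have "\<bar>sq N (Suc k) S b y/n N - limQ b1 (c/B) (Suc k) S b\<bar> = 0" for y
    using A2[of N] True by (auto simp: sq_def limQ_def blk_vtx cong: sum.cong)
   then show ?case by (simp add: mean_le_zero)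
  qed
  then show ?thesis by (intro nullL1I[of "%_. 0"]) auto
 next
  case False
  let ?S = "S - {b}" and ?S' = "insert b1 (S - {b})"
  have sub: "insert b1 ?S \<subseteq> {..<B}" "?S' \<subseteq> insert b1 ?S" "b < B" "b \<notin> insert b1 ?S" "b1 \<notin> ?S" "b \<in> S" using Suc.prems False by auto
  have fin: "finite S" using Suc.prems(1) finite_subset[of S "{..<B}"] by auto
  have eq: "sq N (Suc k) S b y = (\<Sum>i\<in>vtx (n N) b. \<Sum>j\<in>J N. (rs N y k ?S ?S' i j)^2)" for N y
   using False unfolding sq_def by (auto simp: chain_Suc_rowsum cong: sum.cong simp del: chain.simps)
  have "limQ b1 (c/B) (Suc k) S b = c/B*(\<Sum>c'\<in>?S'. limQ b1 (c/B) k ?S c')"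
   unfolding limQ_sum[OF fin sub(6) Suc.prems(2)] using False by (simp add: limQ_def del: lim_sq.simps)
  then show ?thesis unfolding eq
   using row_square_conc[OF sub(1-5) g1 Suc.IH[OF sub(1,5)]] by simp
 qed
qed

lemma chain_mean_conc:
 assumes J0: "!!N. J N = {0}" and A0: "!!N l. A0 N l 0 = 1" and "insert b1 S \<subseteq> {..<B}" "b1 \<notin> S" "b \<in> insert b1 S"
 shows "nullL1 (%N y. \<bar>(\<Sum>l\<in>vtx (n N) b. ch N y k S l 0)/n N - limQ b1 (\<kappa>/B) k S b\<bar>)"
 using assms(3-5)
proof (induction k arbitrary: S b)
 case (0 S b)
 have "\<forall>\<^sub>F N in sequentially. mean_le (E N) (%y. \<bar>(\<Sum>l\<in>vtx (n N) b. ch N y 0 S l 0)/n N - limQ b1 (\<kappa>/B) 0 S b\<bar>) 0"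
  using eventually_large
 proof eventually_elim
  case (elim N)
  then have "\<bar>(\<Sum>l\<in>vtx (n N) b. ch N y 0 S l 0)/n N - limQ b1 (\<kappa>/B) 0 S b\<bar> = 0" for y
   using A0 by (cases "b = b1") (auto simp: limQ_def blk_vtx cong: sum.cong)
  then show ?case by (simp add: mean_le_zero)
 qed
 then show ?case by (intro nullL1I[of "%_. 0"]) auto
next
 case (Suc k S b)
 show ?case
 proof (cases "b = b1")
  case True
  have "\<forall>\<^sub>F N in sequentially. mean_le (E N) (%y. \<bar>(\<Sum>l\<in>vtx (n N) b. ch N y (Suc k) S l 0)/n N - limQ b1 (\<kappa>/B) (Suc k) S b\<bar>) 0"
   using eventually_large
  proof eventually_elim
   case (elim N)
   then have "\<bar>(\<Sum>l\<in>vtx (n N) b. ch N y (Suc k) S l 0)/n N - limQ b1 (\<kappa>/B) (Suc k) S b\<bar> = 0" for y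
    using A0 True by (auto simp: limQ_def blk_vtx cong: sum.cong)
   then show ?case by (simp add: mean_le_zero)
  qed
  then show ?thesis by (intro nullL1I[of "%_. 0"]) auto
 next
  case False
  let ?S = "S - {b}" and ?S' = "insert b1 (S - {b})"
  have sub: "insert b1 ?S \<subseteq> {..<B}" "?S' \<subseteq> insert b1 ?S" "b < B" "b \<notin> insert b1 ?S" "b1 \<notin> ?S" "b \<in> S" using Suc.prems False by auto
  have fin: "finite S" using Suc.prems(1) finite_subset[of S "{..<B}"] by auto
  have eq: "(\<Sum>l\<in>vtx (n N) b. ch N y (Suc k) S l 0) = (\<Sum>i\<in>vtx (n N) b. rs N y k ?S ?S' i 0)" for N y
   using False by (auto simp: chain_Suc_rowsum cong: sum.cong simp del: chain.simps)
  have "limQ b1 (\<kappa>/B) (Suc k) S b = \<kappa>/B*(\<Sum>c'\<in>?S'. limQ b1 (\<kappa>/B) k ?S c')"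
   unfolding limQ_sum[OF fin sub(6) Suc.prems(2)] using False by (simp add: limQ_def del: lim_sq.simps)
  then show ?thesis unfolding eq
   using row_mean_conc[OF sub(1-5) J0 Suc.IH[OF sub(1,5)]] by simp
 qed
qed

end

end

section \<open>A conditional central limit theorem\<close>

lemma power4_sum_le: "((a::real) + b)^4 <= 8*(a^4 + b^4)"
proof -
 have "(a + b)^2 <= 2*(a^2 + b^2)" using zero_le_power2[of "a-b"] by (simp add: power2_eq_square algebra_simps)
 then have "((a + b)^2)^2 <= (2*(a^2 + b^2))^2" by (rule power_mono) simp
 also have "... <= 8*(a^4 + b^4)" using zero_le_power2[of "a^2 - b^2"]
  by (simp add: power2_eq_square power4_eq_xxxx algebra_simps)
 finally show ?thesis by simp
qed

lemma power2_sum_le: "((a::real) + b)^2 <= 2*(a^2 + b^2)"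
 using zero_le_power2[of "a-b"] by (simp add: power2_eq_square algebra_simps)

lemma prod_damped:
 fixes m s :: "'i => real" assumes "finite K"
 shows "(\<Prod>e\<in>K. iexp (u * m e) * complex_of_real (exp (- (u^2 * s e/2)))) =
  iexp (u * sum m K) * complex_of_real (exp (- (u^2 * sum s K/2)))"
 using assms
proof (induction K rule: finite_induct)
 case (insert e K)
 have "iexp (u*(m e + sum m K)) = iexp (u * m e) * iexp (u * sum m K)"
  by (simp add: algebra_simps exp_add[symmetric])
 moreover have "exp (- (u^2*(s e + sum s K)/2)) = exp (- (u^2 * s e/2)) * exp (- (u^2 * sum s K/2))"
  by (simp add: algebra_simps add_divide_distrib exp_add[symmetric])
 ultimately show ?case using insert by simp
qed simp

text \<open>A conditional central limit estimate. For fixed weights \<open>w\<close> the factors on the left are the characteristic functions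
  of independent variables \<open>g + t * w e\<close>; \<open>char_second_order\<close> replaces each by a Gaussian one, and the last two terms compare
  the resulting Gaussian with the prescribed parameters \<open>ms\<close>, \<open>ss\<close>. The weights enter through their sums of powers
  only; the fourth powers appear under a square root since only the mean of that root will be controlled.\<close>
lemma (in prob_space) prod_char_bound:
 fixes g t :: "'a => real" and w :: "'i => real"
 assumes g[measurable]: "random_variable borel g" and t[measurable]: "random_variable borel t"
  and g4: "integrable M (%x. g x^4)" and t4: "integrable M (%x. t x^4)"
  and Rg: "expectation (%x. g x^4) <= Rg^2" "0 <= Rg" and q: "expectation (%x. t x^4) <= q^2" "0 <= q"
  and K: "finite K" and \<eta>: "0 < \<eta>" and ss: "0 <= ss"
 defines "mg == expectation g" and "Sg == expectation (%x. (g x)^2)" and "c == expectation (%x. g x * t x)"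
  and "mu == expectation t" and "v == expectation (%x. (t x)^2)"
 shows "cmod ((\<Prod>e\<in>K. expectation (%x. iexp (u*(g x + t x * w e)))) - iexp (u * ms) * complex_of_real (exp (- (u^2 * ss/2))))
  <= 2*\<bar>u\<bar>^3*\<eta>*(real (card K) * Sg + v * (\<Sum>e\<in>K. (w e)^2)) + 2*u^2*(real (card K) * mg^2 + mu^2*(\<Sum>e\<in>K. (w e)^2))
   + 2 * sqrt (8*(\<bar>u\<bar>^3/\<eta> + u^4))*(sqrt (real (card K)) * Rg + q * sqrt (\<Sum>e\<in>K. w e^4))
   + \<bar>u\<bar>*\<bar>real (card K) * mg + mu*(\<Sum>e\<in>K. w e) - ms\<bar>
   + u^2/2*\<bar>real (card K) * Sg + 2 * c*(\<Sum>e\<in>K. w e) + v * (\<Sum>e\<in>K. (w e)^2) - ss\<bar>"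
proof -
 interpret g: entry_family M "%_::unit. g" "UNIV" mg Sg Rg
  by unfold_locales (use g4 Rg indep_vars_unit[OF g] in \<open>auto simp: mg_def Sg_def\<close>)
 interpret t: entry_family M "%_::unit. t" "UNIV" mu v q
  by unfold_locales (use t4 q indep_vars_unit[OF t] in \<open>auto simp: mu_def v_def\<close>)
 have ig: "integrable M g" "integrable M (%x. (g x)^2)" using g.pow_integrable[of "()" 1] g.pow_integrable[of "()" 2] by auto
 have it: "integrable M t" "integrable M (%x. (t x)^2)" using t.pow_integrable[of "()" 1] t.pow_integrable[of "()" 2] by auto
 have igt: "integrable M (%x. g x * t x)"
 proof (rule Bochner_Integration.integrable_bound)
  show "integrable M (%x. (g x)^2 + (t x)^2)" using ig it by simp
  show "AE x in M. norm (g x * t x) <= norm ((g x)^2 + (t x)^2)"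
  proof (intro AE_I2)
   fix x have "2*(\<bar>g x\<bar>*\<bar>t x\<bar>) <= (g x)^2 + (t x)^2" using zero_le_power2[of "\<bar>g x\<bar> - \<bar>t x\<bar>"] by (simp add: power2_diff)
   moreover have "0 <= \<bar>g x\<bar>*\<bar>t x\<bar>" by simp
   ultimately have "\<bar>g x\<bar>*\<bar>t x\<bar> <= (g x)^2 + (t x)^2" by linarith
   then show "norm (g x * t x) <= norm ((g x)^2 + (t x)^2)" by (simp add: abs_mult)
  qed
 qed measurable
 define \<xi> where "\<xi> e x = g x + t x * w e" for e x
 have [measurable]: "random_variable borel (\<xi> e)" for e unfolding \<xi>_def by measurable
 define m where "m e = expectation (\<xi> e)" for e
 define s where "s e = expectation (%x. (\<xi> e x)^2)" for e
 define r where "r e = expectation (%x. \<xi> e x^4)" for e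
 have i4: "integrable M (%x. \<xi> e x^4)" for e
 proof (rule Bochner_Integration.integrable_bound)
  show "integrable M (%x. 8*(g x^4 + t x^4 * w e^4))" using g4 t4 by simp
  show "AE x in M. norm (\<xi> e x^4) <= norm (8*(g x^4 + t x^4 * w e^4))"
   using power4_sum_le[of "g x" "t x * w e" for x] by (auto simp: \<xi>_def power_mult_distrib)
 qed measurable
 have r_le: "r e <= 8*(Rg^2 + q^2 * w e^4)" for e
 proof -
  have "r e <= expectation (%x. 8*(g x^4 + t x^4 * w e^4))"
   unfolding r_def using power4_sum_le[of "g x" "t x * w e" for x] g4 t4 i4
   by (intro integral_mono) (auto simp: \<xi>_def power_mult_distrib)
  also have "... = 8*(expectation (%x. g x^4) + expectation (%x. t x^4) * w e^4)" using g4 t4 by simp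
  also have "... <= 8*(Rg^2 + q^2 * w e^4)" using Rg q by (intro mult_left_mono add_mono mult_right_mono) auto
  finally show ?thesis .
 qed
 have m_eq: "m e = mg + mu * w e" for e unfolding m_def \<xi>_def mg_def mu_def using ig it by simp
 have sq\<xi>: "(\<xi> e x)^2 = (g x)^2 + (2 * w e*(g x * t x) + (t x)^2*(w e)^2)" for e x
  by (simp add: \<xi>_def power2_eq_square algebra_simps)
 have s_eq: "s e = Sg + 2 * c * w e + v * (w e)^2" for e
  unfolding s_def sq\<xi> Sg_def c_def v_def using ig it igt by simp
 have s0: "0 <= s e" for e unfolding s_def by simp
 have s_le: "s e <= 2*(Sg + v * (w e)^2)" for e
 proof -
  have "s e <= expectation (%x. 2*((g x)^2 + (t x)^2*(w e)^2))"
   unfolding s_def using power2_sum_le[of "g x" "t x * w e" for x] ig it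
  proof (intro integral_mono)
   show "integrable M (%x. (\<xi> e x)^2)" unfolding sq\<xi> using ig it igt by simp
  qed (auto simp: \<xi>_def power_mult_distrib)
  also have "... = 2*(Sg + v * (w e)^2)" unfolding Sg_def v_def using ig it by simp
  finally show ?thesis .
 qed
 have m_le: "(m e)^2 <= 2*(mg^2 + mu^2*(w e)^2)" for e
  unfolding m_eq using power2_sum_le[of mg "mu * w e"] by (simp add: power_mult_distrib)
 define \<phi> where "\<phi> e = expectation (%x. iexp (u*\<xi> e x))" for e
 define \<psi> where "\<psi> e = iexp (u * m e) * complex_of_real (exp (- (u^2 * s e/2)))" for e
 define \<zeta> where "\<zeta> = iexp (u * ms) * complex_of_real (exp (- (u^2 * ss/2)))"
 define Sw2 where "Sw2 = (\<Sum>e\<in>K. (w e)^2)"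
 define Sw4 where "Sw4 = (\<Sum>e\<in>K. w e^4)"
 define A where "A = 2*\<bar>u\<bar>^3*\<eta>*(real (card K) * Sg + v * Sw2) + 2*u^2*(real (card K) * mg^2 + mu^2 * Sw2)"
 define C where "C = 8*(\<bar>u\<bar>^3/\<eta> + u^4)"
 define b where "b = C*(real (card K) * Rg^2 + q^2 * Sw4)"
 have C0: "0 <= C" using \<eta> by (auto simp: C_def intro!: add_nonneg_nonneg divide_nonneg_pos)
 have Sw: "0 <= Sw2" "0 <= Sw4" by (auto simp: Sw2_def Sw4_def intro!: sum_nonneg)
 have A0: "0 <= A" using \<eta> Sw g.moment_bounds(3) t.moment_bounds(3)
  by (auto simp: A_def intro!: add_nonneg_nonneg mult_nonneg_nonneg)
 have b0: "0 <= b" using C0 Sw by (auto simp: b_def intro!: mult_nonneg_nonneg add_nonneg_nonneg)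
 have n\<phi>: "cmod (\<phi> e) <= 1" for e
 proof -
  have "cmod (\<phi> e) <= expectation (%x. cmod (iexp (u*\<xi> e x)))" unfolding \<phi>_def by (rule integral_norm_bound)
  then show ?thesis by (simp add: prob_space)
 qed
 have n\<psi>: "cmod (\<psi> e) <= 1" for e using s0[of e] by (simp add: \<psi>_def norm_mult)
 have n\<zeta>: "cmod \<zeta> <= 1" using ss by (simp add: \<zeta>_def norm_mult)
 have diff: "cmod (\<phi> e - \<psi> e) <= \<bar>u\<bar>^3*(\<eta> * s e + r e/\<eta>) + u^2*(m e)^2 + u^4 * r e" for e
  unfolding \<phi>_def \<psi>_def m_def s_def r_def by (rule char_second_order[OF _ i4 \<eta>]) measurable
 have diff2: "cmod (\<phi> e - \<psi> e) <= (2*\<bar>u\<bar>^3*\<eta>*(Sg + v * (w e)^2) + 2*u^2*(mg^2 + mu^2*(w e)^2)) + C*(Rg^2 + q^2 * w e^4)" for e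
 proof -
  have "\<bar>u\<bar>^3*(\<eta> * s e) <= \<bar>u\<bar>^3*(\<eta>*(2*(Sg + v * (w e)^2)))"
   using s_le \<eta> by (intro mult_left_mono) auto
  moreover have "u^2*(m e)^2 <= u^2*(2*(mg^2 + mu^2*(w e)^2))" using m_le by (intro mult_left_mono) auto
  moreover have "(\<bar>u\<bar>^3/\<eta> + u^4) * r e <= (\<bar>u\<bar>^3/\<eta> + u^4)*(8*(Rg^2 + q^2 * w e^4))"
   using r_le C0 by (intro mult_left_mono) (auto simp: C_def)
  moreover have "\<bar>u\<bar>^3*(\<eta> * s e + r e/\<eta>) + u^2*(m e)^2 + u^4 * r e
    = \<bar>u\<bar>^3*(\<eta> * s e) + u^2*(m e)^2 + (\<bar>u\<bar>^3/\<eta> + u^4) * r e" by (simp add: algebra_simps)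
  ultimately show ?thesis using diff[of e] by (simp add: C_def algebra_simps)
 qed
 have "cmod (prod \<phi> K - prod \<psi> K) <= (\<Sum>e\<in>K. cmod (\<phi> e - \<psi> e))"
  by (rule norm_prod_diff) (use n\<phi> n\<psi> in auto)
 also have "... <= (\<Sum>e\<in>K. (2*\<bar>u\<bar>^3*\<eta>*(Sg + v * (w e)^2) + 2*u^2*(mg^2 + mu^2*(w e)^2)) + C*(Rg^2 + q^2 * w e^4))"
  by (intro sum_mono diff2)
 also have "... = A + b"
  unfolding A_def b_def Sw2_def Sw4_def by (simp add: sum.distrib sum_distrib_left algebra_simps)
 finally have P1: "cmod (prod \<phi> K - prod \<psi> K) <= A + b" .
 have "cmod (prod \<psi> K - \<zeta>) <= \<bar>u * sum m K - u * ms\<bar> + \<bar>u^2 * sum s K/2 - u^2 * ss/2\<bar>"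
  unfolding \<psi>_def prod_damped[OF K] \<zeta>_def using s0 ss by (intro damped_iexp_lipschitz) (auto intro!: sum_nonneg mult_nonneg_nonneg)
 also have "... = \<bar>u\<bar>*\<bar>sum m K - ms\<bar> + u^2/2*\<bar>sum s K - ss\<bar>"
 proof -
  have "u * sum m K - u * ms = u*(sum m K - ms)" "u^2 * sum s K/2 - u^2 * ss/2 = u^2/2*(sum s K - ss)"
   by (simp_all add: algebra_simps)
  then show ?thesis by (simp only: abs_mult) simp
 qed
 finally have P2: "cmod (prod \<psi> K - \<zeta>) <= \<bar>u\<bar>*\<bar>sum m K - ms\<bar> + u^2/2*\<bar>sum s K - ss\<bar>" .
 have n2: "cmod (prod \<phi> K - prod \<psi> K) <= 2"
 proof -
  have "cmod (prod \<phi> K) <= 1" "cmod (prod \<psi> K) <= 1"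
   using n\<phi> n\<psi> by (auto simp: prod_norm[symmetric] intro!: prod_le_1)
  then show ?thesis using norm_triangle_ineq4[of "prod \<phi> K" "prod \<psi> K"] by linarith
 qed
 have sqb: "sqrt b <= sqrt C*(sqrt (real (card K)) * Rg + q * sqrt Sw4)"
 proof -
  have "sqrt b = sqrt C * sqrt (real (card K) * Rg^2 + q^2 * Sw4)" by (simp add: b_def real_sqrt_mult)
  also have "sqrt (real (card K) * Rg^2 + q^2 * Sw4) <= sqrt (real (card K) * Rg^2) + sqrt (q^2 * Sw4)"
   using Sw by (intro sqrt_add_le_add_sqrt) auto
  also have "... = sqrt (real (card K)) * Rg + q * sqrt Sw4" using Rg q by (simp add: real_sqrt_mult)
  finally show ?thesis using C0 by (simp add: mult_left_mono)
 qed
 \<comment> \<open>If \<open>b\<close> exceeds 1, the trivial bound 2 on the left side is better; this replaces \<open>b\<close> by its root.\<close>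
 have min: "cmod (prod \<phi> K - prod \<psi> K) <= A + 2 * sqrt b"
 proof (cases "b <= 1")
  case True
  then have "b <= sqrt b" using b0 by (intro real_le_rsqrt) (simp add: power2_eq_square mult_left_le)
  then show ?thesis using P1 b0 by (smt (verit) real_sqrt_ge_zero)
 next
  case False
  then have "1 <= sqrt b" by simp
  then show ?thesis using n2 A0 by linarith
 qed
 have "cmod (prod \<phi> K - \<zeta>) <= cmod (prod \<phi> K - prod \<psi> K) + cmod (prod \<psi> K - \<zeta>)"
  using norm_triangle_ineq[of "prod \<phi> K - prod \<psi> K" "prod \<psi> K - \<zeta>"] by simp
 also have "... <= A + 2*(sqrt C*(sqrt (real (card K)) * Rg + q * sqrt Sw4)) + (\<bar>u\<bar>*\<bar>sum m K - ms\<bar> + u^2/2*\<bar>sum s K - ss\<bar>)"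
  using min sqb P2 by linarith
 finally have fin: "cmod (prod \<phi> K - \<zeta>) <= A + 2*(sqrt C*(sqrt (real (card K)) * Rg + q * sqrt Sw4)) + (\<bar>u\<bar>*\<bar>sum m K - ms\<bar> + u^2/2*\<bar>sum s K - ss\<bar>)" .
 have sm: "sum m K = real (card K) * mg + mu*(\<Sum>e\<in>K. w e)"
  by (simp add: m_eq sum.distrib sum_distrib_left)
 have ssm: "sum s K = real (card K) * Sg + 2 * c*(\<Sum>e\<in>K. w e) + v * Sw2"
  by (simp add: s_eq sum.distrib sum_distrib_left Sw2_def)
 show ?thesis
  using fin unfolding sm ssm unfolding A_def C_def Sw2_def Sw4_def \<phi>_def \<xi>_def \<zeta>_def by (simp add: mult.assoc)
qed

text \<open>Integrate first over the entries in \<open>K\<close>, on which neither \<open>U\<close> nor the weights depend. The conditional characteristic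
  function of the last part of the sum is within \<open>D\<close> of the constant \<open>\<zeta>\<close>, so this constant factors out at the price of
  the mean of \<open>D\<close>.\<close>
lemma peel_independent_entries:
 fixes U :: "('i => real) => real" and w :: "'i => ('i => real) => real"
 assumes fin: "finite I" and Pm: "!!i. prob_space (M i)" and sets: "!!i. sets (M i) = sets borel"
  and K: "K \<subseteq> I" "!!e. e \<in> K ==> M e = \<nu>" "sets \<nu> = sets borel"
  and g[measurable]: "g \<in> borel_measurable borel" and t[measurable]: "t \<in> borel_measurable borel"
  and U[measurable]: "U \<in> borel_measurable (PiM I M)" and w: "!!e. e \<in> K ==> w e \<in> borel_measurable (PiM I M)"
  and Umix: "!!x z. U (mix I K x z) = U x" and wmix: "!!e x z. e \<in> K ==> w e (mix I K x z) = w e x"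
  and D: "mean_le (PiM I M) D d" and D0: "!!x. 0 <= D x"
  and bound: "!!x. cmod ((\<Prod>e\<in>K. LINT y|\<nu>. iexp (u*(g y + t y * w e x))) - \<zeta>) <= D x"
 shows "cmod ((LINT x|PiM I M. iexp (u*(U x + (\<Sum>e\<in>K. g (x e) + t (x e) * w e x)))) - \<zeta>*(LINT x|PiM I M. iexp (u * U x))) <= d"
proof -
 interpret PI: prob_space "PiM I M" by (intro prob_space_PiM Pm)
 interpret PS: product_sigma_finite M
  by (intro product_sigma_finite.intro prob_space_imp_sigma_finite Pm)
 have finK: "finite K" using K fin finite_subset by blast
 have me: "(%x. x e) \<in> borel_measurable (PiM I M)" if "e \<in> I" for e
  using measurable_component_singleton[OF that, of M] measurable_cong_sets[OF refl sets[of e]] by blast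
 define X where "X x = U x + (\<Sum>e\<in>K. g (x e) + t (x e) * w e x)" for x
 have [measurable]: "X \<in> borel_measurable (PiM I M)"
 proof -
  have "(%x. g (x e) + t (x e) * w e x) \<in> borel_measurable (PiM I M)" if "e \<in> K" for e
   using me[of e] w[OF that] K(1) that by (intro borel_measurable_add borel_measurable_times measurable_compose[OF _ g] measurable_compose[OF _ t]) auto
  then show ?thesis unfolding X_def by measurable
 qed
 have iX: "integrable (PiM I M) (%x. iexp (u * X x))" and iU: "integrable (PiM I M) (%x. iexp (u * U x))"
  by (intro PI.integrable_iexp; auto)+
 define \<phi> where "\<phi> x = (\<Prod>e\<in>K. LINT y|\<nu>. iexp (u*(g y + t y * w e x)))" for x
 have inner: "(LINT z|PiM I M. iexp (u * X (mix I K x z))) = iexp (u * U x)*\<phi> x" for x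
 proof -
  have "iexp (u * X (mix I K x z)) = iexp (u * U x)*(\<Prod>e\<in>I. if e \<in> K then iexp (u*(g (z e) + t (z e) * w e x)) else 1)" for z
  proof -
   have mz: "mix I K x z e = z e" if "e \<in> K" for e using that K(1) by (auto simp: mix_def)
   have "X (mix I K x z) = U x + (\<Sum>e\<in>K. g (z e) + t (z e) * w e x)"
    unfolding X_def using mz by (simp add: Umix wmix cong: sum.cong)
   then have "iexp (u * X (mix I K x z)) = iexp (u * U x) * iexp (\<Sum>e\<in>K. u*(g (z e) + t (z e) * w e x))"
    by (simp add: sum_distrib_left algebra_simps exp_add[symmetric])
   also have "iexp (\<Sum>e\<in>K. u*(g (z e) + t (z e) * w e x)) = (\<Prod>e\<in>K. iexp (u*(g (z e) + t (z e) * w e x)))"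
    using finK by (simp add: exp_sum sum_distrib_left)
   also have "... = (\<Prod>e\<in>I. if e \<in> K then iexp (u*(g (z e) + t (z e) * w e x)) else 1)"
    using K(1) fin by (subst prod.inter_restrict[symmetric]) (auto simp: Int_absorb1 Int_commute)
   finally show ?thesis .
  qed
  then have "(LINT z|PiM I M. iexp (u * X (mix I K x z))) = iexp (u * U x)*(LINT z|PiM I M. (\<Prod>e\<in>I. (%y. if e \<in> K then iexp (u*(g y + t y * w e x)) else 1) (z e)))"
   by simp
  also have "(LINT z|PiM I M. (\<Prod>e\<in>I. (%y. if e \<in> K then iexp (u*(g y + t y * w e x)) else 1) (z e)))
    = (\<Prod>e\<in>I. LINT y|M e. (if e \<in> K then iexp (u*(g y + t y * w e x)) else 1))"
  proof (rule PS.product_integral_prod[OF fin])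
   fix e
   interpret Me: prob_space "M e" by (rule Pm)
   have "integrable (M e) (%y. iexp (u*(g y + t y * w e x)))"
   proof (rule Me.integrable_iexp)
    show "(%y. complex_of_real (u*(g y + t y * w e x))) \<in> borel_measurable (M e)"
     unfolding measurable_cong_sets[OF sets refl] by measurable
   qed simp
   then show "integrable (M e) (%y. if e \<in> K then iexp (u*(g y + t y * w e x)) else 1)"
    by (cases "e \<in> K") auto
  qed
  also have "... = (\<Prod>e\<in>I. if e \<in> K then (LINT y|\<nu>. iexp (u*(g y + t y * w e x))) else 1)"
   using K(2) prob_space.prob_space[OF Pm] by (intro prod.cong) auto
  also have "... = \<phi> x"
   unfolding \<phi>_def using K(1) fin by (subst prod.inter_restrict[symmetric]) (auto simp: Int_absorb1 Int_commute)
  finally show ?thesis .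
 qed
 have eq: "(LINT x|PiM I M. iexp (u * X x)) = (LINT x|PiM I M. iexp (u * U x)*\<phi> x)"
  unfolding integral_resample[OF fin Pm iX, of K] inner ..
 have i\<phi>: "integrable (PiM I M) (%x. iexp (u * U x)*\<phi> x)"
 proof (rule PI.integrable_const_bound[of _ 1])
  interpret nu: pair_sigma_finite "PiM I M" "PiM I M" ..
  show "(%x. iexp (u * U x)*\<phi> x) \<in> borel_measurable (PiM I M)"
   unfolding inner[symmetric]
   using measurable_mix[of I K M] by (intro PI.borel_measurable_lebesgue_integral) (auto simp: case_prod_unfold)
  have "cmod (iexp (u * U x)*\<phi> x) <= 1" for x
  proof -
   have "cmod (iexp (u * U x)*\<phi> x) <= (LINT z|PiM I M. cmod (iexp (u * X (mix I K x z))))"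
    unfolding inner[symmetric] by (rule integral_norm_bound)
   then show ?thesis by (simp add: PI.prob_space)
  qed
  then show "AE x in PiM I M. norm (iexp (u * U x)*\<phi> x) <= 1" by simp
 qed
 have "cmod ((LINT x|PiM I M. iexp (u * X x)) - \<zeta>*(LINT x|PiM I M. iexp (u * U x))) =
   cmod (LINT x|PiM I M. iexp (u * U x)*\<phi> x - \<zeta> * iexp (u * U x))"
  unfolding eq using i\<phi> iU by simp
 also have "... <= (LINT x|PiM I M. cmod (iexp (u * U x)*\<phi> x - \<zeta> * iexp (u * U x)))"
  by (rule integral_norm_bound)
 also have "... <= (LINT x|PiM I M. D x)"
 proof (rule integral_mono)
  show "integrable (PiM I M) (%x. cmod (iexp (u * U x)*\<phi> x - \<zeta> * iexp (u * U x)))" using i\<phi> iU by simp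
  show "integrable (PiM I M) D" by (rule mean_le_integral[OF D D0])
  fix x
  have "iexp (u * U x)*\<phi> x - \<zeta> * iexp (u * U x) = iexp (u * U x)*(\<phi> x - \<zeta>)" by (simp add: algebra_simps)
  then show "cmod (iexp (u * U x)*\<phi> x - \<zeta> * iexp (u * U x)) <= D x"
   using bound[of x] by (simp add: norm_mult \<phi>_def)
 qed
 also have "... <= d" by (rule mean_le_integral[OF D D0])
 finally show ?thesis unfolding X_def .
qed

section \<open>The cycle statistic and its Gaussian limit\<close>

lemma rowsum_cong:
 assumes "!!m. m \<in> vtxs n S' ==> Y i m = Y' i m" and "S' \<subseteq> insert b1 S"
  and "!!l m. l \<in> vtxs n (insert b1 S) ==> m \<in> vtxs n (insert b1 S) ==> Y l m = Y' l m"
 shows "rowsum Y n b1 A0 k S S' i j = rowsum Y' n b1 A0 k S S' i j"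
 unfolding rowsum_def
proof (intro sum.cong refl arg_cong2[where f="(*)"] assms(1) chain_cong)
 fix m assume "m \<in> vtxs n S'" then show "m \<in> vtxs n (insert b1 S)" using assms(2) by (auto simp: vtxs_def)
qed (use assms(3) in auto)

lemma chain_target_cong:
 assumes "!!l. l \<in> vtx n b1 ==> A0 l j = A0' l j" "l \<in> vtxs n (insert b1 S)"
 shows "chain Y n b1 A0 k S l j = chain Y n b1 A0' k S l j"
 using assms(2)
proof (induction k arbitrary: S l)
 case 0
 show ?case using assms(1)[of l] in_vtxs_iff[OF 0] by (cases "blk n l = b1") auto
next
 case (Suc k)
 have "chain Y n b1 A0 k (S - {blk n l}) m j = chain Y n b1 A0' k (S - {blk n l}) m j"
  if "m \<in> vtxs n (insert b1 (S - {blk n l}))" for m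
  using Suc.IH[OF that] .
 then show ?case using assms(1)[of l] in_vtxs_iff[OF Suc.prems] by (cases "blk n l = b1") auto
qed

lemma rowsum_sum:
 assumes "finite J"
 shows "(\<Sum>j\<in>J. rowsum Y n b1 A0 k S S' i j) = rowsum Y n b1 (%l _. \<Sum>j\<in>J. A0 l j) k S S' i j'"
 unfolding rowsum_def
 by (subst sum.swap) (simp add: sum_distrib_left[symmetric] chain_sum[OF assms, where j'=j'])

text \<open>Asymptotics of the two further entry functions: \<open>g\<close> will be the curvature term of an off-diagonal entry, of
  order \<open>1/N\<close>, and \<open>a\<close> the score term of a diagonal entry. The number \<open>k\<close> bounds the length of the paths.\<close>
locale clt_full = clt_array +
 fixes g a :: "nat => real => real" and \<gamma>m \<gamma>s \<alpha>m \<alpha>s R :: real and k :: nat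
 assumes gm: "!!N. g N \<in> borel_measurable borel" and am: "!!N. a N \<in> borel_measurable borel"
  and g4: "!!N. integrable (\<nu> N) (%x. g N x^4)" and a4: "!!N. integrable (\<nu>d N) (%x. a N x^4)"
  and lim_gm: "(%N. (real N)^2*(LINT x|\<nu> N. g N x)) ----> \<gamma>m"
  and lim_gs: "(%N. (real N)^2*(LINT x|\<nu> N. (g N x)^2)) ----> \<gamma>s"
  and Rg: "!!N. 0 < N ==> (LINT x|\<nu> N. g N x^4) <= (R/(real N)^2)^2"
  and lim_am: "(%N. real N*(LINT x|\<nu>d N. a N x)) ----> \<alpha>m"
  and lim_as: "(%N. real N*(LINT x|\<nu>d N. (a N x)^2)) ----> \<alpha>s"
  and Ra: "!!N. 0 < N ==> (LINT x|\<nu>d N. a N x^4) <= (R/real N)^2" and R0: "0 <= R"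
begin

abbreviation "\<delta> == (%l j. if l = j then 1 else 0 :: real)"
abbreviation "Sb b b1 == {..<b} - {b1}"

text \<open>Let \<open>r\<close> lie in block \<open>b\<close> and \<open>i\<close> in the lower block \<open>b1\<close>. This is the sum over the paths from \<open>r\<close> to \<open>i\<close> with inner vertices
  in distinct blocks below \<open>b\<close>, the first step going below \<open>b1\<close>. Together with the edge between \<open>i\<close> and \<open>r\<close> each path closes to
  a cycle whose largest block is \<open>b\<close>. Of the two neighbours of \<open>r\<close> on the cycle, \<open>i\<close> is the one in the higher block: thus
  every cycle is counted once, not once per orientation.\<close>
definition Wst :: "nat => nat => nat => (nat \<times> nat => real) => nat => nat => real" where
 "Wst N b b1 y r i = rowsum (Y N y) (n N) b1 \<delta> k (Sb b b1) {..<b1} r i"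

abbreviation "Kbb N b b1 == vtx (n N) b1 \<times> vtx (n N) b"

definition bs :: "nat => nat => nat => (nat \<times> nat => real) => real" where
 "bs N b b1 y = (\<Sum>e\<in>Kbb N b b1. g N (y e) + t N (y e) * Wst N b b1 y (snd e) (fst e))"

text \<open>Partial sums in the lexicographic order of the pairs of blocks. The entries between the blocks \<open>b\<close> and \<open>b1\<close> do not occur in
  the weights of their own pair, nor in the pairs before it. They are therefore peeled off last to first.\<close>
definition Xp :: "nat => nat => nat => (nat \<times> nat => real) => real" where
 "Xp N b b1 y = (\<Sum>b'<b. \<Sum>b1'<b'. bs N b' b1' y) + (\<Sum>b1'<b1. bs N b b1' y)"

definition X :: "nat => (nat \<times> nat => real) => real" where
 "X N y = Xp N B 0 y + (\<Sum>e\<in>{e \<in> upper_indices N. fst e = snd e}. a N (y e))"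

abbreviation "mg N == LINT x|\<nu> N. g N x"
abbreviation "Sg N == LINT x|\<nu> N. (g N x)^2"
abbreviation "cgt N == LINT x|\<nu> N. g N x * t N x"

text \<open>The limits of the normalized squared norm and of the normalized sum of the weights \<open>Wst\<close>; \<open>ms\<close> and \<open>ss\<close> are the
  resulting contributions of one pair of blocks to the mean and the variance.\<close>
definition fl :: "nat => nat => real" where "fl b b1 = c/B*(real b1 * lim_sq (c/B) k (b - 1))"
definition hl :: "nat => nat => real" where "hl b b1 = \<kappa>/B*(real b1 * lim_sq (\<kappa>/B) k (b - 1))"
definition "ms b b1 = \<gamma>m/(real B)^2 + \<kappa>/B * hl b b1"
definition "ss b b1 = \<gamma>s/(real B)^2 + c/B * fl b b1"

lemma c_nonneg: "0 <= c" "0 <= \<gamma>s" "0 <= \<alpha>s"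
proof -
 show "0 <= c" by (rule LIMSEQ_le_const[OF lim_v]) (auto intro!: mult_nonneg_nonneg Bochner_Integration.integral_nonneg)
 show "0 <= \<gamma>s" by (rule LIMSEQ_le_const[OF lim_gs]) (auto intro!: mult_nonneg_nonneg Bochner_Integration.integral_nonneg)
 show "0 <= \<alpha>s" by (rule LIMSEQ_le_const[OF lim_as]) (auto intro!: mult_nonneg_nonneg Bochner_Integration.integral_nonneg)
qed

lemma lim_sq_nonneg: "0 <= d ==> 0 <= lim_sq d k' s"
 by (induction k' arbitrary: s) auto

lemma ss_nonneg: "0 <= ss b b1"
 using c_nonneg lim_sq_nonneg[of "c/B" k "b - 1"] by (auto simp: ss_def fl_def intro!: add_nonneg_nonneg mult_nonneg_nonneg)

context
 fixes b b1 :: nat assumes b: "b1 < b" "b < B"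
begin

lemma sub: "insert b1 (Sb b b1) \<subseteq> {..<B}" "{..<b1} \<subseteq> insert b1 (Sb b b1)" "b < B" "b \<notin> insert b1 (Sb b b1)" "b1 \<notin> Sb b b1"
 using b by auto

lemma cardS: "card (Sb b b1) = b - 1" using b by simp

lemma limsum: "(\<Sum>c'\<in>{..<b1}. limQ b1 d k (Sb b b1) c') = real b1 * lim_sq d k (b - 1)"
proof -
 have "(\<Sum>c'\<in>{..<b1}. limQ b1 d k (Sb b b1) c') = (\<Sum>c'\<in>{..<b1}. lim_sq d k (b - 1))"
 proof (intro sum.cong refl)
  fix c' assume "c' \<in> {..<b1}"
  then have "c' \<noteq> b1" by auto
  then show "limQ b1 d k (Sb b b1) c' = lim_sq d k (b - 1)" by (simp only: limQ_def cardS if_False)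
 qed
 then show ?thesis by simp
qed

lemma n_ge: "N \<ge> B ==> 1 <= n N" using B by (simp add: n_def div_greater_zero_iff Suc_leI)

definition "w1 N y = (\<Sum>r\<in>vtx (n N) b. \<Sum>i\<in>vtx (n N) b1. Wst N b b1 y r i)/n N"
definition "w2 N y = (\<Sum>r\<in>vtx (n N) b. \<Sum>i\<in>vtx (n N) b1. (Wst N b b1 y r i)^2)/n N"
definition "w4 N y = sqrt (\<Sum>r\<in>vtx (n N) b. \<Sum>i\<in>vtx (n N) b1. Wst N b b1 y r i^4)/n N"

lemma sum_Kbb: "(\<Sum>e\<in>Kbb N b b1. F (snd e) (fst e)) = (\<Sum>r\<in>vtx (n N) b. \<Sum>i\<in>vtx (n N) b1. F r i :: real)"
 by (subst sum.swap) (simp add: sum.cartesian_product case_prod_unfold)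

lemma delta_A2: "(\<Sum>l\<in>vtx (n N) b1. \<Sum>j\<in>vtx (n N) b1. (\<delta> l j)^2) = n N"
 by (simp add: if_distrib[of "%x. x^2"] cong: if_cong)

lemma delta_A1: "(\<Sum>j\<in>vtx (n N) b1. (\<Sum>l\<in>vtx (n N) b1. \<delta> l j)^2) <= real (n N)*1"
 by simp

lemma b1_lt: "b1 < B" using b by simp

lemma one_le_n: "N \<ge> B ==> 1 <= (1::real) \<and> 1 <= real (n N)" using n_ge[of N] by simp

lemma w4_null: "nullL1 w4"
 using row_fourth_null[where ?A0.0="%_. \<delta>" and J="%N. vtx (n N) b1" and \<gamma>="%_. 1",
   OF finite_vtx b1_lt delta_A2 delta_A1 one_le_n sub refl, of k]
 unfolding w4_def[abs_def] Wst_def by simp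

lemma w2_null: "nullL1 (%N y. \<bar>w2 N y - fl b b1\<bar>)"
proof -
 have cs: "nullL1 (%N y. \<bar>sq (%_. \<delta>) (%N. vtx (n N) b1) b1 N k (Sb b b1) c' y/n N - limQ b1 (c/B) k (Sb b b1) c'\<bar>)"
  if "c' \<in> {..<b1}" for c'
  by (rule chain_square_conc[where ?A0.0="%_. \<delta>" and J="%N. vtx (n N) b1" and \<gamma>="%_. 1",
   OF finite_vtx b1_lt delta_A2 delta_A1 one_le_n refl sub(1,5)]) (use that sub(2) in blast)+
 show ?thesis
  using row_square_conc[where ?A0.0="%_. \<delta>" and J="%N. vtx (n N) b1" and \<gamma>="%_. 1",
   OF finite_vtx b1_lt delta_A2 delta_A1 one_le_n sub refl cs]
  unfolding w2_def[abs_def] Wst_def limsum fl_def by simp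
qed

lemma w1_null: "nullL1 (%N y. \<bar>w1 N y - hl b b1\<bar>)"
proof -
 let ?o = "%(N::nat) (l::nat) (j::nat). 1::real"
 have o2: "(\<Sum>l\<in>vtx (n N) b1. \<Sum>j\<in>{0::nat}. (?o N l j)^2) = n N" for N by simp
 have o1: "(\<Sum>j\<in>{0::nat}. (\<Sum>l\<in>vtx (n N) b1. ?o N l j)^2) <= n N * real (n N)" for N by (simp add: power2_eq_square)
 have gm: "N \<ge> B ==> 1 <= real (n N) \<and> real (n N) <= real (n N)" for N using n_ge by auto
 have cs: "nullL1 (%N y. \<bar>(\<Sum>l\<in>vtx (n N) c'. chain (Y N y) (n N) b1 (?o N) k (Sb b b1) l 0)/n N - limQ b1 (\<kappa>/B) k (Sb b b1) c'\<bar>)"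
  if "c' \<in> {..<b1}" for c'
  by (rule chain_mean_conc[where ?A0.0="?o" and J="%_. {0}" and \<gamma>="%N. real (n N)",
   OF _ b1_lt o2 o1 gm refl refl sub(1,5)]) (use that sub(2) in \<open>simp; blast\<close>)+
 have eq: "(\<Sum>r\<in>vtx (n N) b. \<Sum>i\<in>vtx (n N) b1. Wst N b b1 y r i) = (\<Sum>r\<in>vtx (n N) b. rowsum (Y N y) (n N) b1 (?o N) k (Sb b b1) {..<b1} r 0)" for N y
 proof (intro sum.cong refl)
  fix r
  have "(\<Sum>i\<in>vtx (n N) b1. Wst N b b1 y r i) = rowsum (Y N y) (n N) b1 (%l _. \<Sum>j\<in>vtx (n N) b1. \<delta> l j) k (Sb b b1) {..<b1} r 0"
   unfolding Wst_def by (rule rowsum_sum) simp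
  also have "... = rowsum (Y N y) (n N) b1 (?o N) k (Sb b b1) {..<b1} r 0"
   unfolding rowsum_def
  proof (intro sum.cong refl arg_cong2[where f="(*)"])
   fix m assume "m \<in> vtxs (n N) {..<b1}"
   then have m: "m \<in> vtxs (n N) (insert b1 (Sb b b1))" using sub(2) by (auto simp: vtxs_def)
   show "chain (Y N y) (n N) b1 (%l _. \<Sum>j\<in>vtx (n N) b1. \<delta> l j) k (Sb b b1) m 0 = chain (Y N y) (n N) b1 (?o N) k (Sb b b1) m 0"
    by (rule chain_target_cong[OF _ m]) simp
  qed
  finally show "(\<Sum>i\<in>vtx (n N) b1. Wst N b b1 y r i) = rowsum (Y N y) (n N) b1 (?o N) k (Sb b b1) {..<b1} r 0" .
 qed
 show ?thesis
  using row_mean_conc[where ?A0.0="?o" and J="%_. {0}" and \<gamma>="%N. real (n N)",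
   OF _ b1_lt o2 o1 gm sub refl cs]
  unfolding w1_def[abs_def] eq limsum hl_def by simp
qed

lemma lim_nn: "(%N. (real (n N))^2 * mg N) ----> \<gamma>m/(real B)^2" "(%N. (real (n N))^2 * Sg N) ----> \<gamma>s/(real B)^2"
proof -
 have *: "(%N. (real (n N))^2 * F N) ----> l/(real B)^2" if "(%N. (real N)^2 * F N) ----> l" for F l
 proof -
  have "(%N. (real (n N)/real N)^2*((real N)^2 * F N)) ----> (1/real B)^2 * l" by (intro tendsto_intros n_ratio that)
  moreover have "\<forall>\<^sub>F N in sequentially. (real (n N)/real N)^2*((real N)^2 * F N) = (real (n N))^2 * F N"
   by (rule eventually_sequentiallyI[of 1]) (simp add: power_divide)
  ultimately show ?thesis by (rule Lim_transform_eventually[THEN tendsto_eq_rhs]) (simp add: power_divide)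
 qed
 show "(%N. (real (n N))^2 * mg N) ----> \<gamma>m/(real B)^2" "(%N. (real (n N))^2 * Sg N) ----> \<gamma>s/(real B)^2"
  using *[OF lim_gm] *[OF lim_gs] by auto
qed

lemma int_pow:
 fixes f :: "real => real"
 assumes "prob_space M" "sets M = sets borel" "f \<in> borel_measurable borel" "integrable M (%x. f x^4)" "j <= 4"
 shows "integrable M (%x. f x^j)"
proof -
 interpret prob_space M by fact
 have f: "f \<in> borel_measurable M" using assms(3) unfolding measurable_cong_sets[OF assms(2) refl] .
 interpret entry_family M "%_::unit. f" "UNIV" "expectation f" "expectation (%x. (f x)^2)" "sqrt (expectation (%x. f x^4))"
  by unfold_locales (use assms(4) indep_vars_unit[OF f] in \<open>auto intro!: Bochner_Integration.integral_nonneg\<close>)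
 show ?thesis using pow_integrable[of "()" j] assms(5) by simp
qed

lemma lim_ncgt: "(%N. real (n N) * cgt N) ----> 0"
proof (rule Lim_null_comparison)
 have "(%N. (1/sqrt (n N))*((real (n N))^2 * Sg N + real (n N) * v N)) ----> 0*(\<gamma>s/(real B)^2 + c/B)"
  by (intro tendsto_intros inv_sqrt_n lim_nn lim_nv)
 then show "(%N. (1/sqrt (n N))*((real (n N))^2 * Sg N + real (n N) * v N)) ----> 0" by simp
 show "\<forall>\<^sub>F N in sequentially. norm (real (n N) * cgt N) <= (1/sqrt (n N))*((real (n N))^2 * Sg N + real (n N) * v N)"
 proof (rule eventually_sequentiallyI[of B])
  fix N assume "B <= N"
  then have n0: "0 < real (n N)" using n_ge[of N] by simp
  interpret nu: prob_space "\<nu> N" by (rule prob_nu)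
  have meas: "g N \<in> borel_measurable (\<nu> N)" "t N \<in> borel_measurable (\<nu> N)"
   using gm tm unfolding measurable_cong_sets[OF sets_nu(1) refl] by auto
  have i2: "integrable (\<nu> N) (%x. (g N x)^2)" "integrable (\<nu> N) (%x. (t N x)^2)"
   using int_pow[OF prob_nu(1) sets_nu(1) gm g4, of 2] int_pow[OF prob_nu(1) sets_nu(1) tm t4, of 2] by auto
  let ?s = "sqrt (n N)"
  have s0: "0 < ?s" using n0 by simp
  have pt: "\<bar>g N x * t N x\<bar> <= ?s*(g N x)^2 + (t N x)^2/?s" for x
  proof -
   have "0 <= (?s*\<bar>g N x\<bar> - \<bar>t N x\<bar>)^2" by simp
   then have "2*?s*(\<bar>g N x\<bar>*\<bar>t N x\<bar>) <= ?s^2*(g N x)^2 + (t N x)^2" by (simp add: power2_diff power_mult_distrib algebra_simps)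
   moreover have "0 <= ?s*(\<bar>g N x\<bar>*\<bar>t N x\<bar>)" using s0 by simp
   ultimately have "?s*(\<bar>g N x\<bar>*\<bar>t N x\<bar>) <= ?s^2*(g N x)^2 + (t N x)^2" by linarith
   then have "?s*\<bar>g N x * t N x\<bar> <= ?s^2*(g N x)^2 + (t N x)^2" by (simp only: abs_mult)
   also have "... = ?s*(?s*(g N x)^2 + (t N x)^2/?s)" using s0 by (simp add: power2_eq_square field_simps)
   finally show ?thesis using s0 by simp
  qed
  have i3: "integrable (\<nu> N) (%x. g N x * t N x)"
  proof (rule Bochner_Integration.integrable_bound)
   show "integrable (\<nu> N) (%x. ?s*(g N x)^2 + (t N x)^2/?s)" using i2 by simp
   show "AE x in \<nu> N. norm (g N x * t N x) <= norm (?s*(g N x)^2 + (t N x)^2/?s)"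
    using pt by (intro AE_I2) (metis abs_ge_self order_trans real_norm_def)
  qed (use meas in measurable)
  have "\<bar>cgt N\<bar> <= (LINT x|\<nu> N. \<bar>g N x * t N x\<bar>)" by (rule integral_abs_bound)
  also have "... <= (LINT x|\<nu> N. ?s*(g N x)^2 + (t N x)^2/?s)"
   using pt i2 i3 by (intro integral_mono) auto
  also have "... = ?s * Sg N + v N/?s" using i2 by simp
  finally have "real (n N)*\<bar>cgt N\<bar> <= real (n N)*(?s * Sg N + v N/?s)" using n0 by (intro mult_left_mono) auto
  also have "... = (1/?s)*((real (n N))^2 * Sg N + real (n N) * v N)"
  proof -
   have "real (n N)*?s = (1/?s)*(real (n N))^2" using n0 by (simp add: power2_eq_square field_simps flip: real_sqrt_mult)
   then show ?thesis by (simp only: distrib_left mult.assoc[symmetric]) simp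
  qed
  finally show "norm (real (n N) * cgt N) <= (1/sqrt (n N))*((real (n N))^2 * Sg N + real (n N) * v N)"
   by (simp add: abs_mult)
 qed
qed

text \<open>The error bound of \<open>prod_char_bound\<close> for the entries between two blocks, as a function of the weights.\<close>
definition Dfun :: "real => real => nat => (nat \<times> nat => real) => real" where
 "Dfun u \<eta> N y = 2*\<bar>u\<bar>^3*\<eta>*((n N)^2 * Sg N + n N * v N * w2 N y)
   + 2*u^2*((n N)^2*(mg N)^2 + n N*(mu N)^2 * w2 N y)
   + 2 * sqrt (8*(\<bar>u\<bar>^3/\<eta> + u^4))*(n N*(R/(real N)^2) + q N * n N * w4 N y)
   + \<bar>u\<bar>*\<bar>(n N)^2 * mg N + n N * mu N * w1 N y - ms b b1\<bar>
   + u^2/2*\<bar>(n N)^2 * Sg N + 2*(n N * cgt N) * w1 N y + n N * v N * w2 N y - ss b b1\<bar>"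

lemma lim_nR: "(%N. n N*(R/(real N)^2)) ----> 0"
proof -
 have "(%N. (real (n N)/real N)*(R*(1/real N))) ----> 1/real B*(R*0)"
  by (intro tendsto_intros n_ratio lim_1_over_n)
 moreover have "(%N. (real (n N)/real N)*(R*(1/real N))) = (%N. n N*(R/(real N)^2))"
  by (simp add: fun_eq_iff power2_eq_square)
 ultimately show ?thesis by simp
qed

lemma lim_nmg: "(%N. (n N)^2*(mg N)^2) ----> 0"
proof -
 have "(%N. ((real (n N))^2 * mg N)^2*(1/real (n N))^2) ----> (\<gamma>m/(real B)^2)^2*0^2"
  by (intro tendsto_intros lim_nn inv_n)
 moreover have "(%N. ((real (n N))^2 * mg N)^2*(1/real (n N))^2) = (%N. (n N)^2*(mg N)^2)"
  by (auto simp: fun_eq_iff power2_eq_square)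
 ultimately show ?thesis by simp
qed

text \<open>The weight sums \<open>w1\<close>, \<open>w2\<close> converge in mean to constants and \<open>w4\<close> to 0. All terms of \<open>Dfun\<close> disappear in the limit,
  except the one with the explicit factor \<open>\<eta>\<close>.\<close>
lemma Dfun_split:
 "\<exists>C\<ge>0. \<forall>\<eta>>0. \<exists>\<delta>. \<delta> ----> 0 \<and> (\<forall>\<^sub>F N in sequentially. mean_le (E N) (Dfun u \<eta> N) (C*\<eta> + \<delta> N))"
proof -
 let ?f = "fl b b1" and ?h = "hl b b1"
 have f0: "0 <= ?f" using c_nonneg lim_sq_nonneg[of "c/B" k "b - 1"] by (auto simp: fl_def intro!: mult_nonneg_nonneg)
 \<comment> \<open>The term with \<open>A\<close> carries the factor \<open>\<eta>\<close>; everything else is collected in \<open>k0\<close> (constant in the weights) and the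
    coefficients \<open>k1\<close>, \<open>k2\<close>, \<open>k4\<close> of the fluctuations of the weight sums.\<close>
 define A where "A N = (n N)^2 * Sg N + n N * v N*?f" for N
 have Alim: "A ----> \<gamma>s/(real B)^2 + c/B*?f" unfolding A_def using lim_nn lim_nv by (intro tendsto_intros) auto
 define C where "C = 2*\<bar>u\<bar>^3*(\<gamma>s/(real B)^2 + c/B*?f + 1)"
 have l0: "0 <= \<gamma>s/(real B)^2 + c/B*?f" using c_nonneg f0 by simp
 show ?thesis
 proof (intro exI[of _ C] conjI allI impI)
  show "0 <= C" using l0 by (simp add: C_def)
  fix \<eta> :: real assume \<eta>: "0 < \<eta>"
  define S where "S = sqrt (8*(\<bar>u\<bar>^3/\<eta> + u^4))"
  have S0: "0 <= S" using \<eta> by (auto simp: S_def intro!: add_nonneg_nonneg divide_nonneg_pos)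
  define k0 where "k0 N = 2*u^2*((n N)^2*(mg N)^2 + n N*(mu N)^2*?f) + 2 * S*(n N*(R/(real N)^2))
    + \<bar>u\<bar>*(\<bar>(n N)^2 * mg N - \<gamma>m/(real B)^2\<bar> + \<bar>n N * mu N - \<kappa>/B\<bar>*\<bar>?h\<bar>)
    + u^2/2*(\<bar>(n N)^2 * Sg N - \<gamma>s/(real B)^2\<bar> + 2*\<bar>n N * cgt N\<bar>*\<bar>?h\<bar> + \<bar>n N * v N - c/B\<bar>*?f)" for N
  define k2 where "k2 N = 2*\<bar>u\<bar>^3*\<eta>*(n N * v N) + 2*u^2*(n N*(mu N)^2) + u^2/2*(n N * v N)" for N
  define k1 where "k1 N = \<bar>u\<bar>*\<bar>n N * mu N\<bar> + u^2/2*(2*\<bar>n N * cgt N\<bar>)" for N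
  define k4 where "k4 N = 2 * S*(q N * n N)" for N
  have v0: "0 <= v N" for N by simp
  have p0: "0 <= k0 N" "0 <= k1 N" "0 <= k2 N" "0 <= k4 N" for N
   using S0 f0 R0 Q(2) \<eta> v0 unfolding k0_def k1_def k2_def k4_def
   by (auto intro!: add_nonneg_nonneg mult_nonneg_nonneg divide_nonneg_nonneg)
  have "k0 ----> 2*u^2*(0 + 0*?f) + 2 * S*0
    + \<bar>u\<bar>*(\<bar>\<gamma>m/(real B)^2 - \<gamma>m/(real B)^2\<bar> + \<bar>\<kappa>/B - \<kappa>/B\<bar>*\<bar>?h\<bar>)
    + u^2/2*(\<bar>\<gamma>s/(real B)^2 - \<gamma>s/(real B)^2\<bar> + 2*\<bar>0\<bar>*\<bar>?h\<bar> + \<bar>c/B - c/B\<bar>*?f)"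
   unfolding k0_def using lim_nmg lim_nmu2 lim_nR lim_nn lim_nmu lim_ncgt lim_nv
   by (intro tendsto_intros) auto
  then have k0: "k0 ----> 0" by simp
  have k1: "k1 ----> \<bar>u\<bar>*\<bar>\<kappa>/B\<bar> + u^2/2*(2*\<bar>0\<bar>)"
   unfolding k1_def using lim_nmu lim_ncgt by (intro tendsto_intros) auto
  have k2: "k2 ----> 2*\<bar>u\<bar>^3*\<eta>*(c/B) + 2*u^2*0 + u^2/2*(c/B)"
   unfolding k2_def using lim_nv lim_nmu2 by (intro tendsto_intros) auto
  have k4: "k4 ----> 2 * S*(Q/B)" unfolding k4_def using lim_qn by (intro tendsto_intros) auto
  have w40: "0 <= w4 N y" for N y by (auto simp: w4_def intro!: divide_nonneg_nonneg sum_nonneg)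
  have w20: "0 <= w2 N y" for N y by (auto simp: w2_def intro!: divide_nonneg_nonneg sum_nonneg)
  define G where "G N y = k0 N + (k1 N*\<bar>w1 N y - ?h\<bar> + (k2 N*\<bar>w2 N y - ?f\<bar> + k4 N * w4 N y))" for N y
  have "nullL1 G" unfolding G_def[abs_def]
   by (intro nullL1_add nullL1_const k0 p0 nullL1_cmult[OF w1_null k1] nullL1_cmult[OF w2_null k2] nullL1_cmult[OF w4_null k4])
     (use p0 w40 in \<open>auto intro!: add_nonneg_nonneg mult_nonneg_nonneg\<close>)
  then obtain \<delta> where \<delta>: "\<delta> ----> 0" "\<forall>\<^sub>F N in sequentially. mean_le (E N) (G N) (\<delta> N)"
   by (auto simp: nullL1_def)
  have G0: "0 <= G N y" for N y unfolding G_def using p0 w40 by (auto intro!: add_nonneg_nonneg mult_nonneg_nonneg)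
  have bound: "Dfun u \<eta> N y <= 2*\<bar>u\<bar>^3*\<eta> * A N + G N y" for N y
  proof -
   let ?w1 = "w1 N y" and ?w2 = "w2 N y" and ?w4 = "w4 N y"
   have w2le: "?w2 <= ?f + \<bar>?w2 - ?f\<bar>" by linarith
   have t1: "2*\<bar>u\<bar>^3*\<eta>*((n N)^2 * Sg N + n N * v N*?w2) <= 2*\<bar>u\<bar>^3*\<eta> * A N + 2*\<bar>u\<bar>^3*\<eta>*(n N * v N)*\<bar>?w2 - ?f\<bar>"
   proof -
    have "n N * v N*?w2 <= n N * v N*(?f + \<bar>?w2 - ?f\<bar>)" using w2le v0 by (intro mult_left_mono) auto
    then have "2*\<bar>u\<bar>^3*\<eta>*((n N)^2 * Sg N + n N * v N*?w2) <= 2*\<bar>u\<bar>^3*\<eta>*((n N)^2 * Sg N + n N * v N*(?f + \<bar>?w2 - ?f\<bar>))"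
     using \<eta> by (intro mult_left_mono add_left_mono) auto
    then show ?thesis unfolding A_def by (simp add: algebra_simps)
   qed
   have t2: "2*u^2*((n N)^2*(mg N)^2 + n N*(mu N)^2*?w2) <= 2*u^2*((n N)^2*(mg N)^2 + n N*(mu N)^2*?f) + 2*u^2*(n N*(mu N)^2)*\<bar>?w2 - ?f\<bar>"
   proof -
    have "n N*(mu N)^2*?w2 <= n N*(mu N)^2*(?f + \<bar>?w2 - ?f\<bar>)" using w2le by (intro mult_left_mono) auto
    then have "2*u^2*((n N)^2*(mg N)^2 + n N*(mu N)^2*?w2) <= 2*u^2*((n N)^2*(mg N)^2 + n N*(mu N)^2*(?f + \<bar>?w2 - ?f\<bar>))"
     by (intro mult_left_mono add_left_mono) auto
    then show ?thesis by (simp add: algebra_simps)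
   qed
   have t4: "\<bar>u\<bar>*\<bar>(n N)^2 * mg N + n N * mu N*?w1 - ms b b1\<bar> <= \<bar>u\<bar>*(\<bar>(n N)^2 * mg N - \<gamma>m/(real B)^2\<bar> + \<bar>n N * mu N - \<kappa>/B\<bar>*\<bar>?h\<bar>) + \<bar>u\<bar>*\<bar>n N * mu N\<bar>*\<bar>?w1 - ?h\<bar>"
   proof -
    have eq: "(n N)^2 * mg N + n N * mu N*?w1 - ms b b1 = ((n N)^2 * mg N - \<gamma>m/(real B)^2) + (n N * mu N - \<kappa>/B)*?h + (n N * mu N)*(?w1 - ?h)"
     unfolding ms_def by (simp add: algebra_simps)
    have le: "\<bar>(n N)^2 * mg N + n N * mu N*?w1 - ms b b1\<bar> <= \<bar>(n N)^2 * mg N - \<gamma>m/(real B)^2\<bar> + \<bar>n N * mu N - \<kappa>/B\<bar>*\<bar>?h\<bar> + \<bar>n N * mu N\<bar>*\<bar>?w1 - ?h\<bar>"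
     unfolding eq abs_mult[symmetric] by (intro order_trans[OF abs_triangle_ineq] add_mono order_refl)
    show ?thesis using mult_left_mono[OF le, of "\<bar>u\<bar>"] by (simp only: distrib_left mult.assoc abs_ge_zero simp_thms)
   qed
   have t5: "u^2/2*\<bar>(n N)^2 * Sg N + 2*(n N * cgt N)*?w1 + n N * v N*?w2 - ss b b1\<bar> \<le>
     u^2/2*(\<bar>(n N)^2 * Sg N - \<gamma>s/(real B)^2\<bar> + 2*\<bar>n N * cgt N\<bar>*\<bar>?h\<bar> + \<bar>n N * v N - c/B\<bar>*?f)
     + u^2/2*(2*\<bar>n N * cgt N\<bar>)*\<bar>?w1 - ?h\<bar> + u^2/2*(n N * v N)*\<bar>?w2 - ?f\<bar>"
   proof -
    have eq: "(n N)^2 * Sg N + 2*(n N * cgt N)*?w1 + n N * v N*?w2 - ss b b1 =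
      ((n N)^2 * Sg N - \<gamma>s/(real B)^2) + (2*(n N * cgt N))*?h + (n N * v N - c/B)*?f + (2*(n N * cgt N))*(?w1 - ?h) + (n N * v N)*(?w2 - ?f)"
     unfolding ss_def by (simp add: algebra_simps)
    have a2: "\<bar>2*(n N * cgt N)\<bar> = 2*\<bar>n N * cgt N\<bar>" by (simp add: abs_mult)
    have av: "\<bar>n N * v N\<bar> = n N * v N" using v0[of N] by (intro abs_of_nonneg mult_nonneg_nonneg) auto
    have af: "\<bar>?f\<bar> = ?f" using f0 by simp
    have le: "\<bar>(n N)^2 * Sg N + 2*(n N * cgt N)*?w1 + n N * v N*?w2 - ss b b1\<bar> <= \<bar>(n N)^2 * Sg N - \<gamma>s/(real B)^2\<bar> + \<bar>2*(n N * cgt N)\<bar>*\<bar>?h\<bar> + \<bar>n N * v N - c/B\<bar>*\<bar>?f\<bar> + \<bar>2*(n N * cgt N)\<bar>*\<bar>?w1 - ?h\<bar> + \<bar>n N * v N\<bar>*\<bar>?w2 - ?f\<bar>"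
     unfolding eq abs_mult[symmetric] by (intro order_trans[OF abs_triangle_ineq] add_mono order_refl)
    have t0: "0 <= u^2/2" by simp
    show ?thesis using mult_left_mono[OF le[unfolded a2 av af] t0] by (simp only: distrib_left mult.assoc)
   qed
   have e3: "2 * S*(n N*(R/(real N)^2) + q N * n N*?w4) = 2 * S*(n N*(R/(real N)^2)) + 2 * S*(q N * n N)*?w4"
    by (simp only: ring_distribs mult.assoc)
   show ?thesis using t1 t2 t4 t5 e3 unfolding Dfun_def G_def k0_def k1_def k2_def k4_def S_def[symmetric]
    by (simp only: distrib_right)
  qed
  have "\<forall>\<^sub>F N in sequentially. A N <= \<gamma>s/(real B)^2 + c/B*?f + 1"
   using order_tendstoD(2)[OF Alim, of "\<gamma>s/(real B)^2 + c/B*?f + 1"] by (auto elim: eventually_mono)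
  with \<delta>(2) eventually_large
  have "\<forall>\<^sub>F N in sequentially. mean_le (E N) (Dfun u \<eta> N) (C*\<eta> + \<delta> N)"
  proof eventually_elim
   case (elim N)
   interpret w: wigner N "n N" B "\<nu> N" "\<nu>d N" "t N" "mu N" "v N" "q N" by (rule wig) (use elim in simp)
   have mW: "(%y. Wst N b b1 y r i) \<in> borel_measurable (E N)" if "r \<in> vtx (n N) b" for r i
    unfolding Wst_def using w.vtx_range[OF that b(2)] by (intro w.measurable_rowsum sub) auto
   have mD: "Dfun u \<eta> N \<in> borel_measurable (E N)"
    unfolding Dfun_def[abs_def] w1_def w2_def w4_def using mW
    by (intro borel_measurable_add borel_measurable_times borel_measurable_const borel_measurable_abs borel_measurable_diff
      borel_measurable_divide borel_measurable_sum borel_measurable_power borel_measurable_sqrt) auto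
   have "2*\<bar>u\<bar>^3*\<eta> * A N <= 2*\<bar>u\<bar>^3*\<eta>*(\<gamma>s/(real B)^2 + c/B*?f + 1)"
    using elim(3) \<eta> by (intro mult_left_mono) auto
   also have "... = C*\<eta>" by (simp add: C_def)
   finally have AC: "2*\<bar>u\<bar>^3*\<eta> * A N <= C*\<eta>" .
   have C0: "0 <= C*\<eta>" using l0 \<eta> by (simp add: C_def)
   show ?case
   proof (rule mean_le_mono[OF mean_le_add[OF w.E.mean_le_const[OF C0] elim(1) C0 G0] mD])
    fix y show "Dfun u \<eta> N y <= C*\<eta> + G N y" using bound[of N y] AC by linarith
   qed simp
  qed
  then show "\<exists>\<delta>. \<delta> ----> 0 \<and> (\<forall>\<^sub>F N in sequentially. mean_le (E N) (Dfun u \<eta> N) (C*\<eta> + \<delta> N))"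
   using \<delta>(1) by blast
 qed
qed

end

end

context clt_full begin

text \<open>The last step of the Lindeberg method: \<open>N\<close> goes to infinity for fixed \<open>\<eta>\<close>, then \<open>\<eta>\<close> goes to 0.\<close>
lemma char_peel_tendsto:
 fixes x :: "nat => real"
 assumes "0 <= C" "!!N. 0 <= x N"
  and "!!\<eta>. \<eta> > 0 ==> \<exists>\<delta>. \<delta> ----> (0::real) \<and> (\<forall>\<^sub>F N in sequentially. x N <= C*\<eta> + \<delta> N)"
 shows "x ----> 0"
proof (rule LIMSEQ_I)
 fix e :: real assume e: "0 < e"
 define \<eta> where "\<eta> = e/(2*(C + 1))"
 have \<eta>: "\<eta> > 0" using e assms(1) by (simp add: \<eta>_def)
 obtain \<delta> where \<delta>: "\<delta> ----> 0" "\<forall>\<^sub>F N in sequentially. x N <= C*\<eta> + \<delta> N" using assms(3)[OF \<eta>] by auto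
 have C: "C*\<eta> <= e/2" using e assms(1) by (simp add: \<eta>_def field_simps)
 have "\<forall>\<^sub>F N in sequentially. \<delta> N < e/2" using order_tendstoD(2)[OF \<delta>(1), of "e/2"] e by simp
 with \<delta>(2) have "\<forall>\<^sub>F N in sequentially. norm (x N - 0) < e"
 proof eventually_elim
  case (elim N) then show ?case using C assms(2)[of N] by simp
 qed
 then show "\<exists>no. \<forall>n\<ge>no. norm (x n - 0) < e" by (simp add: eventually_sequentially)
qed

abbreviation "Me N == (%e::nat\<times>nat. if fst e = snd e then \<nu>d N else \<nu> N)"

lemma Me_props: "prob_space (Me N e)" "sets (Me N e) = sets borel"
 using prob_nu sets_nu by auto

lemma vtx_less: "i \<in> vtx m b1 ==> r \<in> vtx m b ==> b1 < b ==> i < r"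
proof -
 assume a: "i \<in> vtx m b1" "r \<in> vtx m b" "b1 < b"
 then have "(b1 + 1) * m <= b * m" by (intro mult_right_mono) auto
 then show "i < r" using a by (auto simp: vtx_def)
qed

context
 fixes b b1 :: nat assumes b: "b1 < b" "b < B"
begin

lemma Kbb_sub: assumes "N \<ge> B" shows "Kbb N b b1 \<subseteq> upper_indices N" "!!e. e \<in> Kbb N b b1 ==> fst e < snd e"
proof -
 interpret w: wigner N "n N" B "\<nu> N" "\<nu>d N" "t N" "mu N" "v N" "q N" by (rule wig[OF assms])
 show 1: "!!e. e \<in> Kbb N b b1 ==> fst e < snd e" using vtx_less b by auto
 show "Kbb N b b1 \<subseteq> upper_indices N"
  using 1 w.vtx_range[of _ b1] w.vtx_range[of _ b] b by (force simp: upper_indices_def)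
qed

lemma Y_mix:
 assumes "N \<ge> B" "l \<in> vtx (n N) c'" "m \<in> vtx (n N) d" "c' < B" "d < B" "\<not> (c' = b \<and> d = b1)" "\<not> (c' = b1 \<and> d = b)"
 shows "Y N (mix (upper_indices N) (Kbb N b b1) x z) l m = Y N x l m"
proof -
 interpret w: wigner N "n N" B "\<nu> N" "\<nu>d N" "t N" "mu N" "v N" "q N" by (rule wig[OF assms(1)])
 have "(min l m, max l m) \<notin> Kbb N b b1"
 proof
  assume "(min l m, max l m) \<in> Kbb N b b1"
  then have "(blk (n N) l = b1 \<and> blk (n N) m = b) \<or> (blk (n N) m = b1 \<and> blk (n N) l = b)"
   by (auto simp: min_def max_def blk_vtx split: if_splits)
  then show False using assms(6,7) blk_vtx[OF assms(2)] blk_vtx[OF assms(3)] by auto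
 qed
 then show ?thesis
  using w.vtx_range[OF assms(2,4)] w.vtx_range[OF assms(3,5)] by (auto simp: w.Y_def w.ent_mix)
qed

lemma Wst_mix:
 assumes N: "N \<ge> B" and r: "r \<in> vtx (n N) b'" and b': "b1' < b'" "b' < b \<or> (b' = b \<and> b1' <= b1)"
 shows "Wst N b' b1' (mix (upper_indices N) (Kbb N b b1) x z) r i = Wst N b' b1' x r i"
 unfolding Wst_def
proof (rule rowsum_cong)
 fix m assume "m \<in> vtxs (n N) {..<b1'}"
 then obtain d where d: "d < b1'" "m \<in> vtx (n N) d" by (auto simp: vtxs_def)
 show "Y N (mix (upper_indices N) (Kbb N b b1) x z) r m = Y N x r m"
  by (rule Y_mix[OF N r d(2)]) (use d b b' in auto)
next
 show "{..<b1'} \<subseteq> insert b1' (Sb b' b1')" using b' by auto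
next
 fix l m assume "l \<in> vtxs (n N) (insert b1' (Sb b' b1'))" "m \<in> vtxs (n N) (insert b1' (Sb b' b1'))"
 then obtain d c' where d: "d < b'" "m \<in> vtx (n N) d" "c' < b'" "l \<in> vtx (n N) c'" using b' by (auto simp: vtxs_def)
 show "Y N (mix (upper_indices N) (Kbb N b b1) x z) l m = Y N x l m"
  by (rule Y_mix[OF N d(4,2)]) (use d b b' in auto)
qed

lemma bs_mix:
 assumes N: "N \<ge> B" and b': "b1' < b'" "b' < b \<or> (b' = b \<and> b1' < b1)"
 shows "bs N b' b1' (mix (upper_indices N) (Kbb N b b1) x z) = bs N b' b1' x"
 unfolding bs_def
proof (intro sum.cong refl arg_cong2[where f="(+)"] arg_cong2[where f="(*)"])
 fix e assume e: "e \<in> Kbb N b' b1'"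
 interpret w: wigner N "n N" B "\<nu> N" "\<nu>d N" "t N" "mu N" "v N" "q N" by (rule wig[OF N])
 have r: "1 <= fst e \<and> fst e <= N" "1 <= snd e \<and> snd e <= N" "fst e < snd e"
  using e b' b w.vtx_range[of "fst e" b1'] w.vtx_range[of "snd e" b'] vtx_less[of "fst e" "n N" b1' "snd e" b'] by auto
 have "e \<notin> Kbb N b b1"
 proof
  assume "e \<in> Kbb N b b1"
  then have "blk (n N) (snd e) = b" "blk (n N) (fst e) = b1" by (auto simp: blk_vtx)
  moreover have "blk (n N) (snd e) = b'" "blk (n N) (fst e) = b1'" using e by (auto simp: blk_vtx)
  ultimately show False using b' by auto
 qed
 moreover have "e \<in> upper_indices N" using r by (cases e) (auto simp: upper_indices_def)
 ultimately show "g N (mix (upper_indices N) (Kbb N b b1) x z e) = g N (x e)" "t N (mix (upper_indices N) (Kbb N b b1) x z e) = t N (x e)"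
  by (simp_all add: mix_def)
 show "Wst N b' b1' (mix (upper_indices N) (Kbb N b b1) x z) (snd e) (fst e) = Wst N b' b1' x (snd e) (fst e)"
  using e by (intro Wst_mix[OF N]) (use b' in auto)
qed

lemma Xp_mix:
 assumes N: "N \<ge> B" shows "Xp N b b1 (mix (upper_indices N) (Kbb N b b1) x z) = Xp N b b1 x"
 unfolding Xp_def by (intro arg_cong2[where f="(+)"] sum.cong refl bs_mix[OF N]) (use b in auto)

end

lemma measurable_bs:
 assumes N: "N \<ge> B" and b: "b1 < b" "b < B"
 shows "bs N b b1 \<in> borel_measurable (E N)"
  and "e \<in> Kbb N b b1 ==> (%y. Wst N b b1 y (snd e) (fst e)) \<in> borel_measurable (E N)"
proof -
 interpret w: wigner N "n N" B "\<nu> N" "\<nu>d N" "t N" "mu N" "v N" "q N" by (rule wig[OF N])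
 have W: "(%y. Wst N b b1 y (snd e) (fst e)) \<in> borel_measurable (E N)" if "e \<in> Kbb N b b1" for e
  unfolding Wst_def using that w.vtx_range[of "snd e" b] b by (intro w.measurable_rowsum sub[OF b]) auto
 have y: "(%y. y e) \<in> borel_measurable (E N)" if "e \<in> Kbb N b b1" for e
  by (rule w.measurable_entry) (use that Kbb_sub[OF b N] in auto)
 show "bs N b b1 \<in> borel_measurable (E N)"
  unfolding bs_def[abs_def] using W y
  by (intro borel_measurable_sum borel_measurable_add borel_measurable_times measurable_compose[OF _ gm] measurable_compose[OF _ tm]) auto
 show "e \<in> Kbb N b b1 ==> (%y. Wst N b b1 y (snd e) (fst e)) \<in> borel_measurable (E N)" by (rule W)
qed

lemma measurable_Xp:
 assumes "N \<ge> B" "b < B \<and> b1 <= b \<or> b = B \<and> b1 = 0" shows "Xp N b b1 \<in> borel_measurable (E N)"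
 unfolding Xp_def[abs_def] using assms
 by (intro borel_measurable_add borel_measurable_sum measurable_bs(1)) auto

text \<open>The characteristic function of the normal law with mean \<open>m\<close> and variance \<open>s\<close>; degenerate laws are included.\<close>
definition cf :: "real => real => real => complex" where
 "cf u m s = iexp (u * m) * complex_of_real (exp (- (u^2 * s/2)))"

lemma cf_add: "cf u m s * cf u m' s' = cf u (m + m') (s + s')"
proof -
 have "iexp (u*(m + m')) = iexp (u * m) * iexp (u * m')"
  by (simp add: algebra_simps exp_add[symmetric])
 moreover have "exp (- (u^2*(s + s')/2)) = exp (- (u^2 * s/2)) * exp (- (u^2 * s'/2))"
  by (simp add: algebra_simps add_divide_distrib exp_add[symmetric])
 ultimately show ?thesis by (simp add: cf_def)
qed

lemma step_limit:
 fixes f f' :: "nat => complex"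
 assumes "(%N. cmod (f' N - z * f N)) ----> 0" "f ----> l" shows "f' ----> z * l"
proof -
 have "(%N. (f' N - z * f N) + z * f N) ----> 0 + z * l"
  using assms by (intro tendsto_intros) (auto simp: tendsto_norm_zero_iff)
 then show ?thesis by simp
qed

text \<open>Adding one pair of blocks multiplies the limiting characteristic function by a Gaussian factor.\<close>
lemma char_step:
 assumes b: "b1 < b" "b < B"
  and lim: "(%N. LINT y|E N. iexp (u * Xp N b b1 y)) ----> l"
 shows "(%N. LINT y|E N. iexp (u * Xp N b (Suc b1) y)) ----> cf u (ms b b1) (ss b b1) * l"
proof (rule step_limit[OF _ lim])
 obtain C where C: "0 <= C" "!!\<eta>. \<eta> > 0 ==> \<exists>\<delta>. \<delta> ----> 0 \<and> (\<forall>\<^sub>F N in sequentially. mean_le (E N) (Dfun b b1 u \<eta> N) (C*\<eta> + \<delta> N))"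
  using Dfun_split[OF b, of u] by blast
 show "(%N. cmod ((LINT y|E N. iexp (u * Xp N b (Suc b1) y)) - cf u (ms b b1) (ss b b1)*(LINT y|E N. iexp (u * Xp N b b1 y)))) ----> 0"
 proof (rule char_peel_tendsto[OF C(1)])
  fix \<eta> :: real assume \<eta>: "0 < \<eta>"
  obtain \<delta> where \<delta>: "\<delta> ----> 0" "\<forall>\<^sub>F N in sequentially. mean_le (E N) (Dfun b b1 u \<eta> N) (C*\<eta> + \<delta> N)" using C(2)[OF \<eta>] by blast
  from \<delta>(2) eventually_large
  have "\<forall>\<^sub>F N in sequentially. cmod ((LINT y|E N. iexp (u * Xp N b (Suc b1) y)) - cf u (ms b b1) (ss b b1)*(LINT y|E N. iexp (u * Xp N b b1 y))) <= C*\<eta> + \<delta> N"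
  proof eventually_elim
   case (elim N)
   then have N: "N \<ge> B" and N1: "0 < N" using B by auto
   interpret nu: prob_space "\<nu> N" by (rule prob_nu)
   have meas: "g N \<in> borel_measurable (\<nu> N)" "t N \<in> borel_measurable (\<nu> N)"
    using gm tm unfolding measurable_cong_sets[OF sets_nu(1) refl] by auto
   define w where "w e y = Wst N b b1 y (snd e) (fst e)" for e y
   have cK: "real (card (Kbb N b b1)) = (real (n N))^2" by (simp add: power2_eq_square)
   have sK: "sqrt ((real (n N))^2) = real (n N)" by simp
   have w1: "(\<Sum>e\<in>Kbb N b b1. w e y) = n N * w1 b b1 N y" for y
    using elim unfolding w_def w1_def[OF b] sum_Kbb[OF b, where F="%r i. Wst N b b1 y r i"] by simp
   have w2: "(\<Sum>e\<in>Kbb N b b1. (w e y)^2) = n N * w2 b b1 N y" for y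
    using elim unfolding w_def w2_def[OF b] sum_Kbb[OF b, where F="%r i. (Wst N b b1 y r i)^2"] by simp
   have w4: "sqrt (\<Sum>e\<in>Kbb N b b1. w e y^4) = n N * w4 b b1 N y" for y
    using elim unfolding w_def w4_def[OF b] sum_Kbb[OF b, where F="%r i. (Wst N b b1 y r i)^4"] by simp
   have R: "0 <= R/(real N)^2" "0 <= q N" using R0 Q(2) by auto
   have bound: "cmod ((\<Prod>e\<in>Kbb N b b1. LINT x|\<nu> N. iexp (u*(g N x + t N x * w e y))) - cf u (ms b b1) (ss b b1)) <= Dfun b b1 u \<eta> N y" for y
    using nu.prod_char_bound[OF meas g4 t4 Rg[OF N1] R(1) Q(1)[OF N1] R(2) _ \<eta> ss_nonneg[of b b1], of "Kbb N b b1" u "%e. w e y" "ms b b1"]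
    unfolding cK sK w1 w2 w4 Dfun_def[OF b] cf_def by (simp add: mult.assoc mult.left_commute)
   have D0: "0 <= Dfun b b1 u \<eta> N y" for y using order_trans[OF norm_ge_zero bound[of y]] .
   have Ks: "Kbb N b b1 \<subseteq> upper_indices N" by (rule Kbb_sub[OF b N])
   have off: "Me N e = \<nu> N" if "e \<in> Kbb N b b1" for e using Kbb_sub(2)[OF b N that] by simp
   have "cmod ((LINT x|PiM (upper_indices N) (Me N). iexp (u*(Xp N b b1 x + (\<Sum>e\<in>Kbb N b b1. g N (x e) + t N (x e) * w e x)))) - cf u (ms b b1) (ss b b1)*(LINT x|PiM (upper_indices N) (Me N). iexp (u * Xp N b b1 x))) <= C*\<eta> + \<delta> N"
   proof (rule peel_independent_entries[OF finite_upper_indices Me_props(1) Me_props(2) Ks off sets_nu(1) gm tm _ _ _ _ _ D0 bound])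
    show "Xp N b b1 \<in> borel_measurable (PiM (upper_indices N) (Me N))"
     using measurable_Xp[OF N, of b b1] b by (simp add: ensemble_def)
    show "e \<in> Kbb N b b1 ==> w e \<in> borel_measurable (PiM (upper_indices N) (Me N))" for e
     using measurable_bs(2)[OF N b, of e] by (simp add: ensemble_def w_def[abs_def])
    show "Xp N b b1 (mix (upper_indices N) (Kbb N b b1) x z) = Xp N b b1 x" for x z by (rule Xp_mix[OF b N])
    show "e \<in> Kbb N b b1 ==> w e (mix (upper_indices N) (Kbb N b b1) x z) = w e x" for e x z
     unfolding w_def by (rule Wst_mix[OF b N]) (use b in auto)
    show "mean_le (PiM (upper_indices N) (Me N)) (Dfun b b1 u \<eta> N) (C*\<eta> + \<delta> N)" using elim by (simp add: ensemble_def)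
   qed
   moreover have "Xp N b b1 x + (\<Sum>e\<in>Kbb N b b1. g N (x e) + t N (x e) * w e x) = Xp N b (Suc b1) x" for x
    by (simp add: Xp_def bs_def w_def)
   ultimately show ?case by (simp add: ensemble_def)
  qed
  then show "\<exists>\<delta>. \<delta> ----> 0 \<and> (\<forall>\<^sub>F N in sequentially. cmod ((LINT y|E N. iexp (u * Xp N b (Suc b1) y)) - cf u (ms b b1) (ss b b1)*(LINT y|E N. iexp (u * Xp N b b1 y))) <= C*\<eta> + \<delta> N)"
   using \<delta>(1) by blast
 qed simp
qed

lemma char_block:
 assumes "b < B" "b1 <= b" "(%N. LINT y|E N. iexp (u * Xp N b 0 y)) ----> l"
 shows "(%N. LINT y|E N. iexp (u * Xp N b b1 y)) ----> cf u (\<Sum>b1'<b1. ms b b1') (\<Sum>b1'<b1. ss b b1') * l"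
 using assms(2)
proof (induction b1)
 case 0 then show ?case using assms(3) by (simp add: cf_def)
next
 case (Suc b1)
 have "(%N. LINT y|E N. iexp (u * Xp N b (Suc b1) y)) ----> cf u (ms b b1) (ss b b1)*(cf u (\<Sum>b1'<b1. ms b b1') (\<Sum>b1'<b1. ss b b1') * l)"
  by (rule char_step) (use Suc assms in auto)
 then show ?case by (simp add: mult.assoc[symmetric] cf_add add.commute)
qed

lemma char_off:
 assumes "b <= B"
 shows "(%N. LINT y|E N. iexp (u * Xp N b 0 y)) ----> cf u (\<Sum>b'<b. \<Sum>b1'<b'. ms b' b1') (\<Sum>b'<b. \<Sum>b1'<b'. ss b' b1')"
 using assms
proof (induction b)
 case 0
 have "(LINT y|E N. iexp (u * Xp N 0 0 y)) = 1" for N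
 proof -
  interpret prob_space "E N" by (rule probE)
  show ?thesis by (simp add: Xp_def prob_space)
 qed
 then show ?case by (simp add: cf_def)
next
 case (Suc b)
 have "(%N. LINT y|E N. iexp (u * Xp N b b y)) ----> cf u (\<Sum>b1'<b. ms b b1') (\<Sum>b1'<b. ss b b1') * cf u (\<Sum>b'<b. \<Sum>b1'<b'. ms b' b1') (\<Sum>b'<b. \<Sum>b1'<b'. ss b' b1')"
  by (rule char_block) (use Suc in auto)
 moreover have "Xp N (Suc b) 0 y = Xp N b b y" for N y by (simp add: Xp_def)
 ultimately show ?case by (simp add: cf_add add.commute)
qed

definition "mtot = \<alpha>m + (\<Sum>b<B. \<Sum>b1<b. ms b b1)"
definition "stot = \<alpha>s + (\<Sum>b<B. \<Sum>b1<b. ss b b1)"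

abbreviation "ma N == LINT x|\<nu>d N. a N x"
abbreviation "Sa N == LINT x|\<nu>d N. (a N x)^2"
abbreviation "diag N == {e \<in> upper_indices N. fst e = snd e}"

lemma card_diag: "card (diag N) = N"
proof -
 have "diag N = (%i. (i, i)) ` {1..N}" by (auto simp: upper_indices_def)
 then show ?thesis by (simp add: card_image inj_on_def)
qed

lemma Xp_diag:
 assumes N: "N \<ge> B" shows "Xp N B 0 (mix (upper_indices N) (diag N) x z) = Xp N B 0 x"
proof -
 interpret w: wigner N "n N" B "\<nu> N" "\<nu>d N" "t N" "mu N" "v N" "q N" by (rule wig[OF N])
 let ?y = "mix (upper_indices N) (diag N) x z"
 have Y: "Y N ?y l m = Y N x l m" if "1 <= l" "l <= N" "1 <= m" "m <= N" "l \<noteq> m" for l m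
  using that by (simp add: w.Y_def w.ent_mix) (auto simp: min_def max_def)
 have "bs N b b1 ?y = bs N b b1 x" if b: "b1 < b" "b < B" for b b1
  unfolding bs_def
 proof (intro sum.cong refl arg_cong2[where f="(+)"] arg_cong2[where f="(*)"])
  fix e assume e: "e \<in> Kbb N b b1"
  have "e \<in> upper_indices N" "fst e \<noteq> snd e" using Kbb_sub(1)[OF b N] Kbb_sub(2)[OF b N e] e by auto
  then show "g N (?y e) = g N (x e)" "t N (?y e) = t N (x e)" by (simp_all add: mix_def)
  have ch: "chain (Y N ?y) (n N) b1 \<delta> k S l j = chain (Y N x) (n N) b1 \<delta> k S l j" if "insert b1 S \<subseteq> {..<B}" "l \<in> vtxs (n N) (insert b1 S)" for k S l j
   using that
  proof (induction k arbitrary: S l)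
   case (Suc k)
   show ?case
   proof (cases "blk (n N) l = b1")
    case False
    have "Y N ?y l m * chain (Y N ?y) (n N) b1 \<delta> k (S - {blk (n N) l}) m j = Y N x l m * chain (Y N x) (n N) b1 \<delta> k (S - {blk (n N) l}) m j"
     if m: "m \<in> vtxs (n N) (insert b1 (S - {blk (n N) l}))" for m
    proof -
     have m': "m \<in> vtxs (n N) (insert b1 S)" using m by (auto simp: vtxs_def)
     have "blk (n N) m \<noteq> blk (n N) l" using blk_vtxs[OF m] False by auto
     then have "Y N ?y l m = Y N x l m"
      using w.vtxs_range[OF Suc.prems(2,1)] w.vtxs_range[OF m' Suc.prems(1)] by (intro Y) auto
     then show ?thesis using Suc.IH[OF _ m] Suc.prems(1) by auto
    qed
    then show ?thesis using False by simp
   qed simp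
  qed simp
  have Ye: "Y N ?y (snd e) m = Y N x (snd e) m" if m: "m \<in> vtxs (n N) {..<b1}" for m
  proof -
   have "blk (n N) m < b1" using blk_vtxs[OF m] by simp
   moreover have "blk (n N) (snd e) = b" using e by (auto simp: blk_vtx)
   ultimately have "m \<noteq> snd e" using b by auto
   then show ?thesis using w.vtxs_range[OF m] w.vtx_range[of "snd e" b] e b by (intro Y) auto
  qed
  have me: "m \<in> vtxs (n N) (insert b1 (Sb b b1))" if "m \<in> vtxs (n N) {..<b1}" for m
   using that b by (auto simp: vtxs_def)
  show "Wst N b b1 ?y (snd e) (fst e) = Wst N b b1 x (snd e) (fst e)"
   unfolding Wst_def rowsum_def
   by (intro sum.cong refl arg_cong2[where f="(*)"] Ye ch sub(1)[OF b] me)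
 qed
 then show ?thesis unfolding Xp_def by (intro arg_cong2[where f="(+)"] sum.cong refl) auto
qed

lemma lim_aR: "(%N. sqrt (real N)*(R/real N)) ----> 0"
proof -
 have "(%N. R * sqrt (1/real N)) ----> R * sqrt 0" by (intro tendsto_intros lim_1_over_n)
 moreover have "R * sqrt (1/real N) = sqrt (real N)*(R/real N)" for N
  by (cases "N = 0") (auto simp: real_sqrt_divide field_simps)
 ultimately show ?thesis by simp
qed

lemma lim_ma2: "(%N. real N*(ma N)^2) ----> 0"
proof -
 have "(%N. (real N * ma N)^2*(1/real N)) ----> \<alpha>m^2*0" by (intro tendsto_intros lim_am lim_1_over_n)
 moreover have "(real N * ma N)^2*(1/real N) = real N*(ma N)^2" for N by (simp add: power2_eq_square)
 ultimately show ?thesis by simp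
qed

text \<open>The diagonal entries are independent of everything else and are peeled off as one more group, with zero weights.\<close>
theorem char_limit:
 "(%N. LINT y|E N. iexp (u * X N y)) ----> cf u mtot stot"
proof -
 define C where "C = 2*\<bar>u\<bar>^3*(\<alpha>s + 1)"
 have "(%N. LINT y|E N. iexp (u * X N y)) ----> cf u \<alpha>m \<alpha>s * cf u (\<Sum>b<B. \<Sum>b1<b. ms b b1) (\<Sum>b<B. \<Sum>b1<b. ss b b1)"
 proof (rule step_limit[OF char_peel_tendsto char_off[OF order_refl]])
  show "0 <= C" using c_nonneg by (simp add: C_def)
  fix \<eta> :: real assume \<eta>: "0 < \<eta>"
  define Sq where "Sq = sqrt (8*(\<bar>u\<bar>^3/\<eta> + u^4))"
  define \<delta> where "\<delta> N = 2*u^2*(real N*(ma N)^2) + 2 * Sq*(sqrt (real N)*(R/real N)) + \<bar>u\<bar>*\<bar>real N * ma N - \<alpha>m\<bar> + u^2/2*\<bar>real N * Sa N - \<alpha>s\<bar>" for N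
  have "\<delta> ----> 2*u^2*0 + 2 * Sq*0 + \<bar>u\<bar>*\<bar>\<alpha>m - \<alpha>m\<bar> + u^2/2*\<bar>\<alpha>s - \<alpha>s\<bar>"
   unfolding \<delta>_def using lim_ma2 lim_aR lim_am lim_as by (intro tendsto_intros) auto
  then have \<delta>: "\<delta> ----> 0" by simp
  have "\<forall>\<^sub>F N in sequentially. real N * Sa N < \<alpha>s + 1" using order_tendstoD(2)[OF lim_as, of "\<alpha>s + 1"] by simp
  with eventually_large have "\<forall>\<^sub>F N in sequentially. cmod ((LINT y|E N. iexp (u * X N y)) - cf u \<alpha>m \<alpha>s*(LINT y|E N. iexp (u * Xp N B 0 y))) <= C*\<eta> + \<delta> N"
  proof eventually_elim
   case (elim N)
   then have N: "N \<ge> B" and N1: "0 < N" using B by auto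
   interpret nu: prob_space "\<nu>d N" by (rule prob_nu)
   have meas: "a N \<in> borel_measurable (\<nu>d N)" "(%x. 0::real) \<in> borel_measurable (\<nu>d N)"
    using am unfolding measurable_cong_sets[OF sets_nu(2) refl] by auto
   define D where "D = 2*\<bar>u\<bar>^3*\<eta>*(real N * Sa N) + \<delta> N"
   have fin: "finite (diag N)" by simp
   have bound: "cmod ((\<Prod>e\<in>diag N. LINT x|\<nu>d N. iexp (u*(a N x + 0*(%e x. 0) e y))) - cf u \<alpha>m \<alpha>s) <= D" for y :: "nat \<times> nat => real"
    using nu.prod_char_bound[OF meas a4 _ Ra[OF N1] _ _ _ fin \<eta> c_nonneg(3), of 0 u "%_. 0" \<alpha>m] R0
    unfolding card_diag cf_def D_def \<delta>_def Sq_def by (simp add: mult.assoc)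
   have D0: "0 <= D" using order_trans[OF norm_ge_zero bound] .
   have "2*\<bar>u\<bar>^3*\<eta>*(real N * Sa N) <= 2*\<bar>u\<bar>^3*\<eta>*(\<alpha>s + 1)" using elim \<eta> by (intro mult_left_mono) auto
   then have DC: "D <= C*\<eta> + \<delta> N" by (simp add: D_def C_def mult_ac)
   have mX: "Xp N B 0 \<in> borel_measurable (PiM (upper_indices N) (Me N))"
    using measurable_Xp[OF N, of B 0] by (simp add: ensemble_def)
   interpret EE: prob_space "PiM (upper_indices N) (Me N)" using probE[of N] by (simp add: ensemble_def)
   have on: "Me N e = \<nu>d N" if "e \<in> diag N" for e using that by simp
   have "cmod ((LINT x|PiM (upper_indices N) (Me N). iexp (u*(Xp N B 0 x + (\<Sum>e\<in>diag N. a N (x e) + (%_. 0) (x e)*(%e x. 0) e x)))) - cf u \<alpha>m \<alpha>s*(LINT x|PiM (upper_indices N) (Me N). iexp (u * Xp N B 0 x))) <= D"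
    by (rule peel_independent_entries[OF finite_upper_indices Me_props(1) Me_props(2) _ on sets_nu(2) am _ mX _ Xp_diag[OF N] _ EE.mean_le_const[OF D0] D0 bound])
      auto
   then show ?case using DC by (simp add: X_def[abs_def] ensemble_def)
  qed
  then show "\<exists>\<delta>. \<delta> ----> 0 \<and> (\<forall>\<^sub>F N in sequentially. cmod ((LINT y|E N. iexp (u * X N y)) - cf u \<alpha>m \<alpha>s*(LINT y|E N. iexp (u * Xp N B 0 y))) <= C*\<eta> + \<delta> N)"
   using \<delta> by blast
 qed simp
 then show ?thesis by (simp add: cf_add mtot_def stot_def)
qed

lemma measurable_X: assumes "N \<ge> B" shows "X N \<in> borel_measurable (E N)"
proof -
 interpret w: wigner N "n N" B "\<nu> N" "\<nu>d N" "t N" "mu N" "v N" "q N" by (rule wig[OF assms])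
 show ?thesis unfolding X_def[abs_def]
  by (intro borel_measurable_add measurable_Xp borel_measurable_sum measurable_compose[OF _ am]) (use assms w.measurable_entry in auto)
qed

end

section \<open>Shifted densities\<close>

locale nice_density =
 fixes q :: "real => real" and C :: real and m :: nat and \<omega> :: real
 assumes smooth: "smooth_fun q" and pos: "!!x. 0 < q x" and even: "!!x. q (- x) = q x"
  and d1_zero: "(deriv q \<longlongrightarrow> 0) at_infinity"
  and bd1: "!!x. \<bar>deriv q x/q x\<bar> <= C*(1 + \<bar>x\<bar>)^m"
  and bd2: "!!x. \<bar>deriv (deriv q) x/q x\<bar> <= C*(1 + \<bar>x\<bar>)^m"
  and total: "integrable lborel q" "(LBINT x. q x) = 1"
  and moments: "!!k. integrable lborel (%x. \<bar>x\<bar>^k * q x)"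
  and om: "0 < \<omega>"
begin

text \<open>The score and the curvature of the density, the ratio of a shifted density to the original one, and the parts \<open>od\<close>, \<open>evn\<close> of
  this ratio that are odd and even in the shift. Both are of interest since the shift of an entry is \<open>\<delta> N\<close> times a sign.
  The window \<open>{- K N..K N}\<close> grows so slowly that \<open>\<delta> N * K N^m\<close> tends to 0, but as a power of \<open>N\<close>, so that the mass
  outside it is smaller than any power of \<open>1/N\<close>.\<close>
definition "f1 x = deriv q x/q x"
definition "f2 x = deriv (deriv q) x/q x"
definition "\<nu> = density lborel (%x. ennreal (q x))"
definition "r d x = q (x - d)/q x"
definition "od d x = (r d x - r (- d) x)/2"
definition "evn d x = (r d x + r (- d) x)/2"
definition "\<delta> N = sqrt (\<omega>/real N)"
definition "K N = root (4*(m + 1)) (real N)"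

lemma der: "((deriv ^^ k) q has_real_derivative (deriv ^^ Suc k) q x) (at x)"
 using smooth unfolding smooth_fun_def by (auto simp: DERIV_deriv_iff_field_differentiable)

lemma der0: "(q has_real_derivative deriv q x) (at x)" using der[of 0] by simp
lemma der1: "(deriv q has_real_derivative deriv (deriv q) x) (at x)" using der[of 1] by simp
lemma der2: "(deriv (deriv q) has_real_derivative deriv (deriv (deriv q)) x) (at x)"
 using der[of 2] by (simp add: eval_nat_numeral)

lemma cont: "continuous_on UNIV q" "continuous_on UNIV (deriv q)" "continuous_on UNIV (deriv (deriv q))"
 by (auto intro!: continuous_at_imp_continuous_on DERIV_isCont[OF der0] DERIV_isCont[OF der1] DERIV_isCont[OF der2])

lemma meas[measurable]: "q \<in> borel_measurable borel" "deriv q \<in> borel_measurable borel" "deriv (deriv q) \<in> borel_measurable borel"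
 using cont by (auto intro: borel_measurable_continuous_onI)

lemma meas_f[measurable]: "f1 \<in> borel_measurable borel" "f2 \<in> borel_measurable borel" "r d \<in> borel_measurable borel"
  "od d \<in> borel_measurable borel" "evn d \<in> borel_measurable borel"
 unfolding f1_def[abs_def] f2_def[abs_def] r_def[abs_def] od_def[abs_def] evn_def[abs_def] by measurable

lemma cont_f: "continuous_on UNIV f1" "continuous_on UNIV f2"
 unfolding f1_def[abs_def] f2_def[abs_def] using pos by (auto intro!: continuous_intros cont simp: less_imp_neq[symmetric])

lemma sets_nu[simp, measurable_cong]: "sets \<nu> = sets borel" and space_nu[simp]: "space \<nu> = UNIV" by (auto simp: \<nu>_def)

sublocale nu: prob_space \<nu>
proof
 have "(\<integral>\<^sup>+x. ennreal (q x) \<partial>lborel) = ennreal (LBINT x. q x)"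
  using total pos by (intro nn_integral_eq_integral) (auto intro: less_imp_le)
 then show "emeasure \<nu> (space \<nu>) = 1" using total by (simp add: \<nu>_def emeasure_density)
qed

lemma integral_nu: "h \<in> borel_measurable borel ==> (LINT x|\<nu>. h x) = (LBINT x. q x * h x)"
 for h :: "real => real"
 unfolding \<nu>_def using pos by (intro integral_real_density) (auto intro: less_imp_le)

lemma integrable_nu: "h \<in> borel_measurable borel ==> integrable \<nu> h \<longleftrightarrow> integrable lborel (%x. q x * h x)"
 for h :: "real => real"
 unfolding \<nu>_def using pos by (intro integrable_real_density) (auto intro: less_imp_le)

lemma C0: "0 <= C"
proof -
 have "\<bar>deriv q 0/q 0\<bar> <= C" using bd1[of 0] by simp
 then show ?thesis by (rule order_trans[OF abs_ge_zero])
qed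

lemma int_poly: "integrable \<nu> (%x. (a + \<bar>x\<bar>)^k)" 
proof -
 have "integrable \<nu> (%x. \<bar>x\<bar>^j)" for j
  using moments[of j] by (subst integrable_nu) (auto simp: mult.commute)
 then have "integrable \<nu> (%x. \<Sum>j\<le>k. real (k choose j) * a^j*\<bar>x\<bar>^(k - j))"
  by (intro Bochner_Integration.integrable_sum integrable_mult_right)
 then show ?thesis by (simp add: binomial_ring)
qed

lemma int_poly_bounded:
 fixes h :: "real => real"
 assumes "h \<in> borel_measurable borel" "!!x. \<bar>h x\<bar> <= c*(a + \<bar>x\<bar>)^k"
 shows "integrable \<nu> h"
 by (rule Bochner_Integration.integrable_bound[of _ "%x. c*(a + \<bar>x\<bar>)^k"])
   (use int_poly assms in \<open>auto intro!: AE_I2 order_trans[OF _ abs_ge_self]\<close>)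

lemma f1_bd: "\<bar>f1 x\<bar> <= C*(1 + \<bar>x\<bar>)^m" and f2_bd: "\<bar>f2 x\<bar> <= C*(1 + \<bar>x\<bar>)^m"
 using bd1 bd2 by (auto simp: f1_def f2_def)

lemma pow_bd:
 assumes "\<bar>h x\<bar> <= C*(1 + \<bar>x\<bar>)^m"
 shows "\<bar>h x^j\<bar> <= C^j*(1 + \<bar>x\<bar>)^(m * j)"
 using power_mono[OF assms, of j] by (simp add: power_abs power_mult_distrib power_mult)

lemma int_f: "integrable \<nu> (%x. f1 x^j)" "integrable \<nu> (%x. f2 x^j)"
proof -
 show "integrable \<nu> (%x. f1 x^j)"
  by (rule int_poly_bounded[where h="%x. f1 x^j" and c="C^j" and a=1 and k="m * j", OF _ pow_bd[where h=f1, OF f1_bd]]) measurable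
 show "integrable \<nu> (%x. f2 x^j)"
  by (rule int_poly_bounded[where h="%x. f2 x^j" and c="C^j" and a=1 and k="m * j", OF _ pow_bd[where h=f2, OF f2_bd]]) measurable
qed

lemma fisher: "fisher_F q = (LINT x|\<nu>. (f1 x)^2)" "fisher_G q = (LINT x|\<nu>. (f2 x)^2)"
proof -
 have "q x*(f1 x)^2 = (deriv q x)^2/q x" "q x*(f2 x)^2 = (deriv (deriv q) x)^2/q x" for x
  using pos[of x] by (auto simp: f1_def f2_def power2_eq_square)
 then show "fisher_F q = (LINT x|\<nu>. (f1 x)^2)" "fisher_G q = (LINT x|\<nu>. (f2 x)^2)"
  by (simp_all add: integral_nu fisher_F_def fisher_G_def)
qed

lemma deriv_odd: "deriv q (- x) = - deriv q x"
proof -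
 have "((%x. q (- x)) has_real_derivative deriv q (- x)*(- 1)) (at x)"
  by (rule DERIV_chain2[OF der0]) (auto intro!: derivative_eq_intros)
 then have "(q has_real_derivative - deriv q (- x)) (at x)" by (simp add: even)
 then have "deriv q x = - deriv q (- x)" by (rule DERIV_imp_deriv)
 then show ?thesis by simp
qed

lemma deriv2_even: "deriv (deriv q) (- x) = deriv (deriv q) x"
proof -
 have "((%x. - deriv q (- x)) has_real_derivative - (deriv (deriv q) (- x)*(- 1))) (at x)"
  by (intro DERIV_minus DERIV_chain2[OF der1]) (auto intro!: derivative_eq_intros)
 then have "(deriv q has_real_derivative deriv (deriv q) (- x)) (at x)" by (simp add: deriv_odd)
 then have "deriv (deriv q) x = deriv (deriv q) (- x)" by (rule DERIV_imp_deriv)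
 then show ?thesis by simp
qed

lemma f_sym: "f1 (- x) = - f1 x" "f2 (- x) = f2 x"
 by (auto simp: f1_def f2_def deriv_odd deriv2_even even)

lemma r_sym: "r d (- x) = r (- d) x"
 using even[of "x + d"] by (simp add: r_def even)

lemma eo_sym: "od d (- x) = - od d x" "evn d (- x) = evn d x"
 by (simp_all add: od_def evn_def r_sym add.commute minus_divide_left)

lemma integral_flip: "h \<in> borel_measurable borel ==> (LINT x|\<nu>. h (- x)) = (LINT x|\<nu>. h x)" for h :: "real => real"
 using lborel_integral_real_affine[of "-1" "%x. q x * h x" 0] by (simp add: integral_nu even)

lemma integral_odd_zero:
 fixes h :: "real => real"
 assumes "h \<in> borel_measurable borel" "!!x. h (- x) = - h x" shows "(LINT x|\<nu>. h x) = 0"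
 using integral_flip[OF assms(1)] assms(2) by simp

lemma integral_shift:
 fixes h :: "real => real"
 assumes [measurable]: "h \<in> borel_measurable borel"
 shows "(LINT x|\<nu>. h (x + d)) = (LINT x|\<nu>. r d x * h x)"
  and "integrable \<nu> (%x. h (x + d)) \<longleftrightarrow> integrable \<nu> (%x. r d x * h x)"
proof -
 have eq: "q x*(r d x * h x) = q (x - d) * h x" for x using pos[of x] by (simp add: r_def)
 show "(LINT x|\<nu>. h (x + d)) = (LINT x|\<nu>. r d x * h x)"
  using lborel_integral_real_affine[of 1 "%x. q (x - d) * h x" d] by (simp add: integral_nu eq add.commute)
 show "integrable \<nu> (%x. h (x + d)) \<longleftrightarrow> integrable \<nu> (%x. r d x * h x)"
  using lborel_integrable_real_affine_iff[of 1 "%x. q (x - d) * h x" d] by (simp add: integrable_nu eq add.commute)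
qed

lemma mean_f1: "(LINT x|\<nu>. f1 x) = 0" by (rule integral_odd_zero) (auto simp: f_sym)

text \<open>The integral of \<open>deriv (deriv q)\<close> is the difference of the limits of \<open>deriv q\<close> at \<open>\<infinity>\<close> and \<open>-\<infinity>\<close>.\<close>
lemma mean_f2: "(LINT x|\<nu>. f2 x) = 0"
proof -
 have i: "integrable lborel (deriv (deriv q))"
 proof -
  have "q x * f2 x = deriv (deriv q) x" for x using pos[of x] by (simp add: f2_def)
  then show ?thesis using int_f(2)[of 1] by (simp add: integrable_nu)
 qed
 have lim: "(deriv q \<longlongrightarrow> 0) at_top" "(deriv q \<longlongrightarrow> 0) at_bot"
  using d1_zero by (auto simp: at_infinity_eq_at_top_bot filterlim_sup intro: tendsto_mono[OF _ d1_zero] )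
 have "(LBINT x=-\<infinity>..\<infinity>. deriv (deriv q) x) = 0 - 0"
 proof (rule interval_integral_FTC_integrable[where F="deriv q"])
  show "(deriv q has_vector_derivative deriv (deriv q) x) (at x)" for x
   using der1 by (simp add: has_real_derivative_iff_has_vector_derivative)
  show "isCont (deriv (deriv q)) x" for x by (rule DERIV_isCont[OF der2])
  show "set_integrable lborel (einterval (-\<infinity>) \<infinity>) (deriv (deriv q))"
   using i by (simp add: set_integrable_def einterval_eq)
  show "((deriv q \<circ> real_of_ereal) \<longlongrightarrow> 0) (at_right (-\<infinity>))" "((deriv q \<circ> real_of_ereal) \<longlongrightarrow> 0) (at_left \<infinity>)"
   using lim by (auto simp: ereal_tendsto_simps)
 qed auto
 then have "(LBINT x. deriv (deriv q) x) = 0"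
  by (simp add: interval_lebesgue_integral_def einterval_eq set_lebesgue_integral_def)
 moreover have "q x * f2 x = deriv (deriv q) x" for x using pos[of x] by (simp add: f2_def)
 ultimately show ?thesis by (simp add: integral_nu)
qed

lemma \<delta>_nonneg: "0 <= \<delta> N" using om by (simp add: \<delta>_def)
lemma \<delta>_sq: "0 < N ==> real N*(\<delta> N)^2 = \<omega>" using om by (simp add: \<delta>_def)
lemma \<delta>_pos: "0 < N ==> 0 < \<delta> N" using om by (simp add: \<delta>_def)

lemma \<delta>_ev: "\<forall>\<^sub>F N in sequentially. 0 < \<delta> N"
 using eventually_gt_at_top[of 0] by eventually_elim (rule \<delta>_pos)

lemma \<delta>_lim: "\<delta> ----> 0"
proof -
 have "(%N. sqrt (\<omega>*(1/real N))) ----> sqrt (\<omega>*0)" by (intro tendsto_intros lim_1_over_n)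
 then show ?thesis by (simp add: \<delta>_def[abs_def])
qed

lemma \<delta>_le: "\<delta> N <= sqrt \<omega>"
proof (cases "N = 0")
 case False
 then have "\<omega>/real N <= \<omega>" using om by (simp add: field_simps mult_le_cancel_left1)
 then show ?thesis by (simp add: \<delta>_def)
qed (use om in \<open>simp add: \<delta>_def\<close>)

lemma K_pow: "K N^(4*(m + 1)) = real N" by (simp add: K_def)
lemma K_nonneg: "0 <= K N" by (simp add: K_def)
lemma K_ge1: "1 <= N ==> 1 <= K N" by (simp add: K_def)

lemma K_lim: "filterlim K at_top sequentially"
 unfolding filterlim_at_top
proof
 fix Z :: real
 show "\<forall>\<^sub>F N in sequentially. Z <= K N"
 proof (rule eventually_sequentiallyI[of "nat \<lceil>\<bar>Z\<bar>^(4*(m + 1))\<rceil>"])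
  fix N assume "nat \<lceil>\<bar>Z\<bar>^(4*(m + 1))\<rceil> <= N"
  then have "\<bar>Z\<bar>^(4*(m + 1)) <= real N" by linarith
  then have "root (4*(m + 1)) (\<bar>Z\<bar>^(4*(m + 1))) <= K N" unfolding K_def by (intro real_root_le_mono) auto
  moreover have "root (4*(m + 1)) (\<bar>Z\<bar>^(4*(m + 1))) = \<bar>Z\<bar>" by (rule real_root_power_cancel) auto
  ultimately show "Z <= K N" by linarith
 qed
qed

lemma K_delta: "(%N. \<delta> N*(C*(2 + K N)^m)) ----> 0"
proof (rule Lim_null_comparison)
 define c where "c = sqrt \<omega> * C*3^m"
 have "(%N. c * sqrt (sqrt (1/real N))) ----> c * sqrt (sqrt 0)" by (intro tendsto_intros lim_1_over_n)
 then show "(%N. c * sqrt (sqrt (1/real N))) ----> 0" by simp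
 show "\<forall>\<^sub>F N in sequentially. norm (\<delta> N*(C*(2 + K N)^m)) <= c * sqrt (sqrt (1/real N))"
 proof (rule eventually_sequentiallyI[of 1])
  fix N :: nat assume N: "1 <= N"
  have K1: "1 <= K N" using K_ge1[OF N] .
  have "(2 + K N)^m <= (3 * K N)^m" using K1 by (intro power_mono) auto
  also have "... = 3^m * K N^m" by (simp add: power_mult_distrib)
  also have "... <= 3^m * K N^(m + 1)" using K1 by (intro mult_left_mono power_increasing) auto
  also have "K N^(m + 1) = sqrt (sqrt (real N))"
  proof -
   have "K N^(4*(m + 1)) = ((K N^(m + 1))^2)^2" unfolding power_mult[symmetric] by (rule arg_cong[where f="power (K N)"]) simp
   then have e: "real N = ((K N^(m + 1))^2)^2" using K_pow[of N] by simp
   show ?thesis by (subst e) (use K1 in \<open>simp only: real_sqrt_abs abs_power2\<close>, use K1 in simp)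
  qed
  finally have 1: "(2 + K N)^m <= 3^m * sqrt (sqrt (real N))" .
  have 2: "\<delta> N * sqrt (sqrt (real N)) = sqrt \<omega> * sqrt (sqrt (1/real N))"
  proof -
   define A where "A = sqrt (sqrt (1/real N))"
   define R where "R = sqrt (sqrt (real N))"
   have "A * A = sqrt (1/real N)" by (simp add: A_def)
   then have "\<delta> N = sqrt \<omega>*(A * A)" by (simp add: \<delta>_def real_sqrt_divide)
   moreover have "A * R = 1" using N by (simp add: A_def R_def real_sqrt_mult[symmetric])
   ultimately have "\<delta> N * R = sqrt \<omega> * A" by simp
   then show ?thesis by (simp add: A_def R_def)
  qed
  have "\<delta> N*(C*(2 + K N)^m) <= \<delta> N*(C*(3^m * sqrt (sqrt (real N))))"
   using 1 C0 \<delta>_nonneg by (intro mult_left_mono) auto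
  also have "... = C*3^m*(\<delta> N * sqrt (sqrt (real N)))" by simp
  also have "... = c * sqrt (sqrt (1/real N))" unfolding 2 c_def by simp
  finally show "norm (\<delta> N*(C*(2 + K N)^m)) <= c * sqrt (sqrt (1/real N))"
   using C0 \<delta>_nonneg K1 by (simp add: abs_mult)
 qed
qed

text \<open>The derivative of \<open>ln q\<close> is \<open>f1\<close>, and by assumption its size on the window times the shift is at most 1; hence \<open>q\<close>
  varies by a factor of at most \<open>exp 1\<close>.\<close>
lemma ratio_bound:
 assumes "d*(C*(2 + Kk)^m) <= 1" "d <= 1" "\<bar>y\<bar> <= Kk" "\<bar>\<xi> - y\<bar> <= d"
 shows "q \<xi> <= 3 * q y"
proof -
 have d0: "0 <= d" using assms(4) by linarith
 have dl: "((%x. ln (q x)) has_real_derivative f1 x) (at x)" for x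
  using pos[of x] unfolding f1_def by (auto intro!: derivative_eq_intros der0)
 have "\<bar>ln (q \<xi>) - ln (q y)\<bar> <= (C*(2 + Kk)^m)*\<bar>\<xi> - y\<bar>"
 proof (rule field_differentiable_bound[where S="{min \<xi> y..max \<xi> y}" and f'="f1", unfolded real_norm_def])
  fix x assume x: "x \<in> {min \<xi> y..max \<xi> y}"
  then have "\<bar>x\<bar> <= Kk + 1" using assms by (auto simp: min_def max_def split: if_splits)
  then have "(1 + \<bar>x\<bar>)^m <= (2 + Kk)^m" by (intro power_mono) auto
  then show "\<bar>f1 x\<bar> <= C*(2 + Kk)^m" using f1_bd[of x] C0 by (meson mult_left_mono order_trans)
  show "((%x. ln (q x)) has_field_derivative f1 x) (at x within {min \<xi> y..max \<xi> y})"
   by (rule has_field_derivative_at_within[OF dl])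
 qed auto
 also have "... <= (C*(2 + Kk)^m) * d"
  using assms C0 by (intro mult_left_mono mult_nonneg_nonneg zero_le_power) auto
 also have "... <= 1" using assms(1) by (simp add: mult.commute)
 finally have "ln (q \<xi>) <= ln (q y) + 1" by linarith
 then have "q \<xi> <= exp (ln (q y) + 1)" using pos[of \<xi>] by (metis exp_le_cancel_iff exp_ln)
 also have "... = q y * exp 1" using pos[of y] by (simp add: exp_add)
 also have "... <= q y*3" using exp_le pos[of y] by (intro mult_left_mono) auto
 finally show ?thesis by simp
qed

definition "good N \<longleftrightarrow> 0 < N \<and> \<delta> N*(C*(2 + K N)^m) <= 1 \<and> \<delta> N <= 1"

lemma good: "\<forall>\<^sub>F N in sequentially. good N"
proof -
 have "\<forall>\<^sub>F N in sequentially. \<delta> N*(C*(2 + K N)^m) < 1" "\<forall>\<^sub>F N in sequentially. \<delta> N < 1"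
  using order_tendstoD(2)[OF K_delta, of 1] order_tendstoD(2)[OF \<delta>_lim, of 1] by auto
 then show ?thesis using eventually_gt_at_top[of 0] by eventually_elim (auto simp: good_def)
qed

lemma fm_bound:
 assumes g: "good N" and y: "\<bar>y\<bar> <= K N" and x: "\<bar>\<xi> - y\<bar> <= \<delta> N"
 shows "\<bar>deriv q \<xi>\<bar> <= 3 * C*(2 + \<bar>y\<bar>)^m * q y" "\<bar>deriv (deriv q) \<xi>\<bar> <= 3 * C*(2 + \<bar>y\<bar>)^m * q y"
proof -
 have q3: "q \<xi> <= 3 * q y" using ratio_bound[OF _ _ y x] g by (simp add: good_def)
 have "1 + \<bar>\<xi>\<bar> <= 2 + \<bar>y\<bar>" using g x by (auto simp: good_def)
 then have b: "C*(1 + \<bar>\<xi>\<bar>)^m <= C*(2 + \<bar>y\<bar>)^m" using C0 by (intro mult_left_mono power_mono) auto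
 have *: "\<bar>d\<bar> <= 3 * C*(2 + \<bar>y\<bar>)^m * q y" if "\<bar>d/q \<xi>\<bar> <= C*(1 + \<bar>\<xi>\<bar>)^m" for d
 proof -
  have "\<bar>d\<bar> = \<bar>d/q \<xi>\<bar> * q \<xi>" using pos[of \<xi>] by simp
  also have "... <= (C*(2 + \<bar>y\<bar>)^m)*(3 * q y)"
   using that b q3 pos[of \<xi>] C0 by (intro mult_mono) (auto intro: less_imp_le)
  finally show ?thesis by (simp add: mult_ac)
 qed
 show "\<bar>deriv q \<xi>\<bar> <= 3 * C*(2 + \<bar>y\<bar>)^m * q y" "\<bar>deriv (deriv q) \<xi>\<bar> <= 3 * C*(2 + \<bar>y\<bar>)^m * q y"
  using *[OF bd1] *[OF bd2] by auto
qed

text \<open>By the mean value theorem, \<open>od\<close> is \<open>\<delta> N\<close> times a derivative of \<open>q\<close> at a nearby point, divided by \<open>q\<close>. On the window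
  numerator and denominator are comparable by \<open>ratio_bound\<close>.\<close>
lemma od_bound:
 assumes g: "good N" and y: "\<bar>y\<bar> <= K N"
 shows "\<bar>od (\<delta> N) y/\<delta> N\<bar> <= 3 * C*(2 + \<bar>y\<bar>)^m"
proof -
 have d: "0 < \<delta> N" using g \<delta>_pos by (simp add: good_def)
 obtain z where z: "y - \<delta> N < z" "z < y + \<delta> N" "q (y + \<delta> N) - q (y - \<delta> N) = (y + \<delta> N - (y - \<delta> N)) * deriv q z"
  using MVT2[of "y - \<delta> N" "y + \<delta> N" q "deriv q"] d der0 by auto
 then have eq: "od (\<delta> N) y/\<delta> N = - deriv q z/q y"
  using d pos[of y] by (simp add: od_def r_def field_simps)
 have "\<bar>deriv q z\<bar> <= 3 * C*(2 + \<bar>y\<bar>)^m * q y" using z by (intro fm_bound[OF g y]) auto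
 then have "\<bar>deriv q z\<bar>/q y <= 3 * C*(2 + \<bar>y\<bar>)^m" using pos[of y] by (simp only: pos_divide_le_eq)
 then show ?thesis unfolding eq using pos[of y] by (simp add: abs_divide)
qed

lemma ev_bound:
 assumes g: "good N" and y: "\<bar>y\<bar> <= K N"
 shows "\<bar>(evn (\<delta> N) y - 1)/(\<delta> N)^2\<bar> <= 6 * C*(2 + \<bar>y\<bar>)^m"
proof -
 have d: "0 < \<delta> N" using g \<delta>_pos by (simp add: good_def)
 let ?B = "3 * C*(2 + \<bar>y\<bar>)^m * q y"
 have B0: "0 <= ?B" using C0 pos[of y] by (auto intro!: mult_nonneg_nonneg)
 have T: "\<bar>q (y + s) - q y - s * deriv q y\<bar> <= ?B*(\<delta> N)^2" if s: "\<bar>s\<bar> = \<delta> N" for s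
 proof -
  have D: "\<bar>deriv q x - deriv q y\<bar> <= ?B*\<delta> N" if x: "\<bar>x - y\<bar> <= \<delta> N" for x
  proof -
   have "\<bar>deriv q x - deriv q y\<bar> <= ?B*\<bar>x - y\<bar>"
   proof (rule field_differentiable_bound[where S="{min x y..max x y}" and f'="deriv (deriv q)", unfolded real_norm_def])
    fix z assume "z \<in> {min x y..max x y}"
    then have "\<bar>z - y\<bar> <= \<delta> N" using x by (auto simp: min_def max_def split: if_splits)
    then show "\<bar>deriv (deriv q) z\<bar> <= ?B" by (rule fm_bound[OF g y])
   qed (auto intro: has_field_derivative_at_within[OF der1])
   also have "... <= ?B*\<delta> N" using x B0 by (rule mult_left_mono)
   finally show ?thesis .
  qed
  have "\<bar>(q (y + s) - (y + s) * deriv q y) - (q y - y * deriv q y)\<bar> <= (?B*\<delta> N)*\<bar>(y + s) - y\<bar>"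
  proof (rule field_differentiable_bound[where S="{min (y + s) y..max (y + s) y}" and f'="%x. deriv q x - deriv q y", unfolded real_norm_def])
   fix z assume "z \<in> {min (y + s) y..max (y + s) y}"
   then have "\<bar>z - y\<bar> <= \<delta> N" using s by (auto simp: min_def max_def split: if_splits)
   then show "\<bar>deriv q z - deriv q y\<bar> <= ?B*\<delta> N" by (rule D)
   show "((%x. q x - x * deriv q y) has_field_derivative deriv q z - deriv q y) (at z within {min (y + s) y..max (y + s) y})"
    by (rule has_field_derivative_at_within) (auto intro!: derivative_eq_intros der0)
  qed auto
  moreover have "(q (y + s) - (y + s) * deriv q y) - (q y - y * deriv q y) = q (y + s) - q y - s * deriv q y"
   by (simp add: algebra_simps)
  ultimately show ?thesis using s by (simp add: power2_eq_square mult.assoc)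
 qed
 have "evn (\<delta> N) y - 1 = ((q (y + - \<delta> N) - q y - (- \<delta> N) * deriv q y) + (q (y + \<delta> N) - q y - \<delta> N * deriv q y))/(2 * q y)"
  using pos[of y] by (simp add: evn_def r_def field_simps)
 also have "\<bar>...\<bar> <= (?B*(\<delta> N)^2 + ?B*(\<delta> N)^2)/(2 * q y)"
  using T[of "- \<delta> N"] T[of "\<delta> N"] d pos[of y] unfolding abs_divide
  by (intro divide_mono order_trans[OF abs_triangle_ineq] add_mono) auto
 also have "... = 3 * C*(2 + \<bar>y\<bar>)^m*(\<delta> N)^2" using pos[of y] by (simp add: field_simps)
 finally have "\<bar>evn (\<delta> N) y - 1\<bar>/(\<delta> N)^2 <= 3 * C*(2 + \<bar>y\<bar>)^m" using d by (simp add: divide_le_eq)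
 moreover have "0 <= 3 * C*(2 + \<bar>y\<bar>)^m" using C0 by simp
 ultimately show ?thesis by (simp add: abs_divide)
qed

lemma od_lim: "(%N. od (\<delta> N) y/\<delta> N) ----> - f1 y"
proof -
 have at0: "filterlim \<delta> (at 0) sequentially" "filterlim (%N. - \<delta> N) (at 0) sequentially"
  using \<delta>_lim tendsto_minus[OF \<delta>_lim] \<delta>_ev by (auto simp: filterlim_at elim!: eventually_mono)
 have D: "((%h. (q (y + h) - q y)/h) \<longlongrightarrow> deriv q y) (at 0)" using der0[of y] by (simp add: DERIV_def)
 have 1: "(%N. (q (y + \<delta> N) - q y)/\<delta> N) ----> deriv q y" by (rule filterlim_compose[OF D at0(1)])
 have 2: "(%N. (q (y + - \<delta> N) - q y) / - \<delta> N) ----> deriv q y" by (rule filterlim_compose[OF D at0(2)])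
 have "(%N. - (((q (y + \<delta> N) - q y)/\<delta> N + (q (y + - \<delta> N) - q y) / - \<delta> N)/(2 * q y))) ----> - ((deriv q y + deriv q y)/(2 * q y))"
  using pos[of y] by (intro tendsto_intros 1 2) auto
 moreover have "- (((q (y + \<delta> N) - q y)/\<delta> N + (q (y + - \<delta> N) - q y) / - \<delta> N)/(2 * q y)) = od (\<delta> N) y/\<delta> N" for N
  using pos[of y] by (cases "\<delta> N = 0") (auto simp: od_def r_def field_simps)
 ultimately show ?thesis by (simp add: f1_def)
qed

lemma ev_lim: "(%N. (evn (\<delta> N) y - 1)/(\<delta> N)^2) ----> f2 y/2"
proof -
 have at0: "filterlim \<delta> (at_right 0) sequentially"
  using \<delta>_lim \<delta>_ev by (auto simp: filterlim_at elim!: eventually_mono)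
 define F where "F h = q (y + h) + q (y - h) - 2 * q y" for h
 have dF: "(F has_real_derivative deriv q (y + h) - deriv q (y - h)) (at h)" for h
 proof -
  have "((%h. q (y + h)) has_real_derivative deriv q (y + h)*1) (at h)"
   by (rule DERIV_chain2[OF der0]) (auto intro!: derivative_eq_intros)
  moreover have "((%h. q (y - h)) has_real_derivative deriv q (y - h)*(- 1)) (at h)"
   by (rule DERIV_chain2[OF der0]) (auto intro!: derivative_eq_intros)
  ultimately show ?thesis unfolding F_def[abs_def] by (auto intro!: derivative_eq_intros)
 qed
 have "((%h. F h/h^2) \<longlongrightarrow> deriv (deriv q) y) (at_right 0)"
 proof (rule lhopital_right_0[where f'="%h. deriv q (y + h) - deriv q (y - h)" and g'="%h. 2 * h"])
  have "isCont F 0" by (rule DERIV_isCont[OF dF])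
  then show "(F \<longlongrightarrow> 0) (at_right 0)" by (auto simp: isCont_def F_def intro: tendsto_mono[OF at_le])
  show "((%h. h^2) \<longlongrightarrow> (0::real)) (at_right 0)" by (auto intro!: tendsto_eq_intros)
  show "\<forall>\<^sub>F h in at_right 0. h^2 \<noteq> (0::real)" "\<forall>\<^sub>F h in at_right 0. 2 * h \<noteq> (0::real)"
   by (auto simp: eventually_at_filter)
  show "\<forall>\<^sub>F h in at_right 0. (F has_real_derivative deriv q (y + h) - deriv q (y - h)) (at h)" using dF by simp
  show "\<forall>\<^sub>F h in at_right 0. ((%h. h^2) has_real_derivative 2 * h) (at (h::real))" by (auto intro!: derivative_eq_intros always_eventually)
  have D: "((%h. (deriv q (y + h) - deriv q y)/h) \<longlongrightarrow> deriv (deriv q) y) (at 0)" using der1[of y] by (simp add: DERIV_def)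
  have a1: "((%h. (deriv q (y + h) - deriv q y)/h) \<longlongrightarrow> deriv (deriv q) y) (at_right 0)"
   by (rule tendsto_mono[OF at_le D]) auto
  have m: "filterlim (%h. - h) (at 0) (at_right (0::real))"
   by (auto simp: filterlim_at eventually_at_filter intro!: tendsto_eq_intros)
  have a2: "((%h. (deriv q (y + - h) - deriv q y) / - h) \<longlongrightarrow> deriv (deriv q) y) (at_right 0)"
   by (rule filterlim_compose[OF D m])
  have l: "((%h. ((deriv q (y + h) - deriv q y)/h + (deriv q (y + - h) - deriv q y) / - h)/2) \<longlongrightarrow> (deriv (deriv q) y + deriv (deriv q) y)/2) (at_right 0)"
   by (intro tendsto_intros a1 a2) auto
  have "\<forall>\<^sub>F h in at_right 0. ((deriv q (y + h) - deriv q y)/h + (deriv q (y + - h) - deriv q y) / - h)/2 = (deriv q (y + h) - deriv q (y - h))/(2 * h)"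
   by (auto simp: eventually_at_filter field_simps)
  from Lim_transform_eventually[OF l this]
  show "((%h. (deriv q (y + h) - deriv q (y - h))/(2 * h)) \<longlongrightarrow> deriv (deriv q) y) (at_right 0)" by simp
 qed
 from filterlim_compose[OF this at0] have 1: "(%N. F (\<delta> N)/(\<delta> N)^2) ----> deriv (deriv q) y" .
 have "(%N. F (\<delta> N)/(\<delta> N)^2/(2 * q y)) ----> deriv (deriv q) y/(2 * q y)"
  using pos[of y] by (intro tendsto_intros 1) auto
 moreover have "F (\<delta> N)/(\<delta> N)^2/(2 * q y) = (evn (\<delta> N) y - 1)/(\<delta> N)^2" for N
  using pos[of y] by (cases "\<delta> N = 0") (auto simp: F_def evn_def r_def field_simps)
 ultimately show ?thesis by (simp add: f2_def mult.commute)
qed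

text \<open>Dominated convergence: on the window the functions are dominated by a polynomial, and the window exhausts the line.\<close>
lemma truncated_limit:
 fixes h :: "nat => real => real"
 assumes [measurable]: "!!N. h N \<in> borel_measurable borel" "h' \<in> borel_measurable borel"
  and lim: "!!y. (%N. h N y) ----> h' y"
  and bd: "!!N y. good N ==> \<bar>y\<bar> <= K N ==> \<bar>h N y\<bar> <= c*(2 + \<bar>y\<bar>)^k" and c: "0 <= c"
 shows "(%N. LINT y|\<nu>. indicator {- K N..K N} y * h N y) ----> (LINT y|\<nu>. h' y)"
proof -
 obtain N0 where N0: "!!N. N \<ge> N0 ==> good N" using good by (auto simp: eventually_sequentially)
 have "(%N. LINT y|\<nu>. indicator {- K (N + N0)..K (N + N0)} y * h (N + N0) y) ----> (LINT y|\<nu>. h' y)"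
 proof (rule integral_dominated_convergence[where w="%y. c*(2 + \<bar>y\<bar>)^k"])
  show "integrable \<nu> (%y. c*(2 + \<bar>y\<bar>)^k)" using int_poly by simp
  show "AE y in \<nu>. (%N. indicator {- K (N + N0)..K (N + N0)} y * h (N + N0) y) ----> h' y"
  proof (intro AE_I2)
   fix y
   have "\<forall>\<^sub>F N in sequentially. \<bar>y\<bar> <= K N" using K_lim by (auto simp: filterlim_at_top)
   then have "\<forall>\<^sub>F N in sequentially. \<bar>y\<bar> <= K (N + N0)" by (subst eventually_sequentially_seg)
   then have "\<forall>\<^sub>F N in sequentially. h (N + N0) y = indicator {- K (N + N0)..K (N + N0)} y * h (N + N0) y"
    by eventually_elim (auto simp: indicator_def abs_le_iff)
   moreover have "(%N. h (N + N0) y) ----> h' y" using lim[of y] by (rule LIMSEQ_ignore_initial_segment)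
   ultimately show "(%N. indicator {- K (N + N0)..K (N + N0)} y * h (N + N0) y) ----> h' y"
    by (rule Lim_transform_eventually[rotated])
  qed
  show "AE y in \<nu>. norm (indicator {- K (N + N0)..K (N + N0)} y * h (N + N0) y) <= c*(2 + \<bar>y\<bar>)^k" for N
   using bd[OF N0, of "N + N0"] c by (intro AE_I2) (auto simp: indicator_def abs_mult abs_le_iff)
 qed measurable
 then show ?thesis by (rule LIMSEQ_offset)
qed

lemma shift_limit:
 fixes h :: "real => real"
 assumes c: "continuous_on UNIV h" and bd: "!!x. \<bar>h x\<bar> <= c*(1 + \<bar>x\<bar>)^k" "0 <= c"
 shows "(%N. LINT x|\<nu>. h (x + \<delta> N)) ----> (LINT x|\<nu>. h x)"
  and "!!N. integrable \<nu> (%x. h (x + \<delta> N))"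
  and "!!N. \<bar>LINT x|\<nu>. h (x + \<delta> N)\<bar> <= (LINT x|\<nu>. c*(1 + sqrt \<omega> + \<bar>x\<bar>)^k)"
proof -
 have [measurable]: "h \<in> borel_measurable borel" using c by (rule borel_measurable_continuous_onI)
 have b: "\<bar>h (x + \<delta> N)\<bar> <= c*(1 + sqrt \<omega> + \<bar>x\<bar>)^k" for x N
 proof -
  have "\<bar>x + \<delta> N\<bar> <= sqrt \<omega> + \<bar>x\<bar>" using \<delta>_le[of N] \<delta>_nonneg[of N] by linarith
  then have "c*(1 + \<bar>x + \<delta> N\<bar>)^k <= c*(1 + sqrt \<omega> + \<bar>x\<bar>)^k" using bd(2) by (intro mult_left_mono power_mono) auto
  then show ?thesis using bd(1)[of "x + \<delta> N"] by linarith
 qed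
 show i: "integrable \<nu> (%x. h (x + \<delta> N))" for N by (rule int_poly_bounded[OF _ b]) measurable
 show "(%N. LINT x|\<nu>. h (x + \<delta> N)) ----> (LINT x|\<nu>. h x)"
 proof (rule integral_dominated_convergence[where w="%y. c*(1 + sqrt \<omega> + \<bar>y\<bar>)^k"])
  have "isCont h x" for x using c by (simp add: continuous_on_eq_continuous_at)
  then have "(%N. h (x + \<delta> N)) ----> h (x + 0)" for x by (intro isCont_tendsto_compose[of _ h] tendsto_intros \<delta>_lim) auto
  then show "AE x in \<nu>. (%N. h (x + \<delta> N)) ----> h x" by simp
 qed (use int_poly b in auto)
 have "\<bar>LINT x|\<nu>. h (x + \<delta> N)\<bar> <= (LINT x|\<nu>. \<bar>h (x + \<delta> N)\<bar>)" for N by (rule integral_abs_bound)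
 also have "(LINT x|\<nu>. \<bar>h (x + \<delta> N)\<bar>) <= (LINT x|\<nu>. c*(1 + sqrt \<omega> + \<bar>x\<bar>)^k)" for N
  using i b int_poly by (intro integral_mono) auto
 finally show "\<bar>LINT x|\<nu>. h (x + \<delta> N)\<bar> <= (LINT x|\<nu>. c*(1 + sqrt \<omega> + \<bar>x\<bar>)^k)" for N .
qed

text \<open>Where \<open>h\<close> is nonzero, \<open>2 + \<bar>x\<bar>\<close> exceeds \<open>K N\<close>, and \<open>N\<close> is a power of \<open>K N\<close>: any power of \<open>N\<close> is absorbed by moments.\<close>
lemma tail_limit:
 fixes h :: "nat => real => real"
 assumes [measurable]: "!!N. h N \<in> borel_measurable borel" and bd: "!!N x. \<bar>h N x\<bar> <= c*(2 + \<bar>x\<bar>)^k" and c: "0 <= c"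
  and supp: "!!N x. good N ==> \<bar>x\<bar> + 1 <= K N ==> h N x = 0"
 shows "(%N. (real N)^j*(LINT x|\<nu>. h N x)) ----> 0"
proof (rule Lim_null_comparison)
 define L where "L = k + 4*(m + 1)*(j + 1)"
 define c' where "c' = (LINT x|\<nu>. c*(2 + \<bar>x\<bar>)^L)"
 have "(%N. c'*(1/real N)) ----> c'*0" by (intro tendsto_intros lim_1_over_n)
 then show "(%N. c'*(1/real N)) ----> 0" by simp
 show "\<forall>\<^sub>F N in sequentially. norm (real N^j*(LINT x|\<nu>. h N x)) <= c'*(1/real N)"
  using good
 proof eventually_elim
  case (elim N)
  then have N: "0 < N" by (simp add: good_def)
  have ih: "integrable \<nu> (h N)" by (rule int_poly_bounded[OF _ bd]) measurable
  have pt: "real N^(j + 1)*\<bar>h N x\<bar> <= c*(2 + \<bar>x\<bar>)^L" for x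
  proof (cases "\<bar>x\<bar> + 1 <= K N")
   case True then show ?thesis using supp[OF elim True] c by simp
  next
   case False
   have "real N^(j + 1) = K N^(4*(m + 1)*(j + 1))" unfolding K_pow[symmetric] power_mult ..
   also have "... <= (2 + \<bar>x\<bar>)^(4*(m + 1)*(j + 1))" using False K_nonneg by (intro power_mono) auto
   finally have "real N^(j + 1)*\<bar>h N x\<bar> <= (2 + \<bar>x\<bar>)^(4*(m + 1)*(j + 1))*(c*(2 + \<bar>x\<bar>)^k)"
    by (intro mult_mono bd) auto
   then show ?thesis by (simp add: L_def power_add mult_ac)
  qed
  have "real N^(j + 1)*\<bar>LINT x|\<nu>. h N x\<bar> <= real N^(j + 1)*(LINT x|\<nu>. \<bar>h N x\<bar>)"
   by (intro mult_left_mono integral_abs_bound) auto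
  also have "... = (LINT x|\<nu>. real N^(j + 1)*\<bar>h N x\<bar>)" by simp
  also have "... <= c'" unfolding c'_def using ih pt int_poly by (intro integral_mono) auto
  finally have "real N*(real N^j*\<bar>LINT x|\<nu>. h N x\<bar>) <= c'" by (simp add: mult_ac)
  then show ?case using N by (simp add: abs_mult field_simps)
 qed
qed

abbreviation "IK N y == indicator {- K N..K N} y :: real"

lemma lim_od_sq: "(%N. real N*(LINT y|\<nu>. IK N y*(od (\<delta> N) y)^2)) ----> \<omega> * fisher_F q"
proof -
 have "(%N. LINT y|\<nu>. IK N y*(od (\<delta> N) y/\<delta> N)^2) ----> (LINT y|\<nu>. (- f1 y)^2)"
 proof (rule truncated_limit[where c="(3 * C)^2" and k="m*2"])
  fix N y assume "good N" "\<bar>y\<bar> <= K N"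
  from power_mono[OF od_bound[OF this] abs_ge_zero, of 2]
  show "\<bar>(od (\<delta> N) y/\<delta> N)^2\<bar> <= (3 * C)^2*(2 + \<bar>y\<bar>)^(m*2)"
   by (simp only: power2_abs abs_power2 power_mult_distrib power_mult)
 next
  show "(%N. (od (\<delta> N) y/\<delta> N)^2) ----> (- f1 y)^2" for y by (rule tendsto_power[OF od_lim])
 qed auto
 then have "(%N. \<omega>*(LINT y|\<nu>. IK N y*(od (\<delta> N) y/\<delta> N)^2)) ----> \<omega> * fisher_F q"
  unfolding fisher by (intro tendsto_intros) auto
 moreover have "\<forall>\<^sub>F N in sequentially. \<omega>*(LINT y|\<nu>. IK N y*(od (\<delta> N) y/\<delta> N)^2) = real N*(LINT y|\<nu>. IK N y*(od (\<delta> N) y)^2)"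
  using eventually_gt_at_top[of 0]
 proof eventually_elim
  case (elim N)
  have "IK N y*(od (\<delta> N) y/\<delta> N)^2 = (1/(\<delta> N)^2)*(IK N y*(od (\<delta> N) y)^2)" for y by (simp add: power_divide)
  then show ?case using \<delta>_sq[OF elim] \<delta>_pos[OF elim] by (simp add: field_simps)
 qed
 ultimately show ?thesis by (rule Lim_transform_eventually)
qed

lemma lim_ev_sq: "(%N. (real N)^2*(LINT y|\<nu>. IK N y*(evn (\<delta> N) y - 1)^2)) ----> \<omega>^2/4 * fisher_G q"
proof -
 have "(%N. LINT y|\<nu>. IK N y*((evn (\<delta> N) y - 1)/(\<delta> N)^2)^2) ----> (LINT y|\<nu>. (f2 y/2)^2)"
 proof (rule truncated_limit[where c="(6 * C)^2" and k="m*2"])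
  fix N y assume "good N" "\<bar>y\<bar> <= K N"
  from power_mono[OF ev_bound[OF this] abs_ge_zero, of 2]
  show "\<bar>((evn (\<delta> N) y - 1)/(\<delta> N)^2)^2\<bar> <= (6 * C)^2*(2 + \<bar>y\<bar>)^(m*2)"
   by (simp only: power2_abs abs_power2 power_mult_distrib power_mult)
 qed (auto intro!: tendsto_intros ev_lim)
 then have L: "(%N. \<omega>^2*(LINT y|\<nu>. IK N y*((evn (\<delta> N) y - 1)/(\<delta> N)^2)^2)) ----> \<omega>^2*(LINT y|\<nu>. (f2 y/2)^2)"
  by (intro tendsto_intros) auto
 moreover have e: "\<omega>^2*(LINT y|\<nu>. (f2 y/2)^2) = \<omega>^2/4 * fisher_G q" by (simp add: fisher power_divide)
 moreover have ev: "\<forall>\<^sub>F N in sequentially. \<omega>^2*(LINT y|\<nu>. IK N y*((evn (\<delta> N) y - 1)/(\<delta> N)^2)^2) = (real N)^2*(LINT y|\<nu>. IK N y*(evn (\<delta> N) y - 1)^2)"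
  using eventually_gt_at_top[of 0]
 proof eventually_elim
  case (elim N)
  have eq1: "IK N y*((evn (\<delta> N) y - 1)/(\<delta> N)^2)^2 = (1/((\<delta> N)^2)^2)*(IK N y*(evn (\<delta> N) y - 1)^2)" for y by (simp add: power_divide)
  have eq2: "\<omega>^2/((\<delta> N)^2)^2 = (real N)^2" 
  proof -
   have "(real N*(\<delta> N)^2)^2 = \<omega>^2" by (simp only: \<delta>_sq[OF elim])
   then have "\<omega>^2 = (real N)^2*((\<delta> N)^2)^2" by (simp only: power_mult_distrib)
   then show ?thesis using \<delta>_pos[OF elim] by simp
  qed
  show ?case unfolding eq1 integral_mult_right_zero eq2[symmetric] by simp
 qed
 show ?thesis using Lim_transform_eventually[OF L ev] unfolding e .
qed

lemma lim_ev2: "(%N. LINT y|\<nu>. IK N y*(evn (\<delta> N) y)^2) ----> 1"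
proof -
 have "(%N. LINT y|\<nu>. IK N y*(evn (\<delta> N) y)^2) ----> (LINT y|\<nu>. 1)"
 proof (rule truncated_limit[where c="(1 + 6 * C)^2" and k="m*2"])
  fix N y assume g: "good N" and y: "\<bar>y\<bar> <= K N"
  have d: "0 < \<delta> N" "\<delta> N <= 1" using g \<delta>_pos by (auto simp: good_def)
  have "\<bar>evn (\<delta> N) y - 1\<bar> = \<bar>(evn (\<delta> N) y - 1)/(\<delta> N)^2\<bar>*(\<delta> N)^2" using d by (simp add: abs_divide)
  also have "... <= 6 * C*(2 + \<bar>y\<bar>)^m*1" using d C0 by (intro mult_mono ev_bound[OF g y]) (auto simp: power_le_one)
  finally have "\<bar>evn (\<delta> N) y\<bar> <= 1 + 6 * C*(2 + \<bar>y\<bar>)^m" by simp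
  also have "... <= (1 + 6 * C)*(2 + \<bar>y\<bar>)^m"
  proof -
   have "1 <= (2 + \<bar>y\<bar>)^m" by (intro one_le_power) simp
   then show ?thesis by (simp add: algebra_simps)
  qed
  finally show "\<bar>(evn (\<delta> N) y)^2\<bar> <= (1 + 6 * C)^2*(2 + \<bar>y\<bar>)^(m*2)"
   using power_mono[of "\<bar>evn (\<delta> N) y\<bar>" _ 2] by (fastforce simp: power_mult_distrib power_mult)
 next
  fix y
  have "(%N. (((evn (\<delta> N) y - 1)/(\<delta> N)^2)*(\<delta> N)^2 + 1)^2) ----> (f2 y/2*0^2 + 1)^2"
   by (intro tendsto_intros ev_lim \<delta>_lim)
  moreover have "\<forall>\<^sub>F N in sequentially. (((evn (\<delta> N) y - 1)/(\<delta> N)^2)*(\<delta> N)^2 + 1)^2 = (evn (\<delta> N) y)^2"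
   using \<delta>_ev by eventually_elim simp
  ultimately have "(%N. (evn (\<delta> N) y)^2) ----> (f2 y/2*0^2 + 1)^2" by (rule Lim_transform_eventually)
  then show "(%N. (evn (\<delta> N) y)^2) ----> 1" by simp
 qed auto
 then show ?thesis using nu.prob_space by simp
qed

lemma lim_outside: "(%N. real N^j*(LINT y|\<nu>. 1 - IK N y)) ----> 0"
 by (rule tail_limit[where c=1 and k=0]) (auto simp: indicator_def abs_le_iff)

lemma lim_outside_shift: "(%N. real N^j*(LINT x|\<nu>. 1 - IK N (x + \<delta> N))) ----> 0"
 by (rule tail_limit[where c=1 and k=0]) (use \<delta>_nonneg in \<open>auto simp: indicator_def good_def abs_if split: if_splits\<close>, (smt (verit))+)

text \<open>A shift of the argument becomes a change of density, and the part outside the window is negligible.\<close>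
lemma window_identity:
 fixes u :: "real => real"
 assumes [measurable]: "u \<in> borel_measurable borel" and bd: "!!x. \<bar>u x\<bar> <= c*(1 + \<bar>x\<bar>)^k" and c: "0 <= c"
 shows "\<exists>T. (\<forall>j. (%N. real N^j * T N) ----> 0) \<and>
   (\<forall>N. good N \<longrightarrow> (LINT x|\<nu>. u (x + \<delta> N)) = (LINT y|\<nu>. IK N y*(u y * r (\<delta> N) y)) + T N)"
proof (intro exI conjI allI impI)
 define h where "h N x = (if good N then (1 - IK N (x + \<delta> N)) * u (x + \<delta> N) else 0)" for N x
 have [measurable]: "h N \<in> borel_measurable borel" for N unfolding h_def by measurable
 show "(%N. real N^j*(LINT x|\<nu>. h N x)) ----> 0" for j
 proof (rule tail_limit[where c=c and k=k])
  show "\<bar>h N x\<bar> <= c*(2 + \<bar>x\<bar>)^k" for N x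
  proof (cases "good N")
   case True
   then have d: "\<delta> N <= 1" by (simp add: good_def)
   have "\<bar>h N x\<bar> <= \<bar>u (x + \<delta> N)\<bar>" by (auto simp: h_def indicator_def)
   also have "... <= c*(1 + \<bar>x + \<delta> N\<bar>)^k" by (rule bd)
   also have "... <= c*(2 + \<bar>x\<bar>)^k" using d \<delta>_nonneg[of N] c by (intro mult_left_mono power_mono) auto
   finally show ?thesis .
  qed (use c in \<open>simp add: h_def\<close>)
  show "h N x = 0" if "good N" "\<bar>x\<bar> + 1 <= K N" for N x
  proof -
   have "\<delta> N <= 1" "0 <= \<delta> N" using that \<delta>_nonneg by (auto simp: good_def)
   then have "x + \<delta> N \<in> {- K N..K N}" using that(2) by auto
   then show ?thesis by (simp add: h_def)
  qed
 qed (use c in measurable)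
 fix N assume g: "good N"
 then have d: "\<delta> N <= 1" by (simp add: good_def)
 have ub: "\<bar>u (x + \<delta> N)\<bar> <= c*(2 + \<bar>x\<bar>)^k" for x
 proof -
  have "\<bar>u (x + \<delta> N)\<bar> <= c*(1 + \<bar>x + \<delta> N\<bar>)^k" by (rule bd)
  also have "... <= c*(2 + \<bar>x\<bar>)^k" using d \<delta>_nonneg[of N] c by (intro mult_left_mono power_mono) auto
  finally show ?thesis .
 qed
 have i1: "integrable \<nu> (%x. IK N (x + \<delta> N) * u (x + \<delta> N))"
  by (rule int_poly_bounded[where c=c and a=2 and k=k]) (use ub c in \<open>auto simp: indicator_def\<close>)
 have i2: "integrable \<nu> (%x. (1 - IK N (x + \<delta> N)) * u (x + \<delta> N))"
  by (rule int_poly_bounded[where c=c and a=2 and k=k]) (use ub c in \<open>auto simp: indicator_def\<close>)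
 have "(LINT x|\<nu>. u (x + \<delta> N)) = (LINT x|\<nu>. IK N (x + \<delta> N) * u (x + \<delta> N) + (1 - IK N (x + \<delta> N)) * u (x + \<delta> N))"
  by (simp add: algebra_simps)
 also have "... = (LINT x|\<nu>. IK N (x + \<delta> N) * u (x + \<delta> N)) + (LINT x|\<nu>. h N x)"
  unfolding h_def using g i1 i2 by simp
 also have "(LINT x|\<nu>. IK N (x + \<delta> N) * u (x + \<delta> N)) = (LINT y|\<nu>. IK N y*(u y * r (\<delta> N) y))"
  using integral_shift(1)[of "%y. IK N y * u y" "\<delta> N"] by (simp add: mult_ac)
 finally show "(LINT x|\<nu>. u (x + \<delta> N)) = (LINT y|\<nu>. IK N y*(u y * r (\<delta> N) y)) + (LINT x|\<nu>. h N x)" .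
qed

lemma IK_sym: "IK N (- y) = IK N y" by (auto simp: indicator_def)

lemma r_eo: "r d y = evn d y + od d y" by (simp add: od_def evn_def add_divide_distrib[symmetric])

lemma window_integrable:
 assumes g: "good N" and [measurable]: "u \<in> borel_measurable borel" and bd: "!!x. \<bar>u x\<bar> <= c*(1 + \<bar>x\<bar>)^k" and c: "0 <= c"
 shows "integrable \<nu> (%y. IK N y*(u y * od (\<delta> N) y))" "integrable \<nu> (%y. IK N y*(u y * evn (\<delta> N) y))"
proof -
 have d: "0 < \<delta> N" "\<delta> N <= 1" using g \<delta>_pos by (auto simp: good_def)
 have P: "0 <= (2 + \<bar>y\<bar>)^l" for l and y :: real by simp
 have ub: "\<bar>u y\<bar> <= c*(2 + \<bar>y\<bar>)^k" for y
 proof -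
  have "c*(1 + \<bar>y\<bar>)^k <= c*(2 + \<bar>y\<bar>)^k" using c by (intro mult_left_mono power_mono) auto
  then show ?thesis using bd[of y] by linarith
 qed
 have o: "\<bar>od (\<delta> N) y\<bar> <= 3 * C*(2 + \<bar>y\<bar>)^m" if "\<bar>y\<bar> <= K N" for y
 proof -
  have "\<bar>od (\<delta> N) y\<bar> = \<bar>od (\<delta> N) y/\<delta> N\<bar>*\<delta> N" using d by (simp add: abs_divide)
  also have "... <= 3 * C*(2 + \<bar>y\<bar>)^m*1" using d C0 by (intro mult_mono od_bound[OF g that]) auto
  finally show ?thesis by simp
 qed
 have e: "\<bar>evn (\<delta> N) y\<bar> <= (1 + 6 * C)*(2 + \<bar>y\<bar>)^m" if "\<bar>y\<bar> <= K N" for y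
 proof -
  have "\<bar>evn (\<delta> N) y - 1\<bar> = \<bar>(evn (\<delta> N) y - 1)/(\<delta> N)^2\<bar>*(\<delta> N)^2" using d by (simp add: abs_divide)
  also have "... <= 6 * C*(2 + \<bar>y\<bar>)^m*1" using d C0 by (intro mult_mono ev_bound[OF g that]) (auto simp: power_le_one)
  finally have "\<bar>evn (\<delta> N) y\<bar> <= 1 + 6 * C*(2 + \<bar>y\<bar>)^m" by simp
  moreover have "1 <= (2 + \<bar>y\<bar>)^m" by (intro one_le_power) simp
  ultimately have "\<bar>evn (\<delta> N) y\<bar> <= 1*(2 + \<bar>y\<bar>)^m + 6 * C*(2 + \<bar>y\<bar>)^m" by linarith
  then show ?thesis by (simp only: distrib_right)
 qed
 have *: "integrable \<nu> (%y. IK N y*(u y * h y))"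
  if [measurable]: "h \<in> borel_measurable borel" and b: "!!y. \<bar>y\<bar> <= K N ==> \<bar>h y\<bar> <= c'*(2 + \<bar>y\<bar>)^m" and c': "0 <= c'" for h c'
 proof (rule int_poly_bounded[where c="c * c'" and a=2 and k="k + m"])
  show "\<bar>IK N y*(u y * h y)\<bar> <= c * c'*(2 + \<bar>y\<bar>)^(k + m)" for y
  proof (cases "\<bar>y\<bar> <= K N")
   case True
   then have "\<bar>u y\<bar>*\<bar>h y\<bar> <= (c*(2 + \<bar>y\<bar>)^k)*(c'*(2 + \<bar>y\<bar>)^m)" using c by (intro mult_mono ub b) auto
   then show ?thesis using True by (simp add: abs_mult power_add mult_ac indicator_def abs_le_iff)
  next
   case False
   then have "IK N y = 0" by (auto simp: indicator_def)
   then show ?thesis using c c' by simp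
  qed
 qed measurable
 show "integrable \<nu> (%y. IK N y*(u y * od (\<delta> N) y))" by (rule *[OF _ o]) (use C0 in auto)
 show "integrable \<nu> (%y. IK N y*(u y * evn (\<delta> N) y))" by (rule *[OF _ e]) (use C0 in auto)
qed

text \<open>The ratio \<open>r\<close> is expanded on the window. Its even part does not contribute since \<open>f1\<close> is odd, and the odd part is
  approximately \<open>- \<delta> N * f1\<close>. So the mean of the score under the shifted law becomes its second moment under the
  original one.\<close>
lemma score_shift_mean: "(%N. real N*(LINT x|\<nu>. - \<delta> N * f1 (x + \<delta> N))) ----> \<omega> * fisher_F q"
proof -
 obtain T where T: "!!j. (%N. real N^j * T N) ----> 0"
   "!!N. good N ==> (LINT x|\<nu>. f1 (x + \<delta> N)) = (LINT y|\<nu>. IK N y*(f1 y * r (\<delta> N) y)) + T N"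
  using window_identity[OF meas_f(1) f1_bd C0] by auto
 have main: "(%N. LINT y|\<nu>. IK N y*(f1 y*(od (\<delta> N) y/\<delta> N))) ----> (LINT y|\<nu>. f1 y*(- f1 y))"
 proof (rule truncated_limit[where c="C*(3 * C)" and k="m + m"])
  fix N y assume g: "good N" "\<bar>y\<bar> <= K N"
  have "C*(1 + \<bar>y\<bar>)^m <= C*(2 + \<bar>y\<bar>)^m" using C0 by (intro mult_left_mono power_mono) auto
  then have "\<bar>f1 y\<bar> <= C*(2 + \<bar>y\<bar>)^m" using f1_bd[of y] by linarith
  then have "\<bar>f1 y\<bar>*\<bar>od (\<delta> N) y/\<delta> N\<bar> <= (C*(2 + \<bar>y\<bar>)^m)*(3 * C*(2 + \<bar>y\<bar>)^m)"
   using C0 by (intro mult_mono od_bound[OF g]) auto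
  then show "\<bar>f1 y*(od (\<delta> N) y/\<delta> N)\<bar> <= C*(3 * C)*(2 + \<bar>y\<bar>)^(m + m)" by (simp only: abs_mult power_add mult_ac)
 next
  show "(%N. f1 y*(od (\<delta> N) y/\<delta> N)) ----> f1 y*(- f1 y)" for y by (rule tendsto_mult[OF tendsto_const od_lim])
 qed (use C0 in auto)
 have L: "(%N. \<omega>*(- (LINT y|\<nu>. IK N y*(f1 y*(od (\<delta> N) y/\<delta> N)))) - \<delta> N*(real N^1 * T N)) ----> \<omega>*(- (LINT y|\<nu>. f1 y*(- f1 y))) - 0*0"
  by (intro tendsto_intros main T(1) \<delta>_lim)
 moreover have e: "\<omega>*(- (LINT y|\<nu>. f1 y*(- f1 y))) - 0*0 = \<omega> * fisher_F q" by (simp add: fisher power2_eq_square)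
 moreover have ev: "\<forall>\<^sub>F N in sequentially. \<omega>*(- (LINT y|\<nu>. IK N y*(f1 y*(od (\<delta> N) y/\<delta> N)))) - \<delta> N*(real N^1 * T N) = real N*(LINT x|\<nu>. - \<delta> N * f1 (x + \<delta> N))"
  using good
 proof eventually_elim
  case (elim N)
  then have N: "0 < N" by (simp add: good_def)
  note i = window_integrable[OF elim meas_f(1) f1_bd C0]
  have "(LINT y|\<nu>. IK N y*(f1 y * r (\<delta> N) y)) = (LINT y|\<nu>. IK N y*(f1 y * evn (\<delta> N) y) + IK N y*(f1 y * od (\<delta> N) y))"
   by (simp add: r_eo algebra_simps)
  also have "... = (LINT y|\<nu>. IK N y*(f1 y * evn (\<delta> N) y)) + (LINT y|\<nu>. IK N y*(f1 y * od (\<delta> N) y))" using i by simp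
  also have "(LINT y|\<nu>. IK N y*(f1 y * evn (\<delta> N) y)) = 0" by (rule integral_odd_zero) (auto simp: IK_sym f_sym eo_sym)
  also have "(LINT y|\<nu>. IK N y*(f1 y * od (\<delta> N) y)) = \<delta> N*(LINT y|\<nu>. IK N y*(f1 y*(od (\<delta> N) y/\<delta> N)))"
   using \<delta>_pos[OF N] by (subst integral_mult_right_zero[symmetric]) (auto simp: field_simps intro!: Bochner_Integration.integral_cong)
  finally have E: "(LINT x|\<nu>. f1 (x + \<delta> N)) = \<delta> N*(LINT y|\<nu>. IK N y*(f1 y*(od (\<delta> N) y/\<delta> N))) + T N"
   using T(2)[OF elim] by simp
  define M where "M = (LINT y|\<nu>. IK N y*(f1 y*(od (\<delta> N) y/\<delta> N)))"
  have "real N*(- \<delta> N*(\<delta> N * M + T N)) = (real N*(\<delta> N)^2)*(- M) - \<delta> N*(real N^1 * T N)"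
   by (simp add: power2_eq_square field_simps)
  then show ?case unfolding integral_mult_right_zero E M_def[symmetric] \<delta>_sq[OF N] by simp
 qed
 show ?thesis using Lim_transform_eventually[OF L ev] unfolding e .
qed

text \<open>As for the score, but now the even part of \<open>r\<close> contributes. It is approximately \<open>1 + (\<delta> N)^2 / 2 * f2\<close>, and the 1
  contributes nothing as \<open>f2\<close> has mean 0.\<close>
lemma curvature_shift_mean: "(%N. (real N)^2*(LINT x|\<nu>. (\<delta> N)^2/2 * f2 (x + \<delta> N))) ----> \<omega>^2/4 * fisher_G q"
proof -
 obtain T where T: "!!j. (%N. real N^j * T N) ----> 0"
   "!!N. good N ==> (LINT x|\<nu>. f2 (x + \<delta> N)) = (LINT y|\<nu>. IK N y*(f2 y * r (\<delta> N) y)) + T N"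
  using window_identity[OF meas_f(2) f2_bd C0] by auto
 define T' where "T' N = (LINT y|\<nu>. (1 - IK N y) * f2 y)" for N
 have b2: "\<bar>f2 y\<bar> <= C*(2 + \<bar>y\<bar>)^m" for y
 proof -
  have "C*(1 + \<bar>y\<bar>)^m <= C*(2 + \<bar>y\<bar>)^m" using C0 by (intro mult_left_mono power_mono) auto
  then show ?thesis using f2_bd[of y] by linarith
 qed
 have T': "(%N. real N^j * T' N) ----> 0" for j
  unfolding T'_def
 proof (rule tail_limit[where c=C and k=m])
  show "\<bar>(1 - IK N y) * f2 y\<bar> <= C*(2 + \<bar>y\<bar>)^m" for N y using b2[of y] C0 by (auto simp: indicator_def)
 qed (use C0 in \<open>auto simp: indicator_def\<close>)
 have main: "(%N. LINT y|\<nu>. IK N y*(f2 y*((evn (\<delta> N) y - 1)/(\<delta> N)^2))) ----> (LINT y|\<nu>. f2 y*(f2 y/2))"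
 proof (rule truncated_limit[where c="C*(6 * C)" and k="m + m"])
  fix N y assume g: "good N" "\<bar>y\<bar> <= K N"
  have "\<bar>f2 y\<bar>*\<bar>(evn (\<delta> N) y - 1)/(\<delta> N)^2\<bar> <= (C*(2 + \<bar>y\<bar>)^m)*(6 * C*(2 + \<bar>y\<bar>)^m)"
   using C0 b2 by (intro mult_mono ev_bound[OF g]) auto
  then show "\<bar>f2 y*((evn (\<delta> N) y - 1)/(\<delta> N)^2)\<bar> <= C*(6 * C)*(2 + \<bar>y\<bar>)^(m + m)" by (simp only: abs_mult power_add mult_ac)
 next
  show "(%N. f2 y*((evn (\<delta> N) y - 1)/(\<delta> N)^2)) ----> f2 y*(f2 y/2)" for y by (rule tendsto_mult[OF tendsto_const ev_lim])
 qed (use C0 in auto)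
 have L: "(%N. \<omega>^2/2*(LINT y|\<nu>. IK N y*(f2 y*((evn (\<delta> N) y - 1)/(\<delta> N)^2))) + \<omega>/2*(real N^1 * T N - real N^1 * T' N)) ----> \<omega>^2/2*(LINT y|\<nu>. f2 y*(f2 y/2)) + \<omega>/2*(0 - 0)"
  by (intro tendsto_intros main T(1) T')
 moreover have e: "\<omega>^2/2*(LINT y|\<nu>. f2 y*(f2 y/2)) + \<omega>/2*(0 - 0) = \<omega>^2/4 * fisher_G q"
  by (simp add: fisher power2_eq_square)
 moreover have ev: "\<forall>\<^sub>F N in sequentially. \<omega>^2/2*(LINT y|\<nu>. IK N y*(f2 y*((evn (\<delta> N) y - 1)/(\<delta> N)^2))) + \<omega>/2*(real N^1 * T N - real N^1 * T' N) = (real N)^2*(LINT x|\<nu>. (\<delta> N)^2/2 * f2 (x + \<delta> N))"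
  using good
 proof eventually_elim
  case (elim N)
  then have N: "0 < N" by (simp add: good_def)
  note i = window_integrable[OF elim meas_f(2) f2_bd C0]
  have i0: "integrable \<nu> (%y. IK N y * f2 y)" "integrable \<nu> (%y. (1 - IK N y) * f2 y)"
   by (rule int_poly_bounded[where c=C and a=2 and k=m]; use b2 C0 in \<open>auto simp: indicator_def\<close>)+
  have z: "(LINT y|\<nu>. IK N y * f2 y) + T' N = 0"
  proof -
   have "(LINT y|\<nu>. IK N y * f2 y) + T' N = (LINT y|\<nu>. IK N y * f2 y + (1 - IK N y) * f2 y)" unfolding T'_def using i0 by simp
   also have "... = 0" using mean_f2 by (simp add: algebra_simps)
   finally show ?thesis .
  qed
  define M where "M = (LINT y|\<nu>. IK N y*(f2 y*((evn (\<delta> N) y - 1)/(\<delta> N)^2)))"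
  have "(LINT y|\<nu>. IK N y*(f2 y * r (\<delta> N) y)) = (LINT y|\<nu>. IK N y*(f2 y * evn (\<delta> N) y) + IK N y*(f2 y * od (\<delta> N) y))"
   by (simp add: r_eo algebra_simps)
  also have "... = (LINT y|\<nu>. IK N y*(f2 y * evn (\<delta> N) y)) + (LINT y|\<nu>. IK N y*(f2 y * od (\<delta> N) y))" using i by simp
  also have "(LINT y|\<nu>. IK N y*(f2 y * od (\<delta> N) y)) = 0" by (rule integral_odd_zero) (auto simp: IK_sym f_sym eo_sym)
  also have "(LINT y|\<nu>. IK N y*(f2 y * evn (\<delta> N) y)) = (\<delta> N)^2 * M + (LINT y|\<nu>. IK N y * f2 y)"
  proof -
   have eqM: "(\<delta> N)^2*(IK N y*(f2 y*((evn (\<delta> N) y - 1)/(\<delta> N)^2))) = IK N y*(f2 y * evn (\<delta> N) y) - IK N y * f2 y" for y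
    using \<delta>_pos[OF N] by (simp add: field_simps)
   have "(\<delta> N)^2 * M = (LINT y|\<nu>. IK N y*(f2 y * evn (\<delta> N) y) - IK N y * f2 y)"
    unfolding M_def integral_mult_right_zero[symmetric] eqM ..
   then show ?thesis using i i0 by simp
  qed
  finally have E: "(LINT x|\<nu>. f2 (x + \<delta> N)) = (\<delta> N)^2 * M + T N - T' N"
   using T(2)[OF elim] z by simp
  have "(real N)^2*((\<delta> N)^2/2*((\<delta> N)^2 * M + T N - T' N)) = (real N*(\<delta> N)^2)^2/2 * M + (real N*(\<delta> N)^2)/2*(real N^1 * T N - real N^1 * T' N)"
   by (simp add: power2_eq_square field_simps)
  then show ?case unfolding integral_mult_right_zero E M_def[symmetric] \<delta>_sq[OF N] by simp
 qed
 show ?thesis using Lim_transform_eventually[OF L ev] unfolding e .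
qed

text \<open>The shift by \<open>d\<close> followed by a sign \<open>s\<close> is, since the density is even, the shift by \<open>s * d\<close>.\<close>
lemma planted_density:
 assumes s: "s = 1 \<or> s = -1"
 shows "density \<nu> (%x. ennreal (r (s * d) x)) = distr (distr \<nu> borel (%x. x + d)) borel (%x. s * x)"
proof (rule measure_eqI)
 fix A :: "real set" assume "A \<in> sets (density \<nu> (%x. ennreal (r (s * d) x)))"
 then have A[measurable]: "A \<in> sets borel" by simp
 have "emeasure (density \<nu> (%x. ennreal (r (s * d) x))) A = (\<integral>\<^sup>+x. ennreal (q x)*(ennreal (r (s * d) x) * indicator A x) \<partial>lborel)"
  unfolding \<nu>_def by (simp add: emeasure_density nn_integral_density)
 also have "... = (\<integral>\<^sup>+x. ennreal (q (x - s * d)) * indicator A x \<partial>lborel)"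
 proof (intro nn_integral_cong)
  fix x
  have "ennreal (q x) * ennreal (r (s * d) x) = ennreal (q (x - s * d))"
   using pos[of x] pos[of "x - s * d"] by (subst ennreal_mult[symmetric]) (auto simp: r_def less_imp_le)
  then show "ennreal (q x)*(ennreal (r (s * d) x) * indicator A x) = ennreal (q (x - s * d)) * indicator A x"
   by (simp add: mult.assoc[symmetric])
 qed
 also have "... = (\<integral>\<^sup>+x. ennreal (q x) * indicator A (s*(x + d)) \<partial>lborel)"
 proof -
  have "(\<integral>\<^sup>+x. ennreal (q x) * indicator A (s*(x + d)) \<partial>lborel) = ennreal \<bar>s\<bar>*(\<integral>\<^sup>+x. ennreal (q (- d + s * x)) * indicator A (s*(- d + s * x + d)) \<partial>lborel)"
   using s by (intro nn_integral_real_affine) auto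
  moreover have "q (- d + s * x) = q (x - s * d)" for x
   using s even[of "x + d"] by (auto simp: add.commute[of x d] diff_diff_eq minus_diff_commute)
  moreover have "s*(- d + s * x + d) = x" for x using s by auto
  ultimately show ?thesis using s by auto
 qed
 also have "... = emeasure (distr (distr \<nu> borel (%x. x + d)) borel (%x. s * x)) A"
 proof -
  have "emeasure (distr (distr \<nu> borel (%x. x + d)) borel (%x. s * x)) A = (\<integral>\<^sup>+x. indicator A x \<partial>distr (distr \<nu> borel (%x. x + d)) borel (%x. s * x))"
   by (subst nn_integral_indicator) auto
  also have "... = (\<integral>\<^sup>+x. indicator A (s*(x + d)) \<partial>\<nu>)"
   by (subst nn_integral_distr) (auto simp: nn_integral_distr)
  also have "... = (\<integral>\<^sup>+x. ennreal (q x) * indicator A (s*(x + d)) \<partial>lborel)"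
   unfolding \<nu>_def by (subst nn_integral_density) auto
  finally show ?thesis ..
 qed
 finally show "emeasure (density \<nu> (%x. ennreal (r (s * d) x))) A = emeasure (distr (distr \<nu> borel (%x. x + d)) borel (%x. s * x)) A" .
qed simp

text \<open>The second moments of the ratio on the window, over two replicas: the product of two ratios with signs \<open>s\<close> and \<open>t\<close> has
  mean \<open>al N + ta N * (s * t)\<close> because the mixed term is odd.\<close>
definition "al N = (LINT y|\<nu>. IK N y*(evn (\<delta> N) y)^2)"
definition "ta N = (LINT y|\<nu>. IK N y*(od (\<delta> N) y)^2)"

lemma eo_bound:
 assumes g: "good N" and y: "\<bar>y\<bar> <= K N"
 shows "\<bar>od (\<delta> N) y\<bar> <= (1 + 6 * C)*(2 + \<bar>y\<bar>)^m" "\<bar>evn (\<delta> N) y\<bar> <= (1 + 6 * C)*(2 + \<bar>y\<bar>)^m"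
proof -
 have d: "0 < \<delta> N" "\<delta> N <= 1" using g \<delta>_pos by (auto simp: good_def)
 have P: "1 <= (2 + \<bar>y\<bar>)^m" by (intro one_le_power) simp
 have CP: "0 <= C*(2 + \<bar>y\<bar>)^m" using C0 by simp
 have "\<bar>od (\<delta> N) y\<bar> = \<bar>od (\<delta> N) y/\<delta> N\<bar>*\<delta> N" using d by (simp add: abs_divide)
 also have "... <= 3 * C*(2 + \<bar>y\<bar>)^m*1" using d C0 by (intro mult_mono od_bound[OF g y]) auto
 finally show "\<bar>od (\<delta> N) y\<bar> <= (1 + 6 * C)*(2 + \<bar>y\<bar>)^m"
  using P CP unfolding distrib_right mult.assoc mult_1 by linarith
 have "\<bar>evn (\<delta> N) y - 1\<bar> = \<bar>(evn (\<delta> N) y - 1)/(\<delta> N)^2\<bar>*(\<delta> N)^2" using d by (simp add: abs_divide)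
 also have "... <= 6 * C*(2 + \<bar>y\<bar>)^m*1" using d C0 by (intro mult_mono ev_bound[OF g y]) (auto simp: power_le_one)
 finally have "\<bar>evn (\<delta> N) y\<bar> <= 1 + 6 * C*(2 + \<bar>y\<bar>)^m" by simp
 then show "\<bar>evn (\<delta> N) y\<bar> <= (1 + 6 * C)*(2 + \<bar>y\<bar>)^m"
  using P unfolding distrib_right mult.assoc mult_1 by linarith
qed

lemma IK_bounded:
 assumes g: "good N" and [measurable]: "h \<in> borel_measurable borel"
  and b: "!!y. \<bar>y\<bar> <= K N ==> \<bar>h y\<bar> <= c*(2 + \<bar>y\<bar>)^k"
 shows "integrable \<nu> (%y. IK N y * h y)" "!!y. \<bar>IK N y * h y\<bar> <= \<bar>c\<bar>*(2 + K N)^k"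
proof -
 have *: "\<bar>IK N y * h y\<bar> <= \<bar>c\<bar>*(2 + \<bar>y\<bar>)^k" for y
 proof (cases "\<bar>y\<bar> <= K N")
  case True
  have "c*(2 + \<bar>y\<bar>)^k <= \<bar>c\<bar>*(2 + \<bar>y\<bar>)^k" by (intro mult_right_mono) auto
  then have "\<bar>h y\<bar> <= \<bar>c\<bar>*(2 + \<bar>y\<bar>)^k" using b[OF True] by (rule order_trans[rotated])
  then show ?thesis using True by (simp add: indicator_def)
 next
  case False then have "IK N y = 0" by (auto simp: indicator_def)
  then show ?thesis by simp
 qed
 show "integrable \<nu> (%y. IK N y * h y)" by (rule int_poly_bounded[OF _ *]) measurable
 show "\<bar>IK N y * h y\<bar> <= \<bar>c\<bar>*(2 + K N)^k" for y
 proof (cases "\<bar>y\<bar> <= K N")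
  case True
  have "\<bar>c\<bar>*(2 + \<bar>y\<bar>)^k <= \<bar>c\<bar>*(2 + K N)^k" using True by (intro mult_left_mono power_mono) auto
  then show ?thesis using *[of y] by linarith
 next
  case False then have "IK N y = 0" by (auto simp: indicator_def)
  then show ?thesis using K_nonneg[of N] by simp
 qed
qed

lemma r_sign: "s = 1 \<or> s = -1 ==> r (s * d) y = evn d y + s * od d y"
 by (auto simp: od_def evn_def field_simps)

lemma prod_bound: "\<bar>a\<bar> <= c * P ==> \<bar>b\<bar> <= c * P ==> \<bar>a * b\<bar> <= (c * P)^2" for a b c P :: real
 unfolding abs_mult power2_eq_square by (intro mult_mono) (auto intro: order_trans[OF abs_ge_zero])

lemma eo_products:
 assumes g: "good N"
 shows "integrable \<nu> (%y. IK N y*(evn (\<delta> N) y)^2)" "integrable \<nu> (%y. IK N y*(od (\<delta> N) y)^2)"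
  "integrable \<nu> (%y. IK N y*(evn (\<delta> N) y * od (\<delta> N) y))"
proof -
 note eo = eo_bound[OF g]
 have sq: "((1 + 6 * C)*(2 + \<bar>y\<bar>)^m)^2 = (1 + 6 * C)^2*(2 + \<bar>y\<bar>)^(m*2)" for y :: real
  by (simp only: power_mult_distrib power_mult)
 show "integrable \<nu> (%y. IK N y*(evn (\<delta> N) y)^2)"
 proof (rule IK_bounded(1)[OF g])
  show "\<bar>(evn (\<delta> N) y)^2\<bar> <= (1 + 6 * C)^2*(2 + \<bar>y\<bar>)^(m*2)" if "\<bar>y\<bar> <= K N" for y
   unfolding sq[symmetric] power2_eq_square[of "evn _ _"] by (rule prod_bound[OF eo(2)[OF that] eo(2)[OF that]])
 qed measurable
 show "integrable \<nu> (%y. IK N y*(od (\<delta> N) y)^2)"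
 proof (rule IK_bounded(1)[OF g])
  show "\<bar>(od (\<delta> N) y)^2\<bar> <= (1 + 6 * C)^2*(2 + \<bar>y\<bar>)^(m*2)" if "\<bar>y\<bar> <= K N" for y
   unfolding sq[symmetric] power2_eq_square[of "od _ _"] by (rule prod_bound[OF eo(1)[OF that] eo(1)[OF that]])
 qed measurable
 show "integrable \<nu> (%y. IK N y*(evn (\<delta> N) y * od (\<delta> N) y))"
 proof (rule IK_bounded(1)[OF g])
  show "\<bar>evn (\<delta> N) y * od (\<delta> N) y\<bar> <= (1 + 6 * C)^2*(2 + \<bar>y\<bar>)^(m*2)" if "\<bar>y\<bar> <= K N" for y
   unfolding sq[symmetric] by (rule prod_bound[OF eo(2)[OF that] eo(1)[OF that]])
 qed measurable
qed

lemma two_replica: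
 assumes g: "good N" and s: "s = 1 \<or> s = -1" and t: "t = 1 \<or> t = -1"
 shows "(LINT y|\<nu>. IK N y*(r (s*\<delta> N) y * r (t*\<delta> N) y)) = al N + ta N*(s * t)"
proof -
 let ?e = "evn (\<delta> N)" and ?o = "od (\<delta> N)"
 note i = eo_products[OF g]
 have z: "(LINT y|\<nu>. IK N y*(?e y*?o y)) = 0" by (rule integral_odd_zero) (auto simp: IK_sym eo_sym)
 have "IK N y*(r (s*\<delta> N) y * r (t*\<delta> N) y) = IK N y*(?e y)^2 + ((s * t)*(IK N y*(?o y)^2) + (s + t)*(IK N y*(?e y*?o y)))" for y
  unfolding r_sign[OF s] r_sign[OF t] by (simp add: power2_eq_square algebra_simps)
 then have "(LINT y|\<nu>. IK N y*(r (s*\<delta> N) y * r (t*\<delta> N) y)) = al N + ((s * t) * ta N + (s + t)*0)"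
  unfolding al_def ta_def z[symmetric] using i by simp
 then show ?thesis by simp
qed

lemma r_window_bound:
 assumes g: "good N" and s: "s = 1 \<or> s = -1"
 shows "\<bar>IK N y * r (s*\<delta> N) y\<bar> <= 2*(1 + 6 * C)*(2 + K N)^m"
proof -
 have "\<bar>r (s*\<delta> N) y\<bar> <= 2*(1 + 6 * C)*(2 + \<bar>y\<bar>)^m" if "\<bar>y\<bar> <= K N" for y
 proof -
  have "\<bar>r (s*\<delta> N) y\<bar> <= \<bar>evn (\<delta> N) y\<bar> + \<bar>od (\<delta> N) y\<bar>" unfolding r_sign[OF s] using s by auto
  then show ?thesis using eo_bound[OF g that] by linarith
 qed
 from IK_bounded(2)[OF g meas_f(3)[of "s*\<delta> N"] this, of y] show ?thesis using C0 by (simp add: abs_mult)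
qed

lemma two_replica_integrable:
 assumes g: "good N" and s: "s = 1 \<or> s = -1" and t: "t = 1 \<or> t = -1"
 shows "integrable \<nu> (%y. IK N y*(r (s*\<delta> N) y * r (t*\<delta> N) y))"
proof (rule nu.integrable_const_bound[of _ "(2*(1 + 6 * C)*(2 + K N)^m)^2"])
 have "\<bar>IK N y*(r (s*\<delta> N) y * r (t*\<delta> N) y)\<bar> <= (2*(1 + 6 * C)*(2 + K N)^m)^2" for y
 proof -
  have e: "IK N y*(r (s*\<delta> N) y * r (t*\<delta> N) y) = (IK N y * r (s*\<delta> N) y)*(IK N y * r (t*\<delta> N) y)"
   by (simp add: indicator_def)
  show ?thesis unfolding e by (rule prod_bound[OF r_window_bound[OF g s] r_window_bound[OF g t]])
 qed
 then show "AE y in \<nu>. norm (IK N y*(r (s*\<delta> N) y * r (t*\<delta> N) y)) <= (2*(1 + 6 * C)*(2 + K N)^m)^2" by simp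
qed measurable

lemma ta_nonneg: "0 <= ta N" unfolding ta_def by (intro Bochner_Integration.integral_nonneg) simp

text \<open>An upper bound of \<open>al N - 1\<close>, with the limit \<open>\<omega>^2 / 4 * fisher_G q\<close> after multiplication by \<open>N^2\<close>. It is the
  curvature contribution to the second moment.\<close>
definition "be N = (LINT y|\<nu>. IK N y*(evn (\<delta> N) y - 1)^2) + (LINT y|\<nu>. 1 - IK N y)"

lemma be_nonneg: "0 <= be N"
 unfolding be_def by (intro add_nonneg_nonneg Bochner_Integration.integral_nonneg) (auto simp: indicator_def)

text \<open>The mean of the even part is at most 1, since \<open>r\<close> is a ratio of densities; so \<open>E e^2 = E (e - 1)^2 + 2 E e - 1\<close> is at most
  \<open>1 + E (e - 1)^2\<close>, up to the mass outside the window.\<close>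
lemma al_le: assumes g: "good N" shows "al N <= 1 + be N"
proof -
 note eo = eo_bound[OF g]
 let ?e = "evn (\<delta> N)"
 have i: "integrable \<nu> (%y. IK N y*(?e y)^2)"
  by (rule eo_products[OF g])
 have i1: "integrable \<nu> (%y. IK N y*?e y)"
  by (rule IK_bounded(1)[OF g _ eo(2)]) measurable
 have i0: "integrable \<nu> (%y. IK N y)" by (rule nu.integrable_const_bound[of _ 1]) auto
 have irp: "integrable \<nu> (%y. IK N y * r (s*\<delta> N) y)" if "s = 1 \<or> s = -1" for s
  by (rule nu.integrable_const_bound[OF _ ]) (use r_window_bound[OF g that] in \<open>auto intro!: AE_I2\<close>)
 have r1: "(LINT y|\<nu>. IK N y * r d y) <= 1" for d
 proof -
  have "(LINT y|\<nu>. IK N y * r d y) = (LINT x|\<nu>. IK N (x + d))" using integral_shift(1)[of "IK N" d] by (simp add: mult.commute)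
  also have "... <= (LINT x|\<nu>. 1)" by (intro integral_mono nu.integrable_const_bound[of _ 1]) (auto simp: indicator_def)
  finally show ?thesis by (simp add: nu.prob_space[simplified])
 qed
 have "(LINT y|\<nu>. IK N y*?e y) = ((LINT y|\<nu>. IK N y * r (\<delta> N) y) + (LINT y|\<nu>. IK N y * r (- \<delta> N) y))/2"
 proof -
  have e: "IK N y*?e y = (IK N y * r (\<delta> N) y + IK N y * r (- \<delta> N) y)/2" for y
   unfolding evn_def by (simp add: distrib_left)
  have "(LINT y|\<nu>. IK N y * r (\<delta> N) y + IK N y * r (- \<delta> N) y) = (LINT y|\<nu>. IK N y * r (\<delta> N) y) + (LINT y|\<nu>. IK N y * r (- \<delta> N) y)"
   by (rule Bochner_Integration.integral_add) (use irp[of 1] irp[of "-1"] in simp_all)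
  then show ?thesis unfolding e by simp
 qed
 also have "... <= (1 + 1)/2" by (intro divide_right_mono add_mono r1) simp
 finally have e1: "(LINT y|\<nu>. IK N y*?e y) <= 1" by simp
 have eq: "IK N y*(?e y - 1)^2 = IK N y*(?e y)^2 - 2*(IK N y*?e y) + IK N y" for y
  by (simp add: power2_eq_square algebra_simps)
 have "(LINT y|\<nu>. IK N y*(?e y - 1)^2) = al N - 2*(LINT y|\<nu>. IK N y*?e y) + (LINT y|\<nu>. IK N y)"
  unfolding eq al_def using i i0 i1 by simp
 moreover have "(LINT y|\<nu>. 1 - IK N y) = 1 - (LINT y|\<nu>. IK N y)" using i0 nu.prob_space by simp
 ultimately show ?thesis unfolding be_def using e1 by linarith
qed

lemma lim_ta: "(%N. real N * ta N) ----> \<omega> * fisher_F q" unfolding ta_def by (rule lim_od_sq)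
lemma lim_al: "al ----> 1" using lim_ev2 by (simp add: al_def[abs_def])
lemma lim_be: "(%N. (real N)^2 * be N) ----> \<omega>^2/4 * fisher_G q"
 using tendsto_add[OF lim_ev_sq lim_outside[of 2]] by (simp add: be_def distrib_left)

end

section \<open>The Curie-Weiss average\<close>

lemma cosh_le_exp: "exp z + exp (- z) <= 2 * exp (z^2/2)" for z :: real
proof -
 have *: "exp z + exp (- z) <= 2 * exp (z^2/2)" if "0 <= z" for z :: real
 proof -
  have "- (2 * z)*(1/2) + ln (1 + 1/2*(exp (2 * z) - 1)) <= (2 * z)^2/8"
   by (rule Hoeffdings_lemma_aux) (use that in auto)
  then have "ln ((1 + exp (2 * z))/2) <= z + z^2/2" by (simp add: field_simps power_mult_distrib)
  then have "(1 + exp (2 * z))/2 <= exp (z + z^2/2)"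
   by (metis add_pos_pos divide_pos_pos exp_gt_zero exp_le_cancel_iff exp_ln zero_less_numeral zero_less_one)
  then have "exp (- z)*((1 + exp (2 * z))/2) <= exp (- z) * exp (z + z^2/2)" by (intro mult_left_mono) auto
  then show ?thesis by (simp add: exp_add[symmetric] distrib_left)
 qed
 show ?thesis using *[of z] *[of "- z"] by (cases "0 <= z") (auto simp: add.commute)
qed

lemma one_plus_le_exp_cubic:
 fixes z :: real assumes "-1 < z" shows "1 + z <= exp (z - z^2/2 + \<bar>z\<bar>^3)"
proof -
 have "ln (1 + z) <= z - z^2/2 + \<bar>z\<bar>^3"
 proof (cases "0 <= z")
  case True
  define h where "h = (%z::real. z - z^2/2 + z^3 - ln (1 + z))"
  have "h 0 <= h z"
  proof (rule DERIV_nonneg_imp_nondecreasing[OF True])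
   fix x :: real assume x: "0 <= x" "x <= z"
   have "(h has_real_derivative 1 - x + 3 * x^2 - 1/(1 + x)) (at x)"
    unfolding h_def using x by (auto intro!: derivative_eq_intros simp: power2_eq_square)
   moreover have "1 - x + 3 * x^2 - 1/(1 + x) = (2 * x^2 + 3 * x^3)/(1 + x)"
    using x by (simp add: field_simps power2_eq_square power3_eq_cube)
   moreover have "0 <= (2 * x^2 + 3 * x^3)/(1 + x)" using x by auto
   ultimately show "\<exists>y. (h has_real_derivative y) (at x) \<and> 0 <= y" by (metis (no_types, lifting))
  qed
  then show ?thesis using True by (simp add: h_def)
 next
  case False
  define h where "h = (%z::real. z - z^2/2 - z^3 - ln (1 + z))"
  have "h z \<ge> h 0"
  proof (rule DERIV_nonpos_imp_nonincreasing[where f=h])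
   show "z <= 0" using False by simp
   fix x :: real assume x: "z <= x" "x <= 0"
   have x1: "0 < 1 + x" using x assms by simp
   have "(h has_real_derivative 1 - x - 3 * x^2 - 1/(1 + x)) (at x)"
    unfolding h_def using x1 by (auto intro!: derivative_eq_intros simp: power2_eq_square)
   moreover have "1 - x - 3 * x^2 - 1/(1 + x) = - (x^2*(4 + 3 * x))/(1 + x)"
    using x1 by (simp add: field_simps power2_eq_square power3_eq_cube)
   moreover have "- (x^2*(4 + 3 * x))/(1 + x) <= 0" using x1 x assms by (intro divide_nonpos_pos) auto
   ultimately show "\<exists>y. (h has_real_derivative y) (at x) \<and> y <= 0" by (metis (no_types, lifting))
  qed
  then show ?thesis using False by (simp add: h_def)
 qed
 moreover have "0 < 1 + z" using assms by simp
 ultimately show ?thesis by (metis exp_le_cancel_iff exp_ln)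
qed

definition signs :: "nat => (nat => real) set" where
 "signs N = {1..N} \<rightarrow>\<^sub>E {- 1, 1}"

lemma finite_signs[simp]: "finite (signs N)" by (simp add: signs_def finite_PiE)

lemma card_signs: "card (signs N) = 2^N"
 by (simp add: signs_def card_PiE numeral_2_eq_2)

lemma signs_val: "\<sigma> \<in> signs N ==> i \<in> {1..N} ==> \<sigma> i = 1 \<or> \<sigma> i = - 1"
 by (auto simp: signs_def PiE_iff)

lemma signs_sq: "\<sigma> \<in> signs N ==> i \<in> {1..N} ==> \<sigma> i*\<sigma> i = 1"
 using signs_val by fastforce

lemma gauss_exp: "(\<integral>\<^sup>+x. ennreal (normal_density 0 1 x * exp (a * x)) \<partial>lborel) = ennreal (exp (a^2/2))"
proof -
 have "normal_density 0 1 x * exp (a * x) = exp (a^2/2) * normal_density a 1 x" for x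
  by (simp add: normal_density_def exp_add[symmetric] power2_eq_square algebra_simps diff_divide_distrib add_divide_distrib)
 then have "(\<integral>\<^sup>+x. ennreal (normal_density 0 1 x * exp (a * x)) \<partial>lborel) = ennreal (exp (a^2/2))*(\<integral>\<^sup>+x. ennreal (normal_density a 1 x) \<partial>lborel)"
  by (simp add: ennreal_mult nn_integral_cmult normal_density_nonneg)
 also have "(\<integral>\<^sup>+x. ennreal (normal_density a 1 x) \<partial>lborel) = 1"
 proof -
  interpret prob_space "density lborel (normal_density a 1)" by (rule prob_space_normal_density) simp
  show ?thesis using emeasure_space_1 by (simp add: emeasure_density)
 qed
 finally show ?thesis by simp
qed

lemma gauss_square_exp:
 assumes "s < 1" shows "(\<integral>\<^sup>+x. ennreal (normal_density 0 1 x * exp (s * x^2/2)) \<partial>lborel) = ennreal (1/sqrt (1 - s))"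
proof -
 define \<tau> where "\<tau> = 1/sqrt (1 - s)"
 have \<tau>: "0 < \<tau>" "1/\<tau>^2 = 1 - s" using assms by (auto simp: \<tau>_def power_divide)
 have "normal_density 0 1 x * exp (s * x^2/2) = \<tau> * normal_density 0 \<tau> x" for x
 proof -
  have "- (x^2/(2*\<tau>^2)) = - (x^2*(1/\<tau>^2)/2)" by simp
  also have "... = - (x^2/2) + s * x^2/2" unfolding \<tau>(2) by (simp add: algebra_simps diff_divide_distrib)
  finally have e: "exp (- (x^2/(2*\<tau>^2))) = exp (- (x^2/2)) * exp (s * x^2/2)" by (simp only: exp_add)
  show ?thesis using \<tau>(1) e by (simp add: normal_density_def real_sqrt_mult)
 qed
 then have "(\<integral>\<^sup>+x. ennreal (normal_density 0 1 x * exp (s * x^2/2)) \<partial>lborel) = ennreal \<tau>*(\<integral>\<^sup>+x. ennreal (normal_density 0 \<tau> x) \<partial>lborel)"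
  using \<tau> by (simp add: ennreal_mult nn_integral_cmult normal_density_nonneg)
 also have "(\<integral>\<^sup>+x. ennreal (normal_density 0 \<tau> x) \<partial>lborel) = 1"
 proof -
  interpret prob_space "density lborel (normal_density 0 \<tau>)" by (rule prob_space_normal_density) (use \<tau> in simp)
  show ?thesis using emeasure_space_1 by (simp add: emeasure_density)
 qed
 finally show ?thesis by (simp add: \<tau>_def)
qed

text \<open>The Hubbard-Stratonovich transformation: \<open>exp (a^2 / 2)\<close> is the mean of \<open>exp (a * g)\<close> for a standard Gaussian \<open>g\<close>. Under
  this mean the sum over signs factorizes into hyperbolic cosines, which are at most \<open>exp (y * g^2 / 2)\<close>.\<close>
lemma curie_weiss_bound:
 assumes y: "0 <= y" "real N * y < 1"
 shows "(\<Sum>\<rho>\<in>signs N. exp (y*(\<Sum>i\<in>{1..N}. \<rho> i)^2/2)) <= 2^N/sqrt (1 - real N * y)"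
proof -
 have "ennreal (\<Sum>\<rho>\<in>signs N. exp (y*(\<Sum>i\<in>{1..N}. \<rho> i)^2/2)) = (\<Sum>\<rho>\<in>signs N. ennreal (exp ((sqrt y*(\<Sum>i\<in>{1..N}. \<rho> i))^2/2)))"
  using y by (simp add: power_mult_distrib)
 also have "... = (\<Sum>\<rho>\<in>signs N. \<integral>\<^sup>+x. ennreal (normal_density 0 1 x * exp (sqrt y*(\<Sum>i\<in>{1..N}. \<rho> i) * x)) \<partial>lborel)"
  by (simp only: gauss_exp)
 also have "... = (\<integral>\<^sup>+x. (\<Sum>\<rho>\<in>signs N. ennreal (normal_density 0 1 x * exp (sqrt y*(\<Sum>i\<in>{1..N}. \<rho> i) * x))) \<partial>lborel)"
  by (subst nn_integral_sum) auto
 also have "... <= (\<integral>\<^sup>+x. ennreal (2^N) * ennreal (normal_density 0 1 x * exp (real N * y * x^2/2)) \<partial>lborel)"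
 proof (intro nn_integral_mono)
  fix x :: real
  have "(\<Sum>\<rho>\<in>signs N. exp (sqrt y*(\<Sum>i\<in>{1..N}. \<rho> i) * x)) = (\<Sum>\<rho>\<in>signs N. \<Prod>i\<in>{1..N}. exp (sqrt y * x*\<rho> i))"
   by (simp add: exp_sum[symmetric] sum_distrib_left sum_distrib_right mult_ac)
  also have "... = (\<Prod>i\<in>{1..N}. \<Sum>s\<in>{-1, 1}. exp (sqrt y * x * s))"
   unfolding signs_def by (subst prod_sum_PiE) auto
  also have "... = (exp (sqrt y * x) + exp (- (sqrt y * x)))^N" by (simp add: add.commute)
  also have "... <= (2 * exp ((sqrt y * x)^2/2))^N" by (intro power_mono cosh_le_exp) (auto intro: add_nonneg_nonneg)
  also have "... = 2^N * exp (real N * y * x^2/2)"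
   using y by (simp add: power_mult_distrib exp_of_nat_mult[symmetric])
  finally have "normal_density 0 1 x*(\<Sum>\<rho>\<in>signs N. exp (sqrt y*(\<Sum>i\<in>{1..N}. \<rho> i) * x)) <= normal_density 0 1 x*(2^N * exp (real N * y * x^2/2))"
   by (intro mult_left_mono normal_density_nonneg) auto
  then have "ennreal (\<Sum>\<rho>\<in>signs N. normal_density 0 1 x * exp (sqrt y*(\<Sum>i\<in>{1..N}. \<rho> i) * x)) <= ennreal (2^N*(normal_density 0 1 x * exp (real N * y * x^2/2)))"
   by (intro ennreal_leI) (simp add: sum_distrib_left mult_ac)
  then show "(\<Sum>\<rho>\<in>signs N. ennreal (normal_density 0 1 x * exp (sqrt y*(\<Sum>i\<in>{1..N}. \<rho> i) * x))) <= ennreal (2^N) * ennreal (normal_density 0 1 x * exp (real N * y * x^2/2))"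
   by (subst sum_ennreal, simp, subst ennreal_mult[symmetric]) auto
 qed
 also have "... = ennreal (2^N) * ennreal (1/sqrt (1 - real N * y))"
  by (subst nn_integral_cmult) (auto simp: gauss_square_exp[OF y(2)])
 also have "... = ennreal (2^N/sqrt (1 - real N * y))" using y by (subst ennreal_mult[symmetric]) auto
 finally show ?thesis using y by (simp add: ennreal_le_iff)
qed

lemma finite_strict[simp]: "finite (strict_upper_indices N)"
 by (rule finite_subset[of _ "{1..N} \<times> {1..N}"]) (auto simp: strict_upper_indices_def)

lemma sum_pairs: "(\<Sum>i\<in>{1..N}. \<rho> i)^2 = (\<Sum>i\<in>{1..N}. (\<rho> i)^2) + 2*(\<Sum>(i, j)\<in>strict_upper_indices N. \<rho> i*\<rho> j :: real)"
proof (induction N)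
 case 0
 have "strict_upper_indices 0 = {}" by (auto simp: strict_upper_indices_def)
 then show ?case by simp
next
 case (Suc N)
 have eq: "strict_upper_indices (Suc N) = strict_upper_indices N \<union> (%i. (i, Suc N)) ` {1..N}"
  by (auto simp: strict_upper_indices_def)
 have "(\<Sum>(i, j)\<in>strict_upper_indices (Suc N). \<rho> i*\<rho> j) = (\<Sum>(i, j)\<in>strict_upper_indices N. \<rho> i*\<rho> j) + (\<Sum>i\<in>{1..N}. \<rho> i*\<rho> (Suc N))"
 proof -
  have d: "strict_upper_indices N \<inter> (%i. (i, Suc N)) ` {1..N} = {}" by (auto simp: strict_upper_indices_def)
  show ?thesis unfolding eq by (subst sum.union_disjoint[OF finite_strict _ d]) (auto simp: sum.reindex inj_on_def)
 qed
 then show ?case using Suc.IH by (simp add: power2_sum sum_distrib_left sum_distrib_right algebra_simps)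
qed

lemma card_strict: "2 * real (card (strict_upper_indices N)) = real N*(real N - 1)"
 using sum_pairs[of "%_. 1" N] by (simp add: power2_eq_square algebra_simps case_prod_unfold)

text \<open>Each factor is \<open>a * (1 + x * s)\<close> with a sign \<open>s\<close>. Its logarithm is \<open>x * s - x^2 / 2\<close> up to third order, so that the
  product is a constant times a Curie-Weiss weight below the critical temperature.\<close>
lemma replica_average_bound:
 assumes a: "0 < a" and t: "0 <= t" and x1: "t/a <= 1/2" and Nx: "real N*(t/a) < 1" and al: "a <= 1 + b" and b: "0 <= b"
 defines "x == t/a"
 shows "(\<Sum>\<rho>\<in>signs N. \<Prod>(i, j)\<in>strict_upper_indices N. a + t*(\<rho> i*\<rho> j)) \<le>
   2^N * exp ((real N)^2/2 * b - real N*(real N - 1)/4 * x^2 + (real N)^2/2 * x^3 - real N * x/2)/sqrt (1 - real N * x)"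
proof -
 let ?S = "strict_upper_indices N"
 define n2 where "n2 = real (card ?S)"
 have n2: "n2 = real N*(real N - 1)/2" using card_strict[of N] by (simp add: n2_def)
 have x0: "0 <= x" "x <= 1/2" using a t x1 by (auto simp: x_def)
 define P where "P \<rho> = (\<Sum>(i, j)\<in>?S. \<rho> i*\<rho> j :: real)" for \<rho> :: "nat => real"
 have tm: "(\<Prod>(i, j)\<in>?S. a + t*(\<rho> i*\<rho> j)) <= exp (n2 * b - n2 * x^2/2 + n2 * x^3) * exp (x * P \<rho>)" if \<rho>: "\<rho> \<in> signs N" for \<rho>
 proof -
  have e: "0 <= a + t*(\<rho> i*\<rho> j) \<and> a + t*(\<rho> i*\<rho> j) <= exp (b - x^2/2 + x^3 + x*(\<rho> i*\<rho> j))" if "(i, j) \<in> ?S" for i j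
  proof -
   have "\<rho> i = 1 \<or> \<rho> i = -1" "\<rho> j = 1 \<or> \<rho> j = -1" using that signs_val[OF \<rho>] by (auto simp: strict_upper_indices_def)
   then have p: "\<rho> i*\<rho> j = 1 \<or> \<rho> i*\<rho> j = -1" by auto
   have z: "-1 < x*(\<rho> i*\<rho> j)" using p x0 by auto
   have eq: "a + t*(\<rho> i*\<rho> j) = a*(1 + x*(\<rho> i*\<rho> j))" using a by (simp add: x_def field_simps)
   have "1 + x*(\<rho> i*\<rho> j) <= exp (x*(\<rho> i*\<rho> j) - x^2/2 + x^3)"
    using p
   proof
    assume "\<rho> i*\<rho> j = 1"
    then show ?thesis using one_plus_le_exp_cubic[OF z] x0 by simp
   next
    assume "\<rho> i*\<rho> j = -1"
    then show ?thesis using one_plus_le_exp_cubic[OF z] x0 by simp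
   qed
   moreover have "a <= exp b" using al exp_ge_add_one_self[of b] by linarith
   ultimately have "a*(1 + x*(\<rho> i*\<rho> j)) <= exp b * exp (x*(\<rho> i*\<rho> j) - x^2/2 + x^3)"
    using a z by (intro mult_mono) auto
   moreover have "0 <= a*(1 + x*(\<rho> i*\<rho> j))" using a z by (intro mult_nonneg_nonneg) auto
   ultimately show ?thesis unfolding eq by (simp add: exp_add[symmetric] algebra_simps)
  qed
  have "(\<Prod>(i, j)\<in>?S. a + t*(\<rho> i*\<rho> j)) <= (\<Prod>(i, j)\<in>?S. exp (b - x^2/2 + x^3 + x*(\<rho> i*\<rho> j)))"
   using e by (intro prod_mono) auto
  also have "... = exp (\<Sum>(i, j)\<in>?S. b - x^2/2 + x^3 + x*(\<rho> i*\<rho> j))"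
   by (simp add: exp_sum case_prod_unfold)
  also have "(\<Sum>(i, j)\<in>?S. b - x^2/2 + x^3 + x*(\<rho> i*\<rho> j)) = (n2 * b - n2 * x^2/2 + n2 * x^3) + x * P \<rho>"
   by (simp add: P_def n2_def case_prod_unfold sum.distrib sum_subtractf sum_distrib_left algebra_simps)
  finally show ?thesis by (simp add: exp_add)
 qed
 have Pe: "exp (x * P \<rho>) = exp (- (real N * x/2)) * exp (x*(\<Sum>i\<in>{1..N}. \<rho> i)^2/2)" if \<rho>: "\<rho> \<in> signs N" for \<rho>
 proof -
  have "(\<Sum>i\<in>{1..N}. (\<rho> i)^2) = real N" using signs_sq[OF \<rho>] by (simp add: power2_eq_square)
  then have "x * P \<rho> = - (real N * x/2) + x*(\<Sum>i\<in>{1..N}. \<rho> i)^2/2"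
   using sum_pairs[of \<rho> N] by (simp add: P_def algebra_simps)
  then show ?thesis by (simp add: exp_add[symmetric])
 qed
 have "(\<Sum>\<rho>\<in>signs N. \<Prod>(i, j)\<in>?S. a + t*(\<rho> i*\<rho> j)) <= (\<Sum>\<rho>\<in>signs N. exp (n2 * b - n2 * x^2/2 + n2 * x^3)*(exp (- (real N * x/2)) * exp (x*(\<Sum>i\<in>{1..N}. \<rho> i)^2/2)))"
  using tm Pe by (intro sum_mono) auto
 also have "... = exp (n2 * b - n2 * x^2/2 + n2 * x^3) * exp (- (real N * x/2))*(\<Sum>\<rho>\<in>signs N. exp (x*(\<Sum>i\<in>{1..N}. \<rho> i)^2/2))"
  by (simp add: sum_distrib_left mult.assoc)
 also have "... <= exp (n2 * b - n2 * x^2/2 + n2 * x^3) * exp (- (real N * x/2))*(2^N/sqrt (1 - real N * x))"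
  using x0 Nx by (intro mult_left_mono curie_weiss_bound) (auto simp: x_def)
 also have "... <= exp ((real N)^2/2 * b - real N*(real N - 1)/4 * x^2 + (real N)^2/2 * x^3) * exp (- (real N * x/2))*(2^N/sqrt (1 - real N * x))"
 proof (intro mult_right_mono)
  have nn: "n2 <= (real N)^2/2" unfolding n2 by (simp add: power2_eq_square algebra_simps)
  have "n2 * b <= (real N)^2/2 * b" "n2 * x^3 <= (real N)^2/2 * x^3" using b x0 by (intro mult_right_mono nn; simp)+
  moreover have "n2 * x^2/2 = real N*(real N - 1)/4 * x^2" unfolding n2 by simp
  ultimately show "exp (n2 * b - n2 * x^2/2 + n2 * x^3) <= exp ((real N)^2/2 * b - real N*(real N - 1)/4 * x^2 + (real N)^2/2 * x^3)"
   unfolding exp_le_cancel_iff by linarith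
 qed (use Nx in \<open>auto simp: x_def\<close>)
 also have "... = 2^N * exp ((real N)^2/2 * b - real N*(real N - 1)/4 * x^2 + (real N)^2/2 * x^3 - real N * x/2)/sqrt (1 - real N * x)"
 proof -
  have ex: "exp (U - real N * x/2) = exp U * exp (- (real N * x/2))" for U by (simp add: exp_add[symmetric])
  show ?thesis unfolding ex by simp
 qed
 finally show ?thesis .
qed

section \<open>Densities and coordinate maps on product spaces\<close>

text \<open>Both sides are product measures on the boxes, where integrals of products of functions of one coordinate factorize.\<close>
lemma PiM_density:
 assumes fin: "finite I" and M: "!!e. prob_space (M e)" and f[measurable]: "!!e. f e \<in> borel_measurable (M e)"
  and D: "!!e. prob_space (density (M e) (f e))"
 shows "PiM I (%e. density (M e) (f e)) = density (PiM I M) (%x. \<Prod>e\<in>I. f e (x e))"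
proof -
 interpret PM: product_prob_space M by (intro product_prob_spaceI M)
 interpret PD: product_prob_space "%e. density (M e) (f e)" by (intro product_prob_spaceI D)
 have [measurable]: "(%x. \<Prod>e\<in>I. f e (x e)) \<in> borel_measurable (PiM I M)"
  by (intro borel_measurable_prod_ennreal measurable_compose[OF measurable_component_singleton[of _ I M] f]) auto
 show ?thesis
 proof (rule PD.PiM_eqI[OF fin, symmetric])
  show "sets (density (PiM I M) (%x. \<Prod>e\<in>I. f e (x e))) = sets (PiM I (%e. density (M e) (f e)))"
   by (simp cong: sets_PiM_cong)
  fix A assume "!!e. e \<in> I ==> A e \<in> sets (density (M e) (f e))"
  then have A[measurable]: "!!e. e \<in> I ==> A e \<in> sets (M e)" by simp
  have R: "Pi\<^sub>E I A \<in> sets (PiM I M)" using A fin by (intro sets_PiM_I_finite) auto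
  have "emeasure (density (PiM I M) (%x. \<Prod>e\<in>I. f e (x e))) (Pi\<^sub>E I A) = (\<integral>\<^sup>+x. (\<Prod>e\<in>I. f e (x e)) * indicator (Pi\<^sub>E I A) x \<partial>PiM I M)"
   using R by (simp add: emeasure_density)
  also have "... = (\<integral>\<^sup>+x. (\<Prod>e\<in>I. f e (x e) * indicator (A e) (x e)) \<partial>PiM I M)"
  proof (intro nn_integral_cong)
   fix x assume x: "x \<in> space (PiM I M)"
   have "indicator (Pi\<^sub>E I A) x = (\<Prod>e\<in>I. indicator (A e) (x e) :: ennreal)"
   proof (cases "x \<in> Pi\<^sub>E I A")
    case True then show ?thesis by (auto simp: indicator_def PiE_iff)
   next
    case False
    then obtain e where "e \<in> I" "x e \<notin> A e" using x by (auto simp: space_PiM PiE_iff)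
    then show ?thesis using False fin by (auto simp: indicator_def prod_zero_iff)
   qed
   then show "(\<Prod>e\<in>I. f e (x e)) * indicator (Pi\<^sub>E I A) x = (\<Prod>e\<in>I. f e (x e) * indicator (A e) (x e))"
    by (simp add: prod.distrib)
  qed
  also have "... = (\<Prod>e\<in>I. \<integral>\<^sup>+x. f e x * indicator (A e) x \<partial>M e)"
   using A by (intro PM.product_nn_integral_prod fin) auto
  also have "... = (\<Prod>e\<in>I. emeasure (density (M e) (f e)) (A e))"
   using A by (intro prod.cong) (auto simp: emeasure_density)
  finally show "emeasure (density (PiM I M) (%x. \<Prod>e\<in>I. f e (x e))) (Pi\<^sub>E I A) = (\<Prod>e\<in>I. emeasure (density (M e) (f e)) (A e))" .
 qed
qed

lemma PiM_distr:
 assumes fin: "finite I" and M: "!!e. prob_space (M e)" and f[measurable]: "!!e. f e \<in> measurable (M e) borel"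
 shows "PiM I (%e. distr (M e) (borel :: real measure) (f e)) = distr (PiM I M) (PiM I (%_. borel)) (%x. \<lambda>e\<in>I. f e (x e))"
proof -
 interpret PM: product_prob_space M by (intro product_prob_spaceI M)
 have D: "prob_space (distr (M e) borel (f e))" for e by (intro prob_space.prob_space_distr M f)
 interpret PD: product_prob_space "%e. distr (M e) borel (f e)" by (intro product_prob_spaceI D)
 have F[measurable]: "(%x. \<lambda>e\<in>I. f e (x e)) \<in> measurable (PiM I M) (PiM I (%_. borel))"
  by (intro measurable_restrict measurable_compose[OF measurable_component_singleton[of _ I M] f]) auto
 show ?thesis
 proof (rule PD.PiM_eqI[OF fin, symmetric])
  show "sets (distr (PiM I M) (PiM I (%_. borel)) (%x. \<lambda>e\<in>I. f e (x e))) = sets (PiM I (%e. distr (M e) borel (f e)))"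
   by (simp cong: sets_PiM_cong)
  fix A assume "!!e. e \<in> I ==> A e \<in> sets (distr (M e) borel (f e))"
  then have A[measurable]: "!!e. e \<in> I ==> A e \<in> sets borel" by simp
  have "emeasure (distr (PiM I M) (PiM I (%_. borel)) (%x. \<lambda>e\<in>I. f e (x e))) (Pi\<^sub>E I A) = emeasure (PiM I M) ((%x. \<lambda>e\<in>I. f e (x e)) -` Pi\<^sub>E I A \<inter> space (PiM I M))"
   using A fin by (subst emeasure_distr) (auto intro!: sets_PiM_I_finite)
  also have "(%x. \<lambda>e\<in>I. f e (x e)) -` Pi\<^sub>E I A \<inter> space (PiM I M) = Pi\<^sub>E I (%e. f e -` A e \<inter> space (M e))"
   by (auto simp: space_PiM PiE_iff extensional_def)
  also have "emeasure (PiM I M) (Pi\<^sub>E I (%e. f e -` A e \<inter> space (M e))) = (\<Prod>e\<in>I. emeasure (M e) (f e -` A e \<inter> space (M e)))"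
   using A by (intro PM.emeasure_PiM fin) auto
  also have "... = (\<Prod>e\<in>I. emeasure (distr (M e) borel (f e)) (A e))"
   using A by (intro prod.cong) (auto simp: emeasure_distr)
  finally show "emeasure (distr (PiM I M) (PiM I (%_. borel)) (%x. \<lambda>e\<in>I. f e (x e))) (Pi\<^sub>E I A) = (\<Prod>e\<in>I. emeasure (distr (M e) borel (f e)) (A e))" .
 qed
qed

section \<open>The limiting variance\<close>

text \<open>With real argument, the product vanishes by itself for a natural number \<open>x\<close> below \<open>k\<close>, and no case distinctions arise
  in the sums.\<close>
definition falling :: "real => nat => real" where "falling x k = (\<Prod>i<k. x - real i)"

lemma falling_Suc: "falling x (Suc k) = falling x k*(x - real k)"
 by (simp add: falling_def)

lemma falling_Suc': "falling x (Suc k) = x * falling (x - 1) k"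
 unfolding falling_def prod.lessThan_Suc_shift by (simp add: algebra_simps)

lemma falling_sum: "(\<Sum>b<B. falling (real b) k) = falling (real B) (Suc k)/real (Suc k)"
proof (induction B)
 case 0 then show ?case by (simp add: falling_Suc')
next
 case (Suc B)
 have "falling (real (Suc B)) (Suc k) - falling (real B) (Suc k) = real (Suc k) * falling (real B) k"
  unfolding falling_Suc'[of "real (Suc B)"] falling_Suc[of "real B"] by (simp add: algebra_simps)
 then have "falling (real (Suc B)) (Suc k)/real (Suc k) = falling (real B) (Suc k)/real (Suc k) + falling (real B) k"
  by (simp add: field_simps)
 then show ?case using Suc.IH by simp
qed

text \<open>Unfolding the recursion: the number of ways to choose \<open>q\<close> further blocks in order, with one factor \<open>d\<close> for each step.\<close>
lemma lim_sq_falling: "1 <= s ==> lim_sq d k s = (\<Sum>q<k. d^Suc q * falling (real s - 1) q)"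
proof (induction k arbitrary: s)
 case (Suc k)
 have "real (s - 1) * lim_sq d k (s - 1) = (real s - 1)*(\<Sum>q<k. d^Suc q * falling (real s - 1 - 1) q)"
 proof (cases "s = 1")
  case False
  then have "1 <= s - 1" using Suc.prems by simp
  from Suc.IH[OF this] show ?thesis using Suc.prems by (simp add: of_nat_diff)
 qed simp
 also have "... = (\<Sum>q<k. d^Suc q * falling (real s - 1) (Suc q))"
  by (simp add: falling_Suc' sum_distrib_left mult_ac)
 finally have "lim_sq d (Suc k) s = d*(1 + (\<Sum>q<k. d^Suc q * falling (real s - 1) (Suc q)))"
  by simp
 then show ?case
  by (simp only: sum.lessThan_Suc_shift) (simp add: falling_def sum_distrib_left distrib_left mult_ac)
qed simp

lemma sum_real_below: "(\<Sum>j<b. real j) = falling (real b) 2/2"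
proof -
 have "falling (real j) 1 = real j" for j by (simp add: falling_def)
 then show ?thesis using falling_sum[where B=b and k=1] by (simp add: numeral_2_eq_2)
qed

lemma variance_sum:
 "(\<Sum>b<B. \<Sum>b1<b. d*(real b1 * lim_sq d k (b - 1))) = (\<Sum>q<k. d^(q + 2) * falling (real B) (q + 3)/(2 * real (q + 3)))"
proof -
 have "(\<Sum>b1<b. d*(real b1 * lim_sq d k (b - 1))) = (\<Sum>q<k. d^(q + 2)/2 * falling (real b) (q + 2))" for b
 proof (cases "b <= 1")
  case True
  then have "b = 0 \<or> b = 1" by auto
  then show ?thesis by (auto simp: falling_Suc')
 next
  case False
  then have b: "1 <= b - 1" "real (b - 1) = real b - 1" by auto
  have "(\<Sum>b1<b. d*(real b1 * lim_sq d k (b - 1))) = d*(\<Sum>b1<b. real b1) * lim_sq d k (b - 1)"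
   by (simp add: sum_distrib_left sum_distrib_right mult_ac)
  also have "... = d*(falling (real b) 2/2)*(\<Sum>q<k. d^Suc q * falling (real b - 1 - 1) q)"
   unfolding sum_real_below lim_sq_falling[OF b(1)] b(2) ..
  also have "... = (\<Sum>q<k. d^(q + 2)/2 * falling (real b) (q + 2))"
   by (simp add: sum_distrib_left falling_Suc' numeral_2_eq_2 falling_def[of _ 0] mult_ac)
  finally show ?thesis .
 qed
 then have "(\<Sum>b<B. \<Sum>b1<b. d*(real b1 * lim_sq d k (b - 1))) = (\<Sum>q<k. \<Sum>b<B. d^(q + 2)/2 * falling (real b) (q + 2))"
  by (simp add: sum.swap[of _ "{..<B}"])
 also have "... = (\<Sum>q<k. d^(q + 2)/2*(falling (real B) (Suc (q + 2))/real (Suc (q + 2))))"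
  unfolding sum_distrib_left[symmetric] falling_sum ..
 finally show ?thesis by (simp add: numeral_3_eq_3 numeral_2_eq_2)
qed

lemma falling_le: "\<bar>falling (real B) k\<bar> <= real B^k"
proof (cases "k <= B")
 case True
 have "\<bar>falling (real B) k\<bar> = (\<Prod>i<k. \<bar>real B - real i\<bar>)" by (simp add: falling_def abs_prod)
 also have "... <= (\<Prod>i<k. real B)" using True by (intro prod_mono) auto
 finally show ?thesis by simp
next
 case False
 then have "falling (real B) k = 0" by (auto simp: falling_def prod_zero_iff intro!: bexI[of _ B])
 then show ?thesis by simp
qed

lemma falling_ratio: "(%B. falling (real B) k/real B^k) ----> 1"
proof -
 have "(%B. \<Prod>i<k. 1 - real i/real B) ----> (\<Prod>i<k. 1 - 0)"
  by (intro tendsto_prod tendsto_diff tendsto_const tendsto_divide_0[OF tendsto_const] filterlim_at_top_imp_at_infinity[OF filterlim_real_sequentially])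
 moreover have "\<forall>\<^sub>F B in sequentially. (\<Prod>i<k. 1 - real i/real B) = falling (real B) k/real B^k"
  using eventually_gt_at_top[of 0]
 proof eventually_elim
  case (elim B)
  then have "1 - real i/real B = (real B - real i)/real B" for i by (simp add: field_simps)
  then show ?case by (simp add: falling_def prod_dividef)
 qed
 ultimately show ?thesis by (simp add: Lim_transform_eventually)
qed

lemma log_tail_sums:
 assumes "0 <= c" "c < (1::real)"
 shows "(%q. c^(q + 3)/(2 * real (q + 3))) sums ((- ln (1 - c) - c - c^2/2)/2)"
proof -
 have "(%n. - (c^n)/real n) sums ln (1 - c)"
  using ln_series'[of "- c"] assms by simp
 then have "(%n. c^n/real n) sums (- ln (1 - c))" using sums_minus by fastforce
 from sums_split_initial_segment[OF this, of 3]
 have "(%q. c^(q + 3)/real (q + 3)) sums (- ln (1 - c) - (\<Sum>i<3. c^i/real i))" .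
 then have "(%q. c^(q + 3)/real (q + 3)) sums (- ln (1 - c) - c - c^2/2)"
  by (simp add: eval_nat_numeral lessThan_Suc algebra_simps)
 from sums_divide[OF this, of 2] show ?thesis by (simp add: mult.commute)
qed

lemma log_tail_nonneg:
 assumes "0 <= c" "c < (1::real)" shows "0 <= - ln (1 - c) - c - c^2/2"
proof -
 have "0 <= (- ln (1 - c) - c - c^2/2)/2"
  by (rule sums_le[OF _ sums_zero log_tail_sums[OF assms]]) (use assms in simp)
 then show ?thesis by simp
qed

text \<open>By \<open>variance_sum\<close> the variance is a sum over cycle lengths \<open>l = q + 3\<close> of \<open>(c / B)^l\<close> times the number of ways to choose \<open>l\<close>
  distinct blocks, divided by \<open>2 * l\<close> for rotations and reflections. Each term tends to \<open>c^l / (2 * l)\<close> and is dominated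
  by it, and Tannery's theorem applies.\<close>
lemma variance_limit:
 assumes c: "0 <= c" "c < 1"
 shows "(%B. \<Sum>b<B. \<Sum>b1<b. \<gamma>/(real B)^2 + c/real B*(c/real B*(real b1 * lim_sq (c/real B) B (b - 1))))
   ----> \<gamma>/2 + (- ln (1 - c) - c - c^2/2)/2"
proof -
 define T where "T B q = (if q < B then (c/real B)^(q + 3) * falling (real B) (q + 3)/(2 * real (q + 3)) else 0)" for B q
 have Teq: "T B q = c^(q + 3)/(2 * real (q + 3))*(falling (real B) (q + 3)/real B^(q + 3))" if "q < B" for B q
  using that by (simp add: T_def power_divide mult_ac)
 have "(%B. \<Sum>q. T B q) ----> (\<Sum>q. c^(q + 3)/(2 * real (q + 3)))"
 proof (rule tannerys_theorem[where a="%q B. T B q" and b="%q. c^(q + 3)/(2 * real (q + 3))" and M="%q. c^(q + 3)/(2 * real (q + 3))", THEN conjunct2, THEN conjunct2])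
  show "(%B. T B q) ----> c^(q + 3)/(2 * real (q + 3))" for q
  proof (rule Lim_transform_eventually)
   show "(%B. c^(q + 3)/(2 * real (q + 3))*(falling (real B) (q + 3)/real B^(q + 3))) ----> c^(q + 3)/(2 * real (q + 3))"
    using tendsto_mult[OF tendsto_const falling_ratio, of "c^(q + 3)/(2 * real (q + 3))" "q + 3"] by simp
   show "\<forall>\<^sub>F B in sequentially. c^(q + 3)/(2 * real (q + 3))*(falling (real B) (q + 3)/real B^(q + 3)) = T B q"
    using eventually_gt_at_top[of q] by eventually_elim (simp only: Teq)
  qed
  show "\<forall>\<^sub>F (q, B) in at_top \<times>\<^sub>F sequentially. norm (T B q) <= c^(q + 3)/(2 * real (q + 3))"
  proof (intro always_eventually allI, clarify)
   fix q B :: nat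
   show "norm (T B q) <= c^(q + 3)/(2 * real (q + 3))"
   proof (cases "q < B")
    case True
    have "\<bar>falling (real B) (q + 3)/real B^(q + 3)\<bar> <= 1"
     using falling_le[of B "q + 3"] True by (simp add: abs_divide)
    then have "c^(q + 3)/(2 * real (q + 3))*\<bar>falling (real B) (q + 3)/real B^(q + 3)\<bar> <= c^(q + 3)/(2 * real (q + 3))*1"
     using c by (intro mult_left_mono) auto
    then show ?thesis unfolding Teq[OF True] real_norm_def abs_mult using c by simp
   qed (use c in \<open>simp add: T_def\<close>)
  qed
  show "summable (%q. c^(q + 3)/(2 * real (q + 3)))" using log_tail_sums[OF c] by (rule sums_summable)
 qed simp
 moreover have "(\<Sum>q. T B q) = (\<Sum>q<B. (c/real B)^(q + 3) * falling (real B) (q + 3)/(2 * real (q + 3)))" for B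
  by (subst suminf_finite[of "{..<B}"]) (auto simp: T_def)
 ultimately have L1: "(%B. \<Sum>q<B. (c/real B)^(q + 3) * falling (real B) (q + 3)/(2 * real (q + 3))) ----> (- ln (1 - c) - c - c^2/2)/2"
  using sums_unique[OF log_tail_sums[OF c]] by simp
 have L2: "(%B. \<gamma>/2*(falling (real B) 2/real B^2)) ----> \<gamma>/2*1" by (intro tendsto_intros falling_ratio)
 have "(\<Sum>b<B. \<Sum>b1<b. \<gamma>/(real B)^2 + c/real B*(c/real B*(real b1 * lim_sq (c/real B) B (b - 1))))
   = \<gamma>/2*(falling (real B) 2/real B^2) + (\<Sum>q<B. (c/real B)^(q + 3) * falling (real B) (q + 3)/(2 * real (q + 3)))" for B
 proof -
  have "(\<Sum>b<B. \<Sum>b1<b. \<gamma>/(real B)^2) = (\<Sum>b<B. real b)*(\<gamma>/(real B)^2)" by (simp add: sum_distrib_right sum_divide_distrib)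
  moreover have "(\<Sum>b<B. \<Sum>b1<b. c/real B*(c/real B*(real b1 * lim_sq (c/real B) B (b - 1)))) = c/real B*(\<Sum>q<B. (c/real B)^(q + 2) * falling (real B) (q + 3)/(2 * real (q + 3)))"
   unfolding variance_sum[symmetric] by (simp only: sum_distrib_left)
  ultimately show ?thesis by (simp add: sum.distrib sum_real_below sum_distrib_left numeral_3_eq_3 numeral_2_eq_2 mult_ac)
 qed
 then show ?thesis using tendsto_add[OF L2 L1] by simp
qed

section \<open>Gaussian limits of test functions\<close>

text \<open>The logarithm is not Lipschitz near 0, but the step function is constant to the left of \<open>a\<close>: only arguments above
  \<open>exp a\<close> matter, where the logarithm has the Lipschitz constant \<open>exp (- a)\<close>.\<close>
lemma cts_step_ln_lipschitz:
 assumes ab: "a < b" and u: "0 < u" "0 < v"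
 shows "\<bar>cts_step a b (ln u) - cts_step a b (ln v)\<bar> <= exp (- a)/(b - a)*\<bar>u - v\<bar>"
proof -
 have s: "\<bar>cts_step a b x - cts_step a b y\<bar> <= \<bar>max a x - max a y\<bar>/(b - a)" for x y
  using ab by (auto simp: cts_step_def max_def divide_simps)
 have *: "\<bar>max a (ln u) - max a (ln v)\<bar> <= exp (- a)*\<bar>u - v\<bar>" if "u <= v" "0 < u" "0 < v" for u v
 proof -
  have l: "max a (ln w) = ln (max (exp a) w)" if "0 < w" for w
  proof (cases "exp a <= w")
   case True
   then have "a <= ln w" using that by (simp add: ln_ge_iff)
   then show ?thesis using True by simp
  next
   case False
   then have "ln w < a" using that by (metis exp_gt_zero ln_exp ln_less_cancel_iff not_le)
   then show ?thesis using False by simp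
  qed
  define u' v' where "u' = max (exp a) u" and "v' = max (exp a) v"
  have p: "exp a <= u'" "u' <= v'" "v' - u' <= v - u" using that by (auto simp: u'_def v'_def)
  then have u0: "0 < u'" "0 < v'" using exp_gt_zero[of a] by linarith+
  have "ln v' - ln u' = ln (v'/u')" using u0 by (simp add: ln_div)
  also have "... <= v'/u' - 1" using u0 by (intro ln_le_minus_one) simp
  also have "... = (v' - u')/u'" using u0 by (simp add: field_simps)
  also have "... <= (v - u)/exp a" using p u0 that by (intro frac_le) auto
  finally have "ln v' - ln u' <= exp (- a)*(v - u)" by (simp add: exp_minus field_simps)
  moreover have "ln u' <= ln v'" using p u0 by simp
  moreover have "exp (- a)*\<bar>u - v\<bar> = exp (- a)*(v - u)" using that by simp
  ultimately show ?thesis unfolding l[OF that(2)] l[OF that(3)] u'_def[symmetric] v'_def[symmetric] by linarith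
 qed
 have "\<bar>max a (ln u) - max a (ln v)\<bar> <= exp (- a)*\<bar>u - v\<bar>"
  using *[of u v] *[of v u] u by (cases "u <= v") (auto simp: abs_minus_commute)
 then have "\<bar>max a (ln u) - max a (ln v)\<bar>/(b - a) <= exp (- a)*\<bar>u - v\<bar>/(b - a)" using ab by (intro divide_right_mono) auto
 then show ?thesis using s[of "ln u" "ln v"] by simp
qed

lemma std_normal: "prob_space std_normal_distribution" "sets std_normal_distribution = sets borel"
 using real_dist_normal_dist by (auto simp: real_distribution_def)

lemma normal_law_affine:
 assumes "0 < v" shows "normal_law m v = distr std_normal_distribution borel (%z. m + sqrt v * z)"
proof (rule measure_eqI)
 fix A :: "real set" assume "A \<in> sets (normal_law m v)"
 then have A[measurable]: "A \<in> sets borel" by (simp add: normal_law_def)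
 have "emeasure (distr std_normal_distribution borel (%z. m + sqrt v * z)) A = (\<integral>\<^sup>+z. indicator A z \<partial>distr std_normal_distribution borel (%z. m + sqrt v * z))"
  by (subst nn_integral_indicator) auto
 also have "... = (\<integral>\<^sup>+z. indicator A (m + sqrt v * z) \<partial>std_normal_distribution)" by (subst nn_integral_distr) auto
 also have "... = (\<integral>\<^sup>+z. ennreal (normal_density 0 1 z) * indicator A (m + sqrt v * z) \<partial>lborel)" by (subst nn_integral_density) auto
 also have "... = (\<integral>\<^sup>+z. ennreal (sqrt v)*(ennreal (normal_density m (sqrt v) (m + sqrt v * z)) * indicator A (m + sqrt v * z)) \<partial>lborel)"
 proof (intro nn_integral_cong)
  fix z
  have "ennreal (normal_density 0 1 z) = ennreal (sqrt v) * ennreal (normal_density m (sqrt v) (m + sqrt v * z))"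
   using assms by (subst ennreal_mult[symmetric]) (auto simp: normal_density_def power_mult_distrib real_sqrt_mult)
  then show "ennreal (normal_density 0 1 z) * indicator A (m + sqrt v * z) = ennreal (sqrt v)*(ennreal (normal_density m (sqrt v) (m + sqrt v * z)) * indicator A (m + sqrt v * z))"
   by (simp add: mult.assoc)
 qed
 also have "... = ennreal \<bar>sqrt v\<bar>*(\<integral>\<^sup>+z. ennreal (normal_density m (sqrt v) (m + sqrt v * z)) * indicator A (m + sqrt v * z) \<partial>lborel)"
  using assms by (subst nn_integral_cmult) auto
 also have "... = (\<integral>\<^sup>+x. ennreal (normal_density m (sqrt v) x) * indicator A x \<partial>lborel)"
  using assms by (intro nn_integral_real_affine[symmetric]) auto
 also have "... = emeasure (normal_law m v) A" unfolding normal_law_def by (simp add: emeasure_density)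
 finally show "emeasure (normal_law m v) A = emeasure (distr std_normal_distribution borel (%z. m + sqrt v * z)) A" by simp
qed (simp add: normal_law_def)

lemma char_affine_normal:
 "char (distr std_normal_distribution borel (%z. m + sqrt v * z)) u = iexp (u * m) * complex_of_real (exp (- (u^2*\<bar>v\<bar>/2)))"
proof -
 have "char (distr std_normal_distribution borel (%z. m + sqrt v * z)) u = (LINT z|std_normal_distribution. iexp (u*(m + sqrt v * z)))"
  unfolding char_def by (subst integral_distr) auto
 also have "... = (LINT z|std_normal_distribution. iexp (u * m) * iexp (u * sqrt v * z))"
  by (simp add: distrib_left exp_add[symmetric] mult_ac)
 also have "... = iexp (u * m) * char std_normal_distribution (u * sqrt v)"
  unfolding char_def by simp
 also have "char std_normal_distribution (u * sqrt v) = complex_of_real (exp (- (u^2*\<bar>v\<bar>/2)))"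
 proof -
  have "(sqrt v)^2 = \<bar>v\<bar>" using real_sqrt_pow2[of "- v"] by (cases "0 <= v") (auto simp: real_sqrt_minus)
  then show ?thesis by (simp add: char_std_normal_distribution power_mult_distrib)
 qed
 finally show ?thesis .
qed

lemma normal_exp_moment:
 "integrable std_normal_distribution (%z. exp (a * z))" "(LINT z|std_normal_distribution. exp (a * z)) = exp (a^2/2)"
proof -
 have "(\<integral>\<^sup>+z. ennreal (exp (a * z)) \<partial>std_normal_distribution) = (\<integral>\<^sup>+z. ennreal (normal_density 0 1 z * exp (a * z)) \<partial>lborel)"
  by (subst nn_integral_density) (auto simp: ennreal_mult normal_density_nonneg)
 then have e: "(\<integral>\<^sup>+z. ennreal (exp (a * z)) \<partial>std_normal_distribution) = ennreal (exp (a^2/2))" by (simp only: gauss_exp)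
 show "integrable std_normal_distribution (%z. exp (a * z))"
  by (rule integrableI_nonneg) (use e in auto)
 show "(LINT z|std_normal_distribution. exp (a * z)) = exp (a^2/2)"
  by (rule integral_eq_nn_integral[THEN trans]) (use e in auto)
qed

lemma char_to_expectation:
 fixes M :: "nat => 'b measure" and X :: "nat => 'b => real" and f :: "real => real"
 assumes M: "!!n. n0 <= n ==> prob_space (M n)" and X: "!!n. n0 <= n ==> X n \<in> borel_measurable (M n)"
  and v: "0 <= v"
  and L: "!!u. (%n. LINT y|M n. iexp (u * X n y)) ----> iexp (u * m) * complex_of_real (exp (- (u^2 * v/2)))"
  and f: "!!x. isCont f x" "!!x. \<bar>f x\<bar> <= b"
 shows "(%n. LINT y|M n. f (X n y)) ----> (LINT z|std_normal_distribution. f (m + sqrt v * z))"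
proof -
 define D where "D n = distr (M (n + n0)) borel (X (n + n0))" for n
 define D' where "D' = distr std_normal_distribution borel (%z. m + sqrt v * z)"
 have fm: "f \<in> borel_measurable borel" using f(1) by (intro borel_measurable_continuous_onI continuous_at_imp_continuous_on) auto
 have rd: "real_distribution (D n)" for n
  unfolding D_def by (intro prob_space.real_distribution_distr M X) auto
 interpret sn: prob_space std_normal_distribution by (rule std_normal)
 have rd': "real_distribution D'" unfolding D'_def by (intro sn.real_distribution_distr) auto
 have "weak_conv_m D D'"
 proof (rule levy_continuity[OF rd rd'])
  fix u
  have "char (D n) u = (LINT y|M (n + n0). iexp (u * X (n + n0) y))" for n
   unfolding char_def D_def using X[of "n + n0"] by (subst integral_distr) auto
  then show "(%n. char (D n) u) ----> char D' u"
   using LIMSEQ_ignore_initial_segment[OF L[of u], of n0] v unfolding D'_def char_affine_normal by simp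
 qed
 from weak_conv_imp_integral_bdd_continuous_conv[OF rd rd' this f(1), of b]
 have "(%n. integral\<^sup>L (D n) f) ----> integral\<^sup>L D' f" using f(2) by simp
 moreover have "integral\<^sup>L (D n) f = (LINT y|M (n + n0). f (X (n + n0) y))" for n
  unfolding D_def using X[of "n + n0"] fm by (subst integral_distr) auto
 moreover have "integral\<^sup>L D' f = (LINT z|std_normal_distribution. f (m + sqrt v * z))"
  unfolding D'_def using fm by (subst integral_distr) auto
 ultimately have "(%n. LINT y|M (n + n0). f (X (n + n0) y)) ----> (LINT z|std_normal_distribution. f (m + sqrt v * z))" by simp
 then show ?thesis by (rule LIMSEQ_offset)
qed

text \<open>Without the truncation the mean is exactly \<open>exp (s n)\<close>; the truncation level tends to infinity.\<close>
lemma truncated_exp_limit: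
 assumes s: "s ----> S" "!!n. 0 <= s n"
 shows "(%n. LINT z|std_normal_distribution. min (exp (s n/2 + sqrt (s n) * z)) (real n)) ----> exp S"
proof -
 interpret sn: prob_space std_normal_distribution by (rule std_normal)
 obtain U where U: "!!n. s n <= U" using convergent_imp_Bseq[OF convergentI[OF s(1)]] unfolding Bseq_def by (metis abs_le_D1 real_norm_def)
 have S: "0 <= S" by (rule LIMSEQ_le_const[OF s(1)]) (use s(2) in auto)
 have "(%n. LINT z|std_normal_distribution. min (exp (s n/2 + sqrt (s n) * z)) (real n)) ----> (LINT z|std_normal_distribution. exp (S/2 + sqrt S * z))"
 proof (rule integral_dominated_convergence[where w="%z. exp (U/2)*(exp (sqrt U * z) + exp (- sqrt U * z))"])
  show "AE z in std_normal_distribution. (%n. min (exp (s n/2 + sqrt (s n) * z)) (real n)) ----> exp (S/2 + sqrt S * z)"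
  proof (rule AE_I2)
   fix z
   have l: "(%n. exp (s n/2 + sqrt (s n) * z)) ----> exp (S/2 + sqrt S * z)" using s(1) by (intro tendsto_intros) auto
   have "\<forall>\<^sub>F n in sequentially. exp (s n/2 + sqrt (s n) * z) < exp (S/2 + sqrt S * z) + 1" by (rule order_tendstoD(2)[OF l]) simp
   moreover have "\<forall>\<^sub>F n in sequentially. exp (S/2 + sqrt S * z) + 1 <= real n"
    using filterlim_real_sequentially by (simp add: filterlim_at_top)
   ultimately have "\<forall>\<^sub>F n in sequentially. exp (s n/2 + sqrt (s n) * z) = min (exp (s n/2 + sqrt (s n) * z)) (real n)"
    by eventually_elim simp
   then show "(%n. min (exp (s n/2 + sqrt (s n) * z)) (real n)) ----> exp (S/2 + sqrt S * z)" by (rule Lim_transform_eventually[OF l])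
  qed
  show "AE z in std_normal_distribution. norm (min (exp (s n/2 + sqrt (s n) * z)) (real n)) <= exp (U/2)*(exp (sqrt U * z) + exp (- sqrt U * z))" for n
  proof (rule AE_I2)
   fix z
   have "sqrt (s n) * z <= sqrt (s n)*\<bar>z\<bar>" by (intro mult_left_mono) (use s(2) in auto)
   also have "... <= sqrt U*\<bar>z\<bar>" using U[of n] by (intro mult_right_mono) auto
   finally have "s n/2 + sqrt (s n) * z <= U/2 + sqrt U*\<bar>z\<bar>" using U[of n] by linarith
   then have "exp (s n/2 + sqrt (s n) * z) <= exp (U/2) * exp (sqrt U*\<bar>z\<bar>)" by (simp add: exp_add[symmetric])
   also have "... <= exp (U/2)*(exp (sqrt U * z) + exp (- sqrt U * z))" by (intro mult_left_mono) (auto simp: abs_if)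
   finally show "norm (min (exp (s n/2 + sqrt (s n) * z)) (real n)) <= exp (U/2)*(exp (sqrt U * z) + exp (- sqrt U * z))" by simp
  qed
  show "integrable std_normal_distribution (%z. exp (U/2)*(exp (sqrt U * z) + exp (- sqrt U * z)))"
   by (intro integrable_mult_right Bochner_Integration.integrable_add normal_exp_moment)
 qed auto
 also have "(LINT z|std_normal_distribution. exp (S/2 + sqrt S * z)) = exp (S/2)*(LINT z|std_normal_distribution. exp (sqrt S * z))"
  by (simp add: exp_add)
 also have "... = exp S" unfolding normal_exp_moment using S by (simp add: exp_add[symmetric])
 finally show ?thesis .
qed

section \<open>Score, curvature and gauge invariance\<close>

context nice_density
begin

text \<open>The terms of first and second order in the expansion of the ratio \<open>r (\<delta> N)\<close>.\<close>
definition "score N x = - \<delta> N * f1 x"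
definition "curv N x = (\<delta> N)^2/2 * f2 x"
definition "shifted N = distr \<nu> borel (%x. x + \<delta> N)"
text \<open>A common bound for the fourth moments of \<open>f1\<close> and \<open>f2\<close> under the original and all the shifted laws.\<close>
definition "U = (LINT x|\<nu>. C^4*(1 + sqrt \<omega> + \<bar>x\<bar>)^(m*4))"

lemma score_meas[measurable]: "score N \<in> borel_measurable borel" "curv N \<in> borel_measurable borel"
 unfolding score_def[abs_def] curv_def[abs_def] by measurable

lemma score_sym: "score N (- x) = - score N x" "curv N (- x) = curv N x"
 by (simp_all add: score_def curv_def f_sym)

lemma shifted_prob: "prob_space (shifted N)" "sets (shifted N) = sets borel"
 unfolding shifted_def by (auto intro: nu.prob_space_distr)

lemma integral_shifted: "h \<in> borel_measurable borel ==> (LINT x|shifted N. h x) = (LINT x|\<nu>. h (x + \<delta> N))" for h :: "real => real"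
 unfolding shifted_def by (subst integral_distr) auto

lemma integrable_shifted: "h \<in> borel_measurable borel ==> integrable (shifted N) h \<longleftrightarrow> integrable \<nu> (%x. h (x + \<delta> N))" for h :: "real => real"
 unfolding shifted_def by (subst integrable_distr_eq) auto

lemma U0: "0 <= U" unfolding U_def using C0 om by (intro Bochner_Integration.integral_nonneg) simp

lemma fourth:
 assumes "f = f1 \<or> f = f2"
 shows "integrable \<nu> (%x. f x^4)" "(LINT x|\<nu>. f x^4) <= U"
  "integrable \<nu> (%x. f (x + \<delta> N)^4)" "(LINT x|\<nu>. f (x + \<delta> N)^4) <= U"
  "(%N. LINT x|\<nu>. (f (x + \<delta> N))^2) ----> (LINT x|\<nu>. (f x)^2)"
proof -
 have bd: "\<bar>f x\<bar> <= C*(1 + \<bar>x\<bar>)^m" for x using assms f1_bd f2_bd by auto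
 have cf: "continuous_on UNIV f" using assms cont_f by auto
 have c4: "continuous_on UNIV (%x. f x^4)" and c2: "continuous_on UNIV (%x. f x^2)" using cf by (auto intro!: continuous_intros)
 have b4: "\<bar>f x^4\<bar> <= C^4*(1 + \<bar>x\<bar>)^(m*4)" and b2: "\<bar>f x^2\<bar> <= C^2*(1 + \<bar>x\<bar>)^(m*2)" for x
  by (rule pow_bd[OF bd])+
 note s4 = shift_limit[OF c4 b4] and s2 = shift_limit[OF c2 b2]
 show i: "integrable \<nu> (%x. f x^4)" using assms int_f[of 4] by auto
 show "integrable \<nu> (%x. f (x + \<delta> N)^4)" using s4(2) C0 by simp
 show "(LINT x|\<nu>. f (x + \<delta> N)^4) <= U" using s4(3)[of N] C0 unfolding U_def by simp
 have pt: "f x^4 <= C^4*(1 + sqrt \<omega> + \<bar>x\<bar>)^(m*4)" for x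
 proof -
  have "f x^4 <= C^4*(1 + \<bar>x\<bar>)^(m*4)" using b4[of x] by linarith
  also have "... <= C^4*(1 + sqrt \<omega> + \<bar>x\<bar>)^(m*4)" using C0 om by (intro mult_left_mono power_mono) auto
  finally show ?thesis .
 qed
 show "(LINT x|\<nu>. f x^4) <= U" unfolding U_def using i pt int_poly by (intro integral_mono) auto
 show "(%N. LINT x|\<nu>. (f (x + \<delta> N))^2) ----> (LINT x|\<nu>. (f x)^2)" using s2(1) C0 by simp
qed

lemma \<delta>_pow4: "0 < N ==> \<delta> N^4 = (\<omega>/real N)^2"
proof -
 have "(\<delta> N)^2 = \<omega>/real N" using om by (simp add: \<delta>_def)
 then have "((\<delta> N)^2)^2 = (\<omega>/real N)^2" by simp
 then show ?thesis by (simp flip: power_mult)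
qed

lemma score_fourth:
 assumes N: "0 < N" and U': "(LINT x|\<nu>. f1 (x + d)^4) <= U"
 shows "(LINT x|\<nu>. score N (x + d)^4) <= (\<omega>*(1 + U)/real N)^2"
proof -
 have "(LINT x|\<nu>. score N (x + d)^4) = (\<omega>/real N)^2*(LINT x|\<nu>. f1 (x + d)^4)"
  unfolding \<delta>_pow4[OF N, symmetric] by (simp add: score_def power_mult_distrib)
 also have "... <= (\<omega>/real N)^2*(1 + U)^2"
 proof (intro mult_left_mono order_trans[OF U'])
  have "U <= 1 + 2 * U + U^2" using U0 by simp
  then show "U <= (1 + U)^2" by (simp add: power2_sum)
 qed simp
 also have "... = (\<omega>*(1 + U)/real N)^2" by (simp add: power_mult_distrib[symmetric])
 finally show ?thesis .
qed

lemma curv_fourth: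
 assumes N: "0 < N" and U': "(LINT x|\<nu>. f2 (x + d)^4) <= U"
 shows "(LINT x|\<nu>. curv N (x + d)^4) <= (\<omega>^2*(1 + U)/(real N)^2)^2"
proof -
 have e: "((\<delta> N)^2/2)^4 = (\<omega>/real N)^4/16"
 proof -
  have "((\<delta> N)^2)^4 = (\<delta> N^4)^2" by (simp add: power_mult[symmetric])
  then show ?thesis unfolding \<delta>_pow4[OF N] by (simp add: power_divide flip: power_mult)
 qed
 have "(LINT x|\<nu>. curv N (x + d)^4) = (\<omega>/real N)^4/16*(LINT x|\<nu>. f2 (x + d)^4)"
  unfolding e[symmetric] by (simp add: curv_def power_mult_distrib[of "_/2"] del: times_divide_eq_left)
 also have "... <= (\<omega>/real N)^4*(1 + U)^2"
 proof (intro mult_mono order_trans[OF U'])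
  have "U <= 1 + 2 * U + U^2" using U0 by simp
  then show "U <= (1 + U)^2" by (simp add: power2_sum)
 qed (use om in \<open>auto intro!: Bochner_Integration.integral_nonneg\<close>)
 also have "... = (\<omega>^2*(1 + U)/(real N)^2)^2" by (simp add: power_mult_distrib power_divide flip: power_mult)
 finally show ?thesis .
qed

lemma score_square_lim:
 assumes "(%N. LINT x|\<nu>. (f1 (x + d N))^2) ----> fisher_F q"
 shows "(%N. real N*(LINT x|\<nu>. (score N (x + d N))^2)) ----> \<omega> * fisher_F q"
proof (rule Lim_transform_eventually[OF tendsto_mult[OF tendsto_const assms]])
 show "\<forall>\<^sub>F N in sequentially. \<omega>*(LINT x|\<nu>. (f1 (x + d N))^2) = real N*(LINT x|\<nu>. (score N (x + d N))^2)"
  using eventually_gt_at_top[of 0]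
 proof eventually_elim
  case (elim N)
  have "(LINT x|\<nu>. (score N (x + d N))^2) = (\<delta> N)^2*(LINT x|\<nu>. (f1 (x + d N))^2)" by (simp add: score_def power_mult_distrib)
  then show ?case using \<delta>_sq[OF elim] by (simp add: mult.assoc[symmetric])
 qed
qed

lemma curv_square_lim:
 assumes "(%N. LINT x|\<nu>. (f2 (x + d N))^2) ----> fisher_G q"
 shows "(%N. (real N)^2*(LINT x|\<nu>. (curv N (x + d N))^2)) ----> \<omega>^2/4 * fisher_G q"
proof (rule Lim_transform_eventually[OF tendsto_mult[OF tendsto_const assms]])
 show "\<forall>\<^sub>F N in sequentially. \<omega>^2/4*(LINT x|\<nu>. (f2 (x + d N))^2) = (real N)^2*(LINT x|\<nu>. (curv N (x + d N))^2)"
  using eventually_gt_at_top[of 0]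
 proof eventually_elim
  case (elim N)
  have "(LINT x|\<nu>. (curv N (x + d N))^2) = ((\<delta> N)^2/2)^2*(LINT x|\<nu>. (f2 (x + d N))^2)"
   unfolding curv_def power_mult_distrib by (rule integral_mult_right_zero)
  moreover have "(real N)^2*((\<delta> N)^2/2)^2 = \<omega>^2/4"
   using \<delta>_pow4[OF elim] elim by (simp add: power_divide flip: power_mult)
  ultimately show ?case by (simp add: mult.assoc[symmetric])
 qed
qed

text \<open>If the Fisher information were 0, then \<open>deriv q\<close> would vanish almost everywhere, hence everywhere by continuity, and a
  constant is not a probability density on the line.\<close>
lemma fisher_pos: "0 < fisher_F q"
proof (rule ccontr)
 assume "\<not> 0 < fisher_F q"
 moreover have "0 <= fisher_F q" unfolding fisher by (intro Bochner_Integration.integral_nonneg) simp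
 ultimately have "(LINT x|\<nu>. (f1 x)^2) = 0" unfolding fisher by simp
 then have "AE x in \<nu>. (f1 x)^2 = 0"
  using int_f(1)[of 2] by (subst (asm) integral_nonneg_eq_0_iff_AE) auto
 then have "AE x in lborel. deriv q x = 0"
  unfolding \<nu>_def using pos by (subst (asm) AE_density) (auto simp: f1_def less_imp_neq[symmetric])
 moreover have cl: "closed {x. deriv q x = 0}"
  using closed_vimage[OF closed_singleton cont(2), of 0] by (simp add: vimage_def)
 ultimately have "deriv q x = 0" for x using mem_closed_if_AE_lebesgue[of "{x. deriv q x = 0}" x] by (auto intro: AE_completion)
 then have "(q has_real_derivative 0) (at x)" for x using der0[of x] by simp
 then have "q x = q 0" for x using DERIV_isconst_all by blast
 then have e: "q = (%x. q 0)" by (intro ext)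
 have "(LBINT x. q x) = 0" by (subst e) (simp add: measure_def emeasure_lborel_UNIV)
 then show False using total(2) by simp
qed

end

text \<open>The change of variables that undoes the signs of a rank-one spike. Values outside \<open>upper_indices N\<close> have to be
  \<open>undefined\<close>, as for all points of the product space.\<close>
definition gauge :: "nat => (nat => real) => (nat \<times> nat => real) => nat \<times> nat => real" where
 "gauge N \<sigma> y = (\<lambda>e\<in>upper_indices N. \<sigma> (fst e)*\<sigma> (snd e) * y e)"

text \<open>Along a path the signs of the inner vertices occur twice and cancel; those of the two ends remain.\<close>
lemma chain_gauge:
 assumes \<sigma>: "!!i. i \<in> vtxs n (insert b1 S) ==> \<sigma> i*\<sigma> i = 1"
  and Y: "!!l m. l \<in> vtxs n (insert b1 S) ==> m \<in> vtxs n (insert b1 S) ==> Y' l m = \<sigma> l*\<sigma> m * Y l m"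
  and l: "l \<in> vtxs n (insert b1 S)"
 shows "chain Y' n b1 (%l j. if l = j then 1 else 0) k S l j = \<sigma> l*\<sigma> j * chain Y n b1 (%l j. if l = j then 1 else 0) k S l j"
 using assms
proof (induction k arbitrary: S l)
 case 0 then show ?case by auto
next
 case (Suc k)
 have sub: "vtxs n (insert b1 (S - {blk n l})) \<subseteq> vtxs n (insert b1 S)" by (auto simp: vtxs_def)
 have "Y' l x * chain Y' n b1 (%l j. if l = j then 1 else 0) k (S - {blk n l}) x j
    = \<sigma> l*\<sigma> j*(Y l x * chain Y n b1 (%l j. if l = j then 1 else 0) k (S - {blk n l}) x j)"
  if x: "x \<in> vtxs n (insert b1 (S - {blk n l}))" for x
 proof -
  have ih: "chain Y' n b1 (%l j. if l = j then 1 else 0) k (S - {blk n l}) x j = \<sigma> x*\<sigma> j * chain Y n b1 (%l j. if l = j then 1 else 0) k (S - {blk n l}) x j"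
   by (rule Suc.IH) (use Suc.prems(1,2) sub x in \<open>meson subsetD\<close>)+
  have "\<sigma> x*\<sigma> x = 1" "Y' l x = \<sigma> l*\<sigma> x * Y l x" using Suc.prems sub x by blast+
  then show ?thesis unfolding ih by (simp add: mult_ac)
 qed
 then show ?case using Suc.prems(1)[OF Suc.prems(3)] by (auto simp: sum_distrib_left)
qed

lemma rowsum_gauge:
 assumes \<sigma>: "!!i. i \<in> vtxs n (insert b1 S) ==> \<sigma> i*\<sigma> i = 1"
  and Y: "!!l m. l \<in> vtxs n (insert b1 S) ==> m \<in> vtxs n (insert b1 S) ==> Y' l m = \<sigma> l*\<sigma> m * Y l m"
  and S': "S' \<subseteq> insert b1 S" and i: "!!m. m \<in> vtxs n S' ==> Y' i m = \<sigma> i*\<sigma> m * Y i m"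
 shows "rowsum Y' n b1 (%l j. if l = j then 1 else 0) k S S' i j = \<sigma> i*\<sigma> j * rowsum Y n b1 (%l j. if l = j then 1 else 0) k S S' i j"
 unfolding rowsum_def sum_distrib_left
proof (intro sum.cong refl)
 fix x assume x: "x \<in> vtxs n S'"
 then have xV: "x \<in> vtxs n (insert b1 S)" using S' by (auto simp: vtxs_def)
 define c where "c = chain Y n b1 (%l j. if l = j then 1 else 0) k S x j"
 have cg: "chain Y' n b1 (%l j. if l = j then 1 else 0) k S x j = \<sigma> x*\<sigma> j * c"
  unfolding c_def by (rule chain_gauge[OF \<sigma> Y xV])
 have "(\<sigma> i*\<sigma> x * Y i x)*(\<sigma> x*\<sigma> j * c) = (\<sigma> x*\<sigma> x)*(\<sigma> i*\<sigma> j*(Y i x * c))" by (simp only: mult_ac)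
 then show "Y' i x * chain Y' n b1 (%l j. if l = j then 1 else 0) k S x j = \<sigma> i*\<sigma> j*(Y i x * chain Y n b1 (%l j. if l = j then 1 else 0) k S x j)"
  unfolding i[OF x] cg c_def[symmetric] using \<sigma>[OF xV] by simp
qed

context clt_full
begin

text \<open>The ends of a path are also the ends of the closing edge, whose odd function \<open>t\<close> contributes the same two signs again. The
  even function \<open>g\<close> and the diagonal entries do not see the signs.\<close>
lemma X_gauge:
 assumes N: "N \<ge> B" and \<sigma>: "\<sigma> \<in> signs N" and t: "!!x. t N (- x) = - t N x" and g: "!!x. g N (- x) = g N x"
 shows "X N (gauge N \<sigma> y) = X N y"
proof -
 interpret w: wigner N "n N" B "\<nu> N" "\<nu>d N" "t N" "mu N" "v N" "q N" by (rule wig[OF N])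
 have s1: "\<sigma> i*\<sigma> i = 1" if "1 <= i" "i <= N" for i using signs_sq[OF \<sigma>, of i] that by simp
 have s2: "\<sigma> i = 1 \<or> \<sigma> i = -1" if "1 <= i" "i <= N" for i using signs_val[OF \<sigma>, of i] that by simp
 have tg: "t N (\<sigma> i*\<sigma> j * x) = \<sigma> i*\<sigma> j * t N x" "g N (\<sigma> i*\<sigma> j * x) = g N x"
  if "1 <= i" "i <= N" "1 <= j" "j <= N" for i j x
  using s2[OF that(1,2)] s2[OF that(3,4)] t g by auto
 have Yg: "Y N (gauge N \<sigma> y) i j = \<sigma> i*\<sigma> j * Y N y i j" if ij: "1 <= i" "i <= N" "1 <= j" "j <= N" for i j
 proof -
  have "ent (gauge N \<sigma> y) i j = \<sigma> i*\<sigma> j * ent y i j"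
   using w.pair_in_I[OF ij] by (auto simp: ent_def gauge_def min_def max_def)
  then show ?thesis unfolding w.Y_def by (simp add: tg[OF ij])
 qed
 have bs: "bs N b b1 (gauge N \<sigma> y) = bs N b b1 y" if b: "b < B" "b1 < b" for b b1
  unfolding bs_def
 proof (intro sum.cong refl)
  fix e assume e: "e \<in> Kbb N b b1"
  then obtain i r where e': "e = (i, r)" "i \<in> vtx (n N) b1" "r \<in> vtx (n N) b" by auto
  have ri: "1 <= i" "i <= N" using w.vtx_range[OF e'(2)] b by auto
  have rr: "1 <= r" "r <= N" using w.vtx_range[OF e'(3)] b by auto
  have "b1 * n N + n N <= b * n N" using b by (metis Suc_leI add.commute mult_Suc mult_le_mono1)
  then have ir: "i <= r" using e' by (auto simp: vtx_def)
  have eu: "e \<in> upper_indices N" using ri rr ir e' by (simp add: upper_indices_def)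
  have y: "gauge N \<sigma> y e = \<sigma> i*\<sigma> r * y e" using eu e' by (simp add: gauge_def)
  have rng: "1 <= j \<and> j <= N" if "j \<in> vtxs (n N) (insert b1 (Sb b b1))" for j
   by (rule w.vtxs_range[OF that]) (use b in auto)
  have W: "Wst N b b1 (gauge N \<sigma> y) r i = \<sigma> r*\<sigma> i * Wst N b b1 y r i"
   unfolding Wst_def
  proof (rule rowsum_gauge)
   show "\<sigma> j*\<sigma> j = 1" if "j \<in> vtxs (n N) (insert b1 (Sb b b1))" for j using rng[OF that] s1 by auto
   show "Y N (gauge N \<sigma> y) l j = \<sigma> l*\<sigma> j * Y N y l j" if "l \<in> vtxs (n N) (insert b1 (Sb b b1))" "j \<in> vtxs (n N) (insert b1 (Sb b b1))" for l j
    using rng[OF that(1)] rng[OF that(2)] Yg by auto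
   show "{..<b1} \<subseteq> insert b1 (Sb b b1)" using b by auto
   show "Y N (gauge N \<sigma> y) r j = \<sigma> r*\<sigma> j * Y N y r j" if "j \<in> vtxs (n N) {..<b1}" for j
   proof -
    have "1 <= j \<and> j <= N" by (rule w.vtxs_range[OF that]) (use b in auto)
    then show ?thesis using rr Yg by auto
   qed
  qed
  have "\<sigma> i*\<sigma> r * t N (y e)*(\<sigma> r*\<sigma> i * Wst N b b1 y r i) = (\<sigma> i*\<sigma> i)*(\<sigma> r*\<sigma> r)*(t N (y e) * Wst N b b1 y r i)"
   by (simp only: mult_ac)
  then show "g N (gauge N \<sigma> y e) + t N (gauge N \<sigma> y e) * Wst N b b1 (gauge N \<sigma> y) (snd e) (fst e) = g N (y e) + t N (y e) * Wst N b b1 y (snd e) (fst e)"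
   unfolding y tg[OF ri rr] using W s1[OF ri] s1[OF rr] e' by simp
 qed
 have "a N (gauge N \<sigma> y e) = a N (y e)" if "e \<in> upper_indices N" "fst e = snd e" for e
 proof -
  have "\<sigma> (fst e)*\<sigma> (snd e) = 1" using that s1[of "fst e"] by (cases e) (auto simp: upper_indices_def)
  then show ?thesis using that by (simp add: gauge_def)
 qed
 then show ?thesis unfolding X_def Xp_def using bs by simp
qed

end

section \<open>The likelihood ratio: planted law and second moment\<close>

lemma prod_defect: "finite I ==> (!!e. e \<in> I ==> 0 <= f e \<and> f e <= 1) ==> 1 - (\<Prod>e\<in>I. f e) <= (\<Sum>e\<in>I. 1 - f e)" for f :: "'b => real"
proof (induction I rule: finite_induct)
 case (insert e I)
 have P: "(\<Prod>e\<in>I. f e) <= 1" using insert.prems by (intro prod_le_1) auto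
 have f: "0 <= f e" "f e <= 1" using insert.prems by auto
 have "0 <= (1 - f e)*(1 - (\<Prod>e\<in>I. f e))" using P f by (intro mult_nonneg_nonneg) auto
 then have "1 - f e*(\<Prod>e\<in>I. f e) <= (1 - f e) + (1 - (\<Prod>e\<in>I. f e))" by (simp add: algebra_simps)
 also have "... <= (1 - f e) + (\<Sum>e\<in>I. 1 - f e)" using insert by auto
 finally show ?case using insert.hyps by simp
qed simp

lemma upper_split: "upper_indices N = strict_upper_indices N \<union> (%k. (k, k)) ` {1..N}" "strict_upper_indices N \<inter> (%k. (k, k)) ` {1..N} = {}"
 by (auto simp: upper_indices_def strict_upper_indices_def)

lemma prod_upper: "(\<Prod>e\<in>upper_indices N. f e) = (\<Prod>(i, j)\<in>strict_upper_indices N. f (i, j))*(\<Prod>k\<in>{1..N}. f (k, k) :: real)"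
 unfolding upper_split(1) by (subst prod.union_disjoint[OF finite_strict _ upper_split(2)]) (auto simp: prod.reindex inj_on_def)

lemma card_upper: "real (card (upper_indices N)) <= (real N)^2"
proof -
 have "upper_indices N \<subseteq> {1..N} \<times> {1..N}" by (auto simp: upper_indices_def)
 from card_mono[OF _ this] have "card (upper_indices N) <= N * N" by (simp add: card_cartesian_product)
 then have "real (card (upper_indices N)) <= real (N * N)" by (rule of_nat_mono)
 then show ?thesis by (simp add: power2_eq_square)
qed

lemma ensemble_defect:
 assumes M: "prob_space \<nu>" "prob_space \<nu>d" and sets: "sets \<nu> = sets borel" "sets \<nu>d = sets borel"
  and w[measurable]: "w \<in> borel_measurable borel" "!!x. 0 <= w x \<and> w x <= (1::real)"
 shows "1 - (LINT y|ensemble N \<nu> \<nu>d. (\<Prod>e\<in>upper_indices N. w (y e))) <= (real N)^2*((LINT x|\<nu>. 1 - w x) + (LINT x|\<nu>d. 1 - w x))"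
proof -
 let ?I = "upper_indices N" and ?M = "%e::nat\<times>nat. if fst e = snd e then \<nu>d else \<nu>"
 have prob: "prob_space (?M e)" and s: "sets (?M e) = sets borel" for e using M sets by auto
 interpret product_prob_space ?M by (intro product_prob_spaceI prob)
 interpret E: prob_space "PiM ?I ?M" by (intro prob_space_PiM prob)
 have wm: "w \<in> borel_measurable (?M e)" for e unfolding measurable_cong_sets[OF s refl] by (rule w)
 have w1: "(%x. 1 - w x) \<in> borel_measurable (?M e)" for e using wm[of e] by simp
 have we: "(%y. w (y e)) \<in> borel_measurable (PiM ?I ?M)" if "e \<in> ?I" for e
  by (rule measurable_compose[OF measurable_component_singleton[OF that] wm])
 have i: "integrable (PiM ?I ?M) (%y. w (y e))" if "e \<in> ?I" for e
  using w(2) we[OF that] by (intro E.integrable_const_bound[of _ 1]) auto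
 have P: "0 <= (\<Prod>e\<in>?I. w (y e))" "(\<Prod>e\<in>?I. w (y e)) <= 1" for y
  using w(2) by (auto intro!: prod_nonneg prod_le_1)
 have iP: "integrable (PiM ?I ?M) (%y. \<Prod>e\<in>?I. w (y e))"
  using P by (intro E.integrable_const_bound[of _ 1] borel_measurable_prod we) auto
 have m: "0 <= (LINT x|\<nu>. 1 - w x)" "0 <= (LINT x|\<nu>d. 1 - w x)" using w(2) by (auto intro!: Bochner_Integration.integral_nonneg)
 have "1 - (LINT y|PiM ?I ?M. (\<Prod>e\<in>?I. w (y e))) = (LINT y|PiM ?I ?M. 1 - (\<Prod>e\<in>?I. w (y e)))"
  using iP E.prob_space by simp
 also have "... <= (LINT y|PiM ?I ?M. (\<Sum>e\<in>?I. 1 - w (y e)))"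
  using iP i w(2) by (intro integral_mono prod_defect Bochner_Integration.integrable_sum Bochner_Integration.integrable_diff) auto
 also have "... = (\<Sum>e\<in>?I. LINT y|PiM ?I ?M. 1 - w (y e))"
  using i by (intro Bochner_Integration.integral_sum Bochner_Integration.integrable_diff) auto
 also have "... = (\<Sum>e\<in>?I. LINT x|?M e. 1 - w x)"
 proof (intro sum.cong refl)
  fix e assume e: "e \<in> ?I"
  have "(LINT x|?M e. 1 - w x) = (LINT x|distr (PiM ?I ?M) (?M e) (%y. y e). 1 - w x)"
   by (subst distr_PiM_component[OF _ e]) (auto simp: prob M)
  also have "... = (LINT y|PiM ?I ?M. 1 - w (y e))"
   by (rule integral_distr[OF measurable_component_singleton[OF e] w1])
  finally show "(LINT y|PiM ?I ?M. 1 - w (y e)) = (LINT x|?M e. 1 - w x)" ..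
 qed
 also have "... <= (\<Sum>e\<in>?I. (LINT x|\<nu>. 1 - w x) + (LINT x|\<nu>d. 1 - w x))" using m by (intro sum_mono) auto
 also have "... = real (card ?I)*((LINT x|\<nu>. 1 - w x) + (LINT x|\<nu>d. 1 - w x))" by simp
 also have "... <= (real N)^2*((LINT x|\<nu>. 1 - w x) + (LINT x|\<nu>d. 1 - w x))" using m by (intro mult_right_mono card_upper) auto
 finally show ?thesis by (simp add: ensemble_def)
qed

text \<open>Both densities share the exponent \<open>m\<close>, so that they use the same window and the same notion of a good size \<open>N\<close>.\<close>
locale spiked_model = off: nice_density p C m \<omega> + dia: nice_density pd C m \<omega>
 for p pd :: "real => real" and C :: real and m :: nat and \<omega> :: real +
 assumes subcritical: "\<omega> * fisher_F p < 1"
begin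

abbreviation "\<delta> == off.\<delta>"
abbreviation "K == off.K"
abbreviation "borels N == PiM (upper_indices N) (%_. borel :: real measure)"

text \<open>\<open>E0\<close> is the law of the normalized entries under the null hypothesis; \<open>E1\<close> is the planted law for the spike with all signs
  equal to 1. In \<open>R\<close> the diagonal is treated like the other entries, the product of the two signs being 1 there.\<close>
definition base :: "nat \<times> nat => real measure" where "base e = (if fst e = snd e then dia.\<nu> else off.\<nu>)"
definition ratio :: "nat \<times> nat => real => real => real" where "ratio e = (if fst e = snd e then dia.r else off.r)"
definition "E0 N = ensemble N off.\<nu> dia.\<nu>"
definition "E1 N = ensemble N (off.shifted N) (dia.shifted N)"
definition "R N \<sigma> y = (\<Prod>e\<in>upper_indices N. ratio e (\<sigma> (fst e)*\<sigma> (snd e)*\<delta> N) (y e))" for \<sigma> :: "nat => real" and y :: "nat \<times> nat => real"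
definition "L N y = 1/2^N*(\<Sum>\<sigma>\<in>signs N. R N \<sigma> y)"
definition "window N y = (\<Prod>e\<in>upper_indices N. off.IK N (y e))"

lemma base_props: "prob_space (base e)" "sets (base e) = sets borel"
 by (auto simp: base_def off.nu.prob_space_axioms dia.nu.prob_space_axioms)

lemma E0_PiM: "E0 N = PiM (upper_indices N) base"
 unfolding E0_def ensemble_def base_def[abs_def] ..

lemma E1_PiM: "E1 N = PiM (upper_indices N) (%e. distr (base e) borel (%x. x + \<delta> N))"
 unfolding E1_def ensemble_def base_def off.shifted_def dia.shifted_def by (intro arg_cong2[where f=PiM] ext refl) simp

sublocale E0: prob_space "E0 N" for N unfolding E0_PiM by (intro prob_space_PiM base_props)
sublocale E1: prob_space "E1 N" for N
 unfolding E1_PiM by (intro prob_space_PiM prob_space.prob_space_distr base_props) (simp add: measurable_cong_sets[OF base_props(2) refl])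

lemma sets_E: "sets (E0 N) = sets (borels N)" "sets (E1 N) = sets (borels N)"
 unfolding E0_PiM E1_PiM by (auto intro!: sets_PiM_cong simp: base_props)

lemma measurable_E: "f \<in> borel_measurable (borels N) ==> f \<in> borel_measurable (E0 N)"
 "f \<in> borel_measurable (borels N) ==> f \<in> borel_measurable (E1 N)" for f :: "_ => real"
 by (simp_all only: measurable_cong_sets[OF sets_E(1) refl] measurable_cong_sets[OF sets_E(2) refl])

lemma ratio_pos: "0 < ratio e d x" using off.pos dia.pos by (simp add: ratio_def off.r_def dia.r_def)
lemma ratio_meas[measurable]: "ratio e d \<in> borel_measurable borel" by (simp add: ratio_def)

lemma R_pos: "0 < R N \<sigma> y" unfolding R_def by (intro prod_pos ratio_pos)

lemma R_meas: "R N \<sigma> \<in> borel_measurable (borels N)"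
 unfolding R_def[abs_def]
 by (intro borel_measurable_prod measurable_compose[OF measurable_component_singleton[where M="%_. borel"] ratio_meas]) auto

lemma L_pos: "0 < L N y"
proof -
 have "signs N \<noteq> {}" using card_signs[of N] by auto
 then have "0 < (\<Sum>\<sigma>\<in>signs N. R N \<sigma> y)" by (intro sum_pos R_pos) auto
 then show ?thesis by (simp add: L_def)
qed

lemma L_meas: "L N \<in> borel_measurable (borels N)"
 unfolding L_def[abs_def] by (intro borel_measurable_times borel_measurable_sum R_meas) auto

lemma window_meas: "window N \<in> borel_measurable (borels N)"
 unfolding window_def[abs_def]
 by (intro borel_measurable_prod measurable_compose[OF measurable_component_singleton]) auto

lemma window_01: "window N y = 0 \<or> window N y = 1"
proof (cases "\<exists>e\<in>upper_indices N. off.IK N (y e) = 0")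
 case True then show ?thesis by (auto simp: window_def prod_zero_iff)
next
 case False
 then have "off.IK N (y e) = 1" if "e \<in> upper_indices N" for e using that by (auto simp: indicator_def)
 then show ?thesis by (simp add: window_def)
qed

lemma sign_edge: "\<sigma> \<in> signs N ==> e \<in> upper_indices N ==> \<sigma> (fst e)*\<sigma> (snd e) = 1 \<or> \<sigma> (fst e)*\<sigma> (snd e) = - 1"
 using signs_val[of \<sigma> N "fst e"] signs_val[of \<sigma> N "snd e"] by (auto simp: upper_indices_def)

lemma gauge_meas: "gauge N \<sigma> \<in> measurable (borels N) (borels N)"
 unfolding gauge_def[abs_def]
 by (intro measurable_restrict borel_measurable_times borel_measurable_const measurable_component_singleton)

text \<open>Coordinate by coordinate, a null entry weighted with the ratio is a planted entry with the sign of the edge.\<close>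
lemma planted_law:
 assumes \<sigma>: "\<sigma> \<in> signs N"
 shows "density (E0 N) (%y. ennreal (R N \<sigma> y)) = distr (E1 N) (borels N) (gauge N \<sigma>)"
proof -
 define s where "s e = (if e \<in> upper_indices N then \<sigma> (fst e)*\<sigma> (snd e) else 1)" for e
 have s: "s e = 1 \<or> s e = -1" for e using sign_edge[OF \<sigma>, of e] by (auto simp: s_def)
 have dens: "density (base e) (%x. ennreal (ratio e (s e*\<delta> N) x)) = distr (distr (base e) borel (%x. x + \<delta> N)) borel (%x. s e * x)" for e
  unfolding base_def ratio_def using off.planted_density[OF s[of e]] dia.planted_density[OF s[of e]] by auto
 have M1: "prob_space (distr (base e) borel (%x. x + \<delta> N))" for e
  by (intro prob_space.prob_space_distr base_props) (simp add: measurable_cong_sets[OF base_props(2) refl])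
 have M2: "prob_space (distr (distr (base e) borel (%x. x + \<delta> N)) borel (%x. s e * x))" for e
  by (intro prob_space.prob_space_distr M1) simp
 have "density (E0 N) (%y. ennreal (R N \<sigma> y)) = density (PiM (upper_indices N) base) (%y. \<Prod>e\<in>upper_indices N. ennreal (ratio e (s e*\<delta> N) (y e)))"
  unfolding E0_PiM R_def s_def by (intro arg_cong2[where f=density] ext refl) (simp add: prod_ennreal ratio_pos less_imp_le)
 also have "... = PiM (upper_indices N) (%e. density (base e) (%x. ennreal (ratio e (s e*\<delta> N) x)))"
  by (intro PiM_density[symmetric] base_props) (auto simp: dens M2 measurable_cong_sets[OF base_props(2) refl])
 also have "... = PiM (upper_indices N) (%e. distr (distr (base e) borel (%x. x + \<delta> N)) borel (%x. s e * x))" unfolding dens ..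
 also have "... = distr (E1 N) (borels N) (%x. \<lambda>e\<in>upper_indices N. s e * x e)"
  unfolding E1_PiM by (intro PiM_distr M1) auto
 also have "(%x. \<lambda>e\<in>upper_indices N. s e * x e) = gauge N \<sigma>" by (auto simp: gauge_def s_def fun_eq_iff)
 finally show ?thesis .
qed

text \<open>By \<open>planted_law\<close> every sign vector contributes the same integral, as \<open>h\<close> does not depend on the signs: the likelihood
  ratio is the density of a mixture of gauge transforms of one planted law.\<close>
lemma planted_integral:
 assumes h[measurable]: "h \<in> borel_measurable (borels N)" and b: "!!y. \<bar>h y\<bar> <= b"
  and inv: "!!\<sigma> y. \<sigma> \<in> signs N ==> h (gauge N \<sigma> y) = h y"
 shows "integrable (E0 N) (%y. L N y * h y)" "(LINT y|E0 N. L N y * h y) = (LINT y|E1 N. h y)"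
proof -
 have one: "integrable (E0 N) (%y. R N \<sigma> y * h y) \<and> (LINT y|E0 N. R N \<sigma> y * h y) = (LINT y|E1 N. h y)" if \<sigma>: "\<sigma> \<in> signs N" for \<sigma>
 proof -
  have g: "gauge N \<sigma> \<in> measurable (E1 N) (borels N)" using gauge_meas measurable_cong_sets[OF sets_E(2) refl] by blast
  interpret D: prob_space "distr (E1 N) (borels N) (gauge N \<sigma>)" by (rule E1.prob_space_distr[OF g])
  have hD: "h \<in> borel_measurable (distr (E1 N) (borels N) (gauge N \<sigma>))" by simp
  have "integrable (density (E0 N) (%y. ennreal (R N \<sigma> y))) h"
   unfolding planted_law[OF \<sigma>] by (rule D.integrable_const_bound[of _ b]) (use b hD in auto)
  then have i: "integrable (E0 N) (%y. R N \<sigma> y * h y)"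
   using measurable_E(1)[OF R_meas] measurable_E(1)[OF h] R_pos by (subst (asm) integrable_real_density) (auto intro!: AE_I2 less_imp_le)
  have "(LINT y|E0 N. R N \<sigma> y * h y) = (LINT y|density (E0 N) (%y. ennreal (R N \<sigma> y)). h y)"
   using measurable_E(1)[OF R_meas] measurable_E(1)[OF h] R_pos by (subst integral_real_density) (auto intro!: AE_I2 less_imp_le)
  also have "... = (LINT y|E1 N. h (gauge N \<sigma> y))" unfolding planted_law[OF \<sigma>] by (rule integral_distr[OF g h])
  finally show ?thesis using i inv[OF \<sigma>] by simp
 qed
 have e: "L N y * h y = 1/2^N*(\<Sum>\<sigma>\<in>signs N. R N \<sigma> y * h y)" for y by (simp add: L_def sum_distrib_right)
 show "integrable (E0 N) (%y. L N y * h y)" unfolding e using one by (intro integrable_mult_right Bochner_Integration.integrable_sum) auto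
 have "(LINT y|E0 N. L N y * h y) = 1/2^N*(\<Sum>\<sigma>\<in>signs N. LINT y|E0 N. R N \<sigma> y * h y)"
  unfolding e using one by (subst integral_mult_right_zero, subst Bochner_Integration.integral_sum) auto
 also have "... = (LINT y|E1 N. h y)" using one by (simp add: card_signs)
 finally show "(LINT y|E0 N. L N y * h y) = (LINT y|E1 N. h y)" .
qed

lemma window_gauge: assumes \<sigma>: "\<sigma> \<in> signs N" shows "window N (gauge N \<sigma> y) = window N y"
 unfolding window_def
proof (intro prod.cong refl)
 fix e assume e: "e \<in> upper_indices N"
 show "off.IK N (gauge N \<sigma> y e) = off.IK N (y e)"
  using sign_edge[OF \<sigma> e] e by (auto simp: gauge_def off.IK_sym)
qed

text \<open>The product over two sign vectors factorizes over the entries, and each factor depends only on the product of the two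
  signs at the entry.\<close>
lemma replica_product:
 assumes g: "off.good N" and \<sigma>: "\<sigma> \<in> signs N" and \<tau>: "\<tau> \<in> signs N"
 shows "integrable (E0 N) (%y. window N y*(R N \<sigma> y * R N \<tau> y))"
  "(LINT y|E0 N. window N y*(R N \<sigma> y * R N \<tau> y)) =
   (dia.al N + dia.ta N)^N*(\<Prod>(i, j)\<in>strict_upper_indices N. off.al N + off.ta N*((\<sigma> i*\<tau> i)*(\<sigma> j*\<tau> j)))"
proof -
 interpret PP: product_prob_space base by (intro product_prob_spaceI base_props)
 let ?f = "%e x. off.IK N x*(ratio e (\<sigma> (fst e)*\<sigma> (snd e)*\<delta> N) x * ratio e (\<tau> (fst e)*\<tau> (snd e)*\<delta> N) x)"
 have eq: "window N y*(R N \<sigma> y * R N \<tau> y) = (\<Prod>e\<in>upper_indices N. ?f e (y e))" for y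
  by (simp add: window_def R_def prod.distrib)
 have i: "integrable (base e) (?f e)" if "e \<in> upper_indices N" for e
  unfolding base_def ratio_def using off.two_replica_integrable[OF g sign_edge[OF \<sigma> that] sign_edge[OF \<tau> that]]
   dia.two_replica_integrable[OF g sign_edge[OF \<sigma> that] sign_edge[OF \<tau> that]] by auto
 show "integrable (E0 N) (%y. window N y*(R N \<sigma> y * R N \<tau> y))"
  unfolding eq E0_PiM by (rule PP.product_integrable_prod[OF finite_upper_indices i])
 have "(LINT y|E0 N. window N y*(R N \<sigma> y * R N \<tau> y)) = (\<Prod>e\<in>upper_indices N. LINT x|base e. ?f e x)"
  unfolding eq E0_PiM by (rule PP.product_integral_prod[OF finite_upper_indices i])
 also have "... = (\<Prod>(i, j)\<in>strict_upper_indices N. LINT x|base (i, j). ?f (i, j) x)*(\<Prod>k\<in>{1..N}. LINT x|base (k, k). ?f (k, k) x)"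
  by (rule prod_upper)
 also have "(\<Prod>k\<in>{1..N}. LINT x|base (k, k). ?f (k, k) x) = (\<Prod>k\<in>{1..N}. dia.al N + dia.ta N)"
 proof (intro prod.cong refl)
  fix k assume "k \<in> {1..N}"
  then have "\<sigma> k*\<sigma> k = 1" "\<tau> k*\<tau> k = 1" using signs_sq[OF \<sigma>] signs_sq[OF \<tau>] by auto
  then show "(LINT x|base (k, k). ?f (k, k) x) = dia.al N + dia.ta N" using dia.two_replica[OF g, of 1 1] by (simp add: base_def ratio_def)
 qed
 also have "(\<Prod>(i, j)\<in>strict_upper_indices N. LINT x|base (i, j). ?f (i, j) x) = (\<Prod>(i, j)\<in>strict_upper_indices N. off.al N + off.ta N*((\<sigma> i*\<tau> i)*(\<sigma> j*\<tau> j)))"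
 proof (intro prod.cong refl, clarify)
  fix i j assume ij: "(i, j) \<in> strict_upper_indices N"
  then have u: "(i, j) \<in> upper_indices N" "i \<noteq> j" by (auto simp: upper_indices_def strict_upper_indices_def)
  show "(LINT x|base (i, j). ?f (i, j) x) = off.al N + off.ta N*((\<sigma> i*\<tau> i)*(\<sigma> j*\<tau> j))"
   using off.two_replica[OF g sign_edge[OF \<sigma> u(1)] sign_edge[OF \<tau> u(1)]] u(2) by (simp add: base_def ratio_def mult_ac)
 qed
 finally show "(LINT y|E0 N. window N y*(R N \<sigma> y * R N \<tau> y)) =
   (dia.al N + dia.ta N)^N*(\<Prod>(i, j)\<in>strict_upper_indices N. off.al N + off.ta N*((\<sigma> i*\<tau> i)*(\<sigma> j*\<tau> j)))"
  by (simp add: mult.commute)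
qed

lemma signs_translate:
 assumes \<tau>: "\<tau> \<in> signs N"
 shows "bij_betw (%\<sigma>. \<lambda>i\<in>{1..N}. \<sigma> i*\<tau> i) (signs N) (signs N)"
proof (rule bij_betw_byWitness[where f'="%\<sigma>. \<lambda>i\<in>{1..N}. \<sigma> i*\<tau> i"])
 have inv: "(\<lambda>i\<in>{1..N}. (\<lambda>i\<in>{1..N}. \<sigma> i*\<tau> i) i*\<tau> i) = \<sigma>" if "\<sigma> \<in> signs N" for \<sigma>
  using that signs_sq[OF \<tau>] by (auto simp: fun_eq_iff signs_def PiE_iff extensional_def mult.assoc restrict_def)
 show "\<forall>\<sigma>\<in>signs N. (\<lambda>i\<in>{1..N}. (\<lambda>i\<in>{1..N}. \<sigma> i*\<tau> i) i*\<tau> i) = \<sigma>" "\<forall>\<sigma>\<in>signs N. (\<lambda>i\<in>{1..N}. (\<lambda>i\<in>{1..N}. \<sigma> i*\<tau> i) i*\<tau> i) = \<sigma>"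
  using inv by auto
 have "(\<lambda>i\<in>{1..N}. \<sigma> i*\<tau> i) \<in> signs N" if "\<sigma> \<in> signs N" for \<sigma>
 proof -
  have "\<sigma> i*\<tau> i = 1 \<or> \<sigma> i*\<tau> i = -1" if "i \<in> {1..N}" for i
   using signs_val[OF \<open>\<sigma> \<in> signs N\<close> that] signs_val[OF \<tau> that] by auto
  then show ?thesis unfolding signs_def restrict_PiE_iff by blast
 qed
 then show "(%\<sigma>. \<lambda>i\<in>{1..N}. \<sigma> i*\<tau> i) ` signs N \<subseteq> signs N" "(%\<sigma>. \<lambda>i\<in>{1..N}. \<sigma> i*\<tau> i) ` signs N \<subseteq> signs N" by auto
qed

definition "avg N = (\<Sum>\<rho>\<in>signs N. \<Prod>(i, j)\<in>strict_upper_indices N. off.al N + off.ta N*(\<rho> i*\<rho> j))"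

lemma second_moment:
 assumes g: "off.good N"
 shows "integrable (E0 N) (%y. (window N y * L N y)^2)"
  "(LINT y|E0 N. (window N y * L N y)^2) = (dia.al N + dia.ta N)^N*(avg N/2^N)"
proof -
 have e: "(window N y * L N y)^2 = 1/(2^N*2^N)*(\<Sum>\<tau>\<in>signs N. \<Sum>\<sigma>\<in>signs N. window N y*(R N \<sigma> y * R N \<tau> y))" for y
 proof -
  have "(\<Sum>\<tau>\<in>signs N. \<Sum>\<sigma>\<in>signs N. window N y*(R N \<sigma> y * R N \<tau> y)) = window N y*((\<Sum>\<sigma>\<in>signs N. R N \<sigma> y)*(\<Sum>\<tau>\<in>signs N. R N \<tau> y))"
   by (subst sum.swap) (simp only: sum_product, simp only: sum_distrib_left)
  moreover have "window N y * window N y = window N y" using window_01[of N y] by auto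
  ultimately show ?thesis by (simp add: L_def power2_eq_square) (metis mult.assoc mult.left_commute)
 qed
 note ii = replica_product(1)[OF g]
 show "integrable (E0 N) (%y. (window N y * L N y)^2)"
  unfolding e by (intro integrable_mult_right Bochner_Integration.integrable_sum ii)
 let ?P = "%\<rho>. \<Prod>(i, j)\<in>strict_upper_indices N. off.al N + off.ta N*(\<rho> i*\<rho> j)"
 have inner: "(\<Sum>\<sigma>\<in>signs N. LINT y|E0 N. window N y*(R N \<sigma> y * R N \<tau> y)) = (dia.al N + dia.ta N)^N * avg N" if \<tau>: "\<tau> \<in> signs N" for \<tau>
 proof -
  have "(\<Sum>\<sigma>\<in>signs N. LINT y|E0 N. window N y*(R N \<sigma> y * R N \<tau> y)) = (\<Sum>\<sigma>\<in>signs N. (dia.al N + dia.ta N)^N*?P (\<lambda>i\<in>{1..N}. \<sigma> i*\<tau> i))"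
  proof (intro sum.cong refl)
   fix \<sigma> assume \<sigma>: "\<sigma> \<in> signs N"
   have "?P (\<lambda>i\<in>{1..N}. \<sigma> i*\<tau> i) = (\<Prod>(i, j)\<in>strict_upper_indices N. off.al N + off.ta N*((\<sigma> i*\<tau> i)*(\<sigma> j*\<tau> j)))"
    by (intro prod.cong refl) (auto simp: strict_upper_indices_def)
   then show "(LINT y|E0 N. window N y*(R N \<sigma> y * R N \<tau> y)) = (dia.al N + dia.ta N)^N*?P (\<lambda>i\<in>{1..N}. \<sigma> i*\<tau> i)"
    unfolding replica_product(2)[OF g \<sigma> \<tau>] by simp
  qed
  also have "... = (dia.al N + dia.ta N)^N*(\<Sum>\<sigma>\<in>signs N. ?P (\<lambda>i\<in>{1..N}. \<sigma> i*\<tau> i))" by (simp only: sum_distrib_left)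
  also have "(\<Sum>\<sigma>\<in>signs N. ?P (\<lambda>i\<in>{1..N}. \<sigma> i*\<tau> i)) = avg N"
   unfolding avg_def by (rule sum.reindex_bij_betw[OF signs_translate[OF \<tau>], of ?P])
  finally show ?thesis .
 qed
 have "(LINT y|E0 N. (window N y * L N y)^2) = 1/(2^N*2^N)*(\<Sum>\<tau>\<in>signs N. \<Sum>\<sigma>\<in>signs N. LINT y|E0 N. window N y*(R N \<sigma> y * R N \<tau> y))"
 proof -
  have "(LINT y|E0 N. (\<Sum>\<tau>\<in>signs N. \<Sum>\<sigma>\<in>signs N. window N y*(R N \<sigma> y * R N \<tau> y))) = (\<Sum>\<tau>\<in>signs N. \<Sum>\<sigma>\<in>signs N. LINT y|E0 N. window N y*(R N \<sigma> y * R N \<tau> y))"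
   using ii by (subst Bochner_Integration.integral_sum, auto intro!: Bochner_Integration.integrable_sum sum.cong) 
  then show ?thesis unfolding e by simp
 qed
 also have "... = 1/(2^N*2^N)*(\<Sum>\<tau>\<in>signs N. (dia.al N + dia.ta N)^N * avg N)"
  using inner by simp
 also have "... = (dia.al N + dia.ta N)^N*(avg N/2^N)" by (simp add: card_signs)
 finally show "(LINT y|E0 N. (window N y * L N y)^2) = (dia.al N + dia.ta N)^N*(avg N/2^N)" .
qed

lemma exp_rho: "exp (\<omega> * fisher_F pd)*(exp (\<omega>^2/4 * fisher_G p/2 - (\<omega> * fisher_F p)^2/4 - \<omega> * fisher_F p/2)/sqrt (1 - \<omega> * fisher_F p)) = exp (2 * rho p pd \<omega>)"
proof -
 have c: "0 < 1 - \<omega> * fisher_F p" using subcritical by simp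
 have "1/sqrt (1 - \<omega> * fisher_F p) = exp (- ln (1 - \<omega> * fisher_F p)/2)"
  using c by (simp add: exp_minus ln_sqrt[symmetric] inverse_eq_divide)
 then have h: "exp b/sqrt (1 - \<omega> * fisher_F p) = exp (b + - ln (1 - \<omega> * fisher_F p)/2)" for b
  unfolding exp_add by (metis times_divide_eq_right mult.right_neutral)
 have "2 * rho p pd \<omega> = \<omega> * fisher_F pd + ((\<omega>^2/4 * fisher_G p/2 - (\<omega> * fisher_F p)^2/4 - \<omega> * fisher_F p/2) + - ln (1 - \<omega> * fisher_F p)/2)"
  by (simp add: rho_def field_simps power2_eq_square)
 then show ?thesis unfolding h exp_add[symmetric] by simp
qed

text \<open>Write \<open>x N\<close> for the ratio of \<open>ta\<close> to \<open>al\<close>, which is approximately \<open>c / N\<close>. The replica average then has the limit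
  \<open>exp (\<omega>^2 / 8 * fisher_G p - c^2 / 4 - c / 2) / sqrt (1 - c)\<close>, and the diagonal entries contribute the factor
  \<open>exp (\<omega> * fisher_F pd)\<close>. Only the second moment on the window is bounded: outside it the ratios need not have one.\<close>
lemma second_moment_limit:
 obtains V where "V ----> exp (2 * rho p pd \<omega>)" "\<forall>\<^sub>F N in sequentially. (LINT y|E0 N. (window N y * L N y)^2) <= V N"
proof -
 define c where "c = \<omega> * fisher_F p"
 have c1: "c < 1" using subcritical by (simp add: c_def)
 define x where "x N = off.ta N/off.al N" for N
 have xlim: "(%N. real N * x N) ----> c"
  using tendsto_divide[OF off.lim_ta off.lim_al] by (simp add: x_def c_def)
 have x0: "x ----> 0"
 proof (rule Lim_transform_eventually)
  show "(%N. real N * x N*(1/real N)) ----> 0" using tendsto_mult[OF xlim lim_1_over_n] by simp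
  show "\<forall>\<^sub>F N in sequentially. real N * x N*(1/real N) = x N" using eventually_gt_at_top[of 0] by eventually_elim simp
 qed
 define D where "D N = exp (real N * dia.be N + real N * dia.ta N)" for N
 define A where "A N = exp ((real N)^2 * off.be N/2 - (real N * x N)^2/4 + real N * x N * x N/4 + (real N * x N)^2 * x N/2 - real N * x N/2)/sqrt (1 - real N * x N)" for N
 have "A ----> exp (\<omega>^2/4 * fisher_G p/2 - c^2/4 + c*0/4 + c^2*0/2 - c/2)/sqrt (1 - c)"
  unfolding A_def using c1 by (intro tendsto_intros off.lim_be xlim x0) auto
 moreover have "D ----> exp (0 + \<omega> * fisher_F pd)"
  unfolding D_def
 proof (intro tendsto_exp tendsto_add dia.lim_ta)
  have "(%N. (real N)^2 * dia.be N*(1/real N)) ----> 0" using tendsto_mult[OF dia.lim_be lim_1_over_n] by simp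
  moreover have "(real N)^2 * dia.be N*(1/real N) = real N * dia.be N" for N by (simp add: power2_eq_square)
  ultimately show "(%N. real N * dia.be N) ----> 0" by simp
 qed
 ultimately have V: "(%N. D N * A N) ----> exp (2 * rho p pd \<omega>)"
  unfolding exp_rho[symmetric] c_def[symmetric] by (intro tendsto_eq_intros) auto
 have "\<forall>\<^sub>F N in sequentially. 0 < off.al N" using order_tendstoD(1)[OF off.lim_al, of 0] by simp
 moreover have "\<forall>\<^sub>F N in sequentially. x N < 1/2" using order_tendstoD(2)[OF x0, of "1/2"] by simp
 moreover have "\<forall>\<^sub>F N in sequentially. real N * x N < 1" using order_tendstoD(2)[OF xlim c1] .
 ultimately have "\<forall>\<^sub>F N in sequentially. (LINT y|E0 N. (window N y * L N y)^2) <= D N * A N"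
  using off.good
 proof eventually_elim
  case (elim N)
  note g = elim(4)
  have "avg N <= 2^N * exp ((real N)^2/2 * off.be N - real N*(real N - 1)/4*(x N)^2 + (real N)^2/2 * x N^3 - real N * x N/2)/sqrt (1 - real N * x N)"
   unfolding avg_def x_def
   by (rule replica_average_bound) (use elim off.ta_nonneg off.be_nonneg off.al_le[OF g] in \<open>auto simp: x_def\<close>)
  also have "(real N)^2/2 * off.be N - real N*(real N - 1)/4*(x N)^2 + (real N)^2/2 * x N^3 - real N * x N/2
    = (real N)^2 * off.be N/2 - (real N * x N)^2/4 + real N * x N * x N/4 + (real N * x N)^2 * x N/2 - real N * x N/2"
   by (simp add: power2_eq_square power3_eq_cube field_simps)
  finally have av: "avg N/2^N <= A N" unfolding A_def by (simp add: field_simps)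
  have t0: "0 <= dia.al N + dia.ta N"
   unfolding dia.al_def dia.ta_def by (intro add_nonneg_nonneg Bochner_Integration.integral_nonneg) auto
  have "dia.al N + dia.ta N <= 1 + (dia.be N + dia.ta N)" using dia.al_le[OF g] by simp
  also have "... <= exp (dia.be N + dia.ta N)" by (rule exp_ge_add_one_self)
  finally have "(dia.al N + dia.ta N)^N <= exp (dia.be N + dia.ta N)^N" using t0 by (rule power_mono)
  also have "... = D N" unfolding D_def by (simp add: exp_of_nat_mult[symmetric] distrib_left)
  finally have d: "(dia.al N + dia.ta N)^N <= D N" .
  have "0 <= (LINT y|E0 N. (window N y * L N y)^2)" by (intro Bochner_Integration.integral_nonneg) simp
  have A0: "0 <= A N" using elim by (simp add: A_def)
  have "(dia.al N + dia.ta N)^N*(avg N/2^N) <= (dia.al N + dia.ta N)^N * A N" using av t0 by (intro mult_left_mono) auto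
  also have "... <= D N * A N" using d A0 by (rule mult_right_mono)
  finally show ?case unfolding second_moment(2)[OF g] .
 qed
 with V show ?thesis by (rule that)
qed

end

section \<open>Approximation by the cycle statistic\<close>

lemma isCont_cts_step: "a < b ==> isCont (cts_step a b) x"
 using uniformly_continuous_imp_continuous[OF cts_step_uniformly_continuous[of a b]] by (simp add: continuous_on_eq_continuous_at)

lemma cts_step_bounds: "0 <= cts_step a b x" "cts_step a b x <= 1"
 by (auto simp: cts_step_def divide_simps)

lemma cts_step_meas[measurable]: "cts_step a b \<in> borel_measurable borel"
 unfolding cts_step_def[abs_def] by measurable

context spiked_model
begin

text \<open>The variance of the cycle statistic with \<open>B\<close> blocks, and at the same time its mean under the planted law.\<close>
definition "block_var B = \<omega> * fisher_F pd + (\<Sum>b<B. \<Sum>b1<b. (\<omega>^2/4 * fisher_G p)/(real B)^2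
  + \<omega> * fisher_F p/real B*(\<omega> * fisher_F p/real B*(real b1 * lim_sq (\<omega> * fisher_F p/real B) B (b - 1))))"

definition "Qc = \<omega>*(1 + off.U)"
definition "Rc = \<omega>^2*(1 + off.U) + \<omega>*(1 + dia.U)"

lemma QR_nonneg: "0 <= Qc" "0 <= Rc"
 using off.U0 dia.U0 off.om by (auto simp: Qc_def Rc_def)

lemma R_bounds:
 "(\<omega>^2*(1 + off.U)/(real N)^2)^2 <= (Rc/(real N)^2)^2" "(\<omega>*(1 + dia.U)/real N)^2 <= (Rc/real N)^2"
 using off.U0 dia.U0 off.om by (auto intro!: power_mono divide_right_mono simp: Rc_def)

text \<open>Under the null law the score and the curvature are centred.\<close>
lemma null_array:
 assumes "0 < B"
 shows "clt_full B (%_. off.\<nu>) (%_. dia.\<nu>) off.score 0 (\<omega> * fisher_F p) Qc off.curv dia.score 0 (\<omega>^2/4 * fisher_G p) 0 (\<omega> * fisher_F pd) Rc"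
proof (intro clt_full.intro clt_array.intro clt_full_axioms.intro)
 note s4 = off.score_fourth[where d=0, simplified, OF _ off.fourth(2)] and g4 = off.curv_fourth[where d=0, simplified, OF _ off.fourth(2)]
  and a4 = dia.score_fourth[where d=0, simplified, OF _ dia.fourth(2)]
 show "0 < B" by fact
 show "prob_space off.\<nu>" "prob_space dia.\<nu>" "sets off.\<nu> = sets borel" "sets dia.\<nu> = sets borel"
  by (auto simp: off.nu.prob_space_axioms dia.nu.prob_space_axioms)
 show "integrable off.\<nu> (%x. off.score N x^4)" for N
  unfolding off.score_def power_mult_distrib by (intro integrable_mult_right off.fourth(1)) simp
 show "integrable off.\<nu> (%x. off.curv N x^4)" for N
  unfolding off.curv_def power_mult_distrib by (intro integrable_mult_right off.fourth(1)) simp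
 show "integrable dia.\<nu> (%x. dia.score N x^4)" for N
  unfolding dia.score_def power_mult_distrib by (intro integrable_mult_right dia.fourth(1)) simp
 show "(%N. real N*(LINT x|off.\<nu>. off.score N x)) ----> 0" by (simp add: off.score_def off.mean_f1)
 show "(%N. (real N)^2*(LINT x|off.\<nu>. off.curv N x)) ----> 0"
  unfolding off.curv_def integral_mult_right_zero off.mean_f2 by simp
 show "(%N. real N*(LINT x|dia.\<nu>. dia.score N x)) ----> 0" by (simp add: dia.score_def dia.mean_f1)
 show "(%N. real N*(LINT x|off.\<nu>. (off.score N x)^2)) ----> \<omega> * fisher_F p"
  using off.score_square_lim[of "%_. 0"] by (simp add: off.fisher)
 show "(%N. (real N)^2*(LINT x|off.\<nu>. (off.curv N x)^2)) ----> \<omega>^2/4 * fisher_G p"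
  using off.curv_square_lim[of "%_. 0"] by (simp add: off.fisher)
 show "(%N. real N*(LINT x|dia.\<nu>. (dia.score N x)^2)) ----> \<omega> * fisher_F pd"
  using dia.score_square_lim[of "%_. 0"] by (simp add: dia.fisher)
 show "(LINT x|off.\<nu>. off.score N x^4) <= (Qc/real N)^2" if "0 < N" for N using s4[OF that] by (simp add: Qc_def)
 show "(LINT x|off.\<nu>. off.curv N x^4) <= (Rc/(real N)^2)^2" if "0 < N" for N by (rule order_trans[OF g4[OF that] R_bounds(1)]) simp
 show "(LINT x|dia.\<nu>. dia.score N x^4) <= (Rc/real N)^2" if "0 < N" for N by (rule order_trans[OF a4[OF that] R_bounds(2)]) simp
qed (use QR_nonneg in auto)

text \<open>Under the planted law the score of an off-diagonal entry has a mean of the size of its variance, and so do the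
  other two functions. This makes the mean of the statistic equal to its variance, as it must be for contiguous laws.\<close>
lemma planted_array:
 assumes "0 < B"
 shows "clt_full B off.shifted dia.shifted off.score (\<omega> * fisher_F p) (\<omega> * fisher_F p) Qc off.curv dia.score
  (\<omega>^2/4 * fisher_G p) (\<omega>^2/4 * fisher_G p) (\<omega> * fisher_F pd) (\<omega> * fisher_F pd) Rc"
proof (intro clt_full.intro clt_array.intro clt_full_axioms.intro)
 have im: "(%x. off.score N x^4) \<in> borel_measurable borel" "(%x. off.curv N x^4) \<in> borel_measurable borel"
  "(%x. dia.score N x^4) \<in> borel_measurable borel" "(%x. (off.score N x)^2) \<in> borel_measurable borel"
  "(%x. (off.curv N x)^2) \<in> borel_measurable borel" "(%x. (dia.score N x)^2) \<in> borel_measurable borel" for N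
  by measurable
 show "0 < B" by fact
 show "prob_space (off.shifted N)" "prob_space (dia.shifted N)" "sets (off.shifted N) = sets borel" "sets (dia.shifted N) = sets borel" for N
  by (simp_all only: off.shifted_prob dia.shifted_prob)
 show "integrable (off.shifted N) (%x. off.score N x^4)" for N
  unfolding off.integrable_shifted[OF im(1)] unfolding off.score_def power_mult_distrib by (intro integrable_mult_right off.fourth(3)) simp
 show "integrable (off.shifted N) (%x. off.curv N x^4)" for N
  unfolding off.integrable_shifted[OF im(2)] unfolding off.curv_def power_mult_distrib by (intro integrable_mult_right off.fourth(3)) simp
 show "integrable (dia.shifted N) (%x. dia.score N x^4)" for N
  unfolding dia.integrable_shifted[OF im(3)] unfolding dia.score_def power_mult_distrib by (intro integrable_mult_right dia.fourth(3)) simp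
 show "(%N. real N*(LINT x|off.shifted N. off.score N x)) ----> \<omega> * fisher_F p"
  unfolding off.integral_shifted[OF off.score_meas(1)] unfolding off.score_def by (rule off.score_shift_mean)
 show "(%N. (real N)^2*(LINT x|off.shifted N. off.curv N x)) ----> \<omega>^2/4 * fisher_G p"
  unfolding off.integral_shifted[OF off.score_meas(2)] unfolding off.curv_def by (rule off.curvature_shift_mean)
 show "(%N. real N*(LINT x|dia.shifted N. dia.score N x)) ----> \<omega> * fisher_F pd"
  unfolding dia.integral_shifted[OF dia.score_meas(1)] unfolding dia.score_def by (rule dia.score_shift_mean)
 show "(%N. real N*(LINT x|off.shifted N. (off.score N x)^2)) ----> \<omega> * fisher_F p"
  unfolding off.integral_shifted[OF im(4)] by (rule off.score_square_lim) (use off.fourth(5)[of off.f1] in \<open>simp add: off.fisher\<close>)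
 show "(%N. (real N)^2*(LINT x|off.shifted N. (off.curv N x)^2)) ----> \<omega>^2/4 * fisher_G p"
  unfolding off.integral_shifted[OF im(5)] by (rule off.curv_square_lim) (use off.fourth(5)[of off.f2] in \<open>simp add: off.fisher\<close>)
 show "(%N. real N*(LINT x|dia.shifted N. (dia.score N x)^2)) ----> \<omega> * fisher_F pd"
  unfolding dia.integral_shifted[OF im(6)] by (rule dia.score_square_lim) (use dia.fourth(5)[of dia.f1] in \<open>simp add: dia.fisher\<close>)
 show "(LINT x|off.shifted N. off.score N x^4) <= (Qc/real N)^2" if "0 < N" for N
  unfolding off.integral_shifted[OF im(1)] Qc_def by (intro off.score_fourth[OF that] off.fourth(4)) simp
 show "(LINT x|off.shifted N. off.curv N x^4) <= (Rc/(real N)^2)^2" if "0 < N" for N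
  unfolding off.integral_shifted[OF im(2)] by (intro order_trans[OF _ R_bounds(1)] off.curv_fourth[OF that] off.fourth(4)) simp
 show "(LINT x|dia.shifted N. dia.score N x^4) <= (Rc/real N)^2" if "0 < N" for N
  unfolding dia.integral_shifted[OF im(3)] by (intro order_trans[OF _ R_bounds(2)] dia.score_fourth[OF that] dia.fourth(4)) simp
qed (use QR_nonneg in auto)

lemma chaos_statistic:
 assumes B: "0 < B"
 obtains X where "!!N. B <= N ==> X N \<in> borel_measurable (borels N)"
  "!!N \<sigma> y. B <= N ==> \<sigma> \<in> signs N ==> X N (gauge N \<sigma> y) = X N y"
  "!!u. (%N. LINT y|E0 N. iexp (u * X N y)) ----> iexp (u*0) * complex_of_real (exp (- (u^2 * block_var B/2)))"
  "!!u. (%N. LINT y|E1 N. iexp (u * X N y)) ----> iexp (u * block_var B) * complex_of_real (exp (- (u^2 * block_var B/2)))"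
  "0 <= block_var B"
proof -
 interpret n: clt_full B "%_. off.\<nu>" "%_. dia.\<nu>" off.score 0 "\<omega> * fisher_F p" Qc off.curv dia.score 0 "\<omega>^2/4 * fisher_G p" 0 "\<omega> * fisher_F pd" Rc B
  by (rule null_array[OF B])
 interpret p: clt_full B off.shifted dia.shifted off.score "\<omega> * fisher_F p" "\<omega> * fisher_F p" Qc off.curv dia.score "\<omega>^2/4 * fisher_G p" "\<omega>^2/4 * fisher_G p" "\<omega> * fisher_F pd" "\<omega> * fisher_F pd" Rc B
  by (rule planted_array[OF B])
 have st: "n.stot = block_var B" "p.stot = block_var B" "p.mtot = block_var B"
  unfolding n.stot_def p.stot_def p.mtot_def n.ss_def p.ss_def p.ms_def n.fl_def p.fl_def p.hl_def block_var_def by simp_all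
 have m0: "n.mtot = 0" unfolding n.mtot_def n.ms_def n.hl_def by simp
 show thesis
 proof (rule that[of n.X])
  show "n.X N \<in> borel_measurable (borels N)" if "B <= N" for N
   using n.measurable_X[OF that] measurable_cong_sets[OF sets_E(1) refl] unfolding E0_def by blast
  show "n.X N (gauge N \<sigma> y) = n.X N y" if "B <= N" "\<sigma> \<in> signs N" for N \<sigma> y
   by (rule n.X_gauge[OF that]) (simp_all add: off.score_sym)
  show "(%N. LINT y|E0 N. iexp (u * n.X N y)) ----> iexp (u*0) * complex_of_real (exp (- (u^2 * block_var B/2)))" for u
   using n.char_limit[of u] unfolding st m0 n.cf_def E0_def .
  show "(%N. LINT y|E1 N. iexp (u * n.X N y)) ----> iexp (u * block_var B) * complex_of_real (exp (- (u^2 * block_var B/2)))" for u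
   using p.char_limit[of u] unfolding st p.cf_def E1_def .
  show "0 <= block_var B" unfolding st(1)[symmetric] n.stot_def
   by (intro add_nonneg_nonneg sum_nonneg n.ss_nonneg n.c_nonneg)
 qed
qed

lemma window_limits:
 "(%N. 1 - (LINT y|E0 N. window N y)) ----> 0" "(%N. 1 - (LINT y|E1 N. window N y)) ----> 0"
proof -
 have w: "off.IK N \<in> borel_measurable borel" "0 <= off.IK N x \<and> off.IK N x <= 1" for N x by (auto simp: indicator_def)
 have le: "(LINT y|E0 N. window N y) <= 1" "(LINT y|E1 N. window N y) <= 1" for N
 proof -
  have 1: "\<bar>window N y\<bar> <= 1" for y using window_01[of N y] by auto
  have "integrable (E0 N) (window N)" "integrable (E1 N) (window N)"
   by (rule E0.integrable_const_bound[of _ 1] E1.integrable_const_bound[of _ 1]; use 1 measurable_E[OF window_meas] in simp)+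
  then show "(LINT y|E0 N. window N y) <= 1" "(LINT y|E1 N. window N y) <= 1"
   using abs_le_D1[OF 1] by (intro E0.integral_le_const E1.integral_le_const AE_I2; simp)+
 qed
 have "(%N. (real N)^2*(LINT x|off.\<nu>. 1 - off.IK N x) + (real N)^2*(LINT x|dia.\<nu>. 1 - off.IK N x)) ----> 0 + 0"
  by (intro tendsto_add off.lim_outside dia.lim_outside)
 then have l0: "(%N. (real N)^2*((LINT x|off.\<nu>. 1 - off.IK N x) + (LINT x|dia.\<nu>. 1 - off.IK N x))) ----> 0" by (simp add: distrib_left)
 have i1: "(%x. 1 - off.IK N x) \<in> borel_measurable borel" for N by measurable
 have "(%N. (real N)^2*(LINT x|off.shifted N. 1 - off.IK N x) + (real N)^2*(LINT x|dia.shifted N. 1 - off.IK N x)) ----> 0 + 0"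
  unfolding off.integral_shifted[OF i1] dia.integral_shifted[OF i1] by (intro tendsto_add off.lim_outside_shift dia.lim_outside_shift)
 then have l1: "(%N. (real N)^2*((LINT x|off.shifted N. 1 - off.IK N x) + (LINT x|dia.shifted N. 1 - off.IK N x))) ----> 0" by (simp add: distrib_left)
 show "(%N. 1 - (LINT y|E0 N. window N y)) ----> 0"
 proof (rule tendsto_sandwich[OF _ _ tendsto_const l0]; intro always_eventually allI)
  show "0 <= 1 - (LINT y|E0 N. window N y)" for N using le(1)[of N] by simp
  show "1 - (LINT y|E0 N. window N y) <= (real N)^2*((LINT x|off.\<nu>. 1 - off.IK N x) + (LINT x|dia.\<nu>. 1 - off.IK N x))" for N
   unfolding E0_def window_def
   by (rule ensemble_defect[OF off.nu.prob_space_axioms dia.nu.prob_space_axioms off.sets_nu dia.sets_nu w])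
 qed
 show "(%N. 1 - (LINT y|E1 N. window N y)) ----> 0"
 proof (rule tendsto_sandwich[OF _ _ tendsto_const l1]; intro always_eventually allI)
  show "0 <= 1 - (LINT y|E1 N. window N y)" for N using le(2)[of N] by simp
  show "1 - (LINT y|E1 N. window N y) <= (real N)^2*((LINT x|off.shifted N. 1 - off.IK N x) + (LINT x|dia.shifted N. 1 - off.IK N x))" for N
   unfolding E1_def window_def
   by (rule ensemble_defect[OF off.shifted_prob(1) dia.shifted_prob(1) off.shifted_prob(2) dia.shifted_prob(2) w])
 qed
qed

text \<open>Expand the square of \<open>window * L - h\<close>. The mixed term is computed by \<open>planted_integral\<close>, which turns it into a mean under
  the planted law; so no joint law of \<open>L\<close> and \<open>h\<close> is needed. The window costs the probability of its complement.\<close>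
lemma L2_distance:
 assumes g: "off.good N" and b: "!!y. 0 < h y \<and> h y <= b" and h: "h \<in> borel_measurable (borels N)"
  and inv: "!!\<sigma> y. \<sigma> \<in> signs N ==> h (gauge N \<sigma> y) = h y"
  and ab: "lo < up"
 shows "\<bar>(LINT y|E0 N. cts_step lo up (ln (L N y))) - (LINT y|E0 N. cts_step lo up (ln (h y)))\<bar>
   <= (1 - (LINT y|E0 N. window N y)) + exp (- lo)/(up - lo) *
    sqrt (max 0 ((LINT y|E0 N. (window N y * L N y)^2) - 2*((LINT y|E1 N. h y) - b*(1 - (LINT y|E1 N. window N y))) + (LINT y|E0 N. (h y)^2)))"
proof -
 define Lip where "Lip = exp (- lo)/(up - lo)"
 have Lip: "0 <= Lip" using ab by (simp add: Lip_def)
 define \<phi> where "\<phi> = cts_step lo up"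
 have b0: "0 <= b" using b[of undefined] by linarith
 have m[measurable]: "L N \<in> borel_measurable (E0 N)" "window N \<in> borel_measurable (E0 N)" "h \<in> borel_measurable (E0 N)"
  "L N \<in> borel_measurable (E1 N)" "window N \<in> borel_measurable (E1 N)" "h \<in> borel_measurable (E1 N)"
  by (intro measurable_E L_meas window_meas h)+
 have p[measurable]: "\<phi> \<in> borel_measurable borel" by (simp add: \<phi>_def)
 have \<phi>1: "\<bar>\<phi> x\<bar> <= 1" for x using cts_step_bounds[of lo up x] by (simp add: \<phi>_def)
 have w01: "0 <= window N y" "window N y <= 1" for y using window_01[of N y] by auto
 have iw: "integrable (E0 N) (window N)" "integrable (E1 N) (window N)"
  using w01 by (auto intro!: E0.integrable_const_bound[of _ 1] E1.integrable_const_bound[of _ 1])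
 have i\<phi>: "integrable (E0 N) (%y. \<phi> (ln (L N y)))" "integrable (E0 N) (%y. \<phi> (ln (h y)))"
  using \<phi>1 by (auto intro!: E0.integrable_const_bound[of _ 1])
 have hb: "\<bar>h y\<bar> <= b" for y using b[of y] by simp
 have wh: "\<bar>window N y * h y\<bar> <= b" for y using window_01[of N y] hb[of y] b0 by auto
 have ih: "integrable (E0 N) h" "integrable (E1 N) h" "integrable (E0 N) (%y. (h y)^2)"
 proof -
  show "integrable (E0 N) h" "integrable (E1 N) h"
   using hb by (auto intro!: E0.integrable_const_bound[of _ b] E1.integrable_const_bound[of _ b])
  have "\<bar>(h y)^2\<bar> <= b^2" for y using power_mono[OF hb[of y], of 2] by simp
  then show "integrable (E0 N) (%y. (h y)^2)" by (intro E0.integrable_const_bound[of _ "b^2"]) auto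
 qed
 have whm: "(%y. window N y * h y) \<in> borel_measurable (borels N)" using window_meas h by (rule borel_measurable_times)
 have whi: "window N (gauge N \<sigma> y) * h (gauge N \<sigma> y) = window N y * h y" if "\<sigma> \<in> signs N" for \<sigma> y
  using window_gauge[OF that] inv[OF that] by simp
 note pl = planted_integral[OF whm wh whi]
 define D where "D y = window N y * L N y - h y" for y
 have Dsq: "(D y)^2 = (window N y * L N y)^2 - 2*(L N y*(window N y * h y)) + (h y)^2" for y
  by (simp add: D_def power2_eq_square algebra_simps)
 have iD2: "integrable (E0 N) (%y. (D y)^2)"
  unfolding Dsq using second_moment(1)[OF g] pl(1) ih(3) by simp
 have D2: "(LINT y|E0 N. (D y)^2) = (LINT y|E0 N. (window N y * L N y)^2) - 2*(LINT y|E1 N. window N y * h y) + (LINT y|E0 N. (h y)^2)"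
  unfolding Dsq using second_moment(1)[OF g] pl ih(3) by simp
 have iwh: "integrable (E1 N) (%y. window N y * h y)" using wh by (intro E1.integrable_const_bound[of _ b]) auto
 have "(LINT y|E1 N. h y) - (LINT y|E1 N. window N y * h y) = (LINT y|E1 N. h y - window N y * h y)" using iwh ih by simp
 also have "... <= (LINT y|E1 N. b*(1 - window N y))"
 proof (intro integral_mono)
  show "h y - window N y * h y <= b*(1 - window N y)" for y using window_01[of N y] b[of y] by auto
 qed (use iwh ih iw in auto)
 also have "... = b*(1 - (LINT y|E1 N. window N y))" using iw E1.prob_space[of N] by simp
 finally have w1: "(LINT y|E1 N. h y) - b*(1 - (LINT y|E1 N. window N y)) <= (LINT y|E1 N. window N y * h y)" by linarith
 have Dm: "(%y. \<bar>D y\<bar>) \<in> borel_measurable (E0 N)" unfolding D_def by measurable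
 have iD: "integrable (E0 N) (%y. \<bar>D y\<bar>)"
  by (rule E0.square_integrable_imp_integrable[OF Dm]) (use iD2 in simp)
 have "(LINT y|E0 N. \<bar>D y\<bar>)^2 <= (LINT y|E0 N. (D y)^2)"
  using E0.variance_positive[of N "%y. \<bar>D y\<bar>"] E0.variance_eq[OF iD] iD2 by simp
 also have "... <= max 0 ((LINT y|E0 N. (window N y * L N y)^2) - 2*((LINT y|E1 N. h y) - b*(1 - (LINT y|E1 N. window N y))) + (LINT y|E0 N. (h y)^2))"
  unfolding D2 by (intro max.coboundedI2 add_right_mono diff_left_mono mult_left_mono w1) simp
 finally have D1: "(LINT y|E0 N. \<bar>D y\<bar>) <= sqrt (max 0 ((LINT y|E0 N. (window N y * L N y)^2) - 2*((LINT y|E1 N. h y) - b*(1 - (LINT y|E1 N. window N y))) + (LINT y|E0 N. (h y)^2)))"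
  by (rule real_le_rsqrt)
 have pt: "\<bar>\<phi> (ln (L N y)) - \<phi> (ln (h y))\<bar> <= (1 - window N y) + Lip*\<bar>D y\<bar>" for y
  using window_01[of N y]
 proof
  assume "window N y = 0"
  moreover have "\<bar>\<phi> (ln (L N y)) - \<phi> (ln (h y))\<bar> <= 1"
   using cts_step_bounds[of lo up "ln (L N y)"] cts_step_bounds[of lo up "ln (h y)"] unfolding \<phi>_def by linarith
  moreover have "0 <= Lip*\<bar>D y\<bar>" using Lip by simp
  ultimately show ?thesis by linarith
 next
  assume w: "window N y = 1"
  show ?thesis using cts_step_ln_lipschitz[OF ab L_pos, of "h y" N y] b[of y] unfolding \<phi>_def D_def Lip_def w by simp
 qed
 have "\<bar>(LINT y|E0 N. \<phi> (ln (L N y))) - (LINT y|E0 N. \<phi> (ln (h y)))\<bar> = \<bar>LINT y|E0 N. \<phi> (ln (L N y)) - \<phi> (ln (h y))\<bar>"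
  using i\<phi> by simp
 also have "... <= (LINT y|E0 N. \<bar>\<phi> (ln (L N y)) - \<phi> (ln (h y))\<bar>)" by (rule integral_abs_bound)
 also have "... <= (LINT y|E0 N. (1 - window N y) + Lip*\<bar>D y\<bar>)" using pt i\<phi> iw iD by (intro integral_mono) auto
 also have "... = (1 - (LINT y|E0 N. window N y)) + Lip*(LINT y|E0 N. \<bar>D y\<bar>)" using iw iD E0.prob_space[of N] by simp
 also have "... <= (1 - (LINT y|E0 N. window N y)) + Lip * sqrt (max 0 ((LINT y|E0 N. (window N y * L N y)^2) - 2*((LINT y|E1 N. h y) - b*(1 - (LINT y|E1 N. window N y))) + (LINT y|E0 N. (h y)^2)))"
  by (intro add_left_mono mult_left_mono D1 Lip)
 finally show ?thesis unfolding \<phi>_def Lip_def .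
qed

text \<open>The values in the limit, for the truncation level \<open>B\<close> of the statistic \<open>exp (X - block_var B / 2)\<close>: \<open>target\<close> is the mean of the
  test function, \<open>gain\<close> the mean of the truncated statistic under the planted law.\<close>
definition "target B lo up = (LINT z|std_normal_distribution. cts_step lo up (min (sqrt (block_var B) * z - block_var B/2) (ln (real B))))"
definition "gain B = (LINT z|std_normal_distribution. min (exp (block_var B/2 + sqrt (block_var B) * z)) (real B))"

text \<open>Apply \<open>L2_distance\<close> to the truncation at \<open>B\<close> of \<open>exp (X - s / 2)\<close>, where \<open>X\<close> is the cycle statistic and \<open>s\<close> its variance. The truncation
  makes this function bounded, so that the weak convergence of \<open>X\<close> under both laws gives the limits of the means.\<close>
lemma block_approximation:
 assumes B: "0 < B" and ab: "lo < up" and \<eta>: "0 < \<eta>"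
 shows "\<forall>\<^sub>F N in sequentially. \<bar>(LINT y|E0 N. cts_step lo up (ln (L N y))) - target B lo up\<bar>
   < \<eta> + exp (- lo)/(up - lo) * sqrt (max 0 (exp (2 * rho p pd \<omega>) - 2 * gain B + exp (block_var B)))"
proof -
 obtain X where X: "!!N. B <= N ==> X N \<in> borel_measurable (borels N)"
  "!!N \<sigma> y. B <= N ==> \<sigma> \<in> signs N ==> X N (gauge N \<sigma> y) = X N y"
  "!!u. (%N. LINT y|E0 N. iexp (u * X N y)) ----> iexp (u*0) * complex_of_real (exp (- (u^2 * block_var B/2)))"
  "!!u. (%N. LINT y|E1 N. iexp (u * X N y)) ----> iexp (u * block_var B) * complex_of_real (exp (- (u^2 * block_var B/2)))"
  and s0: "0 <= block_var B" by (rule chaos_statistic[OF B]) blast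
 obtain V where V: "V ----> exp (2 * rho p pd \<omega>)" "\<forall>\<^sub>F N in sequentially. (LINT y|E0 N. (window N y * L N y)^2) <= V N"
  by (rule second_moment_limit)
 interpret sn: prob_space std_normal_distribution by (rule std_normal)
 define s where "s = block_var B"
 define Lip where "Lip = exp (- lo)/(up - lo)"
 have Lip: "0 <= Lip" using ab by (simp add: Lip_def)
 define f where "f x = min (exp (x - s/2)) (real B)" for x
 have f0: "0 < f x \<and> f x <= real B" for x using B by (simp add: f_def)
 have fc: "isCont f x" for x unfolding f_def[abs_def] by (intro continuous_intros)
 have lnf: "ln (f x) = min (x - s/2) (ln (real B))" for x
 proof (cases "exp (x - s/2) <= real B")
  case True
  then have "x - s/2 <= ln (real B)" using B by (simp add: ln_ge_iff)
  then show ?thesis using True by (simp add: f_def)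
 next
  case False
  then have "ln (real B) < x - s/2" using B by (metis exp_gt_zero ln_exp ln_less_cancel_iff not_le of_nat_0_less_iff)
  then show ?thesis using False by (simp add: f_def)
 qed
 have fm: "f \<in> borel_measurable borel" using fc by (intro borel_measurable_continuous_onI continuous_at_imp_continuous_on) auto
 have l1: "(%N. LINT y|E1 N. f (X N y)) ----> (LINT z|std_normal_distribution. f (s + sqrt s * z))"
  by (rule char_to_expectation[where ?n0.0=B and b="real B", OF E1.prob_space_axioms measurable_E(2)[OF X(1)] s0[folded s_def] X(4)[folded s_def] fc])
    (use f0 in \<open>auto simp: abs_of_pos\<close>)
 have l0: "(%N. LINT y|E0 N. (f (X N y))^2) ----> (LINT z|std_normal_distribution. (f (0 + sqrt s * z))^2)"
 proof (rule char_to_expectation[where ?n0.0=B and f="%x. (f x)^2" and b="(real B)^2", OF E0.prob_space_axioms measurable_E(1)[OF X(1)] s0[folded s_def] X(3)[folded s_def]])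
  show "isCont (%x. (f x)^2) x" for x by (intro continuous_intros fc)
  show "\<bar>(f x)^2\<bar> <= (real B)^2" for x using f0[of x] by (simp add: power_mono)
 qed
 have lt: "(%N. LINT y|E0 N. cts_step lo up (ln (f (X N y)))) ----> (LINT z|std_normal_distribution. cts_step lo up (ln (f (0 + sqrt s * z))))"
 proof (rule char_to_expectation[where ?n0.0=B and f="%x. cts_step lo up (ln (f x))" and b=1, OF E0.prob_space_axioms measurable_E(1)[OF X(1)] s0[folded s_def] X(3)[folded s_def]])
  show "isCont (%x. cts_step lo up (ln (f x))) x" for x
  proof (rule isCont_o2[where g="cts_step lo up", OF _ isCont_cts_step[OF ab]])
   show "isCont (%x. ln (f x)) x" by (rule isCont_o2[OF fc isCont_ln]) (use f0[of x] in auto)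
  qed
  show "\<bar>cts_step lo up (ln (f x))\<bar> <= 1" for x using cts_step_bounds[of lo up "ln (f x)"] by simp
 qed
 have tg: "(LINT z|std_normal_distribution. cts_step lo up (ln (f (0 + sqrt s * z)))) = target B lo up"
  unfolding lnf target_def s_def by simp
 have gn: "(LINT z|std_normal_distribution. f (s + sqrt s * z)) = gain B"
  unfolding gain_def f_def s_def by (simp add: algebra_simps)
 have J: "(LINT z|std_normal_distribution. (f (0 + sqrt s * z))^2) <= exp s"
 proof -
  have "(f (0 + sqrt s * z))^2 <= exp (- s) * exp (2 * sqrt s * z)" for z
  proof -
   have "f (0 + sqrt s * z) <= exp (sqrt s * z - s/2)" by (simp add: f_def)
   then have "(f (0 + sqrt s * z))^2 <= (exp (sqrt s * z - s/2))^2" using f0[of "0 + sqrt s * z"] by (intro power_mono) auto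
   also have "... = exp (- s) * exp (2 * sqrt s * z)" by (simp add: power2_eq_square exp_add[symmetric])
   finally show ?thesis .
  qed
  then have "(LINT z|std_normal_distribution. (f (0 + sqrt s * z))^2) <= (LINT z|std_normal_distribution. exp (- s) * exp (2 * sqrt s * z))"
   using fm by (intro integral_mono_AE sn.integrable_const_bound[of _ "(real B)^2"] integrable_mult_right normal_exp_moment AE_I2)
    (auto intro!: power_mono simp: f0 less_imp_le)
  also have "... = exp (- s) * exp ((2 * sqrt s)^2/2)" by (simp add: normal_exp_moment)
  also have "... = exp s" using s0 by (simp add: exp_add[symmetric] power_mult_distrib s_def)
  finally show ?thesis .
 qed
 define A where "A N = (1 - (LINT y|E0 N. window N y)) + Lip * sqrt (max 0 (V N - 2*((LINT y|E1 N. f (X N y)) - real B*(1 - (LINT y|E1 N. window N y))) + (LINT y|E0 N. (f (X N y))^2)))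
   + \<bar>(LINT y|E0 N. cts_step lo up (ln (f (X N y)))) - target B lo up\<bar>" for N
 have "A ----> 0 + Lip * sqrt (max 0 (exp (2 * rho p pd \<omega>) - 2*(gain B - real B*0) + (LINT z|std_normal_distribution. (f (0 + sqrt s * z))^2))) + \<bar>target B lo up - target B lo up\<bar>"
  unfolding A_def by (intro tendsto_intros tendsto_max window_limits V(1) l1[unfolded gn] l0 lt[unfolded tg])
 moreover have "0 + Lip * sqrt (max 0 (exp (2 * rho p pd \<omega>) - 2*(gain B - real B*0) + (LINT z|std_normal_distribution. (f (0 + sqrt s * z))^2))) + \<bar>target B lo up - target B lo up\<bar>
   < \<eta> + Lip * sqrt (max 0 (exp (2 * rho p pd \<omega>) - 2 * gain B + exp s))"
 proof -
  have "Lip * sqrt (max 0 (exp (2 * rho p pd \<omega>) - 2*(gain B - real B*0) + (LINT z|std_normal_distribution. (f (0 + sqrt s * z))^2))) <= Lip * sqrt (max 0 (exp (2 * rho p pd \<omega>) - 2 * gain B + exp s))"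
   using J by (intro mult_left_mono Lip real_sqrt_le_mono max.mono) auto
  then show ?thesis using \<eta> by simp
 qed
 ultimately have "\<forall>\<^sub>F N in sequentially. A N < \<eta> + Lip * sqrt (max 0 (exp (2 * rho p pd \<omega>) - 2 * gain B + exp s))"
  by (rule order_tendstoD(2))
 then show ?thesis
  using V(2) off.good eventually_ge_at_top[of B]
 proof eventually_elim
  case (elim N)
  have hm: "(%y. f (X N y)) \<in> borel_measurable (borels N)" using measurable_compose[OF X(1)[OF elim(4)] fm] .
  have "\<bar>(LINT y|E0 N. cts_step lo up (ln (L N y))) - (LINT y|E0 N. cts_step lo up (ln (f (X N y))))\<bar>
   <= (1 - (LINT y|E0 N. window N y)) + Lip *
    sqrt (max 0 ((LINT y|E0 N. (window N y * L N y)^2) - 2*((LINT y|E1 N. f (X N y)) - real B*(1 - (LINT y|E1 N. window N y))) + (LINT y|E0 N. (f (X N y))^2)))"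
   unfolding Lip_def by (rule L2_distance[OF elim(3) f0 hm _ ab]) (simp add: X(2)[OF elim(4)])
  also have "... <= (1 - (LINT y|E0 N. window N y)) + Lip *
    sqrt (max 0 (V N - 2*((LINT y|E1 N. f (X N y)) - real B*(1 - (LINT y|E1 N. window N y))) + (LINT y|E0 N. (f (X N y))^2)))"
   using elim(2) by (intro add_left_mono mult_left_mono Lip real_sqrt_le_mono max.mono) auto
  finally have "\<bar>(LINT y|E0 N. cts_step lo up (ln (L N y))) - target B lo up\<bar> <= A N" unfolding A_def by linarith
  then show ?case using elim(1) unfolding Lip_def s_def by linarith
 qed
qed

lemma block_var_limit: "block_var ----> 2 * rho p pd \<omega>"
proof -
 have c: "0 <= \<omega> * fisher_F p" "\<omega> * fisher_F p < 1" using subcritical off.fisher_pos off.om by auto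
 have "block_var ----> \<omega> * fisher_F pd + ((\<omega>^2/4 * fisher_G p)/2 + (- ln (1 - \<omega> * fisher_F p) - \<omega> * fisher_F p - (\<omega> * fisher_F p)^2/2)/2)"
  unfolding block_var_def[abs_def] by (intro tendsto_add tendsto_const variance_limit c)
 moreover have "\<omega> * fisher_F pd + ((\<omega>^2/4 * fisher_G p)/2 + (- ln (1 - \<omega> * fisher_F p) - \<omega> * fisher_F p - (\<omega> * fisher_F p)^2/2)/2) = 2 * rho p pd \<omega>"
  by (simp add: rho_def field_simps power2_eq_square)
 ultimately show ?thesis by simp
qed

text \<open>Positivity keeps the normal law in the limit from degenerating. It comes from the diagonal entries; the other
  contributions are nonnegative.\<close>
lemma rho_pos: "0 < rho p pd \<omega>"
proof -
 have c: "0 <= \<omega> * fisher_F p" "\<omega> * fisher_F p < 1" using subcritical off.fisher_pos off.om by auto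
 have "0 < \<omega> * fisher_F pd" using dia.fisher_pos off.om by simp
 moreover have "0 <= fisher_G p" unfolding off.fisher by (intro Bochner_Integration.integral_nonneg) simp
 then have "0 <= \<omega>^2/4 * fisher_G p/2" by simp
 moreover have "2 * rho p pd \<omega> = \<omega> * fisher_F pd + (\<omega>^2/4 * fisher_G p/2 + (- ln (1 - \<omega> * fisher_F p) - \<omega> * fisher_F p - (\<omega> * fisher_F p)^2/2)/2)"
  by (simp add: rho_def field_simps power2_eq_square)
 ultimately have "0 < 2 * rho p pd \<omega>"
  using log_tail_nonneg[OF c] by (simp only:) (intro add_pos_nonneg add_nonneg_nonneg divide_nonneg_pos; simp)
 then show ?thesis by simp
qed

text \<open>As \<open>B\<close> tends to infinity, \<open>block_var B\<close> and \<open>ln (gain B)\<close> tend to \<open>2 * rho p pd \<omega>\<close>; the error in \<open>block_approximation\<close> becomes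
  \<open>V - 2 * V + V\<close> with \<open>V = exp (2 * rho p pd \<omega>)\<close>, that is 0.\<close>
theorem log_likelihood_limit:
 assumes ab: "lo < up"
 shows "(%N. LINT y|E0 N. cts_step lo up (ln (L N y))) ----> (LINT z|std_normal_distribution. cts_step lo up (- rho p pd \<omega> + sqrt (2 * rho p pd \<omega>) * z))"
proof -
 interpret sn: prob_space std_normal_distribution by (rule std_normal)
 define S where "S = 2 * rho p pd \<omega>"
 define T where "T = (LINT z|std_normal_distribution. cts_step lo up (- rho p pd \<omega> + sqrt (2 * rho p pd \<omega>) * z))"
 define Lip where "Lip = exp (- lo)/(up - lo)"
 have s0: "0 <= block_var B" for B
 proof (cases "B = 0")
  case True
  then show ?thesis using dia.fisher_pos off.om by (simp add: block_var_def less_imp_le)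
 next
  case False then show ?thesis by (rule_tac chaos_statistic[of B]) auto
 qed
 have bv: "block_var ----> S" using block_var_limit by (simp add: S_def)
 have lnB: "\<forall>\<^sub>F B in sequentially. a <= ln (real B)" for a :: real
  using filterlim_compose[OF ln_at_top filterlim_real_sequentially] by (simp add: filterlim_at_top)
 have "(%B. target B lo up) ----> T"
  unfolding target_def T_def
 proof (rule integral_dominated_convergence[where w="%_. 1"])
  show "AE z in std_normal_distribution. (%B. cts_step lo up (min (sqrt (block_var B) * z - block_var B/2) (ln (real B)))) ----> cts_step lo up (- rho p pd \<omega> + sqrt (2 * rho p pd \<omega>) * z)"
  proof (rule AE_I2)
   fix z
   have l: "(%B. sqrt (block_var B) * z - block_var B/2) ----> sqrt S * z - S/2" by (intro tendsto_intros bv) simp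
   have "\<forall>\<^sub>F B in sequentially. sqrt (block_var B) * z - block_var B/2 < sqrt S * z - S/2 + 1" by (rule order_tendstoD(2)[OF l]) simp
   then have "\<forall>\<^sub>F B in sequentially. sqrt (block_var B) * z - block_var B/2 = min (sqrt (block_var B) * z - block_var B/2) (ln (real B))"
    using lnB[of "sqrt S * z - S/2 + 1"] by eventually_elim simp
   then have "(%B. min (sqrt (block_var B) * z - block_var B/2) (ln (real B))) ----> sqrt S * z - S/2" by (rule Lim_transform_eventually[OF l])
   from isCont_tendsto_compose[OF isCont_cts_step[OF ab] this]
   show "(%B. cts_step lo up (min (sqrt (block_var B) * z - block_var B/2) (ln (real B)))) ----> cts_step lo up (- rho p pd \<omega> + sqrt (2 * rho p pd \<omega>) * z)"
    by (simp add: S_def)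
  qed
  show "AE z in std_normal_distribution. norm (cts_step lo up (min (sqrt (block_var B) * z - block_var B/2) (ln (real B)))) <= 1" for B
   using cts_step_bounds by (auto intro!: AE_I2)
 qed auto
 then have tT: "(%B. target B lo up) ----> T" .
 have "gain ----> exp S"
  unfolding gain_def[abs_def] by (rule truncated_exp_limit[OF bv s0])
 then have "(%B. Lip * sqrt (max 0 (exp S - 2 * gain B + exp (block_var B)))) ----> Lip * sqrt (max 0 (exp S - 2 * exp S + exp S))"
  by (intro tendsto_intros tendsto_max bv)
 then have eL: "(%B. Lip * sqrt (max 0 (exp S - 2 * gain B + exp (block_var B)))) ----> 0" by simp
 show ?thesis unfolding T_def[symmetric]
 proof (rule tendstoI)
  fix e :: real assume e: "0 < e"
  have "\<forall>\<^sub>F B in sequentially. dist (target B lo up) T < e/3" using tendstoD[OF tT, of "e/3"] e by simp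
  moreover have "\<forall>\<^sub>F B in sequentially. Lip * sqrt (max 0 (exp S - 2 * gain B + exp (block_var B))) < e/3"
   using order_tendstoD(2)[OF eL, of "e/3"] e by simp
  moreover have "\<forall>\<^sub>F B in sequentially. (0::nat) < B" by (rule eventually_gt_at_top)
  ultimately have "\<forall>\<^sub>F B in sequentially. dist (target B lo up) T < e/3 \<and> Lip * sqrt (max 0 (exp S - 2 * gain B + exp (block_var B))) < e/3 \<and> 0 < B"
   by eventually_elim simp
  then obtain B where B: "dist (target B lo up) T < e/3" "Lip * sqrt (max 0 (exp S - 2 * gain B + exp (block_var B))) < e/3" "0 < B"
   by (auto simp: eventually_sequentially)
  have "0 < e/3" using e by simp
  from block_approximation[OF B(3) ab this]
  show "\<forall>\<^sub>F N in sequentially. dist (LINT y|E0 N. cts_step lo up (ln (L N y))) T < e"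
  proof eventually_elim
   case (elim N)
   then show ?case using B(1,2) unfolding dist_real_def Lip_def S_def by linarith
  qed
 qed
qed

end

section \<open>The log likelihood ratio of the data matrix\<close>

lemma density_from_distributed:
 assumes M: "prob_space M" and D: "distributed M lborel X (%x. ennreal (q x))"
  and q: "!!x. 0 < q x" and qm[measurable]: "q \<in> borel_measurable borel"
  and mom: "!!d. 0 < d ==> integrable M (%s. \<bar>X s\<bar> powr d)"
 shows "integrable lborel q" "(LBINT x. q x) = 1" "integrable lborel (%x. \<bar>x\<bar>^k * q x)"
proof -
 interpret prob_space M by fact
 have Xm[measurable]: "X \<in> borel_measurable M" using distributed_measurable[OF D] by simp
 have q0: "0 <= q x" for x using q[of x] by simp
 note di = distributed_integrable[OF D _ q0]
 show i: "integrable lborel q" using di[of "%_. 1"] by simp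
 show "(LBINT x. q x) = 1" using distributed_integral[OF D _ q0, of "%_. 1"] prob_space by simp
 have "integrable M (%s. \<bar>X s\<bar>^k)"
 proof (cases "k = 0")
  case False
  have "\<bar>X s\<bar> powr real k = \<bar>X s\<bar>^k" for s using False by (cases "X s = 0") (auto simp: powr_realpow)
  then show ?thesis using mom[of "real k"] False by simp
 qed simp
 then show "integrable lborel (%x. \<bar>x\<bar>^k * q x)"
  using di[of "%x. \<bar>x\<bar>^k"] by (simp add: mult.commute)
qed

text \<open>Integer powers are closed under the products that occur above, so real exponents are rounded up.\<close>
lemma powr_growth_bound:
 assumes r: "0 < r" "r <= real m" and C: "0 < C" "C <= C'"
 shows "C*(1 + \<bar>x\<bar> powr r) <= 2 * C'*(1 + \<bar>x\<bar>)^m"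
proof -
 have "\<bar>x\<bar> powr r <= (1 + \<bar>x\<bar>) powr r" using r by (intro powr_mono2) auto
 also have "... <= (1 + \<bar>x\<bar>) powr real m" using r by (intro powr_mono) auto
 also have "... = (1 + \<bar>x\<bar>)^m" by (subst powr_realpow) auto
 finally have "\<bar>x\<bar> powr r <= (1 + \<bar>x\<bar>)^m" .
 moreover have "1 <= (1 + \<bar>x\<bar>)^m" by (intro one_le_power) simp
 ultimately have "1 + \<bar>x\<bar> powr r <= 2*(1 + \<bar>x\<bar>)^m" by linarith
 then have "C*(1 + \<bar>x\<bar> powr r) <= C'*(2*(1 + \<bar>x\<bar>)^m)" using C by (intro mult_mono) auto
 then show ?thesis by simp
qed

lemma spikes_image: "rademacher_spikes N = (%\<sigma>. \<lambda>i\<in>{1..N}. \<sigma> i/sqrt (real N)) ` signs N" (is "?A = ?f ` _")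
 and spikes_inj: "inj_on (%\<sigma>. \<lambda>i\<in>{1..N}. \<sigma> i/sqrt (real N)) (signs N)"
proof -
 show "inj_on ?f (signs N)"
 proof (rule inj_onI)
  fix \<sigma> \<tau> assume st: "\<sigma> \<in> signs N" "\<tau> \<in> signs N" "?f \<sigma> = ?f \<tau>"
  show "\<sigma> = \<tau>"
  proof
   fix i show "\<sigma> i = \<tau> i"
   proof (cases "i \<in> {1..N}")
    case True
    then have "\<sigma> i/sqrt (real N) = \<tau> i/sqrt (real N)" using fun_cong[OF st(3), of i] by simp
    then show ?thesis using True by simp
   next
    case False then show ?thesis using st by (simp add: signs_def PiE_def extensional_def)
   qed
  qed
 qed
 show "?A = ?f ` signs N"
 proof
  show "?f ` signs N \<subseteq> ?A"
  proof
   fix x assume "x \<in> ?f ` signs N"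
   then obtain \<sigma> where \<sigma>: "\<sigma> \<in> signs N" "x = ?f \<sigma>" by auto
   have "\<sigma> i/sqrt (real N) \<in> {- 1/sqrt (real N), 1/sqrt (real N)}" if "i \<in> {1..N}" for i
    using signs_val[OF \<sigma>(1) that] by auto
   then show "x \<in> ?A" unfolding \<sigma>(2) rademacher_spikes_def restrict_PiE_iff by blast
  qed
  show "?A \<subseteq> ?f ` signs N"
  proof
   fix x assume x: "x \<in> ?A"
   define \<sigma> where "\<sigma> = (\<lambda>i\<in>{1..N}. x i * sqrt (real N))"
   have xi: "x i \<in> {- 1/sqrt (real N), 1/sqrt (real N)}" if "i \<in> {1..N}" for i
    using PiE_mem[OF x[unfolded rademacher_spikes_def] that] .
   have "x i * sqrt (real N) \<in> {-1, 1}" if "i \<in> {1..N}" for i using xi[OF that] that by auto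
   then have "\<sigma> \<in> signs N" unfolding \<sigma>_def signs_def restrict_PiE_iff by blast
   moreover have "x = ?f \<sigma>"
   proof
    fix i show "x i = ?f \<sigma> i"
     using x by (cases "i \<in> {1..N}") (auto simp: \<sigma>_def rademacher_spikes_def PiE_def extensional_def)
   qed
   ultimately show "x \<in> ?f ` signs N" by blast
  qed
 qed
qed

text \<open>A spike is a sign vector divided by \<open>sqrt N\<close>, which turns \<open>sqrt (\<omega> * N) * x i * x j\<close> into \<open>\<delta> N\<close> times two signs.\<close>
lemma (in spiked_model) likelihood_ratio_eq:
 assumes N: "1 <= N"
 shows "likelihood_ratio p pd \<omega> N M = L N (\<lambda>e\<in>upper_indices N. sqrt (real N) * M (fst e) (snd e))"
proof -
 let ?f = "%\<sigma>. \<lambda>i\<in>{1..N}. \<sigma> i/sqrt (real N)"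
 let ?y = "\<lambda>e\<in>upper_indices N. sqrt (real N) * M (fst e) (snd e)"
 have d: "sqrt (\<omega> * real N)/real N = \<delta> N"
 proof -
  have "sqrt (\<omega> * real N)/real N = sqrt \<omega>*(sqrt (real N)/real N)" by (simp add: real_sqrt_mult)
  also have "sqrt (real N)/real N = 1/sqrt (real N)" using N by (simp add: real_div_sqrt field_simps)
  finally show ?thesis by (simp add: off.\<delta>_def real_sqrt_divide)
 qed
 have term1: "sqrt (\<omega> * real N)*?f \<sigma> i*?f \<sigma> j = \<sigma> i*\<sigma> j*\<delta> N" if "i \<in> {1..N}" "j \<in> {1..N}" for \<sigma> i j
  unfolding d[symmetric] using that N by simp
 have one: "(\<Prod>(i, j)\<in>strict_upper_indices N. p (sqrt (real N) * M i j - sqrt (\<omega> * real N)*?f \<sigma> i*?f \<sigma> j)/p (sqrt (real N) * M i j)) *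
    (\<Prod>k\<in>{1..N}. pd (sqrt (real N) * M k k - sqrt (\<omega> * real N)*(?f \<sigma> k)^2)/pd (sqrt (real N) * M k k)) = R N \<sigma> ?y" if "\<sigma> \<in> signs N" for \<sigma>
  unfolding R_def prod_upper
 proof (intro arg_cong2[where f="(*)"] prod.cong refl, goal_cases)
  case (1 e)
  obtain i j where e: "e = (i, j)" by fastforce
  have ij: "i \<in> {1..N}" "j \<in> {1..N}" "(i, j) \<in> upper_indices N" "i \<noteq> j" using 1 e by (auto simp: strict_upper_indices_def upper_indices_def)
  show ?case unfolding e prod.case term1[OF ij(1,2)] using ij by (simp add: ratio_def off.r_def)
 next
  case (2 k)
  then have kk: "(k, k) \<in> upper_indices N" by (simp add: upper_indices_def)
  have "sqrt (\<omega> * real N)*(?f \<sigma> k)^2 = \<sigma> k*\<sigma> k*\<delta> N" using term1[OF 2 2, of \<sigma>] by (simp only: power2_eq_square mult.assoc)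
  then show ?case using kk by (simp add: ratio_def dia.r_def)
 qed
 show ?thesis
  unfolding likelihood_ratio_def L_def spikes_image sum.reindex[OF spikes_inj] comp_def using one by simp
qed

theorem theorem2p3:
  fixes P :: "nat \<Rightarrow> 'a measure"
    and H :: "nat \<Rightarrow> 'a \<Rightarrow> nat \<Rightarrow> nat \<Rightarrow> real"
    and p pd :: "real \<Rightarrow> real"
    and w2 \<omega> :: real
  assumes "noise_densities p pd"
    and "noise_matrices P H p pd w2"
    and "\<omega> > 0"
    and "\<omega> * fisher_F p < 1"
  shows "weak_conv_m (\<lambda>N. distr (P N) borel (\<lambda>s. ln (likelihood_ratio p pd \<omega> N (H N s))))
           (normal_law (- rho p pd \<omega>) (2 * rho p pd \<omega>))"
proof -
 have reg: "smooth_fun q \<and> (\<forall>x. 0 < q x) \<and> (\<forall>x. q (- x) = q x) \<and> (\<forall>k. (((deriv ^^ k) q) \<longlongrightarrow> 0) at_infinity)"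
  if "q = p \<or> q = pd" for q
  using assms(1) that unfolding noise_densities_def by blast
 have growth: "\<exists>C>0. \<exists>r>0. \<forall>q\<in>{p, pd}. \<forall>x. \<bar>(deriv ^^ s) q x/q x\<bar> <= C*(1 + \<bar>x\<bar> powr r)" if "1 <= s" for s
  using assms(1) that unfolding noise_densities_def by blast
 obtain C1 r1 where C1: "0 < C1" "0 < r1" "!!q x. q = p \<or> q = pd ==> \<bar>(deriv ^^ 1) q x/q x\<bar> <= C1*(1 + \<bar>x\<bar> powr r1)"
  using growth[of 1] by auto
 obtain C2 r2 where C2: "0 < C2" "0 < r2" "!!q x. q = p \<or> q = pd ==> \<bar>(deriv ^^ 2) q x/q x\<bar> <= C2*(1 + \<bar>x\<bar> powr r2)"
  using growth[of 2] by auto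
 define m where "m = nat \<lceil>max r1 r2\<rceil>"
 define C where "C = 2*(C1 + C2)"
 have m: "r1 <= real m" "r2 <= real m" unfolding m_def by linarith+
 have b1: "\<bar>deriv q x/q x\<bar> <= C*(1 + \<bar>x\<bar>)^m" if "q = p \<or> q = pd" for q x
  using C1(3)[OF that, of x] powr_growth_bound[OF C1(2) m(1) C1(1), of "C1 + C2" x] C2(1) by (simp add: C_def)
 have b2: "\<bar>deriv (deriv q) x/q x\<bar> <= C*(1 + \<bar>x\<bar>)^m" if "q = p \<or> q = pd" for q x
  using C2(3)[OF that, of x] powr_growth_bound[OF C2(2) m(2) C2(1), of "C1 + C2" x] C1(1) by (simp add: C_def numeral_2_eq_2)
 have qm: "q \<in> borel_measurable borel" if "q = p \<or> q = pd" for q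
 proof -
  have "((deriv ^^ 0) q) field_differentiable (at x)" for x using reg[OF that] unfolding smooth_fun_def by blast
  then have "isCont q x" for x by (simp add: field_differentiable_imp_continuous_at)
  then show ?thesis by (intro borel_measurable_continuous_onI continuous_at_imp_continuous_on) auto
 qed
 have PN: "prob_space (P N)" if "1 <= N" for N using assms(2) that unfolding noise_matrices_def by blast
 have ind: "prob_space.indep_vars (P N) (%_. borel) (%(i, j) s. H N s i j) (upper_indices N)" if "1 <= N" for N
  using assms(2) that unfolding noise_matrices_def by blast
 have offd: "distributed (P N) lborel (%s. sqrt (real N) * H N s i j) (%x. ennreal (p x))" if "1 <= N" "(i, j) \<in> strict_upper_indices N" for N i j
  using assms(2) that unfolding noise_matrices_def by blast
 have diad: "distributed (P N) lborel (%s. sqrt (real N) * H N s i i) (%x. ennreal (pd x))" if "1 <= N" "i \<in> {1..N}" for N i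
  using assms(2) that unfolding noise_matrices_def by blast
 have mom: "integrable (P N) (%s. \<bar>sqrt (real N) * H N s i j\<bar> powr d)" if "1 <= N" "(i, j) \<in> upper_indices N" "0 < d" for N i j d
 proof -
  have "integrable (P N) (%s. \<bar>H N s i j\<bar> powr d)"
   using assms(2) that unfolding noise_matrices_def by blast
  then show ?thesis by (simp add: abs_mult powr_mult)
 qed
 \<comment> \<open>The densities do not depend on \<open>N\<close>: one entry of a 2 by 2 matrix and one of a 1 by 1 matrix determine their moments.\<close>
 note densp = density_from_distributed[OF PN[of 2] offd[of 2 1 2] _ qm mom[of 2 1 2]]
 note densd = density_from_distributed[OF PN[of 1] diad[of 1 1] _ qm mom[of 1 1 1]]
 interpret spiked_model p pd C m \<omega>
 proof (intro spiked_model.intro spiked_model_axioms.intro nice_density.intro)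
  show "integrable lborel p" "(LBINT x. p x) = 1" "integrable lborel (%x. \<bar>x\<bar>^k * p x)" for k
   by (rule densp; use reg[of p] in \<open>simp add: strict_upper_indices_def upper_indices_def\<close>)+
  show "integrable lborel pd" "(LBINT x. pd x) = 1" "integrable lborel (%x. \<bar>x\<bar>^k * pd x)" for k
   by (rule densd; use reg[of pd] in \<open>simp add: upper_indices_def\<close>)+
  show "(deriv p \<longlongrightarrow> 0) at_infinity" using reg[of p] by (metis funpow_0 funpow_simps_right(2) comp_apply)
  show "(deriv pd \<longlongrightarrow> 0) at_infinity" using reg[of pd] by (metis funpow_0 funpow_simps_right(2) comp_apply)
 qed (use reg b1 b2 assms(3,4) in auto)
 have law: "distr (P N) (borels N) (%s. \<lambda>e\<in>upper_indices N. sqrt (real N) * H N s (fst e) (snd e)) = E0 N" if N: "1 <= N" for N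
 proof -
  interpret PP: prob_space "P N" by (rule PN[OF N])
  let ?X = "%e s. sqrt (real N) * H N s (fst e) (snd e)"
  have iv: "PP.indep_vars (%_. borel) ?X (upper_indices N)"
   using PP.indep_vars_compose2[OF ind[OF N], of "%_ x. sqrt (real N) * x" "%_. borel"] by (simp add: case_prod_unfold)
  have ne: "upper_indices N \<noteq> {}" using N by (auto simp: upper_indices_def intro!: exI[of _ 1])
  have rv: "?X e \<in> borel_measurable (P N)" if "e \<in> upper_indices N" for e
   using iv that unfolding PP.indep_vars_def by auto
  have "distr (P N) (borels N) (%s. \<lambda>e\<in>upper_indices N. ?X e s) = PiM (upper_indices N) (%e. distr (P N) borel (?X e))"
   using PP.indep_vars_iff_distr_eq_PiM'[OF ne rv] iv by simp
  also have "... = PiM (upper_indices N) base"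
  proof (intro PiM_cong refl)
   fix e assume e: "e \<in> upper_indices N"
   have "distr (P N) borel (?X e) = distr (P N) lborel (?X e)" by (intro distr_cong) auto
   also have "... = base e"
   proof (cases "fst e = snd e")
    case True
    then show ?thesis using distributed_distr_eq_density[OF diad[OF N, of "fst e"]] e
     by (cases e) (auto simp: base_def dia.\<nu>_def upper_indices_def)
   next
    case False
    then show ?thesis using distributed_distr_eq_density[OF offd[OF N, of "fst e" "snd e"]] e
     by (cases e) (auto simp: base_def off.\<nu>_def upper_indices_def strict_upper_indices_def)
   qed
   finally show "distr (P N) borel (?X e) = base e" .
  qed
  finally show ?thesis unfolding E0_PiM .
 qed
 let ?D = "%N. distr (P N) borel (%s. ln (likelihood_ratio p pd \<omega> N (H N s)))"
 have lnm: "(%y. ln (L N y)) \<in> borel_measurable (borels N)" for N using borel_measurable_ln[OF L_meas[of N]] .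
 have D: "?D N = distr (E0 N) borel (%y. ln (L N y))" if N: "1 <= N" for N
 proof -
  let ?Y = "%s. \<lambda>e\<in>upper_indices N. sqrt (real N) * H N s (fst e) (snd e)"
  have "?Y \<in> measurable (P N) (borels N)"
  proof (rule measurable_restrict)
   interpret PP: prob_space "P N" by (rule PN[OF N])
   fix e assume "e \<in> upper_indices N"
   then have "(%s. H N s (fst e) (snd e)) \<in> borel_measurable (P N)"
    using ind[OF N] unfolding PP.indep_vars_def by (auto simp: case_prod_unfold)
   then show "(%s. sqrt (real N) * H N s (fst e) (snd e)) \<in> borel_measurable (P N)" by simp
  qed
  from distr_distr[OF lnm this] show ?thesis
   unfolding law[OF N, symmetric] by (simp add: comp_def likelihood_ratio_eq[OF N])
 qed
 interpret sn: prob_space std_normal_distribution by (rule std_normal)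
 have nl: "normal_law (- rho p pd \<omega>) (2 * rho p pd \<omega>) = distr std_normal_distribution borel (%z. - rho p pd \<omega> + sqrt (2 * rho p pd \<omega>) * z)"
  using rho_pos by (intro normal_law_affine) simp
 have rl: "real_distribution (normal_law (- rho p pd \<omega>) (2 * rho p pd \<omega>))"
  unfolding nl by (intro sn.real_distribution_distr) simp
 have rD: "real_distribution (?D (Suc N))" for N
  unfolding D[of "Suc N", simplified] by (intro E0.real_distribution_distr measurable_E lnm)
 \<comment> \<open>For \<open>N = 0\<close> nothing is known about \<open>P\<close>, so the sequence is shifted by one.\<close>
 have "weak_conv_m (%N. ?D (Suc N)) (normal_law (- rho p pd \<omega>) (2 * rho p pd \<omega>))"
 proof (rule integral_cts_step_conv_imp_weak_conv[OF rD rl])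
  fix lo up :: real assume ab: "lo < up"
  have "integral\<^sup>L (?D (Suc N)) (cts_step lo up) = (LINT y|E0 (Suc N). cts_step lo up (ln (L (Suc N) y)))" for N
   unfolding D[of "Suc N", simplified] by (intro integral_distr measurable_E lnm) simp
  moreover have "integral\<^sup>L (normal_law (- rho p pd \<omega>) (2 * rho p pd \<omega>)) (cts_step lo up) = (LINT z|std_normal_distribution. cts_step lo up (- rho p pd \<omega> + sqrt (2 * rho p pd \<omega>) * z))"
   unfolding nl by (intro integral_distr) auto
  ultimately show "(%N. integral\<^sup>L (?D (Suc N)) (cts_step lo up)) ----> integral\<^sup>L (normal_law (- rho p pd \<omega>) (2 * rho p pd \<omega>)) (cts_step lo up)"
   using LIMSEQ_Suc[OF log_likelihood_limit[OF ab]] by simp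
 qed
 then show ?thesis
  unfolding weak_conv_m_def weak_conv_def by (auto intro: LIMSEQ_imp_Suc)
qed

end
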